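(* Let $G$ be a bipartite plabic tree of type $(k,km+1)$. Then $\operatorname{IN}_m(G)=1$ if and only if $G$ is $m$-balanced. If $G$ is not $m$-balanced, then $\operatorname{IN}_m(G)=0$.
   Context: A plabic tree is a plabic graph (planar graph in a disk with black/white internal vertices, boundary vertices $1,\dots,n$ on the circle each incident to one edge, leafless) whose underlying graph is a tree; here it is bipartite with boundary vertices $B_{bd}$ regarded as black, $B_{int}$ the internal black vertices. A plabic tree with $n$ boundary vertices has type $(k,n)$ with $k=1+\sum_{b\in B_{int}}(\deg b-2)$, and its positroid variety $\Pi_G\subseteq\mathrm{Gr}_{k,n}$ has dimension $n-1$. $m$-balanced: for each edge $e$ of $G$, write $G\setminus\{e\}=G_1\sqcup G_2$, where each $G_i$ receives half of $e$ (whose free end becomes a new boundary vertex of $G_i$); with $k_i$ the $k$-statistic of $G_i$, require $m(k_i-1)<\dim\Pi_{G_i}\le mk_i$ for $i=1,2$. Equivalently, $1\le |B_{bd}\cap G_i|-m\sum_{b\in G_i\cap B_{int}}(\deg b-2)\le m$ for $i=1,2$, degrees taken in $G$. $m$-intersection number: for generic full-rank $Z\in\mathrm{Mat}_{n,k+m}(\mathbb{C})$ consider $\Pi_G\dashrightarrow\mathrm{Gr}_{k,k+m}$, $C\mapsto CZ$; $\operatorname{IN}_m(G)=0$ if its image has dimension less than $\dim\Pi_G$, and $\operatorname{IN}_m(G)=d$ if it is generically $d$-to-$1$. *)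

theory Defs
  imports
    "HOL-Analysis.Abstract_Topology"
    "HOL-Library.Extended_Nat"
    "HOL-Combinatorics.Orbits"
    "Jordan_Normal_Form.DL_Rank"
    "Jordan_Normal_Form.DL_Submatrix"
begin

section \<open>Topological spaces: dimension and generic points\<close>

definition irreducible_closed :: "'a topology \<Rightarrow> 'a set \<Rightarrow> bool" where
  "irreducible_closed X Y \<longleftrightarrow> closedin X Y \<and> Y \<noteq> {} \<and>
     (\<forall>A B. closedin X A \<longrightarrow> closedin X B \<longrightarrow> Y \<subseteq> A \<union> B \<longrightarrow> Y \<subseteq> A \<or> Y \<subseteq> B)"

text \<open>Krull dimension; the empty space gets dimension \<open>0\<close>.\<close>

definition krull_dim :: "'a topology \<Rightarrow> enat" where
  "krull_dim X = Sup {enat r | r. \<exists>C :: nat \<Rightarrow> 'a set.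
     (\<forall>i\<le>r. irreducible_closed X (C i)) \<and> (\<forall>i<r. C i \<subset> C (Suc i))}"

definition generically :: "'a topology \<Rightarrow> ('a \<Rightarrow> bool) \<Rightarrow> bool" where
  "generically X P \<longleftrightarrow> (\<exists>U. openin X U \<and> X closure_of U = topspace X \<and> (\<forall>x\<in>U. P x))"


section \<open>Complex matrices and Grassmannians\<close>

inductive_set mat_polys :: "nat \<Rightarrow> nat \<Rightarrow> (complex mat \<Rightarrow> complex) set" for r c where
  const: "(\<lambda>A. a) \<in> mat_polys r c"
| entry: "i < r \<Longrightarrow> j < c \<Longrightarrow> (\<lambda>A. A $$ (i, j)) \<in> mat_polys r c"
| add: "f \<in> mat_polys r c \<Longrightarrow> g \<in> mat_polys r c \<Longrightarrow> (\<lambda>A. f A + g A) \<in> mat_polys r c"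
| mult: "f \<in> mat_polys r c \<Longrightarrow> g \<in> mat_polys r c \<Longrightarrow> (\<lambda>A. f A * g A) \<in> mat_polys r c"

definition zariski_mat :: "nat \<Rightarrow> nat \<Rightarrow> complex mat topology" where
  "zariski_mat r c =
     topology_generated_by {{A \<in> carrier_mat r c. f A \<noteq> 0} | f. f \<in> mat_polys r c}"

definition mats_of_rank :: "nat \<Rightarrow> nat \<Rightarrow> nat \<Rightarrow> complex mat set" where
  "mats_of_rank r c p = {A \<in> carrier_mat r c. vec_space.rank r A = p}"

abbreviation row_span :: "nat \<Rightarrow> complex mat \<Rightarrow> complex vec set" where
  "row_span n A \<equiv> vec_space.row_space n A"

text \<open>\<open>Gr\<^bsub>k,n\<^esub>(\<complex>)\<close>, its points being the \<open>k\<close>-dimensional subspaces of \<open>\<complex>\<^sup>n\<close>.\<close>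

definition grassmannian :: "nat \<Rightarrow> nat \<Rightarrow> complex vec set set" where
  "grassmannian k n = row_span n ` mats_of_rank k n k"

text \<open>
  The Zariski topology of \<open>Gr\<^bsub>k,n\<^esub>\<close> is the quotient topology of the one on the full-rank
  \<open>k \<times> n\<close> matrices, because \<open>A \<mapsto> row_span n A\<close> is a \<open>GL\<^sub>k\<close>-torsor and hence an open map.
\<close>

definition zariski_gr :: "nat \<Rightarrow> nat \<Rightarrow> complex vec set topology" where
  "zariski_gr k n = topology (\<lambda>U. U \<subseteq> grassmannian k n \<and>
     openin (subtopology (zariski_mat k n) (mats_of_rank k n k))
       {A \<in> mats_of_rank k n k. row_span n A \<in> U})"

lemma topspace_zariski_mat: "topspace (zariski_mat r c) = carrier_mat r c"
proof -
  let ?B = "{{A \<in> carrier_mat r c. f A \<noteq> 0} | f. f \<in> mat_polys r c}"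
  have "carrier_mat r c = {A \<in> carrier_mat r c. (\<lambda>A. 1 :: complex) A \<noteq> 0}" by simp
  then have "carrier_mat r c \<in> ?B"
    using mat_polys.const[of 1 r c] by (intro CollectI exI conjI)
  then have "\<Union>?B = carrier_mat r c" by (intro equalityI Union_least Union_upper) auto
  then show ?thesis
    unfolding zariski_mat_def topology_generated_by_topspace .
qed

lemma openin_zariski_gr:
  "openin (zariski_gr k n) U \<longleftrightarrow> U \<subseteq> grassmannian k n \<and>
     openin (subtopology (zariski_mat k n) (mats_of_rank k n k))
       {A \<in> mats_of_rank k n k. row_span n A \<in> U}"
proof -
  let ?X = "subtopology (zariski_mat k n) (mats_of_rank k n k)"
  let ?pre = "\<lambda>U. {A \<in> mats_of_rank k n k. row_span n A \<in> U}"
  have "istopology (\<lambda>U. U \<subseteq> grassmannian k n \<and> openin ?X (?pre U))"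
    unfolding istopology_def
  proof (intro conjI allI impI)
    fix S T assume S: "S \<subseteq> grassmannian k n \<and> openin ?X (?pre S)"
      and T: "T \<subseteq> grassmannian k n \<and> openin ?X (?pre T)"
    show "S \<inter> T \<subseteq> grassmannian k n" using S by blast
    have "?pre (S \<inter> T) = ?pre S \<inter> ?pre T" by blast
    then show "openin ?X (?pre (S \<inter> T))" using S T by (simp only: openin_Int)
  next
    fix K assume K: "\<forall>U\<in>K. U \<subseteq> grassmannian k n \<and> openin ?X (?pre U)"
    show "\<Union>K \<subseteq> grassmannian k n" using K by blast
    have "?pre (\<Union>K) = (\<Union>U\<in>K. ?pre U)" by blast
    moreover have "openin ?X (\<Union>U\<in>K. ?pre U)" using K by blast
    ultimately show "openin ?X (?pre (\<Union>K))" by (simp only:)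
  qed
  then show ?thesis
    unfolding zariski_gr_def by (simp add: topology_inverse')
qed

lemma topspace_zariski_gr: "topspace (zariski_gr k n) = grassmannian k n"
proof -
  have "{A \<in> mats_of_rank k n k. row_span n A \<in> grassmannian k n} = mats_of_rank k n k"
    unfolding grassmannian_def by blast
  moreover have "openin (subtopology (zariski_mat k n) (mats_of_rank k n k)) (mats_of_rank k n k)"
    using openin_topspace[of "subtopology (zariski_mat k n) (mats_of_rank k n k)"]
    by (simp add: topspace_zariski_mat mats_of_rank_def Int_absorb1)
  ultimately have "openin (zariski_gr k n) (grassmannian k n)"
    unfolding openin_zariski_gr by simp
  then have "grassmannian k n \<subseteq> topspace (zariski_gr k n)" by (rule openin_subset)
  moreover have "topspace (zariski_gr k n) \<subseteq> grassmannian k n"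
    using openin_topspace[of "zariski_gr k n", unfolded openin_zariski_gr] by (rule conjunct1)
  ultimately show ?thesis by (rule subset_antisym[rotated])
qed

text \<open>
  Dimension of a subset of the Grassmannian, i.e. of its Zariski closure (for a constructible
  set this is the usual dimension).
\<close>

definition gr_dim :: "nat \<Rightarrow> nat \<Rightarrow> complex vec set set \<Rightarrow> enat" where
  "gr_dim k n X = krull_dim (subtopology (zariski_gr k n) (zariski_gr k n closure_of X))"

definition maximal_minor :: "complex mat \<Rightarrow> nat set \<Rightarrow> complex" where
  "maximal_minor A I = det (submatrix A UNIV I)"

text \<open>The map \<open>C \<mapsto> C Z\<close> on row spans: each row vector \<open>v\<close> goes to \<open>v Z\<close>.\<close>

definition amp_map :: "complex mat \<Rightarrow> complex vec set \<Rightarrow> complex vec set" where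
  "amp_map Z V = (\<lambda>v. transpose_mat Z *\<^sub>v v) ` V"


section \<open>Plabic trees\<close>

text \<open>
  Undirected simple graphs with edges given as two-element sets of vertices (a tree has no
  multiple edges). The list \<open>bdry\<close> holds the boundary vertices in their clockwise order, so the
  boundary vertex \<open>i\<close> is \<open>bdry G ! (i - 1)\<close>; columns of matrices are numbered from \<open>0\<close>
  accordingly. The set \<open>white\<close> holds the white vertices; all others, in particular the boundary
  vertices, are black.
\<close>

record 'v plabic =
  verts :: "'v set"
  edges :: "'v set set"
  white :: "'v set"
  bdry :: "'v list"

definition internal :: "('v, 'x) plabic_scheme \<Rightarrow> 'v set" where
  "internal G = verts G - set (bdry G)"

definition black_internal :: "('v, 'x) plabic_scheme \<Rightarrow> 'v set" where
  "black_internal G = internal G - white G"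

definition nbrs :: "('v, 'x) plabic_scheme \<Rightarrow> 'v \<Rightarrow> 'v set" where
  "nbrs G v = {u. {v, u} \<in> edges G}"

definition degree :: "('v, 'x) plabic_scheme \<Rightarrow> 'v \<Rightarrow> nat" where
  "degree G v = card (nbrs G v)"

definition reachable :: "'v set set \<Rightarrow> 'v \<Rightarrow> 'v set" where
  "reachable E u = {v. (u, v) \<in> {(a, b). {a, b} \<in> E}\<^sup>*}"

definition is_cycle :: "'v set set \<Rightarrow> 'v list \<Rightarrow> bool" where
  "is_cycle E vs \<longleftrightarrow> 3 \<le> length vs \<and> distinct vs \<and>
     (\<forall>i<length vs. {vs ! i, vs ! (Suc i mod length vs)} \<in> E)"

definition is_tree :: "('v, 'x) plabic_scheme \<Rightarrow> bool" where
  "is_tree G \<longleftrightarrow> finite (verts G) \<and> verts G \<noteq> {} \<and>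
     (\<forall>e\<in>edges G. e \<subseteq> verts G \<and> card e = 2) \<and>
     (\<forall>u\<in>verts G. \<forall>v\<in>verts G. v \<in> reachable (edges G) u) \<and>
     (\<nexists>vs. is_cycle (edges G) vs)"

text \<open>
  A drawing of a tree in the disk is encoded by its rotation system: \<open>rot v\<close> permutes the
  neighbours of \<open>v\<close> cyclically, in the order of the edges around \<open>v\<close>. Walking along the tree
  with the rotation system (arrive at \<open>v\<close> from \<open>u\<close>, leave to \<open>rot v u\<close>) goes once around the
  whole tree; it is drawn in the disk with the boundary vertices \<open>1, \<dots>, n\<close> in this order on
  the circle iff the walk meets them in the cyclic order \<open>1, \<dots>, n\<close>.
\<close>

definition face_step :: "('v \<Rightarrow> 'v \<Rightarrow> 'v) \<Rightarrow> 'v \<times> 'v \<Rightarrow> 'v \<times> 'v" where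
  "face_step rot = (\<lambda>(u, v). (v, rot v u))"

definition disk_embedding :: "('v, 'x) plabic_scheme \<Rightarrow> ('v \<Rightarrow> 'v \<Rightarrow> 'v) \<Rightarrow> bool" where
  "disk_embedding G rot \<longleftrightarrow>
     (\<forall>v\<in>verts G. nbrs G v \<noteq> {} \<longrightarrow> cyclic_on (rot v) (nbrs G v)) \<and>
     (\<forall>i<length (bdry G). \<forall>u\<in>nbrs G (bdry G ! i). \<exists>r.
        snd ((face_step rot ^^ r) (bdry G ! i, u)) = bdry G ! (Suc i mod length (bdry G)) \<and>
        (\<forall>s<r. snd ((face_step rot ^^ s) (bdry G ! i, u)) \<notin> set (bdry G)))"

definition bipartite_plabic_tree :: "('v, 'x) plabic_scheme \<Rightarrow> bool" where
  "bipartite_plabic_tree G \<longleftrightarrow> is_tree G \<and>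
     distinct (bdry G) \<and> set (bdry G) \<subseteq> verts G \<and> white G \<subseteq> internal G \<and>
     (\<forall>e\<in>edges G. card (e \<inter> white G) = 1) \<and>
     (\<forall>v\<in>set (bdry G). degree G v = 1) \<and>
     (\<forall>v\<in>internal G. degree G v \<noteq> 1) \<and>
     (\<exists>rot. disk_embedding G rot)"

text \<open>No truncation occurs in \<open>degree G b - 2\<close> for leafless trees with an edge.\<close>

definition k_stat :: "('v, 'x) plabic_scheme \<Rightarrow> nat" where
  "k_stat G = 1 + (\<Sum>b\<in>black_internal G. degree G b - 2)"

definition plabic_type :: "('v, 'x) plabic_scheme \<Rightarrow> nat \<times> nat" where
  "plabic_type G = (k_stat G, length (bdry G))"


section \<open>Positroid varieties\<close>

definition almost_perfect_matching :: "('v, 'x) plabic_scheme \<Rightarrow> 'v set set \<Rightarrow> bool" where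
  "almost_perfect_matching G M \<longleftrightarrow> M \<subseteq> edges G \<and>
     (\<forall>v\<in>internal G. \<exists>!e. e \<in> M \<and> v \<in> e) \<and> (\<forall>e\<in>M. \<forall>f\<in>M. e \<noteq> f \<longrightarrow> e \<inter> f = {})"

definition matching_boundary :: "('v, 'x) plabic_scheme \<Rightarrow> 'v set set \<Rightarrow> nat set" where
  "matching_boundary G M = {i. i < length (bdry G) \<and> bdry G ! i \<in> \<Union>M}"

text \<open>
  The (positive) positroid cell is the image of the boundary measurement map: positive edge
  weights \<open>w\<close> go to the point with Pluecker coordinates
  \<open>\<Delta>\<^sub>I = \<Sum>\<^bsub>\<partial>M = I\<^esub> \<Prod>\<^bsub>e \<in> M\<^esub> w\<^sub>e\<close>, the sum being over almost perfect matchings \<open>M\<close>.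
  The positroid variety is the Zariski closure of the cell. Bipartiteness is assumed, with
  boundary vertices counted as black.
\<close>

definition positroid_cell :: "('v, 'x) plabic_scheme \<Rightarrow> complex vec set set" where
  "positroid_cell G = (let k = k_stat G; n = length (bdry G) in
     {row_span n A | A. A \<in> mats_of_rank k n k \<and>
        (\<exists>w :: 'v set \<Rightarrow> real. (\<forall>e\<in>edges G. 0 < w e) \<and>
          (\<forall>I. I \<subseteq> {..<n} \<longrightarrow> card I = k \<longrightarrow>
             maximal_minor A I = complex_of_real
               (\<Sum>M | almost_perfect_matching G M \<and> matching_boundary G M = I. \<Prod>e\<in>M. w e)))})"

definition positroid_variety :: "('v, 'x) plabic_scheme \<Rightarrow> complex vec set set" where
  "positroid_variety G = zariski_gr (k_stat G) (length (bdry G)) closure_of positroid_cell G"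

definition positroid_dim :: "('v, 'x) plabic_scheme \<Rightarrow> enat" where
  "positroid_dim G = gr_dim (k_stat G) (length (bdry G)) (positroid_variety G)"


section \<open>Balanced plabic trees\<close>

text \<open>
  \<open>half_tree G u v\<close> is the part \<open>G\<^sub>1\<close> of \<open>G \<setminus> {e}\<close>, \<open>e = {u, v}\<close>, that contains \<open>u\<close>, together
  with the half of \<open>e\<close> at \<open>u\<close>. The free end of the half-edge is the new boundary vertex
  \<open>None\<close>. If \<open>u\<close> is black then, to keep the tree bipartite with black boundary vertices, a
  white vertex of degree \<open>2\<close> is inserted on the half-edge, which changes neither the
  \<open>k\<close>-statistic nor the positroid variety; \<open>Some v\<close> serves as its name. The boundary
  vertices of \<open>G\<close> not in \<open>G\<^sub>1\<close> are cyclically consecutive, and \<open>None\<close> takes their place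
  (\<open>remdups\<close> keeps one copy, and which end of the list it sits at is irrelevant up to rotation).
\<close>

definition half_tree :: "('v, 'x) plabic_scheme \<Rightarrow> 'v \<Rightarrow> 'v \<Rightarrow> 'v option plabic" where
  "half_tree G u v = (let
       S = reachable (edges G - {{u, v}}) u;
       T = (if u \<in> white G then S else insert v S);
       w = (if u \<in> white G then u else v)
     in \<lparr> verts = insert None (Some ` T),
          edges = insert {Some w, None} ((`) Some ` {e \<in> edges G. e \<subseteq> T}),
          white = Some ` (white G \<inter> T),
          bdry = remdups (map (\<lambda>b. if b \<in> S then Some b else None) (bdry G)) \<rparr>)"

text \<open>Ordered pairs \<open>(u, v)\<close> range over all edges together with a choice of one of the halves.\<close>

definition balanced :: "nat \<Rightarrow> ('v, 'x) plabic_scheme \<Rightarrow> bool" where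
  "balanced m G \<longleftrightarrow> (\<forall>u v. {u, v} \<in> edges G \<longrightarrow>
     enat (m * (k_stat (half_tree G u v) - 1)) < positroid_dim (half_tree G u v) \<and>
     positroid_dim (half_tree G u v) \<le> enat (m * k_stat (half_tree G u v)))"


section \<open>Intersection number\<close>

definition full_rank_zariski :: "nat \<Rightarrow> nat \<Rightarrow> complex mat topology" where
  "full_rank_zariski r c = subtopology (zariski_mat r c) (mats_of_rank r c (min r c))"

text \<open>The image of the rational map \<open>C \<mapsto> C Z\<close>, which is defined where \<open>C Z\<close> has rank \<open>k\<close>.\<close>

definition amp_image :: "nat \<Rightarrow> ('v, 'x) plabic_scheme \<Rightarrow> complex mat \<Rightarrow> complex vec set set" where
  "amp_image m G Z =
     amp_map Z ` positroid_variety G \<inter> grassmannian (k_stat G) (k_stat G + m)"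

text \<open>For \<open>d > 0\<close>: a generic \<open>V\<close> has exactly \<open>d\<close> points in its fibre.\<close>

definition generically_to_one ::
  "nat \<Rightarrow> nat \<Rightarrow> ('v, 'x) plabic_scheme \<Rightarrow> complex mat \<Rightarrow> bool" where
  "generically_to_one d m G Z \<longleftrightarrow>
     generically (subtopology (zariski_gr (k_stat G) (length (bdry G))) (positroid_variety G))
       (\<lambda>V. amp_map Z V \<in> grassmannian (k_stat G) (k_stat G + m) \<and>
            card {W \<in> positroid_variety G. amp_map Z W = amp_map Z V} = d)"

definition intersection_number :: "nat \<Rightarrow> ('v, 'x) plabic_scheme \<Rightarrow> nat" where
  "intersection_number m G = (
     let Zs = full_rank_zariski (length (bdry G)) (k_stat G + m) in
     if generically Zs
          (\<lambda>Z. gr_dim (k_stat G) (k_stat G + m) (amp_image m G Z) < positroid_dim G)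
     then 0
     else (THE d. 0 < d \<and> generically Zs (generically_to_one d m G)))"

end

theory Submission
  imports Defs "HOL-Library.Transitive_Closure_Table" "Jordan_Normal_Form.DL_Rank_Submatrix"
begin

text \<open>
  Root the tree at a boundary vertex. Almost perfect matchings correspond to sets of boundary
  vertices that meet the side below each edge in one of two admissible sizes (bases), and
  the edge weights act only by rescaling the boundary vertices. Hence the positroid cell is the
  orbit of a single matrix \<open>A\<close>, whose maximal minors are the indicators of the bases, under positive
  column scalings, and it has dimension \<open>n - 1\<close>. A generic fibre of \<open>C \<mapsto> C Z\<close> is a point as soon
  as a column scaling with a zero entry never maps the rows of \<open>A Z\<close> into their span. If the tree is
  balanced, then for every \<open>i\<close> the remaining \<open>m k\<close> boundary vertices can be partitioned into \<open>m\<close> bases;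
  this yields a matrix \<open>Z\<close> with that property, and the property is open. If the tree is not balanced, then one
  side \<open>C\<close> of an edge meets every basis in at least \<open>s \<ge> |C| / m\<close> elements, and counting the parameters on which
  the image depends shows that its dimension is less than \<open>m k\<close>.
\<close>


section \<open>Polynomial functions\<close>

text \<open>Everything about a fibre is linear. For \<open>n = m * k + 1\<close> and a suitable
  \<open>Z\<close> this system amounts to \<open>m * k\<close> equations in \<open>n\<close>
  unknowns; it always has a nonzero solution, and balancedness provides coefficients for which no
  nonzero solution has a zero entry, which makes the solution unique up to a factor. Planarity
  matters for signs: the order of the boundary vertices on the circle is what allows all minors of
  \<open>A\<close> to be 0 or 1 at once. The cell is parametrized by positive reals whereas the
  topology is the complex Zariski one; convex sets of real parameters bridge the gap, because a
  polynomial restricted to a segment has finitely many zeros or vanishes. Dimension is bounded from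
  below by explicit chains of orbit pieces and from above by algebraic dependence of
  coordinates.\<close>

inductive_set fpolys :: "('p \<Rightarrow> complex) set \<Rightarrow> ('p \<Rightarrow> complex) set" for X where
 const: "(\<lambda>x. a) \<in> fpolys X"
| gen: "f \<in> X \<Longrightarrow> f \<in> fpolys X"
| add: "f \<in> fpolys X \<Longrightarrow> g \<in> fpolys X \<Longrightarrow> (\<lambda>x. f x + g x) \<in> fpolys X"
| mult: "f \<in> fpolys X \<Longrightarrow> g \<in> fpolys X \<Longrightarrow> (\<lambda>x. f x * g x) \<in> fpolys X"

lemma fpolys_minus: "f \<in> fpolys X \<Longrightarrow> (\<lambda>x. - f x) \<in> fpolys X"
 using fpolys.mult[OF fpolys.const[of "-1"], of f X] by simp

lemma fpolys_diff: "f \<in> fpolys X \<Longrightarrow> g \<in> fpolys X \<Longrightarrow> (\<lambda>x. f x - g x) \<in> fpolys X"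
 using fpolys.add[OF _ fpolys_minus, of f X g] by simp

lemma fpolys_sum: "(\<And>i. i \<in> I \<Longrightarrow> f i \<in> fpolys X) \<Longrightarrow> (\<lambda>x. \<Sum>i\<in>I. f i x) \<in> fpolys X"
proof (induction I rule: infinite_finite_induct)
 case (insert i I)
 hence "(\<lambda>x. f i x + (\<Sum>i\<in>I. f i x)) \<in> fpolys X" by (intro fpolys.add) auto
 with insert show ?case by simp
qed (auto intro: fpolys.const)

lemma fpolys_prod: "(\<And>i. i \<in> I \<Longrightarrow> f i \<in> fpolys X) \<Longrightarrow> (\<lambda>x. \<Prod>i\<in>I. f i x) \<in> fpolys X"
proof (induction I rule: infinite_finite_induct)
 case (insert i I)
 hence "(\<lambda>x. f i x * (\<Prod>i\<in>I. f i x)) \<in> fpolys X" by (intro fpolys.mult) auto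
 with insert show ?case by simp
qed (auto intro: fpolys.const)

lemma fpolys_power: "f \<in> fpolys X \<Longrightarrow> (\<lambda>x. f x ^ n) \<in> fpolys X"
proof (induction n)
 case (Suc n)
 hence "(\<lambda>x. f x * f x ^ n) \<in> fpolys X" by (intro fpolys.mult) auto
 thus ?case by simp
qed (auto intro: fpolys.const)

lemmas fpolys_intros = fpolys.const fpolys.add fpolys.mult fpolys_minus fpolys_diff fpolys_sum
 fpolys_prod fpolys_power

lemma fpolys_compose:
 assumes "f \<in> fpolys X" "\<And>x. x \<in> X \<Longrightarrow> (\<lambda>\<theta>. x (\<phi> \<theta>)) \<in> fpolys Y"
 shows "(\<lambda>\<theta>. f (\<phi> \<theta>)) \<in> fpolys Y"
 using assms(1) by induction (auto intro: assms(2) fpolys_intros)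

text \<open>Clearing denominators: if all generators become rational functions with denominator
  \<open>q\<close>, a polynomial in them has a power of \<open>q\<close> as denominator. The
  exponent \<open>e\<close> depends on the degree of \<open>f\<close>, and the identity is asked for
  only on \<open>\<Theta>\<close>, where the generators are known to have that form.\<close>

lemma fpolys_rational_compose:
 assumes "f \<in> fpolys X" "q \<in> fpolys Y"
  and "\<And>x. x \<in> X \<Longrightarrow> \<exists>P\<in>fpolys Y. \<forall>\<theta>\<in>\<Theta>. x (\<phi> \<theta>) * q \<theta> = P \<theta>"
 shows "\<exists>e. \<exists>P\<in>fpolys Y. \<forall>\<theta>\<in>\<Theta>. f (\<phi> \<theta>) * q \<theta> ^ e = P \<theta>"
 using assms(1)
proof induction
 case (const a)
 show ?case by (rule exI[of _ 0], rule bexI[of _ "\<lambda>_. a"]) (auto intro: fpolys_intros)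
next
 case (gen f)
 then obtain P where "P \<in> fpolys Y" "\<forall>\<theta>\<in>\<Theta>. f (\<phi> \<theta>) * q \<theta> = P \<theta>" using assms(3) by blast
 thus ?case by (intro exI[of _ 1] bexI[of _ P]) auto
next
 case (add f g)
 then obtain e P e' P' where P: "P \<in> fpolys Y" "\<forall>\<theta>\<in>\<Theta>. f (\<phi> \<theta>) * q \<theta> ^ e = P \<theta>"
  "P' \<in> fpolys Y" "\<forall>\<theta>\<in>\<Theta>. g (\<phi> \<theta>) * q \<theta> ^ e' = P' \<theta>" by blast
 have "\<forall>\<theta>\<in>\<Theta>. (f (\<phi> \<theta>) + g (\<phi> \<theta>)) * q \<theta> ^ (e + e') = P \<theta> * q \<theta> ^ e' + P' \<theta> * q \<theta> ^ e"
  using P by (auto simp: power_add algebra_simps)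
 moreover have "(\<lambda>\<theta>. P \<theta> * q \<theta> ^ e' + P' \<theta> * q \<theta> ^ e) \<in> fpolys Y"
  using P assms(2) by (intro fpolys_intros)
 ultimately show ?case by (intro exI[of _ "e + e'"] bexI[of _ "\<lambda>\<theta>. P \<theta> * q \<theta> ^ e' + P' \<theta> * q \<theta> ^ e"]) auto
next
 case (mult f g)
 then obtain e P e' P' where P: "P \<in> fpolys Y" "\<forall>\<theta>\<in>\<Theta>. f (\<phi> \<theta>) * q \<theta> ^ e = P \<theta>"
  "P' \<in> fpolys Y" "\<forall>\<theta>\<in>\<Theta>. g (\<phi> \<theta>) * q \<theta> ^ e' = P' \<theta>" by blast
 have "\<forall>\<theta>\<in>\<Theta>. (f (\<phi> \<theta>) * g (\<phi> \<theta>)) * q \<theta> ^ (e + e') = P \<theta> * P' \<theta>"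
 proof
  fix \<theta> assume "\<theta> \<in> \<Theta>"
  have "(f (\<phi> \<theta>) * g (\<phi> \<theta>)) * q \<theta> ^ (e + e') = (f (\<phi> \<theta>) * q \<theta> ^ e) * (g (\<phi> \<theta>) * q \<theta> ^ e')"
   by (simp add: power_add)
  thus "(f (\<phi> \<theta>) * g (\<phi> \<theta>)) * q \<theta> ^ (e + e') = P \<theta> * P' \<theta>"
   using P \<open>\<theta> \<in> \<Theta>\<close> by simp
 qed
 moreover have "(\<lambda>\<theta>. P \<theta> * P' \<theta>) \<in> fpolys Y"
  using P assms(2) by (intro fpolys_intros)
 ultimately show ?case by (intro exI[of _ "e + e'"] bexI[of _ "\<lambda>\<theta>. P \<theta> * P' \<theta>"]) auto
qed

definition mat_entries :: "nat \<Rightarrow> nat \<Rightarrow> (complex mat \<Rightarrow> complex) set" where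
 "mat_entries r c = {\<lambda>A. A $$ (i, j) | i j. i < r \<and> j < c}"

lemma mat_polys_eq: "mat_polys r c = fpolys (mat_entries r c)"
proof
 show "mat_polys r c \<subseteq> fpolys (mat_entries r c)"
 proof
  fix f assume "f \<in> mat_polys r c"
  thus "f \<in> fpolys (mat_entries r c)"
   by induction (auto intro: fpolys.intros simp: mat_entries_def)
 qed
 show "fpolys (mat_entries r c) \<subseteq> mat_polys r c"
 proof
  fix f assume "f \<in> fpolys (mat_entries r c)"
  thus "f \<in> mat_polys r c"
   by induction (auto intro: mat_polys.intros simp: mat_entries_def)
 qed
qed

lemma fpolys_segment:
 assumes "f \<in> fpolys X" "\<And>x. x \<in> X \<Longrightarrow> \<exists>p. \<forall>s. x (\<gamma> s) = poly p (of_real s)"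
 shows "\<exists>p :: complex poly. \<forall>s :: real. f (\<gamma> s) = poly p (of_real s)"
 using assms(1)
proof induction
 case (const a) show ?case by (rule exI[of _ "[:a:]"]) simp
next
 case (gen f) thus ?case using assms(2) by blast
next
 case (add f g)
 then obtain p p' where "\<forall>s. f (\<gamma> s) = poly p (of_real s)" "\<forall>s. g (\<gamma> s) = poly p' (of_real s)" by blast
 thus ?case by (intro exI[of _ "p + p'"]) simp
next
 case (mult f g)
 then obtain p p' where "\<forall>s. f (\<gamma> s) = poly p (of_real s)" "\<forall>s. g (\<gamma> s) = poly p' (of_real s)" by blast
 thus ?case by (intro exI[of _ "p * p'"]) simp
qed

text \<open>This makes convex sets of parameters irreducible.\<close>

lemma fpolys_segment_nonzero:
 assumes "f \<in> fpolys X" "g \<in> fpolys X" "\<And>x. x \<in> X \<Longrightarrow> \<exists>p. \<forall>s. x (\<gamma> s) = poly p (of_real s)"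
  and "f (\<gamma> 0) \<noteq> 0" "g (\<gamma> s1) \<noteq> 0"
 shows "\<exists>s. 0 < s \<and> s < 1 \<and> f (\<gamma> s) \<noteq> 0 \<and> g (\<gamma> s) \<noteq> 0"
proof -
 obtain p where p: "\<forall>s. f (\<gamma> s) = poly p (of_real s)" using fpolys_segment[of f X \<gamma>] assms by blast
 obtain p' where p': "\<forall>s. g (\<gamma> s) = poly p' (of_real s)" using fpolys_segment[of g X \<gamma>] assms by blast
 have "p * p' \<noteq> 0" using p p' assms(4,5) by auto
 hence "finite {z. poly (p * p') z = 0}" by (rule poly_roots_finite)
 moreover have "infinite (of_real ` {0<..<1::real} :: complex set)"
  using finite_imageD[of of_real "{0<..<1::real}"] by (auto simp: inj_on_def)
 ultimately have "\<not> (of_real ` {0<..<1::real} \<subseteq> {z. poly (p * p') z = (0::complex)})"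
  using finite_subset by blast
 thus ?thesis using p p' by auto
qed

section \<open>Linear systems with polynomial coefficients\<close>

text \<open>Gaussian elimination by cross-multiplication, a division-free Cramer rule. A trivial
  kernel at the single point \<open>x0\<close> yields a polynomial \<open>D\<close> such that
  wherever \<open>D\<close> is nonzero a solution is forced to be \<open>N / D\<close> times
  \<open>\<tau>\<close>. There may be more equations than unknowns, even infinitely many, and no
  solution is claimed to exist.\<close>

lemma linear_system_elimination:
 fixes L :: "'s \<Rightarrow> 'i \<Rightarrow> 'p \<Rightarrow> complex"
 assumes "finite I"
  and "\<And>\<xi> i. \<xi> \<in> S \<Longrightarrow> i \<in> I \<Longrightarrow> L \<xi> i \<in> fpolys X" "\<And>\<xi>. \<xi> \<in> S \<Longrightarrow> R \<xi> \<in> fpolys X"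
  and "\<And>t. (\<forall>\<xi>\<in>S. (\<Sum>i\<in>I. L \<xi> i x0 * t i) = 0) \<Longrightarrow> \<forall>i\<in>I. t i = 0"
 shows "\<exists>D\<in>fpolys X. \<exists>N. (\<forall>i. N i \<in> fpolys X) \<and> D x0 \<noteq> 0 \<and>
  (\<forall>x t \<tau>. D x \<noteq> 0 \<longrightarrow> (\<forall>\<xi>\<in>S. (\<Sum>i\<in>I. L \<xi> i x * t i) = R \<xi> x * \<tau>) \<longrightarrow> (\<forall>i\<in>I. D x * t i = N i x * \<tau>))"
 using assms
proof (induction I arbitrary: L R rule: finite_induct)
 case empty
 show ?case
  by (rule bexI[of _ "\<lambda>_. 1"], rule exI[of _ "\<lambda>_ _. 0"]) (auto intro: fpolys_intros)
next
 case (insert p I)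
 \<comment> \<open>A pivot for \<open>p\<close> exists, for otherwise the unit vector at
   \<open>p\<close> would lie in the kernel at \<open>x0\<close>.\<close>
 have "\<exists>\<rho>\<in>S. L \<rho> p x0 \<noteq> 0"
 proof (rule ccontr)
  assume "\<not> ?thesis"
  hence "\<forall>\<xi>\<in>S. (\<Sum>i\<in>insert p I. L \<xi> i x0 * (if i = p then 1 else 0)) = 0"
   using insert.hyps by (auto simp: if_distrib[of "\<lambda>y. _ * y"] cong: if_cong)
  from insert.prems(3)[OF this] show False by auto
 qed
 then obtain \<rho> where \<rho>: "\<rho> \<in> S" "L \<rho> p x0 \<noteq> 0" by blast
 \<comment> \<open>Each equation is multiplied by the pivot before the pivot row is subtracted, so
   the coefficients stay polynomial.\<close>
 define L' where "L' = (\<lambda>\<xi> i x. L \<rho> p x * L \<xi> i x - L \<xi> p x * L \<rho> i x)"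
 define R' where "R' = (\<lambda>\<xi> x. L \<rho> p x * R \<xi> x - L \<xi> p x * R \<rho> x)"
 have elim: "(\<Sum>i\<in>I. L' \<xi> i x * t i) = L \<rho> p x * (\<Sum>i\<in>I. L \<xi> i x * t i) - L \<xi> p x * (\<Sum>i\<in>I. L \<rho> i x * t i)" for \<xi> x t
  unfolding L'_def by (simp add: sum_distrib_left sum_subtractf[symmetric] algebra_simps)
 have "\<exists>D\<in>fpolys X. \<exists>N. (\<forall>i. N i \<in> fpolys X) \<and> D x0 \<noteq> 0 \<and>
  (\<forall>x t \<tau>. D x \<noteq> 0 \<longrightarrow> (\<forall>\<xi>\<in>S. (\<Sum>i\<in>I. L' \<xi> i x * t i) = R' \<xi> x * \<tau>) \<longrightarrow> (\<forall>i\<in>I. D x * t i = N i x * \<tau>))"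
 proof (rule insert.IH)
  show "L' \<xi> i \<in> fpolys X" if "\<xi> \<in> S" "i \<in> I" for \<xi> i
   unfolding L'_def using that \<rho> insert.prems by (intro fpolys_intros) auto
  show "R' \<xi> \<in> fpolys X" if "\<xi> \<in> S" for \<xi>
   unfolding R'_def using that \<rho> insert.prems by (intro fpolys_intros) auto
  fix t assume t: "\<forall>\<xi>\<in>S. (\<Sum>i\<in>I. L' \<xi> i x0 * t i) = 0"
  \<comment> \<open>A solution of the reduced homogeneous system is extended to \<open>p\<close> by
    solving the pivot equation; the trivial kernel is thereby inherited.\<close>
  define u where "u = t(p := - (\<Sum>i\<in>I. L \<rho> i x0 * t i) / L \<rho> p x0)"
  have "(\<Sum>i\<in>insert p I. L \<xi> i x0 * u i) = 0" if "\<xi> \<in> S" for \<xi>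
  proof -
   have "(\<Sum>i\<in>I. L \<xi> i x0 * u i) = (\<Sum>i\<in>I. L \<xi> i x0 * t i)"
    using insert.hyps by (intro sum.cong) (auto simp: u_def)
   hence "L \<rho> p x0 * (\<Sum>i\<in>insert p I. L \<xi> i x0 * u i) =
     L \<xi> p x0 * (L \<rho> p x0 * u p) + L \<rho> p x0 * (\<Sum>i\<in>I. L \<xi> i x0 * t i)"
    using insert.hyps by (simp add: distrib_left mult.left_commute)
   also have "L \<rho> p x0 * u p = - (\<Sum>i\<in>I. L \<rho> i x0 * t i)" using \<rho> by (simp add: u_def)
   finally have "L \<rho> p x0 * (\<Sum>i\<in>insert p I. L \<xi> i x0 * u i) = (\<Sum>i\<in>I. L' \<xi> i x0 * t i)"
    unfolding elim by simp
   with t that \<rho> show ?thesis by simp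
  qed
  hence "\<forall>i\<in>insert p I. u i = 0" by (intro insert.prems(3)) auto
  thus "\<forall>i\<in>I. t i = 0" using insert.hyps by (auto simp: u_def split: if_splits)
 qed
 then obtain D N where D: "D \<in> fpolys X" "\<forall>i. N i \<in> fpolys X" "D x0 \<noteq> 0"
  and sol: "\<And>x t \<tau>. D x \<noteq> 0 \<Longrightarrow> (\<forall>\<xi>\<in>S. (\<Sum>i\<in>I. L' \<xi> i x * t i) = R' \<xi> x * \<tau>) \<Longrightarrow> (\<forall>i\<in>I. D x * t i = N i x * \<tau>)"
  by blast
 define D' where "D' = (\<lambda>x. D x * L \<rho> p x)"
 define N' where "N' = (\<lambda>i. if i = p then (\<lambda>x. D x * R \<rho> x - (\<Sum>i\<in>I. L \<rho> i x * N i x)) else (\<lambda>x. N i x * L \<rho> p x))"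
 show ?case
 proof (rule bexI[of _ D'], rule exI[of _ N'], intro conjI allI impI ballI)
  show "D' \<in> fpolys X" unfolding D'_def using D \<rho> insert.prems by (intro fpolys_intros) auto
  show "N' i \<in> fpolys X" for i unfolding N'_def using D \<rho> insert.prems by (auto intro!: fpolys_intros)
  show "D' x0 \<noteq> 0" using D \<rho> by (simp add: D'_def)
  fix x t \<tau> i assume D'x: "D' x \<noteq> 0" and eq: "\<forall>\<xi>\<in>S. (\<Sum>i\<in>insert p I. L \<xi> i x * t i) = R \<xi> x * \<tau>"
   and i: "i \<in> insert p I"
  have Lp: "L \<xi> p x * t p = R \<xi> x * \<tau> - (\<Sum>i\<in>I. L \<xi> i x * t i)" if "\<xi> \<in> S" for \<xi>
   using eq that insert.hyps by (simp add: algebra_simps)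
  have "\<forall>\<xi>\<in>S. (\<Sum>i\<in>I. L' \<xi> i x * t i) = R' \<xi> x * \<tau>"
  proof
   fix \<xi> assume s: "\<xi> \<in> S"
   have "L \<rho> p x * (L \<xi> p x * t p) = L \<xi> p x * (L \<rho> p x * t p)" by simp
   thus "(\<Sum>i\<in>I. L' \<xi> i x * t i) = R' \<xi> x * \<tau>"
    unfolding Lp[OF s] Lp[OF \<rho>(1)] elim R'_def by (simp add: algebra_simps)
  qed
  hence IH: "\<forall>i\<in>I. D x * t i = N i x * \<tau>" using D'x by (intro sol) (auto simp: D'_def)
  show "D' x * t i = N' i x * \<tau>"
  proof (cases "i = p")
   case True
   have "D' x * t i = D x * (L \<rho> p x * t p)" by (simp add: D'_def True)
   also have "\<dots> = D x * R \<rho> x * \<tau> - (\<Sum>i\<in>I. L \<rho> i x * (D x * t i))"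
    unfolding Lp[OF \<rho>(1)] by (simp add: algebra_simps sum_distrib_left)
   also have "(\<Sum>i\<in>I. L \<rho> i x * (D x * t i)) = (\<Sum>i\<in>I. L \<rho> i x * (N i x * \<tau>))"
    using IH by (intro sum.cong) auto
   finally show ?thesis by (simp add: N'_def True algebra_simps sum_distrib_left)
  next
   case False
   thus ?thesis using IH i by (auto simp: D'_def N'_def)
  qed
 qed
qed

lemma linear_system_trivial_kernel:
 fixes L :: "'s \<Rightarrow> 'i \<Rightarrow> 'p \<Rightarrow> complex"
 assumes "finite I" "\<And>\<xi> i. \<xi> \<in> S \<Longrightarrow> i \<in> I \<Longrightarrow> L \<xi> i \<in> fpolys X"
  and "\<And>t. (\<forall>\<xi>\<in>S. (\<Sum>i\<in>I. L \<xi> i x0 * t i) = 0) \<Longrightarrow> \<forall>i\<in>I. t i = 0"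
 shows "\<exists>D\<in>fpolys X. D x0 \<noteq> 0 \<and>
  (\<forall>x t. D x \<noteq> 0 \<longrightarrow> (\<forall>\<xi>\<in>S. (\<Sum>i\<in>I. L \<xi> i x * t i) = 0) \<longrightarrow> (\<forall>i\<in>I. t i = 0))"
proof -
 have "\<exists>D\<in>fpolys X. \<exists>N. (\<forall>i. N i \<in> fpolys X) \<and> D x0 \<noteq> 0 \<and>
  (\<forall>x t \<tau>. D x \<noteq> 0 \<longrightarrow> (\<forall>\<xi>\<in>S. (\<Sum>i\<in>I. L \<xi> i x * t i) = (\<lambda>_ _. 0) \<xi> x * \<tau>) \<longrightarrow> (\<forall>i\<in>I. D x * t i = N i x * \<tau>))"
  by (rule linear_system_elimination) (use assms in \<open>auto intro: fpolys.const\<close>)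
 then obtain D N where D: "D \<in> fpolys X" "D x0 \<noteq> 0"
  and sol: "\<forall>x t \<tau>. D x \<noteq> 0 \<longrightarrow> (\<forall>\<xi>\<in>S. (\<Sum>i\<in>I. L \<xi> i x * t i) = (\<lambda>_ _. 0) \<xi> x * \<tau>) \<longrightarrow> (\<forall>i\<in>I. D x * t i = N i x * \<tau>)"
  by (elim bexE exE conjE)
 have "\<forall>i\<in>I. t i = 0" if "D x \<noteq> 0" "\<forall>\<xi>\<in>S. (\<Sum>i\<in>I. L \<xi> i x * t i) = 0" for x t
  using sol[rule_format, of x t 0] that by auto
 with D show ?thesis by blast
qed

lemma underdetermined_system:
 fixes L :: "'s \<Rightarrow> 'i \<Rightarrow> complex"
 assumes "finite S" "finite I" "card S < card I"
 shows "\<exists>t. (\<exists>i\<in>I. t i \<noteq> 0) \<and> (\<forall>\<xi>\<in>S. (\<Sum>i\<in>I. L \<xi> i * t i) = 0)"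
 using assms
proof (induction S arbitrary: I L rule: finite_induct)
 case empty
 then obtain i where "i \<in> I" by fastforce
 thus ?case by (intro exI[of _ "\<lambda>_. 1"]) auto
next
 case (insert \<rho> S)
 show ?case
 proof (cases "\<forall>i\<in>I. L \<rho> i = 0")
  case True
  thus ?thesis using insert.IH[of I L] insert.prems insert.hyps by auto
 next
  case False
  then obtain p where p: "p \<in> I" "L \<rho> p \<noteq> 0" by blast
  define J where "J = I - {p}"
  have J: "I = insert p J" "p \<notin> J" "finite J" using p insert.prems by (auto simp: J_def)
  obtain t where t: "\<exists>i\<in>J. t i \<noteq> 0" "\<forall>\<xi>\<in>S. (\<Sum>i\<in>J. (L \<rho> p * L \<xi> i - L \<xi> p * L \<rho> i) * t i) = 0"
   using insert.IH[of J "\<lambda>\<xi> i. L \<rho> p * L \<xi> i - L \<xi> p * L \<rho> i"] J insert.prems insert.hyps by auto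
  define u where "u = t(p := - (\<Sum>i\<in>J. L \<rho> i * t i) / L \<rho> p)"
  have sJ: "(\<Sum>i\<in>J. L \<xi> i * u i) = (\<Sum>i\<in>J. L \<xi> i * t i)" for \<xi>
   using J by (intro sum.cong) (auto simp: u_def)
  have "(\<Sum>i\<in>I. L \<xi> i * u i) = 0" if "\<xi> \<in> insert \<rho> S" for \<xi>
  proof (cases "\<xi> = \<rho>")
   case True
   thus ?thesis using J p sJ by (simp add: u_def)
  next
   case False
   have "L \<rho> p * (\<Sum>i\<in>I. L \<xi> i * u i) = L \<rho> p * (\<Sum>i\<in>J. L \<xi> i * t i) - L \<xi> p * (\<Sum>i\<in>J. L \<rho> i * t i)"
    using J p sJ by (simp add: u_def field_simps)
   also have "\<dots> = (\<Sum>i\<in>J. (L \<rho> p * L \<xi> i - L \<xi> p * L \<rho> i) * t i)"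
    by (simp add: sum_distrib_left sum_subtractf[symmetric] algebra_simps)
   finally show ?thesis using t that False p by auto
  qed
  moreover have "\<exists>i\<in>I. u i \<noteq> 0" using t J by (auto simp: u_def)
  ultimately show ?thesis by blast
 qed
qed

section \<open>Algebraic independence\<close>

text \<open>Extensional functions make the number of exponent vectors exactly
  \<open>D ^ card I\<close>, on which the counting of monomials rests.\<close>

definition exps :: "'i set \<Rightarrow> nat \<Rightarrow> ('i \<Rightarrow> nat) set" where
 "exps I D = PiE I (\<lambda>_. {..<D})"

lemma finite_exps: "finite I \<Longrightarrow> finite (exps I D)"
 by (auto simp: exps_def intro: finite_PiE)

text \<open>Independence modulo the functions that vanish on \<open>Y\<close>: relations are tested
  at the points of \<open>Y\<close> only, and run over boxes of exponents in place of a polynomial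
  ring.\<close>

definition alg_indep :: "nat \<Rightarrow> (nat \<Rightarrow> 'p \<Rightarrow> complex) \<Rightarrow> 'p set \<Rightarrow> bool" where
 "alg_indep r g Y \<longleftrightarrow> (\<forall>D c. (\<forall>x\<in>Y. (\<Sum>\<nu>\<in>exps {..<r} D. c \<nu> * (\<Prod>i<r. g i x ^ \<nu> i)) = 0) \<longrightarrow>
   (\<forall>\<nu>\<in>exps {..<r} D. c \<nu> = 0))"

lemma sum_exps_Suc:
 "(\<Sum>\<nu>\<in>exps {..<Suc r} D. F \<nu>) = (\<Sum>j<D. \<Sum>\<nu>\<in>exps {..<r} D. (F (\<nu>(r := j)) :: complex))"
proof -
 have "exps {..<Suc r} D = (\<lambda>(y, g). g(r := y)) ` ({..<D} \<times> exps {..<r} D)"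
  unfolding exps_def lessThan_Suc by (rule PiE_insert_eq)
 moreover have "inj_on (\<lambda>(y, g). g(r := y)) ({..<D} \<times> exps {..<r} D)"
  unfolding exps_def by (rule inj_combinator) simp
 ultimately have "(\<Sum>\<nu>\<in>exps {..<Suc r} D. F \<nu>) = (\<Sum>p\<in>{..<D} \<times> exps {..<r} D. F ((\<lambda>(y, g). g(r := y)) p))"
  by (simp add: sum.reindex)
 thus ?thesis by (simp add: sum.cartesian_product split_def)
qed

text \<open>A relation on \<open>Y'\<close> is divided by the highest possible power of
  \<open>g\<close>, which \<open>dom\<close> permits because it says that functions on
  \<open>Y'\<close> have no zero divisors. Restricted to \<open>Y\<close>, where \<open>g\<close>
  vanishes, only the lowest coefficient is left, and it is a relation among the old functions. This
  is how transcendence degree grows along a strict inclusion of irreducible sets.\<close>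

lemma alg_indep_extend:
 fixes f :: "nat \<Rightarrow> 'p \<Rightarrow> complex"
 assumes f: "\<And>i. i < r \<Longrightarrow> f i \<in> fpolys X" and g: "g \<in> fpolys X" and ind: "alg_indep r f Y"
  and "Y \<subseteq> Y'" and g0: "\<And>x. x \<in> Y \<Longrightarrow> g x = 0" and g1: "\<exists>x\<in>Y'. g x \<noteq> 0"
  and dom: "\<And>F G. F \<in> fpolys X \<Longrightarrow> G \<in> fpolys X \<Longrightarrow> \<forall>x\<in>Y'. F x * G x = 0 \<Longrightarrow>
   (\<forall>x\<in>Y'. F x = 0) \<or> (\<forall>x\<in>Y'. G x = 0)"
 shows "alg_indep (Suc r) (f(r := g)) Y'"
 unfolding alg_indep_def
proof (intro allI impI)
 fix D c assume z: "\<forall>x\<in>Y'. (\<Sum>\<nu>\<in>exps {..<Suc r} D. c \<nu> * (\<Prod>i<Suc r. (f(r := g)) i x ^ \<nu> i)) = 0"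
 define F where "F = (\<lambda>j x. \<Sum>\<nu>\<in>exps {..<r} D. c (\<nu>(r := j)) * (\<Prod>i<r. f i x ^ \<nu> i))"
 have eq: "(\<Sum>\<nu>\<in>exps {..<Suc r} D. c \<nu> * (\<Prod>i<Suc r. (f(r := g)) i x ^ \<nu> i)) = (\<Sum>j<D. g x ^ j * F j x)" for x
  unfolding sum_exps_Suc F_def sum_distrib_left by (intro sum.cong refl) auto
 have Fp: "F j \<in> fpolys X" for j unfolding F_def using f by (intro fpolys_intros) auto
 have gp: "\<not> (\<forall>x\<in>Y'. g x ^ j = 0)" for j using g1 by auto
 have zero: "\<forall>\<nu>\<in>exps {..<r} D. c (\<nu>(r := j)) = 0" if "j < D" for j
  using that
 proof (induction j rule: less_induct)
  case (less j)
  have Fz: "F i x = 0" if "i < j" for i x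
  proof -
   have "\<forall>\<nu>\<in>exps {..<r} D. c (\<nu>(r := i)) = 0" using less.IH[OF that] that less.prems by (meson order_less_trans)
   thus ?thesis unfolding F_def by (intro sum.neutral ballI) (metis mult_zero_left)
  qed
  \<comment> \<open>\<open>H\<close> is the relation divided by \<open>g ^ j\<close>; the
    coefficients below \<open>j\<close> vanish by induction.\<close>
  define H where "H = (\<lambda>x. \<Sum>i\<in>{j..<D}. g x ^ (i - j) * F i x)"
  have "g x ^ j * H x = (\<Sum>i<D. g x ^ i * F i x)" for x
  proof -
   have "(\<Sum>i<D. g x ^ i * F i x) = (\<Sum>i\<in>{j..<D}. g x ^ i * F i x)"
    using Fz by (intro sum.mono_neutral_right) auto
   also have "\<dots> = g x ^ j * H x"
    unfolding H_def sum_distrib_left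
    by (intro sum.cong refl) (simp add: power_add[symmetric] mult.assoc[symmetric])
   finally show ?thesis by simp
  qed
  hence "\<forall>x\<in>Y'. g x ^ j * H x = 0" using z eq by simp
  moreover have "H \<in> fpolys X" unfolding H_def using g Fp by (intro fpolys_intros)
  ultimately have "\<forall>x\<in>Y'. H x = 0" using dom[of "\<lambda>x. g x ^ j" H] g gp fpolys_power by blast
  moreover have "H x = F j x" if "x \<in> Y" for x
  proof -
   have "H x = (\<Sum>i\<in>{j}. g x ^ (i - j) * F i x)"
    unfolding H_def using g0[OF that] less.prems by (intro sum.mono_neutral_right) auto
   thus ?thesis by simp
  qed
  ultimately have "\<forall>x\<in>Y. F j x = 0" using \<open>Y \<subseteq> Y'\<close> by (metis subsetD)
  hence "\<forall>x\<in>Y. (\<Sum>\<nu>\<in>exps {..<r} D. (\<lambda>\<nu>. c (\<nu>(r := j))) \<nu> * (\<Prod>i<r. f i x ^ \<nu> i)) = 0"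
   by (simp only: F_def)
  thus ?case
   using ind[unfolded alg_indep_def, THEN spec, THEN spec, of "\<lambda>\<nu>. c (\<nu>(r := j))" D] by blast
 qed
 show "\<forall>\<nu>\<in>exps {..<Suc r} D. c \<nu> = 0"
 proof
  fix \<nu> assume "\<nu> \<in> exps {..<Suc r} D"
  hence "\<nu> \<in> (\<lambda>(y, g). g(r := y)) ` ({..<D} \<times> exps {..<r} D)"
   unfolding exps_def lessThan_Suc PiE_insert_eq .
  thus "c \<nu> = 0" using zero by auto
 qed
qed

text \<open>The degree is bounded separately in each generator, so an element is described by
  \<open>(B + 1) ^ card X\<close> coefficients. Uniqueness of the coefficients is not asserted, as
  the generators may satisfy relations.\<close>

definition mono_span :: "('p \<Rightarrow> complex) set \<Rightarrow> nat \<Rightarrow> ('p \<Rightarrow> complex) set" where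
 "mono_span X B = {f. \<exists>c. \<forall>x. f x = (\<Sum>\<beta>\<in>exps X (Suc B). c \<beta> * (\<Prod>y\<in>X. y x ^ \<beta> y))}"

lemma mono_span_add: "f \<in> mono_span X B \<Longrightarrow> g \<in> mono_span X B \<Longrightarrow> (\<lambda>x. f x + g x) \<in> mono_span X B"
 unfolding mono_span_def
proof clarify
 fix c c' assume "\<forall>x. f x = (\<Sum>\<beta>\<in>exps X (Suc B). c \<beta> * (\<Prod>y\<in>X. y x ^ \<beta> y))"
  "\<forall>x. g x = (\<Sum>\<beta>\<in>exps X (Suc B). c' \<beta> * (\<Prod>y\<in>X. y x ^ \<beta> y))"
 thus "\<exists>c. \<forall>x. f x + g x = (\<Sum>\<beta>\<in>exps X (Suc B). c \<beta> * (\<Prod>y\<in>X. y x ^ \<beta> y))"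
  by (intro exI[of _ "\<lambda>\<beta>. c \<beta> + c' \<beta>"]) (simp add: algebra_simps sum.distrib)
qed

lemma mono_span_scale: "f \<in> mono_span X B \<Longrightarrow> (\<lambda>x. a * f x) \<in> mono_span X B"
 unfolding mono_span_def
proof clarify
 fix c assume "\<forall>x. f x = (\<Sum>\<beta>\<in>exps X (Suc B). c \<beta> * (\<Prod>y\<in>X. y x ^ \<beta> y))"
 thus "\<exists>c. \<forall>x. a * f x = (\<Sum>\<beta>\<in>exps X (Suc B). c \<beta> * (\<Prod>y\<in>X. y x ^ \<beta> y))"
  by (intro exI[of _ "\<lambda>\<beta>. a * c \<beta>"]) (simp add: algebra_simps sum_distrib_left)
qed

lemma mono_span_monom:
 assumes "finite X" "\<And>y. y \<in> X \<Longrightarrow> \<beta> y \<le> B"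
 shows "(\<lambda>x. \<Prod>y\<in>X. y x ^ \<beta> y) \<in> mono_span X B"
proof -
 have \<beta>: "restrict \<beta> X \<in> exps X (Suc B)" using assms by (auto simp: exps_def less_Suc_eq_le)
 have "(\<Prod>y\<in>X. y x ^ \<beta> y) = (\<Sum>\<gamma>\<in>exps X (Suc B). (if \<gamma> = restrict \<beta> X then 1 else 0) * (\<Prod>y\<in>X. y x ^ \<gamma> y))" for x
  using \<beta> finite_exps[OF assms(1)] by (simp add: if_distrib[of "\<lambda>z. z * _"] cong: if_cong)
 hence "\<forall>x. (\<Prod>y\<in>X. y x ^ \<beta> y) = (\<Sum>\<gamma>\<in>exps X (Suc B). (if \<gamma> = restrict \<beta> X then 1 else 0) * (\<Prod>y\<in>X. y x ^ \<gamma> y))"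
  by blast
 thus ?thesis unfolding mono_span_def mem_Collect_eq
  by (intro exI[of _ "\<lambda>\<gamma>. if \<gamma> = restrict \<beta> X then 1 else 0"])
qed

lemma mono_span_sum:
 "finite I \<Longrightarrow> (\<And>i. i \<in> I \<Longrightarrow> f i \<in> mono_span X B) \<Longrightarrow> (\<lambda>x. \<Sum>i\<in>I. f i x) \<in> mono_span X B"
proof (induction I rule: finite_induct)
 case empty
 show ?case unfolding mono_span_def by (auto intro!: exI[of _ "\<lambda>_. 0"])
next
 case (insert i I)
 thus ?case using mono_span_add[of "f i" X B "\<lambda>x. \<Sum>i\<in>I. f i x"] by simp
qed

lemma mono_span_mult:
 assumes "finite X" "f \<in> mono_span X B" "g \<in> mono_span X B'"
 shows "(\<lambda>x. f x * g x) \<in> mono_span X (B + B')"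
proof -
 obtain c where c: "\<And>x. f x = (\<Sum>\<beta>\<in>exps X (Suc B). c \<beta> * (\<Prod>y\<in>X. y x ^ \<beta> y))"
  using assms(2) unfolding mono_span_def by blast
 obtain c' where c': "\<And>x. g x = (\<Sum>\<beta>\<in>exps X (Suc B'). c' \<beta> * (\<Prod>y\<in>X. y x ^ \<beta> y))"
  using assms(3) unfolding mono_span_def by blast
 have "f x * g x = (\<Sum>\<beta>\<in>exps X (Suc B). \<Sum>\<beta>'\<in>exps X (Suc B'). (c \<beta> * c' \<beta>') * (\<Prod>y\<in>X. y x ^ (\<beta> y + \<beta>' y)))" for x
  unfolding c c' sum_product by (intro sum.cong refl) (simp add: power_add prod.distrib)
 moreover have "(\<lambda>x. \<Sum>\<beta>\<in>exps X (Suc B). \<Sum>\<beta>'\<in>exps X (Suc B'). (c \<beta> * c' \<beta>') * (\<Prod>y\<in>X. y x ^ (\<beta> y + \<beta>' y))) \<in> mono_span X (B + B')"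
 proof (intro mono_span_sum mono_span_scale mono_span_monom finite_exps assms(1))
  fix \<beta> \<beta>' y assume "\<beta> \<in> exps X (Suc B)" "\<beta>' \<in> exps X (Suc B')" "y \<in> X"
  thus "\<beta> y + \<beta>' y \<le> B + B'"
   by (intro add_mono) (auto simp: exps_def PiE_def Pi_def less_Suc_eq_le)
 qed
 ultimately show ?thesis by simp
qed

lemma mono_span_const: "finite X \<Longrightarrow> (\<lambda>x. a) \<in> mono_span X B"
 using mono_span_scale[OF mono_span_monom[of X "\<lambda>_. 0" B], of a] by simp

lemma mono_span_power:
 "finite X \<Longrightarrow> f \<in> mono_span X B \<Longrightarrow> (\<lambda>x. f x ^ n) \<in> mono_span X (B * n)"
proof (induction n)
 case (Suc n)
 thus ?case using mono_span_mult[of X f B "\<lambda>x. f x ^ n" "B * n"] by simp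
qed (simp add: mono_span_const)

lemma mono_span_prod:
 assumes "finite X" "finite I" "\<And>i. i \<in> I \<Longrightarrow> f i \<in> mono_span X (b i)"
 shows "(\<lambda>x. \<Prod>i\<in>I. f i x) \<in> mono_span X (\<Sum>i\<in>I. b i)"
 using assms(2,3)
proof (induction I rule: finite_induct)
 case (insert i I)
 thus ?case using mono_span_mult[OF assms(1), of "f i" "b i" "\<lambda>x. \<Prod>i\<in>I. f i x"] by simp
qed (simp add: mono_span_const[OF assms(1)])

lemma mono_span_mono:
 assumes "finite X" "f \<in> mono_span X B" "B \<le> B'" shows "f \<in> mono_span X B'"
 using mono_span_mult[OF assms(1,2) mono_span_const[OF assms(1), of 1 "B' - B"]] assms(3) by simp

lemma fpolys_mono_span:
 assumes "finite X" "f \<in> fpolys X"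
 shows "\<exists>B. f \<in> mono_span X B"
 using assms(2)
proof induction
 case (const a) thus ?case using mono_span_const[OF assms(1)] by blast
next
 case (gen f)
 have "(\<lambda>x. \<Prod>y\<in>X. y x ^ (if y = f then 1 else 0)) \<in> mono_span X 1"
  by (rule mono_span_monom[OF assms(1)]) auto
 moreover have "(\<Prod>y\<in>X. y x ^ (if y = f then 1 else 0)) = f x" for x
 proof -
  have "(\<Prod>y\<in>X. y x ^ (if y = f then 1 else 0)) = (\<Prod>y\<in>X. if y = f then y x else 1)"
   by (intro prod.cong) auto
  thus ?thesis using gen assms(1) by simp
 qed
 ultimately have "f \<in> mono_span X 1" by (simp cong: if_cong)
 thus ?case by blast
next
 case (add f g)
 then obtain B B' where "f \<in> mono_span X B" "g \<in> mono_span X B'" by blast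
 thus ?case using mono_span_add[of f X "B + B'" g] mono_span_mono[OF assms(1)]
  by (meson le_add1 le_add2)
next
 case (mult f g)
 thus ?case using mono_span_mult[OF assms(1)] by blast
qed

lemma card_exps: "finite I \<Longrightarrow> card (exps I D) = D ^ card I"
 by (simp add: exps_def card_PiE)

text \<open>Counting monomials: \<open>d + 1\<close> rational functions of \<open>d\<close> parameters are algebraically dependent,
 since there are \<open>D\<^sup>d\<^sup>+\<^sup>1\<close> monomials in them but only \<open>O(D\<^sup>d)\<close> monomials in the parameters.\<close>

lemma not_alg_indep_rational:
 fixes g :: "nat \<Rightarrow> 'p \<Rightarrow> complex"
 assumes X: "finite X" "card X < r" and q: "q \<in> fpolys X" "\<And>x. x \<in> Y \<Longrightarrow> q x \<noteq> 0"
  and P: "\<And>i. i < r \<Longrightarrow> P i \<in> fpolys X" "\<And>i x. i < r \<Longrightarrow> x \<in> Y \<Longrightarrow> g i x * q x = P i x"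
 shows "\<not> alg_indep r g Y"
proof -
 have "\<exists>B. q \<in> mono_span X B \<and> (\<forall>i<r. P i \<in> mono_span X B)"
 proof -
  obtain Bq where Bq: "q \<in> mono_span X Bq" using fpolys_mono_span X q by blast
  have "\<forall>i. \<exists>B. i < r \<longrightarrow> P i \<in> mono_span X B" using fpolys_mono_span X P by blast
  then obtain b where b: "\<And>i. i < r \<Longrightarrow> P i \<in> mono_span X (b i)" by metis
  have "q \<in> mono_span X (Bq + (\<Sum>i<r. b i))" by (rule mono_span_mono[OF X(1) Bq]) simp
  moreover have "P i \<in> mono_span X (Bq + (\<Sum>i<r. b i))" if "i < r" for i
   by (rule mono_span_mono[OF X(1) b[OF that]])
    (simp add: that trans_le_add2 member_le_sum)
  ultimately show ?thesis by blast
 qed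
 then obtain B where B: "q \<in> mono_span X B" "\<And>i. i < r \<Longrightarrow> P i \<in> mono_span X B" by blast
 define d where "d = card X"
 \<comment> \<open>After clearing denominators the exponents are at most \<open>B * (r * D)\<close>.
   The choice of \<open>C\<close> gives \<open>B * (r * D) + 1 \<le> C * D\<close>, and the choice
   of \<open>D\<close> gives \<open>C ^ d < D\<close>, so that
   \<open>(C * D) ^ d < D ^ Suc d\<close>.\<close>
 define C where "C = B * r + 1"
 define D where "D = C ^ d + 1"
 have "(B * (r * D) + 1) ^ d \<le> (C * D) ^ d"
  by (rule power_mono) (auto simp: C_def D_def algebra_simps)
 also have "\<dots> = C ^ d * D ^ d" by (rule power_mult_distrib)
 also have "\<dots> < D * D ^ d" by (rule mult_strict_right_mono) (simp_all add: D_def)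
 also have "\<dots> = D ^ Suc d" by simp
 also have "\<dots> \<le> D ^ r" using X by (intro power_increasing) (auto simp: d_def D_def)
 finally have lt: "card (exps X (Suc (B * (r * D)))) < card (exps {..<r} D)"
  using X by (simp add: card_exps d_def)
 \<comment> \<open>On \<open>Y\<close> this is the monomial in the \<open>g i\<close> times
   \<open>q ^ (r * D)\<close>, one common denominator for all exponent vectors in the box.\<close>
 define h where "h = (\<lambda>\<nu> x. q x ^ (r * D - (\<Sum>i<r. \<nu> i)) * (\<Prod>i<r. P i x ^ \<nu> i))"
 have sum_le: "(\<Sum>i<r. \<nu> i) \<le> r * D" if "\<nu> \<in> exps {..<r} D" for \<nu> :: "nat \<Rightarrow> nat"
 proof -
  have "(\<Sum>i<r. \<nu> i) \<le> (\<Sum>i<r. D)"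
  proof (rule sum_mono)
   fix i assume "i \<in> {..<r}"
   hence "\<nu> i < D" using that by (auto simp: exps_def PiE_def Pi_def)
   thus "\<nu> i \<le> D" by simp
  qed
  thus ?thesis by simp
 qed
 have hs: "h \<nu> \<in> mono_span X (B * (r * D))" if "\<nu> \<in> exps {..<r} D" for \<nu>
 proof -
  have "h \<nu> \<in> mono_span X (B * (r * D - (\<Sum>i<r. \<nu> i)) + (\<Sum>i<r. B * \<nu> i))"
   unfolding h_def using X B by (intro mono_span_mult mono_span_power mono_span_prod) auto
  moreover have "B * (r * D - (\<Sum>i<r. \<nu> i)) + (\<Sum>i<r. B * \<nu> i) = B * (r * D)"
   using sum_le[OF that] by (simp add: sum_distrib_left[symmetric] add_mult_distrib2[symmetric])
  ultimately show ?thesis by simp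
 qed
 have "\<forall>\<nu>. \<exists>c. \<nu> \<in> exps {..<r} D \<longrightarrow> (\<forall>x. h \<nu> x = (\<Sum>\<beta>\<in>exps X (Suc (B * (r * D))). c \<beta> * (\<Prod>y\<in>X. y x ^ \<beta> y)))"
  using hs unfolding mono_span_def by blast
 then obtain co where co: "\<And>\<nu> x. \<nu> \<in> exps {..<r} D \<Longrightarrow> h \<nu> x = (\<Sum>\<beta>\<in>exps X (Suc (B * (r * D))). co \<nu> \<beta> * (\<Prod>y\<in>X. y x ^ \<beta> y))"
  by (drule_tac choice) (elim exE, blast)
 \<comment> \<open>The unknowns are the coefficients of the relation, one for each monomial in the
   \<open>g i\<close>; the equations say that each monomial in the parameters cancels. By the count
   above there are more unknowns than equations.\<close>
 obtain c where c: "\<exists>\<nu>\<in>exps {..<r} D. c \<nu> \<noteq> 0"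
  "\<forall>\<beta>\<in>exps X (Suc (B * (r * D))). (\<Sum>\<nu>\<in>exps {..<r} D. co \<nu> \<beta> * c \<nu>) = 0"
  using underdetermined_system[OF finite_exps finite_exps lt, of "\<lambda>\<beta> \<nu>. co \<nu> \<beta>"] X by auto
 have "(\<Sum>\<nu>\<in>exps {..<r} D. c \<nu> * (\<Prod>i<r. g i x ^ \<nu> i)) = 0" if x: "x \<in> Y" for x
 proof -
  have "q x ^ (r * D) * (\<Sum>\<nu>\<in>exps {..<r} D. c \<nu> * (\<Prod>i<r. g i x ^ \<nu> i)) = (\<Sum>\<nu>\<in>exps {..<r} D. c \<nu> * h \<nu> x)"
   unfolding sum_distrib_left
  proof (intro sum.cong refl)
   fix \<nu> assume \<nu>: "\<nu> \<in> exps {..<r} D"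
   have "(\<Prod>i<r. P i x ^ \<nu> i) = (\<Prod>i<r. g i x ^ \<nu> i * q x ^ \<nu> i)"
    using P(2) x by (intro prod.cong refl) (simp add: P(2)[symmetric] power_mult_distrib)
   also have "\<dots> = (\<Prod>i<r. g i x ^ \<nu> i) * q x ^ (\<Sum>i<r. \<nu> i)"
    by (simp add: prod.distrib power_sum)
   finally show "q x ^ (r * D) * (c \<nu> * (\<Prod>i<r. g i x ^ \<nu> i)) = c \<nu> * h \<nu> x"
    using sum_le[OF \<nu>] unfolding h_def by (simp add: power_add[symmetric] algebra_simps)
  qed
  also have "\<dots> = (\<Sum>\<nu>\<in>exps {..<r} D. \<Sum>\<beta>\<in>exps X (Suc (B * (r * D))). co \<nu> \<beta> * c \<nu> * (\<Prod>y\<in>X. y x ^ \<beta> y))"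
   by (intro sum.cong refl) (simp add: co sum_distrib_left algebra_simps)
  also have "\<dots> = (\<Sum>\<beta>\<in>exps X (Suc (B * (r * D))). (\<Sum>\<nu>\<in>exps {..<r} D. co \<nu> \<beta> * c \<nu>) * (\<Prod>y\<in>X. y x ^ \<beta> y))"
   by (subst sum.swap) (simp add: sum_distrib_right)
  also have "\<dots> = 0" using c by simp
  finally show ?thesis using q x by simp
 qed
 thus ?thesis using c unfolding alg_indep_def by blast
qed

section \<open>Row spans and charts of the Grassmannian\<close>

definition indep_rows :: "nat \<Rightarrow> nat \<Rightarrow> complex mat \<Rightarrow> bool" where
 "indep_rows k N A \<longleftrightarrow> (\<forall>y. (\<forall>j<N. (\<Sum>a<k. y a * A $$ (a, j)) = 0) \<longrightarrow> (\<forall>a<k. y a = 0))"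

text \<open>Columns are given by a list, so that a single index can be replaced in place as Cramer's
  rule requires. Only the first \<open>length xs\<close> rows enter, and repeated indices are
  allowed.\<close>

definition lminor :: "complex mat \<Rightarrow> nat list \<Rightarrow> complex" where
 "lminor A xs = det (mat (length xs) (length xs) (\<lambda>(a, b). A $$ (a, xs ! b)))"

lemma nth_less: "set xs \<subseteq> {..<N} \<Longrightarrow> length xs = k \<Longrightarrow> b < k \<Longrightarrow> xs ! b < (N :: nat)"
 using nth_mem[of b xs] by (auto simp: subset_iff)

lemma row_span_iff:
 assumes "A \<in> carrier_mat k N"
 shows "v \<in> row_span N A \<longleftrightarrow> v \<in> carrier_vec N \<and> (\<exists>y. \<forall>j<N. v $ j = (\<Sum>a<k. y a * A $$ (a, j)))"
proof -
 have entry: "(A\<^sup>T *\<^sub>v y) $ j = (\<Sum>a<k. y $ a * A $$ (a, j))" if "y \<in> carrier_vec k" "j < N" for y j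
 proof -
  have "(A\<^sup>T *\<^sub>v y) $ j = (\<Sum>a = 0..<k. A $$ (a, j) * y $ a)"
   using that assms by (simp add: scalar_prod_def)
  thus ?thesis by (simp add: atLeast0LessThan mult.commute)
 qed
 show ?thesis
 proof
  assume "v \<in> row_span N A"
  then obtain y where "y \<in> carrier_vec k" "v = A\<^sup>T *\<^sub>v y" "v \<in> carrier_vec N"
   using assms by (auto simp: vec_space.row_space_eq[OF assms])
  thus "v \<in> carrier_vec N \<and> (\<exists>y. \<forall>j<N. v $ j = (\<Sum>a<k. y a * A $$ (a, j)))"
   using entry by (auto intro!: exI[of _ "\<lambda>a. y $ a"])
 next
  assume "v \<in> carrier_vec N \<and> (\<exists>y. \<forall>j<N. v $ j = (\<Sum>a<k. y a * A $$ (a, j)))"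
  then obtain y where v: "v \<in> carrier_vec N" and y: "\<forall>j<N. v $ j = (\<Sum>a<k. y a * A $$ (a, j))" by blast
  have "A\<^sup>T *\<^sub>v vec k y = v"
  proof (rule eq_vecI)
   show "dim_vec (A\<^sup>T *\<^sub>v vec k y) = dim_vec v" using v assms by simp
   fix j assume "j < dim_vec v"
   thus "(A\<^sup>T *\<^sub>v vec k y) $ j = v $ j" using entry[of "vec k y" j] y v by simp
  qed
  thus "v \<in> row_span N A" using v assms by (auto simp: vec_space.row_space_eq[OF assms] intro!: bexI[of _ "vec k y"])
 qed
qed

text \<open>Row rank equals column rank, in the form of a choice of columns. If a maximal
  independent set \<open>J\<close> were smaller than the set of rows, some combination of rows would
  vanish on \<open>J\<close> but not at another column, and that column could be added to
  \<open>J\<close>.\<close>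

lemma independent_columns:
 fixes B :: "'r \<Rightarrow> 'c \<Rightarrow> complex"
 assumes "finite Rw" "finite K"
  and rows: "\<And>y. (\<forall>a\<in>K. (\<Sum>\<rho>\<in>Rw. B \<rho> a * y \<rho>) = 0) \<Longrightarrow> \<forall>\<rho>\<in>Rw. y \<rho> = 0"
 shows "\<exists>J\<subseteq>K. card J = card Rw \<and> (\<forall>z. (\<forall>\<rho>\<in>Rw. (\<Sum>a\<in>J. B \<rho> a * z a) = 0) \<longrightarrow> (\<forall>a\<in>J. z a = 0))"
proof -
 define ind where "ind = (\<lambda>J. J \<subseteq> K \<and> (\<forall>z. (\<forall>\<rho>\<in>Rw. (\<Sum>a\<in>J. B \<rho> a * z a) = 0) \<longrightarrow> (\<forall>a\<in>J. z a = 0)))"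
 have "ind {}" by (simp add: ind_def)
 moreover have "\<forall>J. ind J \<longrightarrow> card J \<le> card K" using assms(2) by (auto simp: ind_def intro: card_mono)
 ultimately have "\<exists>J. ind J \<and> (\<forall>J'. ind J' \<longrightarrow> card J' \<le> card J)"
  by (intro ex_has_greatest_nat[of ind "{}" card "Suc (card K)"]) (auto simp: less_Suc_eq_le)
 then obtain J where J: "ind J" "\<And>J'. ind J' \<Longrightarrow> card J' \<le> card J" by blast
 have JK: "J \<subseteq> K" and Jz: "\<And>z. (\<forall>\<rho>\<in>Rw. (\<Sum>a\<in>J. B \<rho> a * z a) = 0) \<Longrightarrow> (\<forall>a\<in>J. z a = 0)"
  using J(1) unfolding ind_def by blast+
 have finJ: "finite J" using JK assms(2) by (rule finite_subset)
 have "\<not> card J < card Rw"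
 proof
  assume "card J < card Rw"
  then obtain y where y: "\<exists>\<rho>\<in>Rw. y \<rho> \<noteq> 0" "\<forall>a\<in>J. (\<Sum>\<rho>\<in>Rw. B \<rho> a * y \<rho>) = 0"
   using underdetermined_system[OF finJ assms(1), of "\<lambda>a \<rho>. B \<rho> a"] by blast
  then obtain a where a: "a \<in> K" "(\<Sum>\<rho>\<in>Rw. B \<rho> a * y \<rho>) \<noteq> 0" using rows by blast
  hence aJ: "a \<notin> J" using y by blast
  have "ind (insert a J)" unfolding ind_def
  proof (intro conjI allI impI)
   show "insert a J \<subseteq> K" using a JK by simp
   fix z assume z: "\<forall>\<rho>\<in>Rw. (\<Sum>b\<in>insert a J. B \<rho> b * z b) = 0"
   have "0 = (\<Sum>\<rho>\<in>Rw. y \<rho> * (\<Sum>b\<in>insert a J. B \<rho> b * z b))" using z by simp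
   also have "\<dots> = (\<Sum>b\<in>insert a J. (\<Sum>\<rho>\<in>Rw. B \<rho> b * y \<rho>) * z b)"
    unfolding sum_distrib_left sum_distrib_right by (subst sum.swap) (simp add: ac_simps)
   also have "\<dots> = (\<Sum>\<rho>\<in>Rw. B \<rho> a * y \<rho>) * z a" using y aJ finJ by simp
   finally have "z a = 0" using a by simp
   hence "\<forall>b\<in>J. z b = 0" using z aJ finJ by (intro Jz) simp
   with \<open>z a = 0\<close> show "\<forall>b\<in>insert a J. z b = 0" by simp
  qed
  from J(2)[OF this] show False using aJ finJ by simp
 qed
 moreover have "\<not> card Rw < card J"
 proof
  assume "card Rw < card J"
  then obtain z where "\<exists>a\<in>J. z a \<noteq> 0" "\<forall>\<rho>\<in>Rw. (\<Sum>a\<in>J. B \<rho> a * z a) = 0"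
   using underdetermined_system[OF assms(1) finJ, of B] by blast
  thus False using Jz by blast
 qed
 ultimately have "card J = card Rw" by simp
 thus ?thesis using JK Jz by blast
qed

lemma det_zero_iff_columns:
 fixes f :: "nat \<Rightarrow> nat \<Rightarrow> complex"
 shows "det (mat k k (\<lambda>(a, b). f a b)) = 0 \<longleftrightarrow> (\<exists>z. (\<exists>b<k. z b \<noteq> 0) \<and> (\<forall>a<k. (\<Sum>b<k. f a b * z b) = 0))"
proof -
 let ?M = "mat k k (\<lambda>(a, b). f a b)"
 have entry: "(?M *\<^sub>v v) $ a = (\<Sum>b<k. f a b * v $ b)" if "v \<in> carrier_vec k" "a < k" for v a
  using that by (simp add: scalar_prod_def atLeast0LessThan)
 have "det ?M = 0 \<longleftrightarrow> (\<exists>v. v \<in> carrier_vec k \<and> v \<noteq> 0\<^sub>v k \<and> ?M *\<^sub>v v = 0\<^sub>v k)"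
  by (rule det_0_iff_vec_prod_zero_field) simp
 also have "\<dots> \<longleftrightarrow> (\<exists>z. (\<exists>b<k. z b \<noteq> 0) \<and> (\<forall>a<k. (\<Sum>b<k. f a b * z b) = 0))"
 proof
  assume "\<exists>v. v \<in> carrier_vec k \<and> v \<noteq> 0\<^sub>v k \<and> ?M *\<^sub>v v = 0\<^sub>v k"
  then obtain v where v: "v \<in> carrier_vec k" "v \<noteq> 0\<^sub>v k" "?M *\<^sub>v v = 0\<^sub>v k" by blast
  have "\<exists>b<k. v $ b \<noteq> 0" using v by (auto simp: vec_eq_iff)
  moreover have "\<forall>a<k. (\<Sum>b<k. f a b * v $ b) = 0" using entry[OF v(1)] v(3) by (metis index_zero_vec(1))
  ultimately show "\<exists>z. (\<exists>b<k. z b \<noteq> 0) \<and> (\<forall>a<k. (\<Sum>b<k. f a b * z b) = 0)" by blast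
 next
  assume "\<exists>z. (\<exists>b<k. z b \<noteq> 0) \<and> (\<forall>a<k. (\<Sum>b<k. f a b * z b) = 0)"
  then obtain z where z: "\<exists>b<k. z b \<noteq> 0" "\<forall>a<k. (\<Sum>b<k. f a b * z b) = 0" by blast
  have "?M *\<^sub>v vec k z = 0\<^sub>v k"
   using z(2) entry[of "vec k z"] by (intro eq_vecI) auto
  moreover have "vec k z \<noteq> 0\<^sub>v k" using z(1) by (metis index_vec index_zero_vec(1))
  ultimately show "\<exists>v. v \<in> carrier_vec k \<and> v \<noteq> 0\<^sub>v k \<and> ?M *\<^sub>v v = 0\<^sub>v k"
   by (intro exI[of _ "vec k z"]) auto
 qed
 finally show ?thesis .
qed

lemma det_zero_iff_rows:
 fixes f :: "nat \<Rightarrow> nat \<Rightarrow> complex"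
 shows "det (mat k k (\<lambda>(a, b). f a b)) = 0 \<longleftrightarrow> (\<exists>y. (\<exists>a<k. y a \<noteq> 0) \<and> (\<forall>b<k. (\<Sum>a<k. y a * f a b) = 0))"
proof -
 have "transpose_mat (mat k k (\<lambda>(a, b). f a b)) = mat k k (\<lambda>(a, b). f b a)"
  by (intro eq_matI) auto
 hence "det (mat k k (\<lambda>(a, b). f a b)) = det (mat k k (\<lambda>(a, b). f b a))"
  by (metis det_transpose mat_carrier)
 thus ?thesis by (simp add: det_zero_iff_columns mult.commute)
qed

lemma lminor_zero_iff:
 "length xs = k \<Longrightarrow> lminor A xs = 0 \<longleftrightarrow> (\<exists>y. (\<exists>a<k. y a \<noteq> 0) \<and> (\<forall>b<k. (\<Sum>a<k. y a * A $$ (a, xs ! b)) = 0))"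
 unfolding lminor_def by (simp add: det_zero_iff_rows[of _ "\<lambda>a b. A $$ (a, xs ! b)"])

lemma lminor_indep_rows:
 assumes "length xs = k" "set xs \<subseteq> {..<N}" "lminor A xs \<noteq> 0"
 shows "indep_rows k N A"
 unfolding indep_rows_def
proof (intro allI impI)
 fix y a assume y: "\<forall>j<N. (\<Sum>a<k. y a * A $$ (a, j)) = 0" and "a < k"
 have "\<forall>b<k. (\<Sum>a<k. y a * A $$ (a, xs ! b)) = 0" using y assms(1,2) by (auto simp: subset_iff)
 thus "y a = 0" using lminor_zero_iff[OF assms(1), of A] assms(3) \<open>a < k\<close> by blast
qed

lemma indep_rows_lminor:
 assumes "indep_rows k N A"
 shows "\<exists>xs. length xs = k \<and> distinct xs \<and> sorted xs \<and> set xs \<subseteq> {..<N} \<and> lminor A xs \<noteq> 0"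
proof -
 have "\<exists>J\<subseteq>{..<N}. card J = card {..<k} \<and> (\<forall>z. (\<forall>\<rho>\<in>{..<k}. (\<Sum>a\<in>J. A $$ (\<rho>, a) * z a) = 0) \<longrightarrow> (\<forall>a\<in>J. z a = 0))"
  using assms unfolding indep_rows_def by (intro independent_columns) (auto simp: mult.commute)
 then obtain J where J: "J \<subseteq> {..<N}" "card J = k"
  "\<And>z. (\<forall>\<rho><k. (\<Sum>a\<in>J. A $$ (\<rho>, a) * z a) = 0) \<Longrightarrow> (\<forall>a\<in>J. z a = 0)" by auto
 define xs where "xs = sorted_list_of_set J"
 have finJ: "finite J" using J(1) finite_subset by blast
 have xs: "length xs = k" "distinct xs" "sorted xs" "set xs = J" using J finJ by (auto simp: xs_def)
 have bij: "bij_betw ((!) xs) {..<k} J" using xs bij_betw_nth by blast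
 have "lminor A xs \<noteq> 0"
 proof
  assume "lminor A xs = 0"
  then obtain z where z: "\<exists>b<k. z b \<noteq> 0" "\<forall>a<k. (\<Sum>b<k. A $$ (a, xs ! b) * z b) = 0"
   unfolding lminor_def xs(1) det_zero_iff_columns[of k "\<lambda>a b. A $$ (a, xs ! b)"] by blast
  define w where "w = (\<lambda>j. z (inv_into {..<k} ((!) xs) j))"
  have w: "w (xs ! b) = z b" if "b < k" for b
   using that bij by (simp add: w_def bij_betw_def)
  have "(\<Sum>j\<in>J. A $$ (a, j) * w j) = (\<Sum>b<k. A $$ (a, xs ! b) * z b)" for a
   using w by (simp add: sum.reindex_bij_betw[OF bij, symmetric])
  hence "\<forall>j\<in>J. w j = 0" using z(2) J(3) by simp
  thus False using z(1) w xs by (metis nth_mem)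
 qed
 thus ?thesis using xs J by blast
qed

section \<open>Maximal minors and rank\<close>

lemma pick_sorted:
 assumes "finite I"
 shows "map (pick I) [0..<card I] = sorted_list_of_set I"
proof -
 let ?p = "map (pick I) [0..<card I]"
 have lt: "pick I a < pick I b" if "a < b" "b < card I" for a b using pick_mono_le that by blast
 have d: "distinct ?p"
  unfolding distinct_map
 proof (intro conjI inj_onI)
  fix a b assume "a \<in> set [0..<card I]" "b \<in> set [0..<card I]" "pick I a = pick I b"
  thus "a = b" using lt[of a b] lt[of b a] by (cases a b rule: linorder_cases) auto
 qed simp
 have "set ?p \<subseteq> I" using pick_in_set_le by auto
 moreover have "card (set ?p) = card I" using distinct_card[OF d] by simp
 ultimately have s: "set ?p = I" using assms card_subset_eq by blast
 have "sorted ?p" unfolding sorted_iff_nth_mono_less using lt by (auto intro: less_imp_le)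
 thus ?thesis using d s assms by (intro sorted_distinct_set_unique) auto
qed

lemma maximal_minor_lminor:
 assumes "A \<in> carrier_mat k n" "I \<subseteq> {..<n}" "card I = k"
 shows "maximal_minor A I = lminor A (sorted_list_of_set I)"
proof -
 have fI: "finite I" using assms finite_subset by blast
 have len: "length (sorted_list_of_set I) = k" using assms fI by simp
 have r: "{i. i < dim_row A \<and> i \<in> UNIV} = {..<k}" and c: "{j. j < dim_col A \<and> j \<in> I} = I" using assms by auto
 have "pick I b = sorted_list_of_set I ! b" if "b < k" for b
  using that assms(3) nth_map[of b "[0..<card I]" "pick I"] by (simp flip: pick_sorted[OF fI])
 hence "submatrix A UNIV I = mat k k (\<lambda>(a, b). A $$ (a, sorted_list_of_set I ! b))"
  unfolding submatrix_def r c using assms(3) by (intro cong_mat) (simp_all add: pick_UNIV)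
 thus ?thesis unfolding maximal_minor_def lminor_def len by (rule arg_cong)
qed

text \<open>The rank counts independent columns; a nonvanishing minor of size \<open>k\<close>
  mediates between columns and rows in both directions.\<close>

lemma rank_eq_iff_indep_rows:
 assumes A: "A \<in> carrier_mat k N"
 shows "vec_space.rank k A = k \<longleftrightarrow> indep_rows k N A"
proof -
 interpret vec_space "TYPE(complex)" k .
 show ?thesis
 proof
  assume rk: "rank A = k"
  obtain S where S: "maximal S (\<lambda>T. T \<subseteq> set (cols A) \<and> lin_indpt T)" "finite S"
   using maximal_exists_superset[of "set (cols A)" "\<lambda>T. T \<subseteq> set (cols A) \<and> lin_indpt T" "{}"]
   by (auto simp: lin_dep_def)
  have cS: "card S = k" using rank_card_indpt[OF A S(1)] rk by simp
  have SA: "S \<subseteq> set (cols A)" "lin_indpt S" using S(1) by (auto simp: maximal_def)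
  obtain vs where vs: "set vs = S" "distinct vs" using S(2) finite_distinct_list by blast
  hence len: "length vs = k" using cS distinct_card by fastforce
  have vc: "set vs \<subseteq> carrier_vec k" using SA vs cols_dim[of A] A by auto
  define B where "B = mat_of_cols k vs"
  have B: "B \<in> carrier_mat k k" using mat_of_cols_carrier(1)[of k vs] len by (simp add: B_def)
  have cols: "cols B = vs" unfolding B_def using vc by (rule cols_mat_of_cols)
  have "rank B = k" using lin_indpt_full_rank[OF B] cols vs SA by simp
  hence "det B \<noteq> 0" using det_rank_iff[OF B] by simp
  moreover have "B = mat k k (\<lambda>(a, b). (vs ! b) $ a)"
   unfolding B_def mat_of_cols_def by (simp add: len)
  ultimately have nz: "\<not> (\<exists>y. (\<exists>a<k. y a \<noteq> 0) \<and> (\<forall>b<k. (\<Sum>a<k. y a * (vs ! b) $ a) = 0))"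
   using det_zero_iff_rows[of k "\<lambda>a b. (vs ! b) $ a"] by simp
  show "indep_rows k N A" unfolding indep_rows_def
  proof (intro allI impI)
   fix y a assume y: "\<forall>j<N. (\<Sum>a<k. y a * A $$ (a, j)) = 0" and "a < k"
   have "(\<Sum>a<k. y a * (vs ! b) $ a) = 0" if "b < k" for b
   proof -
    have "vs ! b \<in> set (cols A)" using that len vs SA by (metis nth_mem subsetD)
    then obtain j where "j < N" "vs ! b = col A j" using A by (auto simp: cols_def)
    thus ?thesis using y A by (auto simp: index_col intro!: sum.cong)
   qed
   thus "y a = 0" using nz \<open>a < k\<close> by blast
  qed
 next
  assume "indep_rows k N A"
  then obtain xs where xs: "length xs = k" "distinct xs" "sorted xs" "set xs \<subseteq> {..<N}" "lminor A xs \<noteq> 0"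
   using indep_rows_lminor by blast
  have "card (set xs) = k" using distinct_card[OF xs(2)] xs(1) by simp
  hence "det (submatrix A UNIV (set xs)) \<noteq> 0"
   using maximal_minor_lminor[OF A xs(4)] xs(2,3,5) by (simp add: maximal_minor_def sorted_list_of_set.idem_if_sorted_distinct)
  from rank_gt_minor[OF A this] have "k \<le> rank A"
   using xs(4) \<open>card (set xs) = k\<close> by (simp add: Collect_conj_eq lessThan_def[symmetric] Int_absorb1)
  moreover have "rank A \<le> k"
  proof -
   obtain S where S: "maximal S (\<lambda>T. T \<subseteq> set (cols A) \<and> lin_indpt T)" "finite S"
    using maximal_exists_superset[of "set (cols A)" "\<lambda>T. T \<subseteq> set (cols A) \<and> lin_indpt T" "{}"]
    by (auto simp: lin_dep_def)
   have "S \<subseteq> carrier_vec k" "lin_indpt S" using S(1) cols_dim[of A] A by (auto simp: maximal_def)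
   hence "card S \<le> k" using li_le_dim(2)[OF fin_dim, of S] dim_is_n by simp
   thus ?thesis using rank_card_indpt[OF A S(1)] by simp
  qed
  ultimately show "rank A = k" by simp
 qed
qed

lemma mats_of_rank_iff: "A \<in> mats_of_rank k N k \<longleftrightarrow> A \<in> carrier_mat k N \<and> indep_rows k N A"
 using rank_eq_iff_indep_rows unfolding mats_of_rank_def by blast

section \<open>Cramer's rule and normalized matrices\<close>

lemma lminor_polys:
 assumes "set xs \<subseteq> {..<N}" "length xs = k"
 shows "(\<lambda>A. lminor A xs) \<in> mat_polys k N"
proof -
 have "lminor A xs = (\<Sum>p\<in>{p. p permutes {0..<k}}. signof p * (\<Prod>i = 0..<k. A $$ (i, xs ! p i)))" for A
  unfolding lminor_def assms(2)
  by (subst det_def'[of _ k]) (auto intro!: sum.cong prod.cong simp: permutes_in_image[of _ "{0..<k}"])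
 moreover have "(\<lambda>A. \<Sum>p\<in>{p. p permutes {0..<k}}. signof p * (\<Prod>i = 0..<k. A $$ (i, xs ! p i))) \<in> mat_polys k N"
  unfolding mat_polys_eq
 proof (intro fpolys_intros)
  fix p i assume "p \<in> {p. p permutes {0..<k}}" and i: "i \<in> {0..<k}"
  hence "p i < k" using permutes_in_image[of p "{0..<k}" i] by auto
  hence "xs ! p i < N" using assms by (metis lessThan_iff nth_mem subsetD)
  thus "(\<lambda>A. A $$ (i, xs ! p i)) \<in> fpolys (mat_entries k N)"
   using i by (intro fpolys.gen) (auto simp: mat_entries_def)
 qed
 ultimately show ?thesis by simp
qed

text \<open>The coordinates of column \<open>j\<close> in the basis formed by the columns at
  \<open>xs\<close> are quotients of minors that differ in one index.\<close>

lemma lminor_cramer: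
 assumes xs: "length xs = k" "lminor A xs \<noteq> 0" and "a < k"
 shows "(\<Sum>b<k. A $$ (a, xs ! b) * lminor A (xs[b := j])) = lminor A xs * A $$ (a, j)"
proof -
 define M where "M = mat k k (\<lambda>(a, b). A $$ (a, xs ! b))"
 have M: "M \<in> carrier_mat k k" by (simp add: M_def)
 have dM: "det M = lminor A xs" using xs by (simp add: M_def lminor_def)
 have "det M \<noteq> 0" using dM xs by simp
 define x where "x = (1 / det M) \<cdot>\<^sub>v (adj_mat M *\<^sub>v vec k (\<lambda>a. A $$ (a, j)))"
 have x: "x \<in> carrier_vec k" using adj_mat(1)[OF M] by (simp add: x_def)
 have Mx: "M *\<^sub>v x = vec k (\<lambda>a. A $$ (a, j))"
 proof -
  have "M *\<^sub>v x = (1 / det M) \<cdot>\<^sub>v (M *\<^sub>v (adj_mat M *\<^sub>v vec k (\<lambda>a. A $$ (a, j))))"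
   unfolding x_def using M adj_mat(1)[OF M] by (intro mult_mat_vec[of _ k k]) auto
  also have "M *\<^sub>v (adj_mat M *\<^sub>v vec k (\<lambda>a. A $$ (a, j))) = (M * adj_mat M) *\<^sub>v vec k (\<lambda>a. A $$ (a, j))"
   using M adj_mat(1)[OF M] by (intro assoc_mult_mat_vec[symmetric]) auto
  also have "\<dots> = det M \<cdot>\<^sub>v vec k (\<lambda>a. A $$ (a, j))"
   unfolding adj_mat(2)[OF M] by (intro eq_vecI) auto
  finally show ?thesis using \<open>det M \<noteq> 0\<close> by (auto intro!: eq_vecI)
 qed
 have xb: "x $ b * lminor A xs = lminor A (xs[b := j])" if "b < k" for b
 proof -
  have "replace_col M (M *\<^sub>v x) b = mat (length (xs[b := j])) (length (xs[b := j])) (\<lambda>(a, c). A $$ (a, xs[b := j] ! c))"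
   unfolding Mx using xs that by (intro eq_matI) (auto simp: replace_col_def M_def nth_list_update)
  thus ?thesis using cramer_lemma_mat[OF M x that] unfolding dM lminor_def by simp
 qed
 have "(M *\<^sub>v x) $ a = (\<Sum>b<k. A $$ (a, xs ! b) * x $ b)"
  using x M \<open>a < k\<close> by (simp add: scalar_prod_def M_def atLeast0LessThan)
 hence "A $$ (a, j) = (\<Sum>b<k. A $$ (a, xs ! b) * x $ b)" using Mx \<open>a < k\<close> by simp
 hence "lminor A xs * A $$ (a, j) = (\<Sum>b<k. A $$ (a, xs ! b) * (x $ b * lminor A xs))"
  by (simp add: sum_distrib_left algebra_simps)
 thus ?thesis using xb by simp
qed

text \<open>The product of the inverse of the block at \<open>xs\<close> with \<open>A\<close>, that
  is, the representative of the row span with an identity block at \<open>xs\<close>. Writing its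
  entries as quotients of minors exhibits them as rational functions of \<open>A\<close> with the
  one denominator \<open>lminor A xs\<close>.\<close>

definition norm_mat :: "nat \<Rightarrow> nat \<Rightarrow> nat list \<Rightarrow> complex mat \<Rightarrow> complex mat" where
 "norm_mat k N xs A = mat k N (\<lambda>(b, j). lminor A (xs[b := j]) / lminor A xs)"

lemma norm_mat_carrier [simp]: "norm_mat k N xs A \<in> carrier_mat k N"
 by (simp add: norm_mat_def)

lemma norm_mat_identity:
 assumes "length xs = k" "set xs \<subseteq> {..<N}" "lminor A xs \<noteq> 0" "a < k" "b < k"
 shows "norm_mat k N xs A $$ (a, xs ! b) = (if a = b then 1 else 0)"
proof -
 have "xs ! b < N" by (rule nth_less[OF assms(2,1,5)])
 moreover have "lminor A (xs[a := xs ! b]) = 0" if "a \<noteq> b"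
  unfolding lminor_def
  by (rule det_identical_columns[of _ k a b])
   (use assms that in \<open>auto intro!: eq_vecI simp: nth_list_update\<close>)
 ultimately show ?thesis using assms by (auto simp: norm_mat_def)
qed

lemma row_span_norm_mat:
 assumes A: "A \<in> carrier_mat k N" and xs: "length xs = k" "set xs \<subseteq> {..<N}" "lminor A xs \<noteq> 0"
 shows "row_span N (norm_mat k N xs A) = row_span N A"
proof (rule Set.set_eqI)
 fix v
 let ?B = "norm_mat k N xs A"
 have lt: "xs ! b < N" if "b < k" for b by (rule nth_less[OF xs(2,1) that])
 have AB: "A $$ (a, j) = (\<Sum>b<k. A $$ (a, xs ! b) * ?B $$ (b, j))" if "a < k" "j < N" for a j
  using lminor_cramer[OF xs(1,3) that(1), of j] xs(3) that
  by (simp add: norm_mat_def sum_divide_distrib[symmetric] field_simps)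
 show "v \<in> row_span N ?B \<longleftrightarrow> v \<in> row_span N A"
 proof
  assume "v \<in> row_span N A"
  then obtain y where v: "v \<in> carrier_vec N" "\<forall>j<N. v $ j = (\<Sum>a<k. y a * A $$ (a, j))"
   using row_span_iff[OF A] by blast
  have "v $ j = (\<Sum>b<k. v $ (xs ! b) * ?B $$ (b, j))" if "j < N" for j
  proof -
   have "v $ j = (\<Sum>a<k. \<Sum>b<k. y a * A $$ (a, xs ! b) * ?B $$ (b, j))"
    using v that AB by (simp add: sum_distrib_left mult.assoc)
   also have "\<dots> = (\<Sum>b<k. v $ (xs ! b) * ?B $$ (b, j))"
    by (subst sum.swap) (simp add: v lt sum_distrib_right)
   finally show ?thesis .
  qed
  thus "v \<in> row_span N ?B"
   unfolding row_span_iff[OF norm_mat_carrier] using v(1)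
   by (intro conjI exI[of _ "\<lambda>b. v $ (xs ! b)"]) auto
 next
  assume "v \<in> row_span N ?B"
  then obtain z where v: "v \<in> carrier_vec N" "\<forall>j<N. v $ j = (\<Sum>b<k. z b * ?B $$ (b, j))"
   using row_span_iff[OF norm_mat_carrier] by blast
  \<comment> \<open>The square system is solved through its homogenization: \<open>k\<close>
    equations in \<open>k + 1\<close> unknowns have a nonzero solution, and its last entry cannot
    vanish because the minor at \<open>xs\<close> is nonzero.\<close>
  have "\<exists>y. \<forall>b<k. (\<Sum>a<k. y a * A $$ (a, xs ! b)) = z b"
  proof -
   have "\<exists>t. (\<exists>i\<in>{..k}. t i \<noteq> 0) \<and> (\<forall>b\<in>{..<k}. (\<Sum>i\<in>{..k}. (if i = k then - z b else A $$ (i, xs ! b)) * t i) = 0)"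
    by (rule underdetermined_system) auto
   then obtain t where t: "\<exists>i\<le>k. t i \<noteq> 0"
    "\<forall>b<k. (\<Sum>i\<in>{..k}. (if i = k then - z b else A $$ (i, xs ! b)) * t i) = 0" by auto
   have s: "(\<Sum>i<k. t i * A $$ (i, xs ! b)) = z b * t k" if "b < k" for b
    using t(2) that by (simp add: lessThan_Suc_atMost[symmetric] mult.commute)
   have "t k \<noteq> 0"
   proof
    assume "t k = 0"
    hence "\<exists>a<k. t a \<noteq> 0" using t(1) by (metis le_neq_implies_less)
    thus False using s \<open>t k = 0\<close> xs(3) lminor_zero_iff[OF xs(1), of A] by auto
   qed
   thus ?thesis using s
    by (intro exI[of _ "\<lambda>a. t a / t k"]) (simp add: sum_divide_distrib[symmetric] )
  qed
  then obtain y where y: "\<forall>b<k. (\<Sum>a<k. y a * A $$ (a, xs ! b)) = z b" by blast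
  have "v $ j = (\<Sum>a<k. y a * A $$ (a, j))" if "j < N" for j
  proof -
   have "(\<Sum>a<k. y a * A $$ (a, j)) = (\<Sum>a<k. \<Sum>b<k. y a * A $$ (a, xs ! b) * ?B $$ (b, j))"
    using that AB by (simp add: sum_distrib_left mult.assoc)
   also have "\<dots> = (\<Sum>b<k. z b * ?B $$ (b, j))"
    by (subst sum.swap) (simp add: y[rule_format, symmetric] sum_distrib_right)
   finally show ?thesis using v that by simp
  qed
  thus "v \<in> row_span N A"
   unfolding row_span_iff[OF A] using v(1) by (intro conjI exI[of _ y]) auto
 qed
qed

lemma norm_mat_unique:
 assumes B: "B \<in> carrier_mat k N" "row_span N B = row_span N B'" and B': "B' \<in> carrier_mat k N"
  and xs: "length xs = k" "set xs \<subseteq> {..<N}"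
  and id: "\<And>a b. a < k \<Longrightarrow> b < k \<Longrightarrow> B $$ (a, xs ! b) = (if a = b then 1 else 0)"
   "\<And>a b. a < k \<Longrightarrow> b < k \<Longrightarrow> B' $$ (a, xs ! b) = (if a = b then 1 else 0)"
 shows "B = B'"
proof (rule eq_matI)
 fix a j assume "a < dim_row B'" "j < dim_col B'"
 hence a: "a < k" "j < N" using B' by auto
 have lt: "xs ! b < N" if "b < k" for b by (rule nth_less[OF xs(2,1) that])
 have "row B a \<in> row_span N B"
  unfolding row_span_iff[OF B(1)]
  using a B(1) by (auto intro!: exI[of _ "\<lambda>i. if i = a then 1 else 0"] simp: if_distrib[of "\<lambda>z. z * _"] cong: if_cong)
 then obtain y where y: "\<forall>j<N. row B a $ j = (\<Sum>b<k. y b * B' $$ (b, j))"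
  using B(2) row_span_iff[OF B'] by auto
 have "y b = (if a = b then 1 else 0)" if "b < k" for b
 proof -
  have "row B a $ (xs ! b) = (\<Sum>c<k. y c * (if c = b then 1 else 0))" using y lt that id(2) by simp
  also have "\<dots> = y b" using that by (simp add: if_distrib[of "\<lambda>z. _ * z"] cong: if_cong)
  finally show ?thesis using id(1)[OF a(1) that] a B(1) lt[OF that] by simp
 qed
 hence "row B a $ j = (\<Sum>b<k. (if a = b then 1 else 0) * B' $$ (b, j))" using y a by simp
 thus "B $$ (a, j) = B' $$ (a, j)"
  using a B(1) by (simp add: if_distrib[of "\<lambda>z. z * _"] cong: if_cong)
qed (use B(1) B' in auto)

text \<open>Vanishing of a minor is a property of the row span alone, which makes the charts
  independent of representatives.\<close>

lemma lminor_nonzero_span: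
 assumes A: "A \<in> carrier_mat k N" and xs: "length xs = k" "set xs \<subseteq> {..<N}"
  and "indep_rows k N A"
 shows "lminor A xs \<noteq> 0 \<longleftrightarrow> (\<forall>v\<in>row_span N A. (\<forall>b<k. v $ (xs ! b) = 0) \<longrightarrow> v = 0\<^sub>v N)"
proof -
 have lt: "xs ! b < N" if "b < k" for b by (rule nth_less[OF xs(2,1) that])
 show ?thesis
 proof
  assume nz: "lminor A xs \<noteq> 0"
  show "\<forall>v\<in>row_span N A. (\<forall>b<k. v $ (xs ! b) = 0) \<longrightarrow> v = 0\<^sub>v N"
  proof (intro ballI impI)
   fix v assume "v \<in> row_span N A" and v0: "\<forall>b<k. v $ (xs ! b) = 0"
   then obtain y where y: "v \<in> carrier_vec N" "\<forall>j<N. v $ j = (\<Sum>a<k. y a * A $$ (a, j))"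
    using row_span_iff[OF A] by blast
   hence "\<forall>b<k. (\<Sum>a<k. y a * A $$ (a, xs ! b)) = 0" using v0 lt by metis
   hence "\<forall>a<k. y a = 0" using nz lminor_zero_iff[OF xs(1), of A] by blast
   thus "v = 0\<^sub>v N" using y by (intro eq_vecI) auto
  qed
 next
  assume r: "\<forall>v\<in>row_span N A. (\<forall>b<k. v $ (xs ! b) = 0) \<longrightarrow> v = 0\<^sub>v N"
  show "lminor A xs \<noteq> 0"
  proof
   assume "lminor A xs = 0"
   then obtain y where y: "\<exists>a<k. y a \<noteq> 0" "\<forall>b<k. (\<Sum>a<k. y a * A $$ (a, xs ! b)) = 0"
    using lminor_zero_iff[OF xs(1)] by blast
   define v where "v = vec N (\<lambda>j. \<Sum>a<k. y a * A $$ (a, j))"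
   have "v \<in> row_span N A" using row_span_iff[OF A] by (auto simp: v_def intro!: exI[of _ y])
   hence "v = 0\<^sub>v N" using r y(2) lt by (auto simp: v_def)
   hence "\<forall>j<N. (\<Sum>a<k. y a * A $$ (a, j)) = 0" by (auto simp: v_def vec_eq_iff)
   thus False using assms(4) y(1) unfolding indep_rows_def by blast
  qed
 qed
qed

section \<open>Charts of the Grassmannian\<close>

definition chart :: "nat \<Rightarrow> nat \<Rightarrow> nat list \<Rightarrow> complex vec set set" where
 "chart k N xs = {row_span N A | A. A \<in> mats_of_rank k N k \<and> lminor A xs \<noteq> 0}"

text \<open>On the chart the arbitrary choice of a representative is harmless, since all
  representatives have the same normalized matrix.\<close>

definition chart_mat :: "nat \<Rightarrow> nat \<Rightarrow> nat list \<Rightarrow> complex vec set \<Rightarrow> complex mat" where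
 "chart_mat k N xs V = norm_mat k N xs (SOME A. A \<in> mats_of_rank k N k \<and> row_span N A = V)"

lemma row_span_in_chart_iff:
 assumes "A \<in> mats_of_rank k N k" "length xs = k" "set xs \<subseteq> {..<N}"
 shows "row_span N A \<in> chart k N xs \<longleftrightarrow> lminor A xs \<noteq> 0"
proof
 assume "row_span N A \<in> chart k N xs"
 then obtain A' where A': "A' \<in> mats_of_rank k N k" "row_span N A = row_span N A'" "lminor A' xs \<noteq> 0"
  unfolding chart_def by blast
 thus "lminor A xs \<noteq> 0"
  using lminor_nonzero_span[of A k N xs] lminor_nonzero_span[of A' k N xs] assms
  by (auto simp: mats_of_rank_iff)
qed (use assms in \<open>auto simp: chart_def\<close>)

lemma chart_mat_row_span:
 assumes "A \<in> mats_of_rank k N k" "length xs = k" "set xs \<subseteq> {..<N}" "lminor A xs \<noteq> 0"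
 shows "chart_mat k N xs (row_span N A) = norm_mat k N xs A"
proof -
 define A' where "A' = (SOME A'. A' \<in> mats_of_rank k N k \<and> row_span N A' = row_span N A)"
 have A': "A' \<in> mats_of_rank k N k" "row_span N A' = row_span N A"
  using someI_ex[of "\<lambda>A'. A' \<in> mats_of_rank k N k \<and> row_span N A' = row_span N A"] assms(1)
  unfolding A'_def by blast+
 have nz: "lminor A' xs \<noteq> 0"
  using lminor_nonzero_span[of A k N xs] lminor_nonzero_span[of A' k N xs] assms A'
  by (auto simp: mats_of_rank_iff)
 have "norm_mat k N xs A' = norm_mat k N xs A"
  using assms A' nz
  by (intro norm_mat_unique[of _ k N _ xs]) (auto simp: row_span_norm_mat norm_mat_identity mats_of_rank_iff)
 thus ?thesis by (simp add: chart_mat_def A'_def)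
qed

lemma grassmannian_chart:
 assumes "V \<in> grassmannian k N"
 shows "\<exists>xs. length xs = k \<and> distinct xs \<and> set xs \<subseteq> {..<N} \<and> V \<in> chart k N xs"
proof -
 obtain A where A: "A \<in> mats_of_rank k N k" "V = row_span N A" using assms unfolding grassmannian_def by blast
 then obtain xs where "length xs = k" "distinct xs" "set xs \<subseteq> {..<N}" "lminor A xs \<noteq> 0"
  using indep_rows_lminor[of k N A] unfolding mats_of_rank_iff by blast
 with A show ?thesis unfolding chart_def by blast
qed

text \<open>A dimension argument in coordinates: a minor that is nonzero for \<open>B\<close> is
  nonzero for \<open>A\<close> as well, and in this common chart the inclusion forces the normalized
  matrices to agree.\<close>

lemma row_span_eqI:
 assumes A: "A \<in> carrier_mat k N" "indep_rows k N A" and B: "B \<in> carrier_mat k N" "indep_rows k N B"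
  and sub: "row_span N A \<subseteq> row_span N B"
 shows "row_span N A = row_span N B"
proof -
 obtain xs where xs: "length xs = k" "set xs \<subseteq> {..<N}" "lminor B xs \<noteq> 0"
  using indep_rows_lminor[OF B(2)] by blast
 have "lminor A xs \<noteq> 0"
  using xs(3) sub unfolding lminor_nonzero_span[OF A(1) xs(1,2) A(2)] lminor_nonzero_span[OF B(1) xs(1,2) B(2)]
  by (meson subsetD)
 have lt: "xs ! b < N" if "b < k" for b by (rule nth_less[OF xs(2,1) that])
 let ?A = "norm_mat k N xs A" and ?B = "norm_mat k N xs B"
 have "?A = ?B"
 proof (rule eq_matI)
  fix a j assume "a < dim_row ?B" "j < dim_col ?B"
  hence a: "a < k" "j < N" by (auto simp: norm_mat_def)
  have "row ?A a \<in> row_span N ?A"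
   unfolding row_span_iff[OF norm_mat_carrier]
   using a norm_mat_carrier[of k N xs A]
   by (auto intro!: exI[of _ "\<lambda>i. if i = a then 1 else 0"]
     simp: if_distrib[of "\<lambda>z. z * _"] simp del: norm_mat_carrier cong: if_cong)
  hence "row ?A a \<in> row_span N ?B"
   using sub row_span_norm_mat[OF A(1) xs(1,2) \<open>lminor A xs \<noteq> 0\<close>] row_span_norm_mat[OF B(1) xs] by blast
  then obtain y where y: "\<forall>j<N. row ?A a $ j = (\<Sum>b<k. y b * ?B $$ (b, j))"
   using row_span_iff[OF norm_mat_carrier] by blast
  have rowA: "row ?A a $ i = ?A $$ (a, i)" if "i < N" for i using a that by (simp add: norm_mat_def)
  have "y b = (if a = b then 1 else 0)" if "b < k" for b
  proof -
   have "row ?A a $ (xs ! b) = (\<Sum>c<k. y c * (if c = b then 1 else 0))"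
    using y lt that norm_mat_identity[OF xs _ that] by simp
   also have "\<dots> = y b" using that by (simp add: if_distrib[of "\<lambda>z. _ * z"] cong: if_cong)
   finally show ?thesis
    using norm_mat_identity[OF xs(1,2) \<open>lminor A xs \<noteq> 0\<close> a(1) that] rowA[OF lt[OF that]] by simp
  qed
  hence "row ?A a $ j = (\<Sum>b<k. (if a = b then 1 else 0) * ?B $$ (b, j))" using y a by simp
  thus "?A $$ (a, j) = ?B $$ (a, j)"
   using a rowA by (simp add: if_distrib[of "\<lambda>z. z * _"] cong: if_cong)
 qed (auto simp: norm_mat_def)
 thus ?thesis
  using row_span_norm_mat[OF A(1) xs(1,2) \<open>lminor A xs \<noteq> 0\<close>] row_span_norm_mat[OF B(1) xs] by simp
qed

text \<open>Normalized matrices consist of quotients of minors, in which the factor \<open>c\<close>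
  cancels; hence Pluecker coordinates determine the subspace.\<close>

lemma row_span_eq_minors:
 assumes "A \<in> mats_of_rank k N k" "B \<in> mats_of_rank k N k" "c \<noteq> 0"
  and "\<And>xs. length xs = k \<Longrightarrow> set xs \<subseteq> {..<N} \<Longrightarrow> lminor A xs = c * lminor B xs"
 shows "row_span N A = row_span N B"
proof -
 obtain xs where xs: "length xs = k" "set xs \<subseteq> {..<N}" "lminor B xs \<noteq> 0"
  using indep_rows_lminor[of k N B] assms(2) unfolding mats_of_rank_iff by blast
 have nz: "lminor A xs \<noteq> 0" using assms(3,4) xs by simp
 have "norm_mat k N xs A = norm_mat k N xs B"
  unfolding norm_mat_def
 proof (intro cong_mat refl)
  fix b j assume "b < k" "j < N"
  hence "set (xs[b := j]) \<subseteq> {..<N}" using xs(2) set_update_subset_insert[of xs b j] by auto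
  thus "(case (b, j) of (b, j) \<Rightarrow> lminor A (xs[b := j]) / lminor A xs) =
   (case (b, j) of (b, j) \<Rightarrow> lminor B (xs[b := j]) / lminor B xs)"
   using assms(3,4) xs by simp
 qed
 thus ?thesis
  using row_span_norm_mat[of A k N xs] row_span_norm_mat[of B k N xs] xs nz assms(1,2)
  by (simp add: mats_of_rank_iff)
qed

lemma lminor_not_distinct:
 assumes "\<not> distinct xs"
 shows "lminor A xs = 0"
proof -
 obtain a b where ab: "a < length xs" "b < length xs" "a \<noteq> b" "xs ! a = xs ! b"
  using assms unfolding distinct_conv_nth by blast
 show ?thesis unfolding lminor_def
  by (rule det_identical_columns[of _ "length xs" a b]) (use ab in \<open>auto intro!: eq_vecI\<close>)
qed

section \<open>Zariski open sets and Krull dimension\<close>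

text \<open>The generating sets form a base: the intersection of two of them is given by the product
  of the two polynomials.\<close>

lemma openin_zariski_mat:
 "openin (zariski_mat r c) U \<longleftrightarrow> U \<subseteq> carrier_mat r c \<and>
   (\<forall>A\<in>U. \<exists>f\<in>mat_polys r c. f A \<noteq> 0 \<and> (\<forall>A'\<in>carrier_mat r c. f A' \<noteq> 0 \<longrightarrow> A' \<in> U))"
proof
 let ?B = "{{A \<in> carrier_mat r c. f A \<noteq> 0} | f. f \<in> mat_polys r c}"
 assume "openin (zariski_mat r c) U"
 hence gen: "generate_topology_on ?B U" unfolding zariski_mat_def openin_topology_generated_by_iff .
 have "\<forall>A\<in>U. \<exists>f\<in>mat_polys r c. f A \<noteq> 0 \<and> (\<forall>A'\<in>carrier_mat r c. f A' \<noteq> 0 \<longrightarrow> A' \<in> U)"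
  using gen
 proof (induction rule: generate_topology_on.induct)
  case Empty
  thus ?case by simp
 next
  case (Int a b)
  show ?case
  proof
   fix A assume "A \<in> a \<inter> b"
   then obtain f g where f: "f \<in> mat_polys r c" "f A \<noteq> 0" "\<forall>A'\<in>carrier_mat r c. f A' \<noteq> 0 \<longrightarrow> A' \<in> a"
    and g: "g \<in> mat_polys r c" "g A \<noteq> 0" "\<forall>A'\<in>carrier_mat r c. g A' \<noteq> 0 \<longrightarrow> A' \<in> b"
    using Int.IH by blast
   show "\<exists>f\<in>mat_polys r c. f A \<noteq> 0 \<and> (\<forall>A'\<in>carrier_mat r c. f A' \<noteq> 0 \<longrightarrow> A' \<in> a \<inter> b)"
    by (rule bexI[OF _ mat_polys.mult[OF f(1) g(1)]]) (use f g in simp)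
  qed
 next
  case (UN K)
  show ?case
  proof
   fix A assume "A \<in> \<Union>K"
   then obtain s where "s \<in> K" "A \<in> s" by blast
   then obtain f where "f \<in> mat_polys r c" "f A \<noteq> 0" "\<forall>A'\<in>carrier_mat r c. f A' \<noteq> 0 \<longrightarrow> A' \<in> s"
    using UN.IH by blast
   thus "\<exists>f\<in>mat_polys r c. f A \<noteq> 0 \<and> (\<forall>A'\<in>carrier_mat r c. f A' \<noteq> 0 \<longrightarrow> A' \<in> \<Union>K)"
    using \<open>s \<in> K\<close> by blast
  qed
 next
  case (Basis s)
  thus ?case by blast
 qed
 moreover have "U \<subseteq> carrier_mat r c"
  using openin_subset[OF \<open>openin (zariski_mat r c) U\<close>] by (simp add: topspace_zariski_mat)
 ultimately show "U \<subseteq> carrier_mat r c \<and>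
   (\<forall>A\<in>U. \<exists>f\<in>mat_polys r c. f A \<noteq> 0 \<and> (\<forall>A'\<in>carrier_mat r c. f A' \<noteq> 0 \<longrightarrow> A' \<in> U))" by blast
next
 let ?B = "{{A \<in> carrier_mat r c. f A \<noteq> 0} | f. f \<in> mat_polys r c}"
 assume U: "U \<subseteq> carrier_mat r c \<and>
   (\<forall>A\<in>U. \<exists>f\<in>mat_polys r c. f A \<noteq> 0 \<and> (\<forall>A'\<in>carrier_mat r c. f A' \<noteq> 0 \<longrightarrow> A' \<in> U))"
 define F where "F = {f \<in> mat_polys r c. \<forall>A'\<in>carrier_mat r c. f A' \<noteq> 0 \<longrightarrow> A' \<in> U}"
 have "U = (\<Union>f\<in>F. {A \<in> carrier_mat r c. f A \<noteq> 0})"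
 proof
  show "U \<subseteq> (\<Union>f\<in>F. {A \<in> carrier_mat r c. f A \<noteq> 0})"
  proof
   fix A assume A: "A \<in> U"
   then obtain f where "f \<in> mat_polys r c" "f A \<noteq> 0" "\<forall>A'\<in>carrier_mat r c. f A' \<noteq> 0 \<longrightarrow> A' \<in> U" using U by auto
   thus "A \<in> (\<Union>f\<in>F. {A \<in> carrier_mat r c. f A \<noteq> 0})" using A U unfolding F_def by auto
  qed
  show "(\<Union>f\<in>F. {A \<in> carrier_mat r c. f A \<noteq> 0}) \<subseteq> U" by (auto simp: F_def)
 qed
 moreover have "openin (zariski_mat r c) (\<Union>f\<in>F. {A \<in> carrier_mat r c. f A \<noteq> 0})"
  by (intro openin_Union) (auto simp: zariski_mat_def F_def intro!: topology_generated_by_Basis)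
 ultimately show "openin (zariski_mat r c) U" by simp
qed

lemma openin_gr_iff:
 "openin (zariski_gr k N) O' \<longleftrightarrow> O' \<subseteq> grassmannian k N \<and>
   (\<forall>A\<in>mats_of_rank k N k. row_span N A \<in> O' \<longrightarrow>
    (\<exists>f\<in>mat_polys k N. f A \<noteq> 0 \<and> (\<forall>A'\<in>mats_of_rank k N k. f A' \<noteq> 0 \<longrightarrow> row_span N A' \<in> O')))"
 (is "_ \<longleftrightarrow> _ \<and> ?P")
proof -
 let ?R = "mats_of_rank k N k"
 let ?pre = "{A \<in> ?R. row_span N A \<in> O'}"
 have sub: "?R \<subseteq> carrier_mat k N" by (auto simp: mats_of_rank_def)
 have "openin (subtopology (zariski_mat k N) ?R) ?pre \<longleftrightarrow> ?P"
 proof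
  assume "openin (subtopology (zariski_mat k N) ?R) ?pre"
  then obtain T where T: "openin (zariski_mat k N) T" "?pre = T \<inter> ?R" unfolding openin_subtopology by blast
  show ?P
  proof (intro ballI impI)
   fix A assume "A \<in> ?R" "row_span N A \<in> O'"
   hence "A \<in> T" using T by blast
   then obtain f where f: "f \<in> mat_polys k N" "f A \<noteq> 0" "\<forall>A'\<in>carrier_mat k N. f A' \<noteq> 0 \<longrightarrow> A' \<in> T"
    using T(1) unfolding openin_zariski_mat by blast
   hence "\<forall>A'\<in>?R. f A' \<noteq> 0 \<longrightarrow> row_span N A' \<in> O'" using T(2) sub by blast
   thus "\<exists>f\<in>mat_polys k N. f A \<noteq> 0 \<and> (\<forall>A'\<in>?R. f A' \<noteq> 0 \<longrightarrow> row_span N A' \<in> O')" using f by blast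
  qed
 next
  assume P: ?P
  define F where "F = {f \<in> mat_polys k N. \<forall>A'\<in>?R. f A' \<noteq> 0 \<longrightarrow> row_span N A' \<in> O'}"
  define T where "T = (\<Union>f\<in>F. {A \<in> carrier_mat k N. f A \<noteq> 0})"
  have "openin (zariski_mat k N) T" unfolding T_def
   by (intro openin_Union) (auto simp: openin_zariski_mat F_def)
  moreover have "?pre = T \<inter> ?R"
  proof
   show "?pre \<subseteq> T \<inter> ?R"
   proof
    fix A assume A: "A \<in> ?pre"
    then obtain f where "f \<in> mat_polys k N" "f A \<noteq> 0" "\<forall>A'\<in>?R. f A' \<noteq> 0 \<longrightarrow> row_span N A' \<in> O'" using P by auto
    thus "A \<in> T \<inter> ?R" using A sub unfolding T_def F_def by auto
   qed
   show "T \<inter> ?R \<subseteq> ?pre" by (auto simp: T_def F_def)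
  qed
  ultimately show "openin (subtopology (zariski_mat k N) ?R) ?pre" unfolding openin_subtopology by blast
 qed
 thus ?thesis unfolding openin_zariski_gr by blast
qed

lemma openin_gr_ex:
 assumes "openin (zariski_gr k N) O'" "A \<in> mats_of_rank k N k" "row_span N A \<in> O'"
 obtains f where "f \<in> mat_polys k N" "f A \<noteq> 0"
  "\<And>A'. A' \<in> mats_of_rank k N k \<Longrightarrow> f A' \<noteq> 0 \<Longrightarrow> row_span N A' \<in> O'"
 using assms unfolding openin_gr_iff by blast

lemma norm_mat_rational:
 assumes xs: "length xs = k" "set xs \<subseteq> {..<N}" and g: "g \<in> mat_polys k N"
 shows "\<exists>e. \<exists>P\<in>mat_polys k N. \<forall>A\<in>{A. lminor A xs \<noteq> 0}.
  g (norm_mat k N xs A) * lminor A xs ^ e = P A"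
 unfolding mat_polys_eq
proof (rule fpolys_rational_compose[OF g[unfolded mat_polys_eq]])
 show "(\<lambda>A. lminor A xs) \<in> fpolys (mat_entries k N)"
  using lminor_polys[OF xs(2,1)] by (simp add: mat_polys_eq)
 fix x assume "x \<in> mat_entries k N"
 then obtain b j where x: "x = (\<lambda>A. A $$ (b, j))" "b < k" "j < N" by (auto simp: mat_entries_def)
 have "set (xs[b := j]) \<subseteq> {..<N}" using xs(2) x set_update_subset_insert[of xs b j] by auto
 hence "(\<lambda>A. lminor A (xs[b := j])) \<in> mat_polys k N" using xs(1) by (intro lminor_polys) auto
 thus "\<exists>P\<in>fpolys (mat_entries k N). \<forall>A\<in>{A. lminor A xs \<noteq> 0}. x (norm_mat k N xs A) * lminor A xs = P A"
  unfolding mat_polys_eq using x by (intro bexI[of _ "\<lambda>A. lminor A (xs[b := j])"]) (auto simp: norm_mat_def)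
qed

text \<open>Multiplied by a power of the minor at \<open>xs\<close>, a polynomial in the normalized
  matrix becomes a polynomial in any representative, so its nonvanishing is an open
  condition.\<close>

lemma openin_chart_nonzero:
 assumes xs: "length xs = k" "set xs \<subseteq> {..<N}" and g: "g \<in> mat_polys k N"
 shows "openin (zariski_gr k N) {V \<in> chart k N xs. g (chart_mat k N xs V) \<noteq> 0}"
 unfolding openin_gr_iff
proof (intro conjI ballI impI)
 show "{V \<in> chart k N xs. g (chart_mat k N xs V) \<noteq> 0} \<subseteq> grassmannian k N"
  by (auto simp: chart_def grassmannian_def)
 fix A assume A: "A \<in> mats_of_rank k N k" "row_span N A \<in> {V \<in> chart k N xs. g (chart_mat k N xs V) \<noteq> 0}"
 obtain e P where P: "P \<in> mat_polys k N"
  "\<And>A. lminor A xs \<noteq> 0 \<Longrightarrow> g (norm_mat k N xs A) * lminor A xs ^ e = P A"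
  using norm_mat_rational[OF xs g] by blast
 have m: "lminor A' xs \<noteq> 0 \<and> g (norm_mat k N xs A') \<noteq> 0 \<longleftrightarrow> row_span N A' \<in> {V \<in> chart k N xs. g (chart_mat k N xs V) \<noteq> 0}"
  if "A' \<in> mats_of_rank k N k" for A'
  using row_span_in_chart_iff[OF that xs] chart_mat_row_span[OF that xs] by auto
 have eq: "lminor A' xs * P A' \<noteq> 0 \<longleftrightarrow> lminor A' xs \<noteq> 0 \<and> g (norm_mat k N xs A') \<noteq> 0" for A'
  using P(2)[of A'] by auto
 show "\<exists>f\<in>mat_polys k N. f A \<noteq> 0 \<and> (\<forall>A'\<in>mats_of_rank k N k. f A' \<noteq> 0 \<longrightarrow>
   row_span N A' \<in> {V \<in> chart k N xs. g (chart_mat k N xs V) \<noteq> 0})"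
 proof (rule bexI[of _ "\<lambda>A. lminor A xs * P A"])
  show "(\<lambda>A. lminor A xs * P A) \<in> mat_polys k N"
   using lminor_polys[OF xs(2,1)] P(1) by (rule mat_polys.mult)
 qed (use m eq A in blast)
qed

lemma openin_chart:
 assumes xs: "length xs = k" "set xs \<subseteq> {..<N}"
 shows "openin (zariski_gr k N) (chart k N xs)"
 using openin_chart_nonzero[OF xs mat_polys.const[of 1]] by simp

text \<open>Irreducibility without closedness, so that it applies to orbits before a closure is
  taken; closures inherit it.\<close>

definition irred_in :: "'a topology \<Rightarrow> 'a set \<Rightarrow> bool" where
 "irred_in T X \<longleftrightarrow> X \<subseteq> topspace T \<and> X \<noteq> {} \<and>
   (\<forall>O1 O2. openin T O1 \<longrightarrow> openin T O2 \<longrightarrow> O1 \<inter> X \<noteq> {} \<longrightarrow> O2 \<inter> X \<noteq> {} \<longrightarrow> O1 \<inter> O2 \<inter> X \<noteq> {})"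

lemma irred_in_closure:
 assumes "irred_in T X" shows "irred_in T (T closure_of X)"
 unfolding irred_in_def
proof (intro conjI allI impI)
 have X: "X \<subseteq> topspace T" "X \<noteq> {}" using assms by (auto simp: irred_in_def)
 show "T closure_of X \<subseteq> topspace T" by (rule closure_of_subset_topspace)
 show "T closure_of X \<noteq> {}" using X closure_of_subset by blast
 fix O1 O2 assume O: "openin T O1" "openin T O2" "O1 \<inter> T closure_of X \<noteq> {}" "O2 \<inter> T closure_of X \<noteq> {}"
 hence "O1 \<inter> X \<noteq> {}" "O2 \<inter> X \<noteq> {}" using openin_Int_closure_of_eq_empty by blast+
 hence "O1 \<inter> O2 \<inter> X \<noteq> {}" using assms O unfolding irred_in_def by blast
 thus "O1 \<inter> O2 \<inter> T closure_of X \<noteq> {}" using closure_of_subset[OF X(1)] by blast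
qed

lemma irreducible_closed_iff: "irreducible_closed T Y \<longleftrightarrow> closedin T Y \<and> irred_in T Y"
proof
 assume irr: "irreducible_closed T Y"
 hence c: "closedin T Y" "Y \<noteq> {}" by (auto simp: irreducible_closed_def)
 have "O1 \<inter> O2 \<inter> Y \<noteq> {}" if O: "openin T O1" "openin T O2" "O1 \<inter> Y \<noteq> {}" "O2 \<inter> Y \<noteq> {}" for O1 O2
 proof
  assume "O1 \<inter> O2 \<inter> Y = {}"
  hence "Y \<subseteq> (topspace T - O1) \<union> (topspace T - O2)" using closedin_subset[OF c(1)] by blast
  moreover have "closedin T (topspace T - O1)" "closedin T (topspace T - O2)" using O by blast+
  ultimately have "Y \<subseteq> topspace T - O1 \<or> Y \<subseteq> topspace T - O2" using irr unfolding irreducible_closed_def by blast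
  thus False using O by blast
 qed
 thus "closedin T Y \<and> irred_in T Y" using c closedin_subset[OF c(1)] unfolding irred_in_def by blast
next
 assume a: "closedin T Y \<and> irred_in T Y"
 have "Y \<subseteq> A \<or> Y \<subseteq> B" if cl: "closedin T A" "closedin T B" "Y \<subseteq> A \<union> B" for A B
 proof (rule ccontr)
  assume n: "\<not> (Y \<subseteq> A \<or> Y \<subseteq> B)"
  have Y: "Y \<subseteq> topspace T" using a closedin_subset by blast
  hence "(topspace T - A) \<inter> Y \<noteq> {}" "(topspace T - B) \<inter> Y \<noteq> {}" using n by blast+
  moreover have "openin T (topspace T - A)" "openin T (topspace T - B)" using cl by blast+
  ultimately have "(topspace T - A) \<inter> (topspace T - B) \<inter> Y \<noteq> {}" using a unfolding irred_in_def by blast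
  thus False using cl by blast
 qed
 thus "irreducible_closed T Y" using a unfolding irreducible_closed_def irred_in_def by blast
qed

lemma irred_in_subtopology:
 assumes "Y \<subseteq> C"
 shows "irred_in (subtopology T C) Y \<longleftrightarrow> irred_in T Y"
proof
 assume a: "irred_in (subtopology T C) Y"
 show "irred_in T Y" unfolding irred_in_def
 proof (intro conjI allI impI)
  show "Y \<subseteq> topspace T" "Y \<noteq> {}" using a by (auto simp: irred_in_def)
  fix O1 O2 assume O: "openin T O1" "openin T O2" "O1 \<inter> Y \<noteq> {}" "O2 \<inter> Y \<noteq> {}"
  have "openin (subtopology T C) (O1 \<inter> C)" "openin (subtopology T C) (O2 \<inter> C)"
   using O openin_subtopology by blast+
  moreover have "(O1 \<inter> C) \<inter> Y \<noteq> {}" "(O2 \<inter> C) \<inter> Y \<noteq> {}" using O assms by blast+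
  ultimately have "(O1 \<inter> C) \<inter> (O2 \<inter> C) \<inter> Y \<noteq> {}" using a unfolding irred_in_def by blast
  thus "O1 \<inter> O2 \<inter> Y \<noteq> {}" by blast
 qed
next
 assume a: "irred_in T Y"
 show "irred_in (subtopology T C) Y" unfolding irred_in_def
 proof (intro conjI allI impI)
  show "Y \<subseteq> topspace (subtopology T C)" "Y \<noteq> {}" using a assms by (auto simp: irred_in_def)
  fix O1 O2 assume O: "openin (subtopology T C) O1" "openin (subtopology T C) O2" "O1 \<inter> Y \<noteq> {}" "O2 \<inter> Y \<noteq> {}"
  obtain T1 T2 where T: "openin T T1" "O1 = T1 \<inter> C" "openin T T2" "O2 = T2 \<inter> C"
   using O(1,2) unfolding openin_subtopology by blast
  hence "T1 \<inter> Y \<noteq> {}" "T2 \<inter> Y \<noteq> {}" using O by blast+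
  hence "T1 \<inter> T2 \<inter> Y \<noteq> {}" using a T unfolding irred_in_def by blast
  thus "O1 \<inter> O2 \<inter> Y \<noteq> {}" using T assms by blast
 qed
qed

lemma irreducible_closed_subtopology:
 assumes "closedin T C"
 shows "irreducible_closed (subtopology T C) Y \<longleftrightarrow> irreducible_closed T Y \<and> Y \<subseteq> C"
 unfolding irreducible_closed_iff closedin_closed_subtopology[OF assms]
 using irred_in_subtopology by blast

text \<open>The chain consists of the closures of the \<open>Y i\<close>. An open set that misses
  \<open>Y i\<close> also misses its closure, which keeps consecutive closures distinct.\<close>

lemma gr_dim_ge:
 assumes X: "X \<subseteq> grassmannian k N"
  and Y: "\<And>i. i \<le> d \<Longrightarrow> irred_in (zariski_gr k N) (Y i)" "\<And>i. i \<le> d \<Longrightarrow> Y i \<subseteq> X"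
  and mono: "\<And>i. i < d \<Longrightarrow> Y i \<subseteq> Y (Suc i)"
  and strict: "\<And>i. i < d \<Longrightarrow> \<exists>O'. openin (zariski_gr k N) O' \<and> O' \<inter> Y i = {} \<and> O' \<inter> Y (Suc i) \<noteq> {}"
 shows "enat d \<le> gr_dim k N X"
proof -
 let ?T = "zariski_gr k N"
 have "irreducible_closed (subtopology ?T (?T closure_of X)) (?T closure_of (Y i))" if "i \<le> d" for i
  unfolding irreducible_closed_subtopology[OF closedin_closure_of]
  unfolding irreducible_closed_iff
  by (intro conjI closedin_closure_of irred_in_closure closure_of_mono Y that)
 moreover have "?T closure_of (Y i) \<subset> ?T closure_of (Y (Suc i))" if i: "i < d" for i
 proof
  show "?T closure_of (Y i) \<subseteq> ?T closure_of (Y (Suc i))" by (rule closure_of_mono[OF mono[OF i]])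
  obtain O' where O': "openin ?T O'" "O' \<inter> Y i = {}" "O' \<inter> Y (Suc i) \<noteq> {}" using strict[OF i] by blast
  have "O' \<inter> ?T closure_of (Y i) = {}" "O' \<inter> ?T closure_of (Y (Suc i)) \<noteq> {}"
   using openin_Int_closure_of_eq_empty[OF O'(1)] O'(2,3) by blast+
  thus "?T closure_of (Y i) \<noteq> ?T closure_of (Y (Suc i))" by blast
 qed
 ultimately show ?thesis unfolding gr_dim_def krull_dim_def
  by (intro Sup_upper CollectI exI[of _ d] conjI exI[of _ "\<lambda>i. ?T closure_of (Y i)"]) auto
qed

lemma chart_functions:
 "f \<in> fpolys ((\<lambda>x V. x (chart_mat k N xs V)) ` mat_entries k N) \<longleftrightarrow>
  (\<exists>g\<in>mat_polys k N. f = (\<lambda>V. g (chart_mat k N xs V)))"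
proof
 assume "f \<in> fpolys ((\<lambda>x V. x (chart_mat k N xs V)) ` mat_entries k N)"
 thus "\<exists>g\<in>mat_polys k N. f = (\<lambda>V. g (chart_mat k N xs V))"
  unfolding mat_polys_eq
 proof induction
  case (const a) show ?case by (rule bexI[of _ "\<lambda>_. a"]) (auto intro: fpolys_intros)
 next
  case (gen f) thus ?case by (auto intro: fpolys.gen)
 next
  case (add f g)
  then obtain f' g' where "f' \<in> fpolys (mat_entries k N)" "g' \<in> fpolys (mat_entries k N)"
   "f = (\<lambda>V. f' (chart_mat k N xs V))" "g = (\<lambda>V. g' (chart_mat k N xs V))" by blast
  thus ?case by (intro bexI[of _ "\<lambda>A. f' A + g' A"]) (auto intro: fpolys.add)
 next
  case (mult f g)
  then obtain f' g' where "f' \<in> fpolys (mat_entries k N)" "g' \<in> fpolys (mat_entries k N)"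
   "f = (\<lambda>V. f' (chart_mat k N xs V))" "g = (\<lambda>V. g' (chart_mat k N xs V))" by blast
  thus ?case by (intro bexI[of _ "\<lambda>A. f' A * g' A"]) (auto intro: fpolys.mult)
 qed
next
 assume "\<exists>g\<in>mat_polys k N. f = (\<lambda>V. g (chart_mat k N xs V))"
 then obtain g where g: "g \<in> fpolys (mat_entries k N)" and f: "f = (\<lambda>V. g (chart_mat k N xs V))"
  unfolding mat_polys_eq by blast
 show "f \<in> fpolys ((\<lambda>x V. x (chart_mat k N xs V)) ` mat_entries k N)"
  unfolding f by (rule fpolys_compose[OF g]) (auto intro: fpolys.gen)
qed

text \<open>Along a chain of irreducible closed sets the transcendence degree of the coordinate functions
 of a chart grows at every step.\<close>

lemma gr_dim_le:
 assumes X: "X \<subseteq> grassmannian k N"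
  and dep: "\<And>xs g. length xs = k \<Longrightarrow> set xs \<subseteq> {..<N} \<Longrightarrow> (\<And>i. i \<le> d \<Longrightarrow> g i \<in> mat_polys k N) \<Longrightarrow>
   \<not> alg_indep (Suc d) (\<lambda>i V. g i (chart_mat k N xs V)) (X \<inter> chart k N xs)"
 shows "gr_dim k N X \<le> enat d"
proof -
 let ?T = "zariski_gr k N"
 let ?C = "?T closure_of X"
 have "r \<le> d" if C: "\<forall>i\<le>r. irreducible_closed (subtopology ?T ?C) (C i)" "\<forall>i<r. C i \<subset> C (Suc i)" for r C
 proof (rule ccontr)
  assume "\<not> r \<le> d"
  hence r: "Suc d \<le> r" by simp
  have irr: "irred_in ?T (C i)" and closed: "closedin ?T (C i)" and sub: "C i \<subseteq> ?C" if "i \<le> Suc d" for i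
  proof -
   have "irreducible_closed (subtopology ?T ?C) (C i)" using C(1) r that by simp
   hence "irreducible_closed ?T (C i) \<and> C i \<subseteq> ?C"
    by (rule irreducible_closed_subtopology[OF closedin_closure_of, THEN iffD1])
   thus "irred_in ?T (C i)" "closedin ?T (C i)" "C i \<subseteq> ?C"
    unfolding irreducible_closed_iff by auto
  qed
  have step: "C i \<subset> C (Suc i)" if "i \<le> d" for i using C(2) r that by simp
  \<comment> \<open>A chart around a point of the smallest member meets every member of the chain,
    so one chart serves throughout.\<close>
  obtain V0 where V0: "V0 \<in> C 0" using irr[of 0] by (auto simp: irred_in_def)
  have "V0 \<in> grassmannian k N" using V0 irr[of 0] by (auto simp: irred_in_def topspace_zariski_gr)
  then obtain xs where xs: "length xs = k" "set xs \<subseteq> {..<N}" and V0c: "V0 \<in> chart k N xs"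
   using grassmannian_chart by blast
  note open_chart = openin_chart[OF xs]
  have V0i: "V0 \<in> C i" if "i \<le> Suc d" for i
   using that
  proof (induction i)
   case (Suc i) thus ?case using step[of i] by auto
  qed (use V0 in simp)
  have "\<exists>g. (\<forall>j<i. g j \<in> mat_polys k N) \<and> alg_indep i (\<lambda>j V. g j (chart_mat k N xs V)) (C i \<inter> chart k N xs)"
   if "i \<le> Suc d" for i
   using that
  proof (induction i)
   case 0
   have "exps ({} :: nat set) D = {\<lambda>_. undefined}" for D by (simp add: exps_def)
   thus ?case using V0 V0c by (auto simp: alg_indep_def)
  next
   case (Suc i)
   then obtain g where g: "\<And>j. j < i \<Longrightarrow> g j \<in> mat_polys k N"
    "alg_indep i (\<lambda>j V. g j (chart_mat k N xs V)) (C i \<inter> chart k N xs)" by auto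
   let ?O = "topspace ?T - C i"
   have O: "openin ?T ?O" using closed[of i] Suc.prems by (simp add: openin_diff)
   have "?O \<inter> C (Suc i) \<noteq> {}"
    using step[of i] irr[of "Suc i"] Suc.prems by (auto simp: irred_in_def)
   moreover have "chart k N xs \<inter> C (Suc i) \<noteq> {}" using V0c V0i[OF Suc.prems] by blast
   ultimately have "?O \<inter> chart k N xs \<inter> C (Suc i) \<noteq> {}"
    using irr[OF Suc.prems] O open_chart unfolding irred_in_def by blast
   then obtain V where V: "V \<in> topspace ?T" "V \<notin> C i" "V \<in> chart k N xs" "V \<in> C (Suc i)" by blast
   obtain A where A: "A \<in> mats_of_rank k N k" "lminor A xs \<noteq> 0" "V = row_span N A"
    using V(3) unfolding chart_def by blast
   have nm: "norm_mat k N xs A' \<in> mats_of_rank k N k" "row_span N (norm_mat k N xs A') = row_span N A'"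
    if "A' \<in> mats_of_rank k N k" "lminor A' xs \<noteq> 0" for A'
   proof -
    show "row_span N (norm_mat k N xs A') = row_span N A'"
     using that xs by (intro row_span_norm_mat) (auto simp: mats_of_rank_iff)
    have "mat (length xs) (length xs) (\<lambda>(a, b). norm_mat k N xs A' $$ (a, xs ! b)) = 1\<^sub>m k"
     using xs norm_mat_identity[OF xs that(2)] by (intro eq_matI) auto
    hence "lminor (norm_mat k N xs A') xs = 1" by (simp add: lminor_def)
    thus "norm_mat k N xs A' \<in> mats_of_rank k N k"
     using lminor_indep_rows[OF xs] by (simp add: mats_of_rank_iff)
   qed
   \<comment> \<open>The next function comes from openness of the complement of \<open>C i\<close>:
     evaluated at normalized matrices, it vanishes on \<open>C i\<close> but not at
     \<open>V\<close>.\<close>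
   have "row_span N (norm_mat k N xs A) \<in> ?O" using V nm[OF A(1,2)] A(3) by simp
   then obtain f where f: "f \<in> mat_polys k N" "f (norm_mat k N xs A) \<noteq> 0"
    "\<And>A'. A' \<in> mats_of_rank k N k \<Longrightarrow> f A' \<noteq> 0 \<Longrightarrow> row_span N A' \<in> ?O"
    using openin_gr_ex[OF O nm(1)[OF A(1,2)]] by blast
   have cm: "chart_mat k N xs (row_span N A') = norm_mat k N xs A'"
    if "A' \<in> mats_of_rank k N k" "lminor A' xs \<noteq> 0" for A'
    using chart_mat_row_span[OF that(1) xs that(2)] .
   let ?g = "g(i := f)"
   have "alg_indep (Suc i) ((\<lambda>j V. g j (chart_mat k N xs V))(i := (\<lambda>V. f (chart_mat k N xs V)))) (C (Suc i) \<inter> chart k N xs)"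
   proof (rule alg_indep_extend[OF _ _ g(2)])
    show "(\<lambda>V. g j (chart_mat k N xs V)) \<in> fpolys ((\<lambda>x V. x (chart_mat k N xs V)) ` mat_entries k N)" if "j < i" for j
     using g(1)[OF that] chart_functions by blast
    show "(\<lambda>V. f (chart_mat k N xs V)) \<in> fpolys ((\<lambda>x V. x (chart_mat k N xs V)) ` mat_entries k N)"
     using f(1) chart_functions by blast
    show "C i \<inter> chart k N xs \<subseteq> C (Suc i) \<inter> chart k N xs" using step[of i] Suc.prems by auto
    show "f (chart_mat k N xs W) = 0" if W: "W \<in> C i \<inter> chart k N xs" for W
    proof (rule ccontr)
     assume nz: "f (chart_mat k N xs W) \<noteq> 0"
     obtain A' where A': "A' \<in> mats_of_rank k N k" "lminor A' xs \<noteq> 0" "W = row_span N A'"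
      using W unfolding chart_def by blast
     have "row_span N (norm_mat k N xs A') \<in> ?O"
      using nz A' cm[OF A'(1,2)] by (intro f(3) nm(1)) auto
     thus False using nm(2)[OF A'(1,2)] A' W by auto
    qed
    show "\<exists>W\<in>C (Suc i) \<inter> chart k N xs. f (chart_mat k N xs W) \<noteq> 0"
     using V A cm[OF A(1,2)] f(2) by (intro bexI[of _ V]) auto
    \<comment> \<open>Irreducibility of \<open>C (Suc i)\<close> says that its chart functions have
      no zero divisors.\<close>
    fix F G assume F: "F \<in> fpolys ((\<lambda>x V. x (chart_mat k N xs V)) ` mat_entries k N)"
     and G: "G \<in> fpolys ((\<lambda>x V. x (chart_mat k N xs V)) ` mat_entries k N)"
     and FG: "\<forall>W\<in>C (Suc i) \<inter> chart k N xs. F W * G W = 0"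
    have op: "openin ?T {V \<in> chart k N xs. H V \<noteq> 0}"
     if H: "H \<in> fpolys ((\<lambda>x V. x (chart_mat k N xs V)) ` mat_entries k N)" for H
    proof -
     obtain h where "h \<in> mat_polys k N" "H = (\<lambda>V. h (chart_mat k N xs V))" using H chart_functions by blast
     thus ?thesis using openin_chart_nonzero[OF xs, of h] by simp
    qed
    show "(\<forall>W\<in>C (Suc i) \<inter> chart k N xs. F W = 0) \<or> (\<forall>W\<in>C (Suc i) \<inter> chart k N xs. G W = 0)"
    proof (rule ccontr)
     assume "\<not> ?thesis"
     hence "{V \<in> chart k N xs. F V \<noteq> 0} \<inter> C (Suc i) \<noteq> {}" "{V \<in> chart k N xs. G V \<noteq> 0} \<inter> C (Suc i) \<noteq> {}"
      by blast+
     hence "{V \<in> chart k N xs. F V \<noteq> 0} \<inter> {V \<in> chart k N xs. G V \<noteq> 0} \<inter> C (Suc i) \<noteq> {}"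
      using irr[OF Suc.prems] op[OF F] op[OF G] unfolding irred_in_def by blast
     thus False using FG by auto
    qed
   qed
   moreover have "(\<lambda>j V. g j (chart_mat k N xs V))(i := (\<lambda>V. f (chart_mat k N xs V))) = (\<lambda>j V. ?g j (chart_mat k N xs V))"
    by (auto simp: fun_eq_iff)
   moreover have "\<forall>j<Suc i. ?g j \<in> mat_polys k N" using g(1) f(1) by (auto simp: less_Suc_eq)
   ultimately show ?case by (intro exI[of _ ?g]) simp
  qed
  then obtain g where g: "\<And>j. j < Suc d \<Longrightarrow> g j \<in> mat_polys k N"
   "alg_indep (Suc d) (\<lambda>j V. g j (chart_mat k N xs V)) (C (Suc d) \<inter> chart k N xs)" by blast
  have "\<not> alg_indep (Suc d) (\<lambda>i V. g i (chart_mat k N xs V)) (X \<inter> chart k N xs)"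
   using g(1) by (intro dep[OF xs]) auto
  then obtain D c \<nu> where c: "\<nu> \<in> exps {..<Suc d} D" "c \<nu> \<noteq> 0"
   "\<forall>V\<in>X \<inter> chart k N xs. (\<Sum>\<nu>\<in>exps {..<Suc d} D. c \<nu> * (\<Prod>i<Suc d. g i (chart_mat k N xs V) ^ \<nu> i)) = 0"
   unfolding alg_indep_def by blast
  \<comment> \<open>The relation holds on \<open>X\<close>. The set where it fails is open in the
    chart and misses \<open>X\<close>, hence misses the closure, which contains the last member of
    the chain.\<close>
  define F where "F = (\<lambda>A. \<Sum>\<nu>\<in>exps {..<Suc d} D. c \<nu> * (\<Prod>i<Suc d. g i A ^ \<nu> i))"
  have "F \<in> mat_polys k N" unfolding F_def using g(1) unfolding mat_polys_eq by (intro fpolys_intros) auto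
  hence "openin ?T {V \<in> chart k N xs. F (chart_mat k N xs V) \<noteq> 0}" by (rule openin_chart_nonzero[OF xs])
  moreover have "{V \<in> chart k N xs. F (chart_mat k N xs V) \<noteq> 0} \<inter> X = {}" using c(3) unfolding F_def by blast
  ultimately have "{V \<in> chart k N xs. F (chart_mat k N xs V) \<noteq> 0} \<inter> ?C = {}"
   using openin_Int_closure_of_eq_empty by blast
  hence "\<forall>V\<in>C (Suc d) \<inter> chart k N xs. F (chart_mat k N xs V) = 0" using sub[of "Suc d"] by auto
  thus False using g(2) c(1,2) unfolding alg_indep_def F_def by blast
 qed
 thus ?thesis unfolding gr_dim_def krull_dim_def by (intro Sup_least) auto
qed

section \<open>Torus orbits\<close>

abbreviation cx :: "(nat \<Rightarrow> real) \<Rightarrow> nat \<Rightarrow> complex" where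
 "cx t \<equiv> (\<lambda>i. of_real (t i))"

definition scale :: "complex mat \<Rightarrow> (nat \<Rightarrow> complex) \<Rightarrow> complex mat" where
 "scale A t = mat (dim_row A) (dim_col A) (\<lambda>(a, i). A $$ (a, i) * t i)"

lemma scale_carrier [simp]: "A \<in> carrier_mat k n \<Longrightarrow> scale A t \<in> carrier_mat k n"
 by (auto simp: scale_def)

lemma scale_index [simp]:
 "A \<in> carrier_mat k n \<Longrightarrow> a < k \<Longrightarrow> i < n \<Longrightarrow> scale A t $$ (a, i) = A $$ (a, i) * t i"
 by (auto simp: scale_def)

lemma mult_mat_index:
 "A \<in> carrier_mat k n \<Longrightarrow> Z \<in> carrier_mat n N \<Longrightarrow> a < k \<Longrightarrow> j < N \<Longrightarrow>
  (A * Z) $$ (a, j) = (\<Sum>i<n. A $$ (a, i) * Z $$ (i, j) :: complex)"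
 by (auto simp: scalar_prod_def atLeast0LessThan)

lemma scale_mult_index:
 assumes "A \<in> carrier_mat k n" "Z \<in> carrier_mat n N" "a < k" "j < N"
 shows "(scale A t * Z) $$ (a, j) = (\<Sum>i<n. A $$ (a, i) * t i * Z $$ (i, j))"
 using mult_mat_index[OF scale_carrier[OF assms(1)] assms(2-4)] assms by simp

lemma scale_one: "A \<in> carrier_mat k n \<Longrightarrow> (\<And>i. i < n \<Longrightarrow> t i = 1) \<Longrightarrow> scale A t = A"
 by (intro eq_matI) (auto simp: scale_def)

lemma row_span_subset_iff:
 assumes C: "C \<in> carrier_mat k N" and B: "B \<in> carrier_mat k N"
 shows "row_span N C \<subseteq> row_span N B \<longleftrightarrow> (\<exists>y. \<forall>a<k. \<forall>j<N. C $$ (a, j) = (\<Sum>b<k. y a b * B $$ (b, j)))"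
proof
 assume sub: "row_span N C \<subseteq> row_span N B"
 have "\<exists>y. \<forall>j<N. C $$ (a, j) = (\<Sum>b<k. y b * B $$ (b, j))" if a: "a < k" for a
 proof -
  have "row C a \<in> row_span N C"
   unfolding row_span_iff[OF C] using a C
   by (auto intro!: exI[of _ "\<lambda>i. if i = a then 1 else 0"] simp: if_distrib[of "\<lambda>z. z * _"] cong: if_cong)
  hence "row C a \<in> row_span N B" using sub by blast
  then obtain y where y: "\<forall>j<N. row C a $ j = (\<Sum>b<k. y b * B $$ (b, j))" using row_span_iff[OF B] by auto
  show ?thesis
  proof (intro exI allI impI)
   fix j assume "j < N"
   thus "C $$ (a, j) = (\<Sum>b<k. y b * B $$ (b, j))" using y a C by auto
  qed
 qed
 thus "\<exists>y. \<forall>a<k. \<forall>j<N. C $$ (a, j) = (\<Sum>b<k. y a b * B $$ (b, j))" by metis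
next
 assume "\<exists>y. \<forall>a<k. \<forall>j<N. C $$ (a, j) = (\<Sum>b<k. y a b * B $$ (b, j))"
 then obtain y where y: "\<And>a j. a < k \<Longrightarrow> j < N \<Longrightarrow> C $$ (a, j) = (\<Sum>b<k. y a b * B $$ (b, j))" by blast
 show "row_span N C \<subseteq> row_span N B"
 proof
  fix v assume "v \<in> row_span N C"
  then obtain z where z: "v \<in> carrier_vec N" "\<forall>j<N. v $ j = (\<Sum>a<k. z a * C $$ (a, j))" using row_span_iff[OF C] by auto
  have "v $ j = (\<Sum>b<k. (\<Sum>a<k. z a * y a b) * B $$ (b, j))" if "j < N" for j
  proof -
   have "v $ j = (\<Sum>a<k. \<Sum>b<k. z a * y a b * B $$ (b, j))" using z y that by (simp add: sum_distrib_left mult.assoc)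
   also have "\<dots> = (\<Sum>b<k. (\<Sum>a<k. z a * y a b) * B $$ (b, j))" by (subst sum.swap) (simp add: sum_distrib_right)
   finally show ?thesis .
  qed
  thus "v \<in> row_span N B" unfolding row_span_iff[OF B] using z(1)
   by (intro conjI exI[of _ "\<lambda>b. \<Sum>a<k. z a * y a b"]) auto
 qed
qed

lemma amp_map_row_span:
 assumes A: "A \<in> carrier_mat k n" and Z: "Z \<in> carrier_mat n N"
 shows "amp_map Z (row_span n A) = row_span N (A * Z)"
proof (rule Set.set_eqI)
 fix w
 have AZ: "A * Z \<in> carrier_mat k N" using A Z by simp
 have entry: "(Z\<^sup>T *\<^sub>v v) $ j = (\<Sum>a<k. y a * (A * Z) $$ (a, j))"
  if v: "v \<in> carrier_vec n" "\<forall>i<n. v $ i = (\<Sum>a<k. y a * A $$ (a, i))" and "j < N" for v y j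
 proof -
  have "(Z\<^sup>T *\<^sub>v v) $ j = (\<Sum>i<n. Z $$ (i, j) * v $ i)" using Z v(1) \<open>j < N\<close> by (auto simp: scalar_prod_def atLeast0LessThan)
  also have "\<dots> = (\<Sum>i<n. \<Sum>a<k. y a * A $$ (a, i) * Z $$ (i, j))" using v(2) by (simp add: sum_distrib_left mult.commute)
  also have "\<dots> = (\<Sum>a<k. y a * (\<Sum>i<n. A $$ (a, i) * Z $$ (i, j)))" by (subst sum.swap) (simp add: sum_distrib_left mult.assoc)
  finally show ?thesis using mult_mat_index[OF A Z _ \<open>j < N\<close>] by simp
 qed
 show "w \<in> amp_map Z (row_span n A) \<longleftrightarrow> w \<in> row_span N (A * Z)"
 proof
  assume "w \<in> amp_map Z (row_span n A)"
  then obtain v where v: "v \<in> row_span n A" "w = Z\<^sup>T *\<^sub>v v" by (auto simp: amp_map_def)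
  then obtain y where "v \<in> carrier_vec n" "\<forall>i<n. v $ i = (\<Sum>a<k. y a * A $$ (a, i))" using row_span_iff[OF A] by auto
  thus "w \<in> row_span N (A * Z)" unfolding row_span_iff[OF AZ] v(2) using entry Z
   by (intro conjI exI[of _ y]) auto
 next
  assume "w \<in> row_span N (A * Z)"
  then obtain y where w: "w \<in> carrier_vec N" "\<forall>j<N. w $ j = (\<Sum>a<k. y a * (A * Z) $$ (a, j))" using row_span_iff[OF AZ] by auto
  define v where "v = vec n (\<lambda>i. \<Sum>a<k. y a * A $$ (a, i))"
  have "v \<in> row_span n A" unfolding row_span_iff[OF A] by (auto simp: v_def intro!: exI[of _ y])
  moreover have "w = Z\<^sup>T *\<^sub>v v" using entry[of v y] w Z by (intro eq_vecI) (auto simp: v_def)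
  ultimately show "w \<in> amp_map Z (row_span n A)" by (auto simp: amp_map_def)
 qed
qed

text \<open>The columns in \<open>L\<close> are scaled in groups, one parameter for each value of
  \<open>\<pi>\<close>, and the other columns are erased. Different choices of \<open>L\<close> and
  \<open>\<pi>\<close> describe the linear families of scalings that occur: all of them, those
  vanishing at one position, and those constant from some position on.\<close>

definition torus_triv ::
 "nat \<Rightarrow> complex mat \<Rightarrow> complex mat \<Rightarrow> complex mat \<Rightarrow> nat set \<Rightarrow> (nat \<Rightarrow> nat) \<Rightarrow> bool" where
 "torus_triv N A Z B L \<pi> \<longleftrightarrow> (\<forall>u.
   row_span N (scale A (\<lambda>l. if l \<in> L then u (\<pi> l) else 0) * Z) \<subseteq> row_span N B \<longrightarrow> (\<forall>c\<in>\<pi> ` L. u c = 0))"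

text \<open>The coefficients that express the scaled rows through the rows of \<open>B\<close> are
  added to the unknowns (\<open>Inr\<close>, next to the scaling parameters \<open>Inl\<close>). The
  condition then says that a linear system with polynomial coefficients has trivial kernel, which
  persists where a suitable polynomial is nonzero. Independence of the rows of \<open>B\<close> at
  \<open>x0\<close> makes the coefficients vanish together with the parameters.\<close>

lemma torus_triv_open:
 assumes A: "A \<in> carrier_mat k n" and Z: "\<And>x. Z x \<in> carrier_mat n N" and B: "\<And>x. B x \<in> carrier_mat k N"
  and Zp: "\<And>i j. i < n \<Longrightarrow> j < N \<Longrightarrow> (\<lambda>x. Z x $$ (i, j)) \<in> fpolys X"
  and Bp: "\<And>a j. a < k \<Longrightarrow> j < N \<Longrightarrow> (\<lambda>x. B x $$ (a, j)) \<in> fpolys X"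
  and x0: "indep_rows k N (B x0)" "torus_triv N A (Z x0) (B x0) L \<pi>" and L: "L \<subseteq> {..<n}"
 shows "\<exists>D\<in>fpolys X. D x0 \<noteq> 0 \<and> (\<forall>x. D x \<noteq> 0 \<longrightarrow> torus_triv N A (Z x) (B x) L \<pi>)"
proof -
 have finL: "finite L" using L finite_subset by blast
 define I :: "(nat + nat \<times> nat) set" where "I = Inl ` (\<pi> ` L) \<union> Inr ` ({..<k} \<times> {..<k})"
 define S where "S = {..<k} \<times> {..<N}"
 define M :: "nat \<times> nat \<Rightarrow> nat + nat \<times> nat \<Rightarrow> _ \<Rightarrow> complex" where
  "M = (\<lambda>(a, j) i x. case i of Inl c \<Rightarrow> \<Sum>l\<in>{l \<in> L. \<pi> l = c}. A $$ (a, l) * Z x $$ (l, j)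
    | Inr (a', b) \<Rightarrow> if a' = a then - B x $$ (b, j) else 0)"
 have sumM: "(\<Sum>i\<in>I. M (a, j) i x * w i) =
   (scale A (\<lambda>l. if l \<in> L then w (Inl (\<pi> l)) else 0) * Z x) $$ (a, j) - (\<Sum>b<k. w (Inr (a, b)) * B x $$ (b, j))"
  if "a < k" "j < N" for a j x w
 proof -
  have "(\<Sum>i\<in>I. M (a, j) i x * w i) = (\<Sum>i\<in>Inl ` (\<pi> ` L). M (a, j) i x * w i) + (\<Sum>i\<in>Inr ` ({..<k} \<times> {..<k}). M (a, j) i x * w i)"
   unfolding I_def using finL by (intro sum.union_disjoint) auto
  also have "(\<Sum>i\<in>Inl ` (\<pi> ` L). M (a, j) i x * w i) = (\<Sum>c\<in>\<pi> ` L. \<Sum>l\<in>{l \<in> L. \<pi> l = c}. A $$ (a, l) * Z x $$ (l, j) * w (Inl (\<pi> l)))"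
   by (subst sum.reindex) (auto simp: M_def sum_distrib_right intro!: sum.cong)
  also have "\<dots> = (\<Sum>l\<in>L. A $$ (a, l) * Z x $$ (l, j) * w (Inl (\<pi> l)))"
   by (rule sum.group) (use finL in auto)
  also have "\<dots> = (\<Sum>l<n. A $$ (a, l) * (if l \<in> L then w (Inl (\<pi> l)) else 0) * Z x $$ (l, j))"
   using L by (intro sum.mono_neutral_cong_left) auto
  also have "\<dots> = (scale A (\<lambda>l. if l \<in> L then w (Inl (\<pi> l)) else 0) * Z x) $$ (a, j)"
   using scale_mult_index[OF A Z that] by simp
  also have "(\<Sum>i\<in>Inr ` ({..<k} \<times> {..<k}). M (a, j) i x * w i) = (\<Sum>a'<k. \<Sum>b<k. (if a' = a then - B x $$ (b, j) else 0) * w (Inr (a', b)))"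
   by (subst sum.reindex) (auto simp: M_def sum.cartesian_product split_def intro!: sum.cong)
  also have "\<dots> = (\<Sum>a'<k. if a' = a then (\<Sum>b<k. - B x $$ (b, j) * w (Inr (a, b))) else 0)"
   by (intro sum.cong refl) auto
  also have "\<dots> = - (\<Sum>b<k. w (Inr (a, b)) * B x $$ (b, j))" using that by (simp add: sum_negf mult.commute)
  finally show ?thesis by simp
 qed
 have ker: "\<forall>i\<in>I. w i = 0" if w: "\<forall>\<xi>\<in>S. (\<Sum>i\<in>I. M \<xi> i x0 * w i) = 0" for w
 proof -
  let ?C = "scale A (\<lambda>l. if l \<in> L then w (Inl (\<pi> l)) else 0) * Z x0"
  have C: "?C \<in> carrier_mat k N" by (rule mult_carrier_mat[OF scale_carrier[OF A] Z])
  have eq: "?C $$ (a, j) = (\<Sum>b<k. w (Inr (a, b)) * B x0 $$ (b, j))" if "a < k" "j < N" for a j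
   using w that sumM[OF that, of x0 w] by (auto simp: S_def)
  hence "row_span N ?C \<subseteq> row_span N (B x0)"
   unfolding row_span_subset_iff[OF C B] by (intro exI[of _ "\<lambda>a b. w (Inr (a, b))"]) auto
  hence u0: "\<forall>c\<in>\<pi> ` L. w (Inl c) = 0" using x0(2)[unfolded torus_triv_def, rule_format, of "\<lambda>c. w (Inl c)"] by blast
  have zero: "?C $$ (a, j) = 0" if "a < k" "j < N" for a j
   using scale_mult_index[OF A Z that] u0 by (auto intro!: sum.neutral)
  have "\<forall>j<N. (\<Sum>b<k. w (Inr (a, b)) * B x0 $$ (b, j)) = 0" if "a < k" for a
   using eq[OF that] zero[OF that] by simp
  hence "\<forall>b<k. w (Inr (a, b)) = 0" if "a < k" for a
   using x0(1)[unfolded indep_rows_def, rule_format, of "\<lambda>b. w (Inr (a, b))"] that by blast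
  thus ?thesis using u0 by (auto simp: I_def)
 qed
 have "\<exists>D\<in>fpolys X. D x0 \<noteq> 0 \<and>
  (\<forall>x t. D x \<noteq> 0 \<longrightarrow> (\<forall>\<xi>\<in>S. (\<Sum>i\<in>I. M \<xi> i x * t i) = 0) \<longrightarrow> (\<forall>i\<in>I. t i = 0))"
 proof (rule linear_system_trivial_kernel)
  show "finite I" using finL by (simp add: I_def)
  fix \<xi> i assume "\<xi> \<in> S" "i \<in> I"
  then obtain a j where aj: "\<xi> = (a, j)" "a < k" "j < N" by (auto simp: S_def)
  show "M \<xi> i \<in> fpolys X"
  proof (cases i)
   case (Inl c)
   show ?thesis unfolding aj(1) M_def Inl using L Zp aj
    by (auto intro!: fpolys.mult fpolys.const fpolys_sum)
  next
   case (Inr p)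
   then obtain a' b where p: "p = (a', b)" "b < k" using \<open>i \<in> I\<close> by (auto simp: I_def)
   thus ?thesis unfolding aj(1) M_def Inr p using Bp[OF p(2) aj(3)]
    by (cases "a' = a") (auto intro: fpolys_minus fpolys.const)
  qed
 qed (rule ker)
 then obtain D where D: "D \<in> fpolys X" "D x0 \<noteq> 0"
  and triv: "\<forall>x w. D x \<noteq> 0 \<longrightarrow> (\<forall>\<xi>\<in>S. (\<Sum>i\<in>I. M \<xi> i x * w i) = 0) \<longrightarrow> (\<forall>i\<in>I. w i = 0)"
  by (elim bexE conjE)
 have "torus_triv N A (Z x) (B x) L \<pi>" if Dx: "D x \<noteq> 0" for x
  unfolding torus_triv_def
 proof (intro allI impI)
  fix u
  let ?C = "scale A (\<lambda>l. if l \<in> L then u (\<pi> l) else 0) * Z x"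
  have C: "?C \<in> carrier_mat k N" by (rule mult_carrier_mat[OF scale_carrier[OF A] Z])
  assume "row_span N ?C \<subseteq> row_span N (B x)"
  then obtain y where y: "\<forall>a<k. \<forall>j<N. ?C $$ (a, j) = (\<Sum>b<k. y a b * B x $$ (b, j))"
   unfolding row_span_subset_iff[OF C B] by blast
  define w where "w = (\<lambda>i. case i of Inl c \<Rightarrow> u c | Inr (a, b) \<Rightarrow> y a b)"
  have w: "w (Inl c) = u c" "w (Inr (a, b)) = y a b" for a b c by (simp_all add: w_def)
  have "\<forall>\<xi>\<in>S. (\<Sum>i\<in>I. M \<xi> i x * w i) = 0"
  proof
   fix \<xi> assume "\<xi> \<in> S"
   then obtain a j where "\<xi> = (a, j)" "a < k" "j < N" by (auto simp: S_def)
   thus "(\<Sum>i\<in>I. M \<xi> i x * w i) = 0" using y sumM[of a j x w] by (simp add: w cong: if_cong)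
  qed
  hence w0: "\<forall>i\<in>I. w i = 0" using triv Dx by blast
  show "\<forall>c\<in>\<pi> ` L. u c = 0"
  proof
   fix c assume "c \<in> \<pi> ` L"
   hence "Inl c \<in> I" by (simp add: I_def)
   thus "u c = 0" using w0 w(1)[of c] by metis
  qed
 qed
 thus ?thesis using D by blast
qed

lemma indep_rows_open:
 assumes Bp: "\<And>a j. a < k \<Longrightarrow> j < N \<Longrightarrow> (\<lambda>x. B x $$ (a, j)) \<in> fpolys X" and "indep_rows k N (B x0)"
 shows "\<exists>D\<in>fpolys X. D x0 \<noteq> 0 \<and> (\<forall>x. D x \<noteq> 0 \<longrightarrow> indep_rows k N (B x))"
proof -
 obtain xs where xs: "length xs = k" "set xs \<subseteq> {..<N}" "lminor (B x0) xs \<noteq> 0"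
  using indep_rows_lminor[OF assms(2)] by blast
 have "(\<lambda>x. lminor (B x) xs) \<in> fpolys X"
  using fpolys_compose[OF lminor_polys[OF xs(2,1), unfolded mat_polys_eq]] Bp
  by (auto simp: mat_entries_def)
 thus ?thesis using xs(3) lminor_indep_rows[OF xs(1,2)]
  by (intro bexI[of _ "\<lambda>x. lminor (B x) xs"]) auto
qed

lemma indep_rows_scale:
 assumes A: "A \<in> carrier_mat k n" "indep_rows k n A" and t: "\<And>i. i < n \<Longrightarrow> t i \<noteq> 0"
 shows "indep_rows k n (scale A t)"
 unfolding indep_rows_def
proof (intro allI impI)
 fix y a assume y: "\<forall>j<n. (\<Sum>a<k. y a * scale A t $$ (a, j)) = 0" and "a < k"
 have "(\<Sum>a<k. y a * A $$ (a, j)) = 0" if "j < n" for j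
 proof -
  have "(\<Sum>a<k. y a * A $$ (a, j)) * t j = 0"
   using y A(1) that by (simp add: sum_distrib_right mult.assoc)
  thus ?thesis using t that by simp
 qed
 thus "y a = 0" using A(2) \<open>a < k\<close> unfolding indep_rows_def by blast
qed

lemma lminor_scale:
 assumes "A \<in> carrier_mat k n" "length xs = k" "set xs \<subseteq> {..<n}"
 shows "lminor (scale A t) xs = lminor A xs * (\<Prod>b<k. t (xs ! b))"
proof -
 have "lminor (scale A t) xs = (\<Sum>p | p permutes {0..<k}. signof p * (\<Prod>i<k. A $$ (p i, xs ! i) * t (xs ! i)))"
  unfolding lminor_def assms(2)
  by (subst det_col[of _ k])
   (use assms in \<open>auto intro!: sum.cong prod.cong simp: permutes_in_image[of _ "{0..<k}"] nth_less\<close>)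
 also have "\<dots> = (\<Sum>p | p permutes {0..<k}. signof p * (\<Prod>i<k. A $$ (p i, xs ! i))) * (\<Prod>b<k. t (xs ! b))"
  by (simp add: sum_distrib_right prod.distrib mult.assoc)
 also have "(\<Sum>p | p permutes {0..<k}. signof p * (\<Prod>i<k. A $$ (p i, xs ! i))) = lminor A xs"
  unfolding lminor_def assms(2)
  by (subst det_col[of _ k])
   (auto intro!: sum.cong prod.cong simp: permutes_in_image[of _ "{0..<k}"])
 finally show ?thesis .
qed

text \<open>Parameters at which the product drops rank are left out, since the projection is
  undefined there. With \<open>Z\<close> the identity this is an orbit itself, in general the image
  of one.\<close>

definition pos_orbit :: "nat \<Rightarrow> complex mat \<Rightarrow> complex mat \<Rightarrow> (nat \<Rightarrow> real) set \<Rightarrow> complex vec set set" where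
 "pos_orbit N A Z \<Theta> = {row_span N (scale A (cx t) * Z) | t. t \<in> \<Theta> \<and>
   indep_rows (dim_row A) N (scale A (cx t) * Z)}"

lemma segment_entries:
 assumes "A \<in> carrier_mat k n" "Z \<in> carrier_mat n N"
  and "x \<in> mat_entries k N"
 shows "\<exists>p. \<forall>s. x (scale A (\<lambda>i. of_real ((1 - s) * t i + s * t' i)) * Z) = poly p (of_real s)"
proof -
 obtain a j where x: "x = (\<lambda>A. A $$ (a, j))" "a < k" "j < N" using assms(3) by (auto simp: mat_entries_def)
 define p where "p = (\<Sum>i<n. [:A $$ (a, i) * Z $$ (i, j) * t i, A $$ (a, i) * Z $$ (i, j) * (t' i - t i):])"
 have "x (scale A (\<lambda>i. of_real ((1 - s) * t i + s * t' i)) * Z) = poly p (of_real s)" for s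
  unfolding x(1) scale_mult_index[OF assms(1,2) x(2,3)] p_def poly_sum
  by (intro sum.cong refl) (simp add: algebra_simps)
 thus ?thesis by blast
qed

text \<open>Parameters of points in the two open sets are joined by a segment. The polynomials that
  witness the open sets and the full rank are nonzero simultaneously at some interior point of the
  segment, and convexity keeps that point in \<open>\<Theta>\<close>.\<close>

lemma pos_orbit_irreducible:
 assumes A: "A \<in> carrier_mat k n" and Z: "Z \<in> carrier_mat n N"
  and conv: "\<And>t t' s. t \<in> \<Theta> \<Longrightarrow> t' \<in> \<Theta> \<Longrightarrow> 0 < s \<Longrightarrow> s < 1 \<Longrightarrow> (\<lambda>i. (1 - s) * t i + s * t' i) \<in> \<Theta>"
  and ne: "pos_orbit N A Z \<Theta> \<noteq> {}"
 shows "irred_in (zariski_gr k N) (pos_orbit N A Z \<Theta>)"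
 unfolding irred_in_def
proof (intro conjI allI impI)
 let ?V = "\<lambda>t :: nat \<Rightarrow> real. scale A (cx t) * Z"
 have V: "?V t \<in> carrier_mat k N" for t by (rule mult_carrier_mat[OF scale_carrier[OF A] Z])
 have mem: "V \<in> pos_orbit N A Z \<Theta> \<longleftrightarrow> (\<exists>t\<in>\<Theta>. V = row_span N (?V t) \<and> ?V t \<in> mats_of_rank k N k)" for V
  unfolding pos_orbit_def using A V by (auto simp: mats_of_rank_iff)
 show "pos_orbit N A Z \<Theta> \<subseteq> topspace (zariski_gr k N)"
  using mem by (auto simp: topspace_zariski_gr grassmannian_def)
 show "pos_orbit N A Z \<Theta> \<noteq> {}" by (rule ne)
 fix O1 O2 assume O: "openin (zariski_gr k N) O1" "openin (zariski_gr k N) O2"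
  and "O1 \<inter> pos_orbit N A Z \<Theta> \<noteq> {}" "O2 \<inter> pos_orbit N A Z \<Theta> \<noteq> {}"
 then obtain t t' where t: "t \<in> \<Theta>" "?V t \<in> mats_of_rank k N k" "row_span N (?V t) \<in> O1"
  and t': "t' \<in> \<Theta>" "?V t' \<in> mats_of_rank k N k" "row_span N (?V t') \<in> O2"
  by (elim ex_in_conv[THEN iffD2, elim_format] exE) (simp only: Int_iff mem, blast)
 obtain f where f: "f \<in> mat_polys k N" "f (?V t) \<noteq> 0"
  "\<And>A'. A' \<in> mats_of_rank k N k \<Longrightarrow> f A' \<noteq> 0 \<Longrightarrow> row_span N A' \<in> O1" using openin_gr_ex[OF O(1) t(2,3)] by blast
 obtain g where g: "g \<in> mat_polys k N" "g (?V t') \<noteq> 0"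
  "\<And>A'. A' \<in> mats_of_rank k N k \<Longrightarrow> g A' \<noteq> 0 \<Longrightarrow> row_span N A' \<in> O2" using openin_gr_ex[OF O(2) t'(2,3)] by blast
 obtain h where h: "h \<in> mat_polys k N" "h (?V t) \<noteq> 0" "\<And>A'. h A' \<noteq> 0 \<Longrightarrow> indep_rows k N A'"
  using indep_rows_open[of k N "\<lambda>A. A" "mat_entries k N" "?V t"] t(2)
  by (auto simp: mats_of_rank_iff mat_polys_eq mat_entries_def intro!: fpolys.gen)
 let ?\<gamma> = "\<lambda>s. ?V (\<lambda>i. (1 - s) * t i + s * t' i)"
 have "\<exists>s. 0 < s \<and> s < 1 \<and> (\<lambda>A. f A * h A) (?\<gamma> s) \<noteq> 0 \<and> g (?\<gamma> s) \<noteq> 0"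
 proof (rule fpolys_segment_nonzero)
  show "(\<lambda>A. f A * h A) \<in> fpolys (mat_entries k N)" "g \<in> fpolys (mat_entries k N)"
   using f g h unfolding mat_polys_eq by (auto intro: fpolys_intros)
  show "g (?\<gamma> 1) \<noteq> 0" "(\<lambda>A. f A * h A) (?\<gamma> 0) \<noteq> 0" using f g h by auto
 qed (rule segment_entries[OF A Z])
 then obtain s where s: "0 < s" "s < 1" "f (?\<gamma> s) \<noteq> 0" "h (?\<gamma> s) \<noteq> 0" "g (?\<gamma> s) \<noteq> 0" by auto
 have M: "?\<gamma> s \<in> mats_of_rank k N k"
  unfolding mats_of_rank_iff by (intro conjI V h(3)[OF s(4)])
 have "row_span N (?\<gamma> s) \<in> pos_orbit N A Z \<Theta>"
  unfolding mem by (rule bexI[OF _ conv[OF t(1) t'(1) s(1,2)]]) (use M in simp)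
 hence "row_span N (?\<gamma> s) \<in> O1 \<inter> O2 \<inter> pos_orbit N A Z \<Theta>"
  using f(3)[OF M s(3)] g(3)[OF M s(5)] by simp
 thus "O1 \<inter> O2 \<inter> pos_orbit N A Z \<Theta> \<noteq> {}" by blast
qed

text \<open>Immersivity at the scaling with all entries 1: the second condition says that the
  differential of \<open>t\<close> going to the row span of \<open>scale A t * Z\<close> is
  injective on the directions that vanish at column 0. Fixing that column removes the overall
  factor, which does not move the row span.\<close>

definition good_proj :: "complex mat \<Rightarrow> complex mat \<Rightarrow> bool" where
 "good_proj A Z \<longleftrightarrow> indep_rows (dim_row A) (dim_col Z) (A * Z) \<and>
   torus_triv (dim_col Z) A Z (A * Z) {1..<dim_col A} id"

text \<open>The multiple of \<open>t\<close> that agrees with \<open>t'\<close> at 0 is subtracted.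
  The difference vanishes at 0 and still maps the rows into the span of \<open>B\<close>, hence it
  is zero.\<close>

lemma torus_triv_proportional:
 assumes A: "A \<in> carrier_mat k n" and Z: "Z \<in> carrier_mat n N" and B: "B \<in> carrier_mat k N"
  and triv: "torus_triv N A Z B {1..<n} id" and t0: "t 0 \<noteq> 0" "0 < n"
  and sub: "row_span N (scale A t * Z) \<subseteq> row_span N B" "row_span N (scale A t' * Z) \<subseteq> row_span N B"
 shows "\<exists>c. \<forall>i<n. t' i = c * t i"
proof -
 define c where "c = t' 0 / t 0"
 define u where "u = (\<lambda>i. t' i - c * t i)"
 have C: "scale A s * Z \<in> carrier_mat k N" for s by (rule mult_carrier_mat[OF scale_carrier[OF A] Z])
 obtain y where y: "\<And>a j. a < k \<Longrightarrow> j < N \<Longrightarrow> (scale A t * Z) $$ (a, j) = (\<Sum>b<k. y a b * B $$ (b, j))"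
  using sub(1) unfolding row_span_subset_iff[OF C B] by blast
 obtain y' where y': "\<And>a j. a < k \<Longrightarrow> j < N \<Longrightarrow> (scale A t' * Z) $$ (a, j) = (\<Sum>b<k. y' a b * B $$ (b, j))"
  using sub(2) unfolding row_span_subset_iff[OF C B] by blast
 have "row_span N (scale A (\<lambda>l. if l \<in> {1..<n} then u (id l) else 0) * Z) \<subseteq> row_span N B"
  unfolding row_span_subset_iff[OF C B]
 proof (intro exI[of _ "\<lambda>a b. y' a b - c * y a b"] allI impI)
  fix a j assume aj: "a < k" "j < N"
  have "(scale A (\<lambda>l. if l \<in> {1..<n} then u (id l) else 0) * Z) $$ (a, j) = (\<Sum>i<n. A $$ (a, i) * u i * Z $$ (i, j))"
   unfolding scale_mult_index[OF A Z aj]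
   using t0 by (intro sum.cong refl) (auto simp: u_def c_def not_le)
  also have "\<dots> = (scale A t' * Z) $$ (a, j) - c * (scale A t * Z) $$ (a, j)"
   unfolding scale_mult_index[OF A Z aj] sum_distrib_left sum_subtractf[symmetric]
   by (intro sum.cong refl) (simp add: u_def algebra_simps)
  also have "\<dots> = (\<Sum>b<k. (y' a b - c * y a b) * B $$ (b, j))"
   using aj y y' by (simp add: left_diff_distrib sum_subtractf sum_distrib_left mult.assoc)
  finally show "(scale A (\<lambda>l. if l \<in> {1..<n} then u (id l) else 0) * Z) $$ (a, j) =
   (\<Sum>b<k. (y' a b - c * y a b) * B $$ (b, j))" .
 qed
 hence "\<forall>i\<in>{1..<n}. u i = 0" using triv[unfolded torus_triv_def, rule_format, of u] by auto
 moreover have "u 0 = 0" using t0 by (simp add: u_def c_def)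
 ultimately have "u i = 0" if "i < n" for i using that by (cases "i = 0") auto
 thus ?thesis by (auto simp: u_def)
qed

text \<open>Polynomial functions take matrices of every size as arguments, whereas
  \<open>torus_triv_open\<close> wants a family of matrices of fixed size for all arguments.
  Clipping supplies it and changes nothing on matrices of the right size.\<close>

definition clip_mat :: "nat \<Rightarrow> nat \<Rightarrow> complex mat \<Rightarrow> complex mat" where
 "clip_mat k N B = mat k N (\<lambda>p. B $$ p)"

lemma clip_mat_carrier [simp]: "clip_mat k N B \<in> carrier_mat k N"
 by (simp add: clip_mat_def)

lemma clip_mat_id [simp]: "B \<in> carrier_mat k N \<Longrightarrow> clip_mat k N B = B"
 by (intro eq_matI) (auto simp: clip_mat_def)

lemma clip_mat_polys: "a < k \<Longrightarrow> j < N \<Longrightarrow> (\<lambda>B. clip_mat k N B $$ (a, j)) \<in> fpolys (mat_entries k N)"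
 by (auto simp: clip_mat_def mat_entries_def intro: fpolys.gen)

lemma torus_triv_cong:
 "row_span N B = row_span N B' \<Longrightarrow> torus_triv N A Z B L \<pi> \<longleftrightarrow> torus_triv N A Z B' L \<pi>"
 by (simp add: torus_triv_def)

lemma scale_cong:
 "A \<in> carrier_mat k n \<Longrightarrow> (\<And>i. i < n \<Longrightarrow> t i = t' i) \<Longrightarrow> scale A t = scale A t'"
 by (intro eq_matI) (auto simp: scale_def)

text \<open>\<open>C\<close> is a square matrix times \<open>C'\<close>, so a nonzero minor of
  \<open>C\<close> is a multiple of the same minor of \<open>C'\<close>.\<close>

lemma indep_rows_row_span:
 assumes C: "C \<in> carrier_mat k N" "indep_rows k N C" and C': "C' \<in> carrier_mat k N"
  and eq: "row_span N C = row_span N C'"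
 shows "indep_rows k N C'"
proof -
 obtain xs where xs: "length xs = k" "set xs \<subseteq> {..<N}" "lminor C xs \<noteq> 0"
  using indep_rows_lminor[OF C(2)] by blast
 obtain y where y: "\<And>a j. a < k \<Longrightarrow> j < N \<Longrightarrow> C $$ (a, j) = (\<Sum>b<k. y a b * C' $$ (b, j))"
  using eq row_span_subset_iff[OF C(1) C'] by blast
 have "mat k k (\<lambda>(a, b). C $$ (a, xs ! b)) = mat k k (\<lambda>(a, b). y a b) * mat k k (\<lambda>(a, b). C' $$ (a, xs ! b))"
  using y nth_less[OF xs(2,1)] by (intro eq_matI) (auto simp: scalar_prod_def atLeast0LessThan)
 hence "lminor C xs = det (mat k k (\<lambda>(a, b). y a b)) * lminor C' xs"
  unfolding lminor_def xs(1) by (simp add: det_mult[of _ k])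
 hence "lminor C' xs \<noteq> 0" using xs(3) by auto
 thus ?thesis using lminor_indep_rows[OF xs(1,2)] by blast
qed

lemma row_span_in_gr_iff:
 assumes "C \<in> carrier_mat k N"
 shows "row_span N C \<in> grassmannian k N \<longleftrightarrow> indep_rows k N C"
proof
 assume "row_span N C \<in> grassmannian k N"
 then obtain B where "B \<in> carrier_mat k N" "indep_rows k N B" "row_span N C = row_span N B"
  unfolding grassmannian_def by (auto simp: mats_of_rank_iff)
 thus "indep_rows k N C" using indep_rows_row_span[of B k N C] assms by simp
next
 assume "indep_rows k N C"
 thus "row_span N C \<in> grassmannian k N" using assms by (auto simp: grassmannian_def mats_of_rank_iff)
qed

lemma row_span_scale:
 assumes A: "A \<in> carrier_mat k n" and "c \<noteq> 0" "\<And>i. i < n \<Longrightarrow> t' i = c * t i"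
 shows "row_span n (scale A t') = row_span n (scale A t)"
proof
 note C = scale_carrier[OF A]
 show "row_span n (scale A t') \<subseteq> row_span n (scale A t)"
  unfolding row_span_subset_iff[OF C C]
  using A assms(2,3) by (intro exI[of _ "\<lambda>a b. if a = b then c else 0"])
   (auto simp: if_distrib[of "\<lambda>z. z * _"] cong: if_cong)
 show "row_span n (scale A t) \<subseteq> row_span n (scale A t')"
  unfolding row_span_subset_iff[OF C C]
  using A assms(2,3) by (intro exI[of _ "\<lambda>a b. if a = b then 1 / c else 0"])
   (auto simp: if_distrib[of "\<lambda>z. z * _"] cong: if_cong)
qed

section \<open>Lower bound for the dimension of an orbit\<close>

abbreviation "all_pos \<equiv> {t :: nat \<Rightarrow> real. \<forall>i. 0 < t i}"

lemma all_pos_convex: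
 "t \<in> all_pos \<Longrightarrow> t' \<in> all_pos \<Longrightarrow> 0 < s \<Longrightarrow> s < 1 \<Longrightarrow> (\<lambda>i. (1 - s) * t i + s * t' i) \<in> all_pos"
 by (simp add: add_pos_pos)

lemma pos_orbit_nonempty:
 assumes A: "A \<in> carrier_mat k n" and "Z \<in> carrier_mat n N" "indep_rows k N (A * Z)" "(\<lambda>_. 1) \<in> \<Theta>"
 shows "row_span N (A * Z) \<in> pos_orbit N A Z \<Theta>"
 unfolding pos_orbit_def using assms scale_one[OF A, of "\<lambda>_. 1"]
 by (intro CollectI exI[of _ "\<lambda>_. 1"]) auto

text \<open>The torus directions are turned on one at a time; a point whose only scalings are the obvious
 ones remembers how many of them are on.\<close>

lemma pos_orbit_dim_ge:
 assumes A: "A \<in> carrier_mat k n" and Z: "Z \<in> carrier_mat n N" and good: "good_proj A Z" and n: "0 < n"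
  and X: "X \<subseteq> grassmannian k N" "pos_orbit N A Z all_pos \<subseteq> X"
 shows "enat (n - 1) \<le> gr_dim k N X"
proof -
 let ?V = "\<lambda>t :: nat \<Rightarrow> real. scale A (cx t) * Z"
 have V: "?V t \<in> carrier_mat k N" for t by (rule mult_carrier_mat[OF scale_carrier[OF A] Z])
 have AZ: "A * Z \<in> carrier_mat k N" using A Z by simp
 have good': "indep_rows k N (A * Z)" "torus_triv N A Z (A * Z) {1..<n} id"
  using good A Z by (auto simp: good_proj_def)
 \<comment> \<open>Scalings that are constant from \<open>i\<close> on; up to a common factor they
   have \<open>i\<close> free parameters, so \<open>i\<close> runs from 0 to
   \<open>n - 1\<close>.\<close>
 define \<Theta> where "\<Theta> = (\<lambda>i. {t \<in> all_pos. \<exists>c. \<forall>l\<ge>i. t l = c})"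
 define Y where "Y = (\<lambda>i. pos_orbit N A Z (\<Theta> i))"
 show ?thesis
 proof (rule gr_dim_ge[OF X(1), where Y = Y])
  fix i
  show "irred_in (zariski_gr k N) (Y i)" unfolding Y_def
  proof (rule pos_orbit_irreducible[OF A Z])
   show "pos_orbit N A Z (\<Theta> i) \<noteq> {}"
    using pos_orbit_nonempty[OF A Z good'(1), of "\<Theta> i"] by (auto simp: \<Theta>_def)
   show "(\<lambda>i. (1 - s) * t i + s * t' i) \<in> \<Theta> i"
    if "t \<in> \<Theta> i" "t' \<in> \<Theta> i" "0 < s" "s < (1 :: real)" for t t' s
   proof -
    note a = that
    then obtain c c' where "\<forall>l\<ge>i. t l = c" "\<forall>l\<ge>i. t' l = c'" unfolding \<Theta>_def by blast
    hence "\<forall>l\<ge>i. (1 - s) * t l + s * t' l = (1 - s) * c + s * c'" by simp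
    thus ?thesis using all_pos_convex[of t t' s] a unfolding \<Theta>_def by blast
   qed
  qed
  show "Y i \<subseteq> X" using X(2) unfolding Y_def pos_orbit_def \<Theta>_def by blast
 next
  fix i
  have "\<Theta> i \<subseteq> \<Theta> (Suc i)" unfolding \<Theta>_def using Suc_leD by blast
  thus "Y i \<subseteq> Y (Suc i)" unfolding Y_def pos_orbit_def by blast
 next
  fix i assume i: "i < n - 1"
  \<comment> \<open>No nonzero scaling that is constant from \<open>i\<close> on maps the rows of
    \<open>A Z\<close> into the span. A point of \<open>Y i\<close> violates this by its own
    parameter; the condition is open and is met by a suitable point of
    \<open>Y (Suc i)\<close>.\<close>
  let ?Q = "\<lambda>B. torus_triv N A Z B {..<n} (\<lambda>l. min l i)"
  define O' where "O' = {row_span N B | B. B \<in> mats_of_rank k N k \<and> ?Q B}"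
  have mem: "row_span N B \<in> O' \<longleftrightarrow> ?Q B" if "B \<in> mats_of_rank k N k" for B
   unfolding O'_def using that torus_triv_cong by blast
  have "openin (zariski_gr k N) O'" unfolding openin_gr_iff
  proof (intro conjI ballI impI)
   show "O' \<subseteq> grassmannian k N" by (auto simp: O'_def grassmannian_def)
   fix B assume B: "B \<in> mats_of_rank k N k" "row_span N B \<in> O'"
   have "\<exists>D\<in>fpolys (mat_entries k N). D B \<noteq> 0 \<and> (\<forall>x. D x \<noteq> 0 \<longrightarrow> ?Q (clip_mat k N x))"
    using B mem[OF B(1)]
    by (intro torus_triv_open[OF A Z clip_mat_carrier]) (auto intro: fpolys.const clip_mat_polys simp: mats_of_rank_iff)
   then obtain D where D: "D \<in> mat_polys k N" "D B \<noteq> 0" "\<And>x. D x \<noteq> 0 \<Longrightarrow> ?Q (clip_mat k N x)"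
    unfolding mat_polys_eq by blast
   have "row_span N B' \<in> O'" if "B' \<in> mats_of_rank k N k" "D B' \<noteq> 0" for B'
    using D(3)[OF that(2)] that(1) mem by (simp add: mats_of_rank_iff)
   thus "\<exists>f\<in>mat_polys k N. f B \<noteq> 0 \<and> (\<forall>A'\<in>mats_of_rank k N k. f A' \<noteq> 0 \<longrightarrow> row_span N A' \<in> O')"
    using D by blast
  qed
  moreover have "O' \<inter> Y i = {}"
  proof (rule ccontr)
   assume "O' \<inter> Y i \<noteq> {}"
   then obtain t where t: "t \<in> \<Theta> i" "indep_rows k N (?V t)" "row_span N (?V t) \<in> O'"
    using A unfolding Y_def pos_orbit_def by auto
   have "?Q (?V t)" using t mem[of "?V t"] V by (simp add: mats_of_rank_iff)
   moreover have "scale A (\<lambda>l. if l \<in> {..<n} then of_real (t (min l i)) else 0) = scale A (cx t)"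
   proof (rule scale_cong[OF A])
    obtain c where c: "\<forall>l\<ge>i. t l = c" using t(1) unfolding \<Theta>_def by blast
    hence "t (min l i) = t l" for l by (cases "l \<le> i") (auto simp: min_def)
    thus "(if l \<in> {..<n} then complex_of_real (t (min l i)) else 0) = complex_of_real (t l)" if "l < n" for l
     using that by simp
   qed
   ultimately have "\<forall>c\<in>(\<lambda>l. min l i) ` {..<n}. complex_of_real (t c) = 0"
    unfolding torus_triv_def by (elim allE[of _ "\<lambda>c. complex_of_real (t c)"]) simp
   hence "complex_of_real (t (min 0 i)) = 0" using n by blast
   hence "t 0 = 0" by simp
   thus False using t(1) unfolding \<Theta>_def by (simp add: less_le)
  qed
  moreover have "O' \<inter> Y (Suc i) \<noteq> {}"
  proof -
   obtain f where f: "f \<in> fpolys (mat_entries k N)" "f (A * Z) \<noteq> 0" "\<forall>x. f x \<noteq> 0 \<longrightarrow> indep_rows k N (clip_mat k N x)"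
    using indep_rows_open[of k N "clip_mat k N" "mat_entries k N" "A * Z", OF clip_mat_polys] good'(1) AZ by auto
   have "\<exists>D\<in>fpolys (mat_entries k N). D (A * Z) \<noteq> 0 \<and> (\<forall>x. D x \<noteq> 0 \<longrightarrow> torus_triv N A Z (clip_mat k N x) {1..<n} id)"
    using good' AZ by (intro torus_triv_open[OF A Z clip_mat_carrier]) (auto intro: fpolys.const clip_mat_polys)
   then obtain g where g: "g \<in> fpolys (mat_entries k N)" "g (A * Z) \<noteq> 0"
    "\<And>x. g x \<noteq> 0 \<Longrightarrow> torus_triv N A Z (clip_mat k N x) {1..<n} id" by blast
   \<comment> \<open>On the segment from the all-one scaling towards \<open>t'\<close> the entries
     at \<open>i\<close> and \<open>Suc i\<close> are \<open>1 + s\<close> and \<open>1\<close>.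
     Their difference rules out every multiple that is constant from \<open>i\<close> on, and near
     \<open>s = 0\<close> the triviality at \<open>A * Z\<close> persists.\<close>
   define t' :: "nat \<Rightarrow> real" where "t' = (\<lambda>l. if l \<le> i then 2 else 1)"
   define tt where "tt = (\<lambda>s i. (1 - s) * (\<lambda>_. 1) i + s * t' i)"
   have one: "?V (tt 0) = A * Z" using scale_one[OF A, of "\<lambda>_. 1"] by (simp add: tt_def)
   have "\<exists>s. 0 < s \<and> s < 1 \<and> (\<lambda>B. f B * g B) (?V (tt s)) \<noteq> 0 \<and> (\<lambda>_. 1 :: complex) (?V (tt s)) \<noteq> 0"
   proof (rule fpolys_segment_nonzero[where \<gamma> = "\<lambda>s. ?V (tt s)"])
    show "(\<lambda>B. f B * g B) \<in> fpolys (mat_entries k N)" "(\<lambda>_. 1) \<in> fpolys (mat_entries k N)"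
     using f g by (auto intro: fpolys_intros)
    show "(\<lambda>B. f B * g B) (?V (tt 0)) \<noteq> 0" unfolding one using f g by simp
    show "\<exists>p. \<forall>s. x (?V (tt s)) = poly p (complex_of_real s)" if "x \<in> mat_entries k N" for x
     unfolding tt_def by (rule segment_entries[OF A Z that])
   qed simp
   then obtain s where s: "0 < s" "s < 1" "f (?V (tt s)) \<noteq> 0" "g (?V (tt s)) \<noteq> 0" by auto
   define t where "t = tt s"
   have pos: "0 < t l" for l using s by (auto simp: t_def tt_def t'_def)
   have t: "t \<in> \<Theta> (Suc i)" using pos by (auto simp: t_def tt_def t'_def \<Theta>_def)
   have ti: "t i = 1 + s" "t (Suc i) = 1" by (auto simp: t_def tt_def t'_def)
   have ind: "indep_rows k N (?V t)" using f(3)[rule_format, OF s(3)] clip_mat_id[OF V[of t]] by (simp add: t_def)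
   have triv: "torus_triv N A Z (?V t) {1..<n} id" using g(3)[OF s(4)] clip_mat_id[OF V[of t]] by (simp add: t_def)
   have "?Q (?V t)" unfolding torus_triv_def
   proof (intro allI impI)
    fix u assume sub: "row_span N (scale A (\<lambda>l. if l \<in> {..<n} then u (min l i) else 0) * Z) \<subseteq> row_span N (?V t)"
    have "\<exists>c. \<forall>l<n. (if l \<in> {..<n} then u (min l i) else 0) = c * complex_of_real (t l)"
     by (rule torus_triv_proportional[OF A Z V triv _ n _ sub]) (use pos[of 0] in auto)
    then obtain c where c: "\<And>l. l < n \<Longrightarrow> u (min l i) = c * complex_of_real (t l)" by auto
    have "c * complex_of_real (1 + s) = c * complex_of_real 1" using c[of i] c[of "Suc i"] i ti by simp
    hence "c = 0" using s(1) by (simp add: distrib_left)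
    thus "\<forall>c\<in>(\<lambda>l. min l i) ` {..<n}. u c = 0" using c by auto
   qed
   hence "row_span N (?V t) \<in> O'" using mem[of "?V t"] ind V by (simp add: mats_of_rank_iff)
   moreover have "row_span N (?V t) \<in> Y (Suc i)" unfolding Y_def pos_orbit_def using t ind A by blast
   ultimately show ?thesis by blast
  qed
  ultimately show "\<exists>O'. openin (zariski_gr k N) O' \<and> O' \<inter> Y i = {} \<and> O' \<inter> Y (Suc i) \<noteq> {}" by blast
 qed
qed

section \<open>Upper bound for the dimension of an orbit\<close>

lemma not_alg_indep_matrix:
 fixes M :: "'p \<Rightarrow> complex mat"
 assumes G: "finite G" "card G < r" and q: "q \<in> fpolys G" "\<And>x. x \<in> Y \<Longrightarrow> q x \<noteq> 0"
  and M: "\<And>b j. b < k \<Longrightarrow> j < N \<Longrightarrow> \<exists>P\<in>fpolys G. \<forall>x\<in>Y. M x $$ (b, j) * q x = P x"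
  and g: "\<And>i. i < r \<Longrightarrow> g i \<in> mat_polys k N"
 shows "\<not> alg_indep r (\<lambda>i x. g i (M x)) Y"
proof -
 have "\<exists>e. \<exists>P\<in>fpolys G. \<forall>x\<in>Y. g i (M x) * q x ^ e = P x" if "i < r" for i
  using M by (intro fpolys_rational_compose[OF g[OF that, unfolded mat_polys_eq] q(1)]) (auto simp: mat_entries_def)
 then obtain e P where P: "\<And>i. i < r \<Longrightarrow> P i \<in> fpolys G" "\<And>i x. i < r \<Longrightarrow> x \<in> Y \<Longrightarrow> g i (M x) * q x ^ e i = P i x"
  by metis
 \<comment> \<open>One exponent that suffices to clear the denominators of all the
   functions.\<close>
 define E where "E = (\<Sum>i<r. e i)"
 have eE: "e i \<le> E" if "i < r" for i unfolding E_def using that by (intro member_le_sum) auto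
 show ?thesis
 proof (rule not_alg_indep_rational[OF G])
  show "(\<lambda>x. q x ^ E) \<in> fpolys G" by (rule fpolys_power[OF q(1)])
  show "q x ^ E \<noteq> 0" if "x \<in> Y" for x using q(2)[OF that] by simp
  show "(\<lambda>x. P i x * q x ^ (E - e i)) \<in> fpolys G" if "i < r" for i
   using P(1)[OF that] q(1) by (intro fpolys_intros)
  fix i x assume i: "i < r" "x \<in> Y"
  have "q x ^ E = q x ^ e i * q x ^ (E - e i)" using eE[OF i(1)] by (simp add: power_add[symmetric])
  thus "g i (M x) * q x ^ E = P i x * q x ^ (E - e i)" using P(2)[OF i] by (simp add: mult.assoc[symmetric])
 qed
qed

lemma pos_orbit_cases:
 assumes "V \<in> pos_orbit N A Z \<Theta>"
 obtains t where "V = row_span N (scale A (cx t) * Z)" "t \<in> \<Theta>"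
  "indep_rows (dim_row A) N (scale A (cx t) * Z)"
 using assms unfolding pos_orbit_def by blast

lemma not_alg_indep_iff:
 "\<not> alg_indep r g Y \<longleftrightarrow> (\<exists>D c. (\<forall>x\<in>Y. (\<Sum>\<nu>\<in>exps {..<r} D. c \<nu> * (\<Prod>i<r. g i x ^ \<nu> i)) = 0) \<and>
   \<not> (\<forall>\<nu>\<in>exps {..<r} D. c \<nu> = 0))"
 unfolding alg_indep_def by (simp only: not_all not_imp)

text \<open>Row operations commute with column scalings, so orbits do not depend on the matrix
  chosen for a row span.\<close>

lemma row_span_scale_cong:
 assumes A: "A \<in> carrier_mat k n" and M: "M \<in> carrier_mat k n" and eq: "row_span n A = row_span n M"
 shows "row_span n (scale A t) \<subseteq> row_span n (scale M t)"
proof -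
 have "\<exists>y. \<forall>a<k. \<forall>j<n. A $$ (a, j) = (\<Sum>b<k. y a b * M $$ (b, j))"
  using row_span_subset_iff[OF A M] eq by simp
 then obtain y where y: "\<forall>a<k. \<forall>j<n. A $$ (a, j) = (\<Sum>b<k. y a b * M $$ (b, j))" ..
 show ?thesis
  unfolding row_span_subset_iff[OF scale_carrier[OF A] scale_carrier[OF M]]
 proof (intro exI[of _ y] allI impI)
  fix a j assume "a < k" "j < n"
  thus "scale A t $$ (a, j) = (\<Sum>b<k. y a b * scale M t $$ (b, j))"
   using y A M by (simp add: sum_distrib_right mult.assoc)
 qed
qed

lemma pos_orbit_cong:
 assumes A: "A \<in> carrier_mat k n" and M: "M \<in> carrier_mat k n" and eq: "row_span n A = row_span n M"
  and Z: "Z \<in> carrier_mat n N"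
 shows "pos_orbit N A Z \<Theta> \<subseteq> pos_orbit N M Z \<Theta>"
proof
 fix V assume "V \<in> pos_orbit N A Z \<Theta>"
 from pos_orbit_cases[OF this] obtain t where t: "V = row_span N (scale A (cx t) * Z)" "t \<in> \<Theta>"
  "indep_rows (dim_row A) N (scale A (cx t) * Z)" .
 let ?A = "scale A (cx t)" and ?M = "scale M (cx t)"
 note cA = scale_carrier[OF A] and cM = scale_carrier[OF M]
 have "row_span n ?A = row_span n ?M"
  using row_span_scale_cong[OF A M eq] row_span_scale_cong[OF M A eq[symmetric]] by (rule subset_antisym)
 hence e: "row_span N (?A * Z) = row_span N (?M * Z)" by (simp only: amp_map_row_span[OF cA Z, symmetric] amp_map_row_span[OF cM Z, symmetric])
 have d: "dim_row A = k" "dim_row M = k" using A M by auto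
 have "indep_rows k N (?M * Z)"
  using indep_rows_row_span[OF mult_carrier_mat[OF cA Z] t(3)[unfolded d] mult_carrier_mat[OF cM Z] e] .
 thus "V \<in> pos_orbit N M Z \<Theta>" unfolding pos_orbit_def d t(1) e using t(2) by blast
qed

lemma scaled_entry_polys:
 assumes A: "A \<in> carrier_mat k n" and Z: "Z \<in> carrier_mat n N" and f: "f \<in> mat_polys k N"
 shows "(\<lambda>t. f (scale A (cx t) * Z)) \<in> fpolys (range (\<lambda>i (t :: nat \<Rightarrow> real). of_real (t i)))"
proof (rule fpolys_compose[OF f[unfolded mat_polys_eq]])
 fix x assume "x \<in> mat_entries k N"
 then obtain a j where x: "x = (\<lambda>M. M $$ (a, j))" "a < k" "j < N" unfolding mat_entries_def by blast
 have "(\<lambda>t. \<Sum>i<n. A $$ (a, i) * of_real (t i) * Z $$ (i, j)) \<in> fpolys (range (\<lambda>i (t :: nat \<Rightarrow> real). of_real (t i)))"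
  by (intro fpolys_intros fpolys.gen rangeI)
 thus "(\<lambda>t. x (scale A (cx t) * Z)) \<in> fpolys (range (\<lambda>i (t :: nat \<Rightarrow> real). of_real (t i)))"
  unfolding x(1) scale_mult_index[OF A Z x(2,3)] .
qed

text \<open>Rows supported on \<open>C\<close> depend only on the scalings at \<open>C\<close>, and they determine as many rows of
 the normalized matrix.\<close>

lemma deficient_dim_le:
 assumes A: "A \<in> carrier_mat k n" and Z: "Z \<in> carrier_mat n (k + m)" and C: "C \<subseteq> {..<n}" "c0 \<in> C" and B: "B \<subseteq> {..<k}"
  and supp: "\<And>b j. b \<in> B \<Longrightarrow> j < n \<Longrightarrow> j \<notin> C \<Longrightarrow> A $$ (b, j) = 0"
 shows "gr_dim k (k + m) (pos_orbit (k + m) A Z all_pos) \<le> enat (card C - 1 + (k - card B) * m)"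
proof (rule gr_dim_le)
 let ?N = "k + m"
 let ?d = "card C - 1 + (k - card B) * m"
 define Ct where "Ct = (\<lambda>t :: nat \<Rightarrow> real. scale A (cx t) * Z)"
 have Ctc: "Ct t \<in> carrier_mat k ?N" for t unfolding Ct_def by (rule mult_carrier_mat[OF scale_carrier[OF A] Z])
 have dA: "dim_row A = k" using A by auto
 have finB: "finite B" and finC: "finite C" using B C finite_subset by blast+
 show "pos_orbit ?N A Z all_pos \<subseteq> grassmannian k ?N"
 proof
  fix V assume "V \<in> pos_orbit ?N A Z all_pos"
  from pos_orbit_cases[OF this] obtain t where t: "V = row_span ?N (scale A (cx t) * Z)" "t \<in> all_pos"
   "indep_rows (dim_row A) ?N (scale A (cx t) * Z)" .
  thus "V \<in> grassmannian k ?N" using row_span_in_gr_iff[OF Ctc[of t]] dA by (simp add: Ct_def)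
 qed
 fix xs g assume xs: "length xs = k" "set xs \<subseteq> {..<?N}" and g: "\<And>i. i \<le> ?d \<Longrightarrow> g i \<in> mat_polys k ?N"
 define w where "w = (\<lambda>t. lminor (Ct t) xs)"
 define Nt where "Nt = (\<lambda>t. norm_mat k ?N xs (Ct t))"
 \<comment> \<open>Normalizing the scaling at \<open>c0\<close> uses up the overall factor; this is
   the \<open>- 1\<close> in the bound.\<close>
 define \<Theta> where "\<Theta> = {t \<in> all_pos. t c0 = 1 \<and> w t \<noteq> 0}"
 have "\<not> alg_indep (Suc ?d) (\<lambda>i t. g i (Nt t)) \<Theta>"
 proof (cases "\<Theta> = {}")
  case True
  show ?thesis
  proof (rule not_alg_indep_matrix[where G = "{}" and q = "\<lambda>_. 1" and k = k and N = ?N])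
   show "\<exists>P\<in>fpolys {}. \<forall>t\<in>\<Theta>. Nt t $$ (b, j) * 1 = P t" for b j
    unfolding True by (intro bexI[of _ "\<lambda>_. 1"] fpolys.const) simp
  qed (use g in \<open>simp_all add: fpolys.const\<close>)
 next
  case False
  then obtain ts where ts: "ts \<in> \<Theta>" by blast
  have wts: "lminor (Ct ts) xs \<noteq> 0" using ts by (simp add: \<Theta>_def w_def)
  have dist: "distinct xs" using wts lminor_not_distinct by blast
  define Jf where "Jf = {..<?N} - set xs"
  have cJf: "card Jf = m" unfolding Jf_def using xs dist by (simp add: card_Diff_subset distinct_card)
  have finJf: "finite Jf" by (simp add: Jf_def)
  \<comment> \<open>\<open>\<rho>\<close> is row \<open>b\<close> of the product written with the
    scalings at \<open>C\<close> only, the one at \<open>c0\<close> being replaced by the constant 1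
    so that it does not count as a parameter.\<close>
  define y where "y = (\<lambda>i (t :: nat \<Rightarrow> real). if i = c0 then 1 else complex_of_real (t i))"
  define \<rho> where "\<rho> = (\<lambda>b j t. \<Sum>i\<in>C. A $$ (b, i) * y i t * Z $$ (i, j))"
  have \<rho>: "Ct t $$ (b, j) = \<rho> b j t" if "t \<in> \<Theta>" "b \<in> B" "j < ?N" for t b j
  proof -
   have b: "b < k" using that(2) B by auto
   have t0: "complex_of_real (t c0) = 1" using that(1) by (simp add: \<Theta>_def)
   have "Ct t $$ (b, j) = (\<Sum>i<n. A $$ (b, i) * of_real (t i) * Z $$ (i, j))"
    unfolding Ct_def by (rule scale_mult_index[OF A Z b that(3)])
   also have "\<dots> = \<rho> b j t" unfolding \<rho>_def
    using C(1) supp[OF that(2)] t0 by (intro sum.mono_neutral_cong_right) (auto simp: y_def)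
   finally show ?thesis .
  qed
  have cramer: "\<rho> b j t = (\<Sum>a<k. \<rho> b (xs ! a) t * Nt t $$ (a, j))" if "t \<in> \<Theta>" "b \<in> B" "j < ?N" for t b j
  proof -
   have b: "b < k" using that(2) B by auto
   have wt: "lminor (Ct t) xs \<noteq> 0" using that(1) by (simp add: \<Theta>_def w_def)
   have "Ct t $$ (b, j) = (\<Sum>a<k. Ct t $$ (b, xs ! a) * lminor (Ct t) (xs[a := j])) / lminor (Ct t) xs"
    using lminor_cramer[OF xs(1) wt b, of j] wt by (simp add: field_simps)
   also have "\<dots> = (\<Sum>a<k. \<rho> b (xs ! a) t * Nt t $$ (a, j))"
    unfolding sum_divide_distrib
    using \<rho>[OF that(1,2)] nth_less[OF xs(2,1)] that(3) by (intro sum.cong refl) (simp add: Nt_def norm_mat_def)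
   finally show ?thesis using \<rho>[OF that] by simp
  qed
  \<comment> \<open>At \<open>ts\<close> the rows in \<open>B\<close> of the block at
    \<open>xs\<close> are independent, so they contain an invertible square block with column
    positions \<open>J\<close>. Through \<open>cramer\<close> the normalized rows in
    \<open>J\<close> can then be solved for.\<close>
  have "\<exists>J\<subseteq>{..<k}. card J = card B \<and> (\<forall>z. (\<forall>b\<in>B. (\<Sum>a\<in>J. \<rho> b (xs ! a) ts * z a) = 0) \<longrightarrow> (\<forall>a\<in>J. z a = 0))"
  proof (rule independent_columns[OF finB finite_lessThan])
   fix z assume z: "\<forall>a\<in>{..<k}. (\<Sum>b\<in>B. \<rho> b (xs ! a) ts * z b) = 0"
   show "\<forall>b\<in>B. z b = 0"
   proof (rule ballI, rule ccontr)
    fix b assume b: "b \<in> B" "z b \<noteq> 0"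
    have "\<forall>c<k. (\<Sum>a<k. (if a \<in> B then z a else 0) * Ct ts $$ (a, xs ! c)) = 0"
    proof (intro allI impI)
     fix c assume c: "c < k"
     have "(\<Sum>a<k. (if a \<in> B then z a else 0) * Ct ts $$ (a, xs ! c)) = (\<Sum>b\<in>B. \<rho> b (xs ! c) ts * z b)"
      using B \<rho>[OF ts _ nth_less[OF xs(2,1) c]] by (intro sum.mono_neutral_cong_right) auto
     thus "(\<Sum>a<k. (if a \<in> B then z a else 0) * Ct ts $$ (a, xs ! c)) = 0" using z c by simp
    qed
    hence "lminor (Ct ts) xs = 0" unfolding lminor_zero_iff[OF xs(1)]
     using b B by (intro exI[of _ "\<lambda>a. if a \<in> B then z a else 0"] conjI exI[of _ b]) auto
    thus False using wts by simp
   qed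
  qed
  then obtain J where J: "J \<subseteq> {..<k}" "card J = card B"
   "\<forall>z. (\<forall>b\<in>B. (\<Sum>a\<in>J. \<rho> b (xs ! a) ts * z a) = 0) \<longrightarrow> (\<forall>a\<in>J. z a = 0)" by (elim exE conjE)
  have finJ: "finite J" using J(1) finite_subset by blast
  \<comment> \<open>The parameters that are kept: the scalings at \<open>C\<close> without
    \<open>c0\<close>, and the normalized rows outside \<open>J\<close> at the \<open>m\<close>
    columns outside \<open>xs\<close>.\<close>
  define G where "G = y ` (C - {c0}) \<union> (\<lambda>(a, j) t. Nt t $$ (a, j)) ` (({..<k} - J) \<times> Jf)"
  have finG: "finite G" using finC finJf by (simp add: G_def)
  have "card G \<le> card (y ` (C - {c0})) + card ((\<lambda>(a, j) t. Nt t $$ (a, j)) ` (({..<k} - J) \<times> Jf))"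
   unfolding G_def by (rule card_Un_le)
  also have "\<dots> \<le> card (C - {c0}) + card (({..<k} - J) \<times> Jf)"
   using finC finJf by (intro add_mono card_image_le) simp_all
  also have "\<dots> = ?d" using C(2) J finJ cJf by (simp add: card_cartesian_product card_Diff_subset)
  finally have cG: "card G < Suc ?d" by simp
  have yG: "y i \<in> fpolys G" if "i \<in> C" for i
  proof (cases "i = c0")
   case True
   hence "y i = (\<lambda>_. 1)" by (simp add: y_def fun_eq_iff)
   thus ?thesis by (simp add: fpolys.const)
  next
   case False
   thus ?thesis using that by (intro fpolys.gen) (simp add: G_def)
  qed
  have \<rho>G: "\<rho> b j \<in> fpolys G" for b j unfolding \<rho>_def by (intro fpolys_sum fpolys.mult fpolys.const yG)
  have NG: "(\<lambda>t. Nt t $$ (a, j)) \<in> fpolys G" if "a \<in> {..<k} - J" "j \<in> Jf" for a j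
  proof (rule fpolys.gen)
   have "(\<lambda>(a, j) t. Nt t $$ (a, j)) (a, j) \<in> G" unfolding G_def using that by blast
   thus "(\<lambda>t. Nt t $$ (a, j)) \<in> G" by simp
  qed
  \<comment> \<open>The identity \<open>cramer\<close> as a linear system for the rows in
    \<open>J\<close>, one decoupled block for each free column; the rows outside \<open>J\<close>
    have been moved to the right-hand side \<open>Rh\<close>.\<close>
  define L where "L = (\<lambda>(b :: nat, j :: nat) (a :: nat, j' :: nat) t. if j = j' then \<rho> b (xs ! a) t else 0)"
  define Rh where "Rh = (\<lambda>(b, j) t. \<rho> b j t - (\<Sum>a\<in>{..<k} - J. \<rho> b (xs ! a) t * Nt t $$ (a, j)))"
  have Lsum: "(\<Sum>i\<in>J \<times> Jf. L (b, j) i t * z i) = (\<Sum>a\<in>J. \<rho> b (xs ! a) t * z (a, j))" if "j \<in> Jf" for b j t z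
  proof -
   have "(\<Sum>i\<in>J \<times> Jf. L (b, j) i t * z i) = (\<Sum>a\<in>J. \<Sum>j'\<in>Jf. L (b, j) (a, j') t * z (a, j'))"
    by (simp add: sum.cartesian_product case_prod_beta)
   also have "\<dots> = (\<Sum>a\<in>J. \<Sum>j'\<in>Jf. if j = j' then \<rho> b (xs ! a) t * z (a, j) else 0)"
    by (intro sum.cong refl) (auto simp: L_def)
   also have "\<dots> = (\<Sum>a\<in>J. \<rho> b (xs ! a) t * z (a, j))" using finJf that by simp
   finally show ?thesis .
  qed
  have "\<exists>D\<in>fpolys G. \<exists>P. (\<forall>i. P i \<in> fpolys G) \<and> D ts \<noteq> 0 \<and>
   (\<forall>t z \<tau>. D t \<noteq> 0 \<longrightarrow> (\<forall>\<xi>\<in>B \<times> Jf. (\<Sum>i\<in>J \<times> Jf. L \<xi> i t * z i) = Rh \<xi> t * \<tau>) \<longrightarrow> (\<forall>i\<in>J \<times> Jf. D t * z i = P i t * \<tau>))"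
  proof (rule linear_system_elimination)
   show "finite (J \<times> Jf)" using finJ finJf by simp
   fix \<xi> i assume "\<xi> \<in> B \<times> Jf" "i \<in> J \<times> Jf"
   obtain b j a j' where e: "\<xi> = (b, j)" "i = (a, j')" by (cases \<xi>, cases i)
   show "L \<xi> i \<in> fpolys G" unfolding e L_def prod.case using \<rho>G fpolys.const by (cases "j = j'") simp_all
  next
   fix \<xi> assume "\<xi> \<in> B \<times> Jf"
   then obtain b j where e: "\<xi> = (b, j)" "j \<in> Jf" by (elim SigmaE)
   show "Rh \<xi> \<in> fpolys G" unfolding e(1) Rh_def prod.case by (intro fpolys_diff fpolys_sum fpolys.mult \<rho>G NG e(2))
  next
   fix z assume z: "\<forall>\<xi>\<in>B \<times> Jf. (\<Sum>i\<in>J \<times> Jf. L \<xi> i ts * z i) = 0"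
   show "\<forall>i\<in>J \<times> Jf. z i = 0"
   proof
    fix i assume "i \<in> J \<times> Jf"
    then obtain a j where i: "i = (a, j)" "a \<in> J" "j \<in> Jf" by (elim SigmaE)
    have "(\<Sum>a\<in>J. \<rho> b (xs ! a) ts * z (a, j)) = 0" if b: "b \<in> B" for b
     using bspec[OF z, of "(b, j)"] b i(3) Lsum[OF i(3)] by simp
    hence "\<forall>b\<in>B. (\<Sum>a\<in>J. \<rho> b (xs ! a) ts * z (a, j)) = 0" by (rule ballI)
    from J(3)[THEN spec, of "\<lambda>a. z (a, j)", THEN mp, OF this] show "z i = 0" unfolding i(1) using i(2) by (rule bspec)
   qed
  qed
  then obtain D P where D: "D \<in> fpolys G" "D ts \<noteq> 0" and P: "\<forall>i. P i \<in> fpolys G" and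
   DP: "\<forall>t z \<tau>. D t \<noteq> 0 \<longrightarrow> (\<forall>\<xi>\<in>B \<times> Jf. (\<Sum>i\<in>J \<times> Jf. L \<xi> i t * z i) = Rh \<xi> t * \<tau>) \<longrightarrow> (\<forall>i\<in>J \<times> Jf. D t * z i = P i t * \<tau>)"
   by (elim bexE exE conjE)
  have NtP: "Nt t $$ (a, j) * D t = P (a, j) t" if t: "t \<in> \<Theta>" "D t \<noteq> 0" and aj: "a \<in> J" "j \<in> Jf" for t a j
  proof -
   have "(\<Sum>i\<in>J \<times> Jf. L \<xi> i t * (case i of (a, j) \<Rightarrow> Nt t $$ (a, j))) = Rh \<xi> t * 1" if \<xi>: "\<xi> \<in> B \<times> Jf" for \<xi>
   proof -
    obtain b j where e: "\<xi> = (b, j)" "b \<in> B" "j \<in> Jf" using \<xi> by (elim SigmaE)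
    have jN: "j < ?N" using e(3) by (simp add: Jf_def)
    have "\<rho> b j t = (\<Sum>a\<in>{..<k} - J. \<rho> b (xs ! a) t * Nt t $$ (a, j)) + (\<Sum>a\<in>J. \<rho> b (xs ! a) t * Nt t $$ (a, j))"
     unfolding cramer[OF t(1) e(2) jN] by (rule sum.subset_diff[OF J(1) finite_lessThan])
    thus ?thesis unfolding e(1) Lsum[OF e(3)] by (simp add: Rh_def)
   qed
   hence "\<forall>\<xi>\<in>B \<times> Jf. (\<Sum>i\<in>J \<times> Jf. L \<xi> i t * (case i of (a, j) \<Rightarrow> Nt t $$ (a, j))) = Rh \<xi> t * 1" by (rule ballI)
   from DP[THEN spec, THEN spec, THEN spec, THEN mp, OF t(2), THEN mp, OF this, THEN bspec, of "(a, j)"]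
   show ?thesis using aj by (simp add: mult.commute)
  qed
  define \<Theta>' where "\<Theta>' = {t \<in> \<Theta>. D t \<noteq> 0}"
  have dep: "\<not> alg_indep (Suc ?d) (\<lambda>i t. g i (Nt t)) \<Theta>'"
  proof (rule not_alg_indep_matrix[OF finG cG D(1), where k = k and N = ?N])
   show "D t \<noteq> 0" if "t \<in> \<Theta>'" for t using that by (simp add: \<Theta>'_def)
   show "g i \<in> mat_polys k ?N" if "i < Suc ?d" for i using g that by simp
   fix a j assume aj: "a < k" "j < ?N"
   show "\<exists>P\<in>fpolys G. \<forall>t\<in>\<Theta>'. Nt t $$ (a, j) * D t = P t"
   proof (cases "j \<in> Jf")
    case True
    show ?thesis
    proof (cases "a \<in> J")
     case aJ: True
     show ?thesis
     proof (intro bexI[of _ "P (a, j)"] ballI)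
      show "P (a, j) \<in> fpolys G" using P by blast
      show "Nt t $$ (a, j) * D t = P (a, j) t" if "t \<in> \<Theta>'" for t using NtP[OF _ _ aJ True] that by (simp add: \<Theta>'_def)
     qed
    next
     case False
     show ?thesis
      by (intro bexI[of _ "\<lambda>t. Nt t $$ (a, j) * D t"] ballI refl fpolys.mult NG D(1)) (use aj False True in auto)
    qed
   next
    case False
    then obtain c where c: "c < k" "j = xs ! c" using aj(2) xs(1) by (auto simp: Jf_def in_set_conv_nth)
    show ?thesis
    proof (intro bexI[of _ "\<lambda>t. (if a = c then 1 else 0) * D t"] ballI)
     show "(\<lambda>t. (if a = c then 1 else 0) * D t) \<in> fpolys G" by (intro fpolys.mult fpolys.const D(1))
     fix t assume "t \<in> \<Theta>'"
     hence "lminor (Ct t) xs \<noteq> 0" by (simp add: \<Theta>'_def \<Theta>_def w_def)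
     thus "Nt t $$ (a, j) * D t = (if a = c then 1 else 0) * D t"
      unfolding Nt_def c(2) using norm_mat_identity[OF xs _ aj(1) c(1)] by simp
    qed
   qed
  qed
  from dep[unfolded not_alg_indep_iff] obtain D' c where c: "\<forall>t\<in>\<Theta>'. (\<Sum>\<nu>\<in>exps {..<Suc ?d} D'. c \<nu> * (\<Prod>i<Suc ?d. g i (Nt t) ^ \<nu> i)) = 0"
   "\<not> (\<forall>\<nu>\<in>exps {..<Suc ?d} D'. c \<nu> = 0)" by (elim exE conjE)
  define h where "h = (\<lambda>M. \<Sum>\<nu>\<in>exps {..<Suc ?d} D'. c \<nu> * (\<Prod>i<Suc ?d. g i M ^ \<nu> i))"
  have gp: "g i \<in> fpolys (mat_entries k ?N)" if "i < Suc ?d" for i using g that by (simp add: mat_polys_eq)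
  have h: "h \<in> mat_polys k ?N" unfolding h_def mat_polys_eq
   by (intro fpolys_sum fpolys.mult fpolys.const fpolys_prod fpolys_power gp) simp
  let ?X = "range (\<lambda>i (t :: nat \<Rightarrow> real). complex_of_real (t i))"
  have wX: "w \<in> fpolys ?X" unfolding w_def Ct_def by (rule scaled_entry_polys[OF A Z lminor_polys[OF xs(2,1)]])
  obtain e Ph where Ph: "Ph \<in> mat_polys k ?N" "\<forall>M\<in>{M. lminor M xs \<noteq> 0}. h (norm_mat k ?N xs M) * lminor M xs ^ e = Ph M"
   using norm_mat_rational[OF xs h] by (elim exE bexE)
  have PhX: "(\<lambda>t. Ph (Ct t)) \<in> fpolys ?X" unfolding Ct_def by (rule scaled_entry_polys[OF A Z Ph(1)])
  have hP: "h (Nt t) * w t ^ e = Ph (Ct t)" if "w t \<noteq> 0" for t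
   using Ph(2)[rule_format, of "Ct t"] that by (simp add: Nt_def w_def)
  have "\<exists>e. \<exists>P\<in>fpolys ?X. \<forall>t\<in>\<Theta>. D t * w t ^ e = P t"
  proof (rule fpolys_rational_compose[OF D(1) wX, where \<phi> = "\<lambda>t. t"])
   fix x assume "x \<in> G"
   then consider i where "x = y i" "i \<in> C - {c0}" | a j where "x = (\<lambda>t. Nt t $$ (a, j))" "a < k" "j < ?N"
    unfolding G_def Jf_def by auto
   thus "\<exists>P\<in>fpolys ?X. \<forall>t\<in>\<Theta>. x t * w t = P t"
   proof cases
    case 1
    have "y i = (\<lambda>t. complex_of_real (t i))" using 1(2) by (auto simp: y_def)
    hence "y i \<in> fpolys ?X" by (intro fpolys.gen) blast
    thus ?thesis unfolding 1(1) by (intro bexI[of _ "\<lambda>t. y i t * w t"] ballI refl fpolys.mult wX)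
   next
    case 2
    have l: "length (xs[a := j]) = k" "set (xs[a := j]) \<subseteq> {..<?N}"
     using xs 2(3) set_update_subset_insert[of xs a j] by auto
    show ?thesis
    proof (intro bexI[of _ "\<lambda>t. lminor (Ct t) (xs[a := j])"] ballI)
     show "(\<lambda>t. lminor (Ct t) (xs[a := j])) \<in> fpolys ?X"
      unfolding Ct_def by (rule scaled_entry_polys[OF A Z lminor_polys[OF l(2,1)]])
     fix t assume "t \<in> \<Theta>"
     thus "x t * w t = lminor (Ct t) (xs[a := j])"
      unfolding 2(1) Nt_def using 2(2,3) by (simp add: norm_mat_def w_def \<Theta>_def)
    qed
   qed
  qed
  then obtain e' PD where PD: "PD \<in> fpolys ?X" "\<forall>t\<in>\<Theta>. D t * w t ^ e' = PD t" by (elim exE bexE)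
  \<comment> \<open>The relation is known where \<open>D\<close> is nonzero. To reach an arbitrary
    \<open>t1\<close>, the segment from \<open>ts\<close> to \<open>t1\<close> is used: after
    multiplication by powers of \<open>w\<close> both \<open>D\<close> and the relation become
    polynomial in \<open>t\<close>, the first nonzero at \<open>ts\<close> and the second, by
    assumption, at \<open>t1\<close>, so both are nonzero at a common interior point.\<close>
  have zero: "h (Nt t1) = 0" if t1: "t1 \<in> \<Theta>" for t1
  proof (rule ccontr)
   assume nz: "h (Nt t1) \<noteq> 0"
   define \<gamma> where "\<gamma> = (\<lambda>s i. (1 - s) * ts i + s * t1 i)"
   have g01: "\<gamma> 0 = ts" "\<gamma> 1 = t1" by (simp_all add: \<gamma>_def fun_eq_iff)
   have wt: "w ts \<noteq> 0" "w t1 \<noteq> 0" using ts t1 by (simp_all add: \<Theta>_def)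
   have seg: "\<exists>p. \<forall>s. x (\<gamma> s) = poly p (complex_of_real s)" if x: "x \<in> ?X" for x
   proof -
    obtain i where "x = (\<lambda>t. complex_of_real (t i))" using x by (rule rangeE)
    thus ?thesis
     by (intro exI[of _ "[:complex_of_real (ts i), complex_of_real (t1 i - ts i):]"]) (simp add: \<gamma>_def algebra_simps)
   qed
   have n0: "PD (\<gamma> 0) * w (\<gamma> 0) \<noteq> 0" using PD(2)[rule_format, OF ts] D(2) wt unfolding g01 by auto
   have n1: "Ph (Ct (\<gamma> 1)) * w (\<gamma> 1) \<noteq> 0" using hP[OF wt(2)] nz wt unfolding g01 by auto
   have "\<exists>s>0. s < 1 \<and> PD (\<gamma> s) * w (\<gamma> s) \<noteq> 0 \<and> Ph (Ct (\<gamma> s)) * w (\<gamma> s) \<noteq> 0"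
    by (rule fpolys_segment_nonzero[where \<gamma> = \<gamma> and ?s1.0 = 1, OF fpolys.mult[OF PD(1) wX] fpolys.mult[OF PhX wX] _ n0 n1])
     (rule seg)
   then obtain s where s: "0 < s" "s < 1" "PD (\<gamma> s) * w (\<gamma> s) \<noteq> 0" "Ph (Ct (\<gamma> s)) * w (\<gamma> s) \<noteq> 0"
    by (elim exE conjE)
   have "\<gamma> s \<in> all_pos" unfolding \<gamma>_def by (rule all_pos_convex[OF _ _ s(1,2)]) (use ts t1 in \<open>simp_all add: \<Theta>_def\<close>)
   moreover have "\<gamma> s c0 = 1" using ts t1 by (simp add: \<gamma>_def \<Theta>_def)
   ultimately have gT: "\<gamma> s \<in> \<Theta>" using s(3) by (simp add: \<Theta>_def)
   hence "D (\<gamma> s) \<noteq> 0" using PD(2)[rule_format, OF gT] s(3) by auto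
   hence "\<gamma> s \<in> \<Theta>'" using gT by (simp add: \<Theta>'_def)
   hence "h (Nt (\<gamma> s)) = 0" using c(1) by (simp add: h_def)
   moreover have "w (\<gamma> s) \<noteq> 0" using s(3) by auto
   ultimately show False using hP[of "\<gamma> s"] s(4) by simp
  qed
  show ?thesis unfolding not_alg_indep_iff
   using c(2) zero[unfolded h_def] by (intro exI[of _ D'] exI[of _ c] conjI ballI)
 qed
 from this[unfolded not_alg_indep_iff] obtain D' c where c: "\<forall>t\<in>\<Theta>. (\<Sum>\<nu>\<in>exps {..<Suc ?d} D'. c \<nu> * (\<Prod>i<Suc ?d. g i (Nt t) ^ \<nu> i)) = 0"
  "\<not> (\<forall>\<nu>\<in>exps {..<Suc ?d} D'. c \<nu> = 0)" by (elim exE conjE)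
 have param: "\<exists>t\<in>\<Theta>. chart_mat k ?N xs V = Nt t" if V: "V \<in> pos_orbit ?N A Z all_pos \<inter> chart k ?N xs" for V
 proof -
  from pos_orbit_cases[OF IntD1[OF V]] obtain t where t: "V = row_span ?N (Ct t)" "t \<in> all_pos" "indep_rows k ?N (Ct t)"
   unfolding Ct_def dA .
  define t' where "t' = (\<lambda>i. t i / t c0)"
  have t0: "t c0 > 0" using t(2) by simp
  have "row_span n (scale A (\<lambda>i. of_real (t' i))) = row_span n (scale A (cx t))"
   using t0 by (intro row_span_scale[OF A, of "of_real (1 / t c0)"]) (auto simp: t'_def)
  hence e: "row_span ?N (Ct t') = row_span ?N (Ct t)"
   unfolding Ct_def by (simp only: amp_map_row_span[OF scale_carrier[OF A] Z, symmetric])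
  have i': "indep_rows k ?N (Ct t')" by (rule indep_rows_row_span[OF Ctc t(3) Ctc e[symmetric]])
  hence mr: "Ct t' \<in> mats_of_rank k ?N k" using Ctc mats_of_rank_iff by blast
  have nz: "lminor (Ct t') xs \<noteq> 0" using row_span_in_chart_iff[OF mr xs] IntD2[OF V] e t(1) by simp
  have "t' \<in> \<Theta>" using t(2) less_imp_neq[OF t0] nz by (simp add: \<Theta>_def t'_def w_def)
  moreover have "chart_mat k ?N xs V = Nt t'" unfolding Nt_def t(1) e[symmetric] by (rule chart_mat_row_span[OF mr xs nz])
  ultimately show ?thesis by (intro bexI)
 qed
 show "\<not> alg_indep (Suc ?d) (\<lambda>i V. g i (chart_mat k ?N xs V)) (pos_orbit ?N A Z all_pos \<inter> chart k ?N xs)"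
  unfolding not_alg_indep_iff
 proof (intro exI[of _ D'] exI[of _ c] conjI ballI)
  show "\<not> (\<forall>\<nu>\<in>exps {..<Suc ?d} D'. c \<nu> = 0)" by (rule c(2))
  fix V assume V: "V \<in> pos_orbit ?N A Z all_pos \<inter> chart k ?N xs"
  obtain t where "t \<in> \<Theta>" "chart_mat k ?N xs V = Nt t" using param[OF V] by (elim bexE)
  thus "(\<Sum>\<nu>\<in>exps {..<Suc ?d} D'. c \<nu> * (\<Prod>i<Suc ?d. g i (chart_mat k ?N xs V) ^ \<nu> i)) = 0"
   using bspec[OF c(1)] by simp
 qed
qed

text \<open>The case of \<open>deficient_dim_le\<close> in which \<open>C\<close> and
  \<open>B\<close> comprise all columns and all rows: the support condition is vacuous, the second
  summand vanishes, and \<open>n - 1\<close> is left.\<close>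

lemma pos_orbit_dim_le:
 assumes A: "A \<in> carrier_mat k n" "indep_rows k n A" and n: "0 < n"
 shows "gr_dim k n (pos_orbit n A (1\<^sub>m n) all_pos) \<le> enat (n - 1)"
proof -
 obtain xs where xs: "length xs = k" "distinct xs" "set xs \<subseteq> {..<n}" using indep_rows_lminor[OF A(2)] by (elim exE conjE)
 have "k \<le> n" using card_mono[OF finite_lessThan xs(3)] distinct_card[OF xs(2)] xs(1) by simp
 hence kn: "k + (n - k) = n" by simp
 have "gr_dim k (k + (n - k)) (pos_orbit (k + (n - k)) A (1\<^sub>m n) all_pos) \<le> enat (card {..<n} - 1 + (k - card {..<k}) * (n - k))"
  by (rule deficient_dim_le[OF A(1), where ?c0.0 = 0]) (use n kn in simp_all)
 thus ?thesis unfolding kn by simp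
qed

section \<open>Rooted trees\<close>

lemma reachable_refl: "u \<in> reachable E u"
 by (simp add: reachable_def)

lemma reachable_step: "v \<in> reachable E u \<Longrightarrow> {v, w} \<in> E \<Longrightarrow> w \<in> reachable E u"
 unfolding reachable_def by (auto intro: rtrancl_into_rtrancl)

lemma reachable_sym: "v \<in> reachable E u \<longleftrightarrow> u \<in> reachable E v"
proof -
 have "sym {(a, b). {a, b} \<in> E}" by (auto simp: sym_def insert_commute)
 thus ?thesis unfolding reachable_def by (metis mem_Collect_eq sym_rtrancl symD)
qed

lemma reachable_trans: "v \<in> reachable E u \<Longrightarrow> w \<in> reachable E v \<Longrightarrow> w \<in> reachable E u"
 unfolding reachable_def by auto

lemma reachable_induct [consumes 1, case_names refl step]:
 assumes "v \<in> reachable E u" "P u"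
  and "\<And>v w. v \<in> reachable E u \<Longrightarrow> P v \<Longrightarrow> {v, w} \<in> E \<Longrightarrow> P w"
 shows "P v"
proof -
 have "(u, v) \<in> {(a, b). {a, b} \<in> E}\<^sup>*" using assms(1) by (simp add: reachable_def)
 thus ?thesis
 proof (induction rule: rtrancl_induct)
  case base
  show ?case by (rule assms(2))
 next
  case (step y z)
  show ?case
  proof (rule assms(3)[of y z])
   show "y \<in> reachable E u" using step(1) by (simp add: reachable_def)
   show "P y" by (rule step(3))
   show "{y, z} \<in> E" using step(2) by simp
  qed
 qed
qed

definition walk :: "'v set set \<Rightarrow> 'v list \<Rightarrow> bool" where
 "walk E p \<longleftrightarrow> (\<forall>i. Suc i < length p \<longrightarrow> {p ! i, p ! Suc i} \<in> E)"

lemma shortest_walk: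
 assumes "v \<in> reachable E u"
 obtains p where "p \<noteq> []" "hd p = u" "last p = v" "walk E p" "distinct p"
proof -
 let ?R = "\<lambda>a b. {a, b} \<in> E"
 have "?R\<^sup>*\<^sup>* u v" using assms by (simp add: reachable_def Enum.rtranclp_rtrancl_eq)
 then obtain xs where "rtrancl_path ?R u xs v" unfolding rtranclp_eq_rtrancl_path ..
 then obtain ys where ys: "rtrancl_path ?R u ys v" "distinct (u # ys)" by (rule rtrancl_path_distinct)
 have "walk E (u # ys)" unfolding walk_def using rtrancl_path_nth[OF ys(1)] by simp
 moreover have "last (u # ys) = v"
 proof (cases "ys = []")
  case True
  thus ?thesis using ys(1) by (auto elim: rtrancl_path.cases)
 next
  case False
  thus ?thesis using rtrancl_path_last[OF ys(1)] by simp
 qed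
 ultimately show thesis using that[of "u # ys"] ys(2) by simp
qed

text \<open>A simple path from \<open>u\<close> to \<open>v\<close> that avoids the edge has at
  least three vertices, and the edge closes it up to a cycle.\<close>

lemma tree_edge_separates:
 assumes tree: "is_tree G" and e: "{u, v} \<in> edges G"
 shows "v \<notin> reachable (edges G - {{u, v}}) u"
proof
 assume "v \<in> reachable (edges G - {{u, v}}) u"
 then obtain p where p: "p \<noteq> []" "hd p = u" "last p = v" "walk (edges G - {{u, v}}) p" "distinct p"
  by (rule shortest_walk)
 have uv: "u \<noteq> v"
 proof
  assume "u = v"
  hence "card {u, v} = 1" by simp
  thus False using tree e unfolding is_tree_def by (metis numeral_eq_one_iff semiring_norm(85))
 qed
 have p0: "p ! 0 = u" "p ! (length p - 1) = v" using p by (auto simp: hd_conv_nth last_conv_nth)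
 have "length p \<noteq> 0" "length p \<noteq> 1" using p p0 uv by auto
 moreover have "length p \<noteq> 2"
 proof
  assume l: "length p = 2"
  hence "{p ! 0, p ! 1} \<in> edges G - {{u, v}}" using p(4) by (simp add: walk_def)
  thus False using p0 l by simp
 qed
 ultimately have len: "3 \<le> length p" by linarith
 have "is_cycle (edges G) p" unfolding is_cycle_def
 proof (intro conjI allI impI)
  fix i assume i: "i < length p"
  show "{p ! i, p ! (Suc i mod length p)} \<in> edges G"
  proof (cases "Suc i < length p")
   case True
   thus ?thesis using p(4) by (simp add: walk_def)
  next
   case False
   hence "i = length p - 1" "Suc i = length p" using i by auto
   thus ?thesis using p0 e by (simp add: insert_commute)
  qed
 qed (use len p in auto)
 thus False using tree unfolding is_tree_def by blast
qed

text \<open>Trees by parent pointers: the depth gives recursion from the root downwards and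
  induction in both directions. The notion agrees with \<open>is_tree\<close>, for every choice of
  the root.\<close>

locale rooted =
 fixes G :: "'v plabic" and r :: 'v and par :: "'v \<Rightarrow> 'v" and dep :: "'v \<Rightarrow> nat"
 assumes fin: "finite (verts G)" and rV: "r \<in> verts G"
  and edges_eq: "edges G = {{x, par x} | x. x \<in> verts G - {r}}"
  and par_in: "x \<in> verts G - {r} \<Longrightarrow> par x \<in> verts G"
  and dep_par: "x \<in> verts G - {r} \<Longrightarrow> dep x = Suc (dep (par x))"
  and dep_r: "dep r = 0"

text \<open>\<open>dep\<close> is the distance from the root and \<open>par\<close> a neighbour one
  step closer. Acyclicity is what makes \<open>par x\<close> the only neighbour that is not farther
  away: a second one, \<open>y\<close>, would be connected to \<open>par x\<close> through the root
  without the edge between \<open>x\<close> and \<open>y\<close>, contradicting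
  \<open>tree_edge_separates\<close>.\<close>

lemma tree_rooted:
 assumes tree: "is_tree G" and r: "r \<in> verts G"
 shows "\<exists>par dep. rooted G r par dep"
proof -
 let ?E = "edges G"
 let ?R = "{(a, b). {a, b} \<in> ?E}"
 define W where "W = (\<lambda>x n. (r, x) \<in> ?R ^^ n)"
 have sub: "e \<subseteq> verts G" "card e = 2" if "e \<in> ?E" for e using tree that unfolding is_tree_def by auto
 have exW: "\<exists>n. W x n" if x: "x \<in> verts G" for x
 proof -
  have "x \<in> reachable ?E r" using tree r x unfolding is_tree_def by blast
  thus ?thesis unfolding W_def reachable_def by (auto dest: rtrancl_imp_relpow)
 qed
 define dep where "dep = (\<lambda>x. LEAST n. W x n)"
 have depW: "W x (dep x)" if "x \<in> verts G" for x using LeastI_ex[OF exW[OF that]] by (simp add: dep_def)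
 have dep_le: "dep x \<le> n" if "W x n" for x n using that by (simp add: dep_def Least_le)
 have W0: "W x 0 \<longleftrightarrow> x = r" for x by (auto simp: W_def)
 have WS: "W y (Suc n)" if "W x n" "{x, y} \<in> ?E" for x y n
  using that unfolding W_def by (auto intro: relpow_Suc_I)
 have WP: "\<exists>y. {y, x} \<in> ?E \<and> W y n" if "W x (Suc n)" for x n
  using that unfolding W_def by (auto elim: relpow_Suc_E)
 have par_ex: "\<exists>y. {x, y} \<in> ?E \<and> dep x = Suc (dep y)" if x: "x \<in> verts G - {r}" for x
 proof -
  have "dep x \<noteq> 0"
  proof
   assume "dep x = 0"
   thus False using depW[of x] W0[of x] x by simp
  qed
  then obtain n where n: "dep x = Suc n" using not0_implies_Suc by blast
  then obtain y where y: "{y, x} \<in> ?E" "W y n" using WP[of x n] depW[of x] x by auto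
  have "y \<in> verts G" using sub(1)[OF y(1)] by simp
  have "dep y = n"
  proof (rule antisym)
   show "dep y \<le> n" by (rule dep_le[OF y(2)])
   have "dep x \<le> Suc (dep y)" by (rule dep_le[OF WS[OF depW[OF \<open>y \<in> verts G\<close>] y(1)]])
   thus "n \<le> dep y" using n by simp
  qed
  thus ?thesis using n y(1) by (auto simp: insert_commute)
 qed
 define par where "par = (\<lambda>x. SOME y. {x, y} \<in> ?E \<and> dep x = Suc (dep y))"
 have par: "{x, par x} \<in> ?E" "dep x = Suc (dep (par x))" if "x \<in> verts G - {r}" for x
  using someI_ex[OF par_ex[OF that]] unfolding par_def by auto
 have toroot: "r \<in> reachable (?E - {{x, y}}) z"
  if "z \<in> verts G" "dep z \<le> dep x" "z \<noteq> x" "x \<in> verts G" for x y z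
  using that
 proof (induction "dep z" arbitrary: z)
  case 0
  hence "z = r" using depW[of z] W0 by simp
  thus ?case by (simp add: reachable_refl)
 next
  case (Suc n)
  hence "z \<noteq> r" using dep_le[of r 0] W0 by auto
  hence z: "z \<in> verts G - {r}" using Suc by simp
  have pz: "par z \<in> verts G" using sub(1)[OF par(1)[OF z]] by simp
  have "par z \<noteq> x" using par(2)[OF z] Suc by auto
  hence "r \<in> reachable (?E - {{x, y}}) (par z)" using par(2)[OF z] Suc pz by (intro Suc) auto
  moreover have "{z, par z} \<noteq> {x, y}" using Suc(5) \<open>par z \<noteq> x\<close> by (auto simp: doubleton_eq_iff)
  hence "par z \<in> reachable (?E - {{x, y}}) z" using par(1)[OF z] by (intro reachable_step[OF reachable_refl]) auto
  ultimately show ?case by (rule reachable_trans[rotated])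
 qed
 have par_unique: "y = par x" if e: "{x, y} \<in> ?E" "dep y \<le> dep x" for x y
 proof (rule ccontr)
  assume ne: "y \<noteq> par x"
  have xy: "x \<in> verts G" "y \<in> verts G" "x \<noteq> y" using sub[OF e(1)] by (auto simp: card_insert_if split: if_splits)
  have "x \<noteq> r"
  proof
   assume "x = r"
   hence "dep y = 0" using e(2) dep_le[of r 0] W0 by simp
   thus False using depW[OF xy(2)] W0 xy(3) \<open>x = r\<close> by simp
  qed
  hence x: "x \<in> verts G - {r}" using xy by simp
  have px: "par x \<in> verts G" "par x \<noteq> x" using sub(1)[OF par(1)[OF x]] par(2)[OF x] by auto
  have "r \<in> reachable (?E - {{x, y}}) y" using xy e(2) by (intro toroot) auto
  moreover have "r \<in> reachable (?E - {{x, y}}) (par x)" using px xy par(2)[OF x] by (intro toroot) auto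
  moreover have "par x \<in> reachable (?E - {{x, y}}) x"
   using par(1)[OF x] ne by (intro reachable_step[OF reachable_refl]) (auto simp: doubleton_eq_iff)
  ultimately have "y \<in> reachable (?E - {{x, y}}) x" using reachable_trans reachable_sym by metis
  thus False using tree_edge_separates[OF tree e(1)] by blast
 qed
 have "?E = {{x, par x} | x. x \<in> verts G - {r}}"
 proof
  show "{{x, par x} | x. x \<in> verts G - {r}} \<subseteq> ?E" using par(1) by auto
  show "?E \<subseteq> {{x, par x} | x. x \<in> verts G - {r}}"
  proof
   fix e assume e: "e \<in> ?E"
   then obtain a b where ab: "e = {a, b}" "a \<noteq> b" using sub(2)[OF e] by (auto simp: card_2_iff)
   define x y where "x = (if dep b \<le> dep a then a else b)" and "y = (if dep b \<le> dep a then b else a)"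
   have xy: "e = {x, y}" "dep y \<le> dep x" "x \<noteq> y" using ab by (auto simp: x_def y_def)
   have yp: "y = par x" using par_unique xy e by blast
   have "x \<in> verts G" using sub(1)[OF e] xy by simp
   moreover have "x \<noteq> r"
   proof
    assume "x = r"
    hence "dep y = 0" using xy(2) dep_le[of r 0] W0 by simp
    moreover have "y \<in> verts G" using sub(1)[OF e] xy by simp
    ultimately show False using depW[of y] W0 xy(3) \<open>x = r\<close> by simp
   qed
   ultimately show "e \<in> {{x, par x} | x. x \<in> verts G - {r}}" using xy(1) yp by blast
  qed
 qed
 moreover have "finite (verts G)" using tree unfolding is_tree_def by blast
 moreover have "par x \<in> verts G" if "x \<in> verts G - {r}" for x using sub(1)[OF par(1)[OF that]] by simp
 moreover have "dep r = 0" using dep_le[of r 0] W0 by simp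
 ultimately have "rooted G r par dep" using r par(2) by unfold_locales auto
 thus ?thesis by blast
qed

section \<open>Descendants and the two sides of an edge\<close>

context rooted
begin

definition ch :: "'v \<Rightarrow> 'v set" where
 "ch v = {c \<in> verts G - {r}. par c = v}"

text \<open>The difference of the depths dictates how often \<open>par\<close> has to be applied, so
  no transitive closure is needed.\<close>

definition desc :: "'v \<Rightarrow> 'v set" where
 "desc x = {y \<in> verts G. dep x \<le> dep y \<and> (par ^^ (dep y - dep x)) y = x}"

lemma finite_ch [simp]: "finite (ch v)"
 using fin by (simp add: ch_def)

lemma finite_desc [simp]: "finite (desc x)"
 using fin by (simp add: desc_def)

lemma chD: "c \<in> ch v \<Longrightarrow> c \<in> verts G \<and> c \<noteq> r \<and> par c = v \<and> dep c = Suc (dep v)"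
 using dep_par by (auto simp: ch_def)

lemma par_neq: "x \<in> verts G - {r} \<Longrightarrow> par x \<noteq> x"
 using dep_par by fastforce

lemma dep_0_iff: "x \<in> verts G \<Longrightarrow> dep x = 0 \<longleftrightarrow> x = r"
 using dep_par[of x] dep_r by (cases "x = r") auto

lemma desc_refl: "x \<in> verts G \<Longrightarrow> x \<in> desc x"
 by (simp add: desc_def)

lemma desc_sub: "desc x \<subseteq> verts G"
 by (auto simp: desc_def)

lemma up:
 "y \<in> verts G \<Longrightarrow> j \<le> dep y \<Longrightarrow> (par ^^ j) y \<in> verts G \<and> dep ((par ^^ j) y) = dep y - j"
proof (induction j)
 case (Suc j)
 hence IH: "(par ^^ j) y \<in> verts G" "dep ((par ^^ j) y) = dep y - j" by auto
 hence "(par ^^ j) y \<noteq> r" using Suc dep_r by auto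
 hence "(par ^^ j) y \<in> verts G - {r}" using IH by simp
 thus ?case using par_in dep_par[of "(par ^^ j) y"] IH Suc by auto
qed auto

lemma desc_root: "desc r = verts G"
proof -
 have "(par ^^ dep y) y = r" if "y \<in> verts G" for y
  using up[OF that, of "dep y"] dep_0_iff[of "(par ^^ dep y) y"] by simp
 thus ?thesis by (auto simp: desc_def dep_r)
qed

lemma desc_dep: "y \<in> desc x \<Longrightarrow> dep x \<le> dep y"
 by (simp add: desc_def)

lemma desc_same_dep: "y \<in> desc x \<Longrightarrow> y \<in> desc x' \<Longrightarrow> dep x = dep x' \<Longrightarrow> x = x'"
 by (auto simp: desc_def)

lemma desc_par: "y \<in> desc x \<Longrightarrow> y \<noteq> x \<Longrightarrow> y \<in> verts G - {r} \<and> par y \<in> desc x \<and> dep x < dep y"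
proof -
 assume y: "y \<in> desc x" "y \<noteq> x"
 hence yV: "y \<in> verts G" and le: "dep x \<le> dep y" and up: "(par ^^ (dep y - dep x)) y = x"
  by (auto simp: desc_def)
 have lt: "dep x < dep y" using le up y(2) by (cases "dep x = dep y") auto
 hence yr: "y \<in> verts G - {r}" using yV dep_r by auto
 have "dep y - dep x = Suc (dep (par y) - dep x)" using dep_par[OF yr] lt by simp
 hence "(par ^^ (dep (par y) - dep x)) (par y) = x" using up by (simp add: funpow_swap1)
 hence "par y \<in> desc x" using par_in[OF yr] dep_par[OF yr] lt by (simp add: desc_def)
 thus ?thesis using yr lt by simp
qed

lemma desc_step: "y \<in> verts G - {r} \<Longrightarrow> par y \<in> desc x \<Longrightarrow> y \<in> desc x"
proof -
 assume y: "y \<in> verts G - {r}" "par y \<in> desc x"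
 hence "dep y - dep x = Suc (dep (par y) - dep x)" "dep x \<le> dep y" using dep_par[OF y(1)] by (auto simp: desc_def)
 thus ?thesis using y by (simp add: desc_def funpow_swap1)
qed

lemma desc_trans: "y \<in> desc x \<Longrightarrow> z \<in> desc y \<Longrightarrow> z \<in> desc x"
proof (induction "dep z" arbitrary: z rule: less_induct)
 case less
 show ?case
 proof (cases "z = y")
  case False
  hence "z \<in> verts G - {r}" "par z \<in> desc y" using desc_par[OF less(3)] by auto
  thus ?thesis using less(1)[of "par z"] dep_par[of z] less(2) desc_step by auto
 qed (use less in simp)
qed

lemma desc_child: "c \<in> ch x \<Longrightarrow> x \<in> verts G \<Longrightarrow> desc c \<subseteq> desc x"
 using desc_trans[of c x] desc_step[of c x] desc_refl[of x] chD by blast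

lemma desc_unfold: "x \<in> verts G \<Longrightarrow> desc x = insert x (\<Union>c\<in>ch x. desc c)"
proof
 assume x: "x \<in> verts G"
 show "insert x (\<Union>c\<in>ch x. desc c) \<subseteq> desc x" using x desc_refl desc_child by blast
 show "desc x \<subseteq> insert x (\<Union>c\<in>ch x. desc c)"
 proof
  fix y assume "y \<in> desc x"
  thus "y \<in> insert x (\<Union>c\<in>ch x. desc c)"
  proof (induction "dep y" arbitrary: y rule: less_induct)
   case less
   show ?case
   proof (cases "y = x")
    case False
    hence y: "y \<in> verts G - {r}" "par y \<in> desc x" using desc_par[OF less(2)] by auto
    hence "par y \<in> insert x (\<Union>c\<in>ch x. desc c)" using less(1)[of "par y"] dep_par[OF y(1)] by auto
    thus ?thesis using y desc_step[OF y(1)] desc_refl[of y] by (auto simp: ch_def)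
   qed simp
  qed
 qed
qed

lemma not_desc_child: "c \<in> ch x \<Longrightarrow> x \<notin> desc c"
 using chD[of c x] desc_dep[of x c] by auto

lemma desc_disjoint: "c \<in> ch x \<Longrightarrow> c' \<in> ch x \<Longrightarrow> c \<noteq> c' \<Longrightarrow> desc c \<inter> desc c' = {}"
 using chD desc_same_dep by fastforce

lemma root_not_desc: "x \<in> verts G - {r} \<Longrightarrow> r \<notin> desc x"
 using dep_par[of x] dep_r desc_dep[of r x] by auto

lemma tree_induct [consumes 1, case_names step]:
 assumes "x \<in> verts G" and step: "\<And>x. x \<in> verts G \<Longrightarrow> (\<And>c. c \<in> ch x \<Longrightarrow> P c) \<Longrightarrow> P x"
 shows "P x"
 using assms(1)
proof (induction "card (desc x)" arbitrary: x rule: less_induct)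
 case less
 show ?case
 proof (rule step[OF less(2)])
  fix c assume c: "c \<in> ch x"
  have "desc c \<subset> desc x" using desc_child[OF c less(2)] not_desc_child[OF c] desc_refl[OF less(2)] by blast
  thus "P c" using less(1)[of c] chD[OF c] by (simp add: psubset_card_mono)
 qed
qed

text \<open>Values may be prescribed from the root downwards, since \<open>dep x\<close> unfoldings
  reach the root. The vertex \<open>x\<close> is an argument of \<open>F\<close>, so siblings may
  receive different values.\<close>

lemma recursion: "\<exists>s. s r = s0 \<and> (\<forall>x\<in>verts G - {r}. s x = F x (s (par x)))"
proof -
 define val where "val = rec_nat (\<lambda>x. s0) (\<lambda>n f x. F x (f (par x)))"
 have val: "val 0 x = s0" "val (Suc n) x = F x (val n (par x))" for n x by (simp_all add: val_def)
 show ?thesis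
  by (rule exI[of _ "\<lambda>x. val (dep x) x"]) (simp add: dep_r val dep_par)
qed

lemma edge_iff: "{x, y} \<in> edges G \<longleftrightarrow> x \<in> ch y \<or> y \<in> ch x"
 by (auto simp: edges_eq ch_def doubleton_eq_iff)

lemma nbrs_eq: "x \<in> verts G \<Longrightarrow> nbrs G x = (if x = r then ch x else insert (par x) (ch x))"
 using par_in by (auto simp: nbrs_def edge_iff) (auto simp: ch_def)

lemma degree_eq: "x \<in> verts G \<Longrightarrow> degree G x = card (ch x) + (if x = r then 0 else 1)"
proof -
 assume x: "x \<in> verts G"
 have "par x \<notin> ch x" if "x \<noteq> r" using chD[of "par x" x] dep_par[of x] x that by auto
 thus ?thesis by (simp add: degree_def nbrs_eq[OF x])
qed

text \<open>Links the rooting to the definition of half trees, whose sides are given by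
  reachability; \<open>reachable_par\<close> treats the other side.\<close>

lemma reachable_desc:
 assumes x: "x \<in> verts G - {r}"
 shows "reachable (edges G - {{x, par x}}) x = desc x"
proof
 show "reachable (edges G - {{x, par x}}) x \<subseteq> desc x"
 proof
  fix y assume "y \<in> reachable (edges G - {{x, par x}}) x"
  thus "y \<in> desc x"
  proof (induction rule: reachable_induct)
   case refl thus ?case using x desc_refl by simp
  next
   case (step v w)
   then consider "v \<in> ch w" | "w \<in> ch v" using edge_iff by blast
   thus ?case
   proof cases
    case 1
    hence "par v = w" "v \<noteq> x" using step chD by auto
    thus ?thesis using desc_par[OF step(3)] by simp
   next
    case 2
    thus ?thesis using desc_step[of w x] chD[OF 2] step(3) by simp
   qed
  qed
 qed
 show "desc x \<subseteq> reachable (edges G - {{x, par x}}) x"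
 proof
  fix y assume "y \<in> desc x"
  thus "y \<in> reachable (edges G - {{x, par x}}) x"
  proof (induction "dep y" arbitrary: y rule: less_induct)
   case less
   show ?case
   proof (cases "y = x")
    case False
    hence y: "y \<in> verts G - {r}" "par y \<in> desc x" "dep x < dep y" using desc_par[OF less(2)] by auto
    hence r: "par y \<in> reachable (edges G - {{x, par x}}) x" using less(1)[of "par y"] dep_par[OF y(1)] by simp
    have "y \<in> ch (par y)" using y(1) by (simp add: ch_def)
    hence "{par y, y} \<in> edges G" unfolding edge_iff by simp
    moreover have "{par y, y} \<noteq> {x, par x}" using False y(3) dep_par[OF x] by (auto simp: doubleton_eq_iff)
    ultimately have "{par y, y} \<in> edges G - {{x, par x}}" by simp
    thus ?thesis by (rule reachable_step[OF r])
   qed (simp add: reachable_refl)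
  qed
 qed
qed

lemma reachable_par:
 assumes x: "x \<in> verts G - {r}"
 shows "reachable (edges G - {{x, par x}}) (par x) = verts G - desc x"
proof
 show "reachable (edges G - {{x, par x}}) (par x) \<subseteq> verts G - desc x"
 proof
  fix y assume "y \<in> reachable (edges G - {{x, par x}}) (par x)"
  thus "y \<in> verts G - desc x"
  proof (induction rule: reachable_induct)
   case refl thus ?case using x par_in[OF x] dep_par[OF x] desc_dep[of "par x" x] by auto
  next
   case (step v w)
   then consider "v \<in> ch w" | "w \<in> ch v" using edge_iff by blast
   thus ?case
   proof cases
    case 1
    thus ?thesis using step desc_step[of v x] chD[OF 1] par_in[of v] by auto
   next
    case 2
    hence "w \<noteq> x" using step chD by (auto simp: insert_commute)
    thus ?thesis using step chD[OF 2] desc_par[of w x] by auto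
   qed
  qed
 qed
 show "verts G - desc x \<subseteq> reachable (edges G - {{x, par x}}) (par x)"
 proof
  have up: "r \<in> reachable (edges G - {{x, par x}}) y" if "y \<in> verts G - desc x" for y
   using that
  proof (induction "dep y" arbitrary: y rule: less_induct)
   case less
   show ?case
   proof (cases "y = r")
    case False
    hence y: "y \<in> verts G - {r}" using less(2) by simp
    have "par y \<notin> desc x" using desc_step[OF y] less(2) by blast
    hence ry: "r \<in> reachable (edges G - {{x, par x}}) (par y)"
     using less(1)[of "par y"] dep_par[OF y] par_in[OF y] by simp
    have "{y, par y} \<in> edges G" using y edges_eq by auto
    moreover have "y \<noteq> x" "par y \<noteq> x" using less(2) \<open>par y \<notin> desc x\<close> x desc_refl[of x] by auto
    hence "{y, par y} \<noteq> {x, par x}" by (auto simp: doubleton_eq_iff)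
    ultimately have "{y, par y} \<in> edges G - {{x, par x}}" by simp
    hence "par y \<in> reachable (edges G - {{x, par x}}) y"
     by (rule reachable_step[OF reachable_refl])
    thus ?thesis using ry by (rule reachable_trans)
   qed (simp add: reachable_refl)
  qed
  fix y assume "y \<in> verts G - desc x"
  hence "r \<in> reachable (edges G - {{x, par x}}) y" by (rule up)
  moreover have "par x \<in> verts G - desc x" using x par_in[OF x] dep_par[OF x] desc_dep[of "par x" x] by auto
  hence "r \<in> reachable (edges G - {{x, par x}}) (par x)" by (rule up)
  ultimately show "y \<in> reachable (edges G - {{x, par x}}) (par x)" using reachable_sym reachable_trans by metis
 qed
qed

text \<open>A cycle has a vertex of maximal depth, and both of its neighbours on the cycle would
  have to be its parent.\<close>

lemma rooted_is_tree: "is_tree G"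
 unfolding is_tree_def
proof (intro conjI ballI notI)
 show "finite (verts G)" by (rule fin)
 show "verts G = {} \<Longrightarrow> False" using rV by simp
 fix e assume "e \<in> edges G"
 then obtain x where x: "x \<in> verts G - {r}" "e = {x, par x}" using edges_eq by auto
 thus "e \<subseteq> verts G" "card e = 2" using par_in[OF x(1)] par_neq[OF x(1)] by auto
next
 have up: "r \<in> reachable (edges G) y" if "y \<in> verts G" for y
  using that
 proof (induction "dep y" arbitrary: y rule: less_induct)
  case less
  show ?case
  proof (cases "y = r")
   case False
   hence y: "y \<in> verts G - {r}" using less(2) by simp
   hence "r \<in> reachable (edges G) (par y)" using less(1)[of "par y"] dep_par[OF y] par_in[OF y] by simp
   moreover have "{y, par y} \<in> edges G" using y edges_eq by auto
   ultimately show ?thesis using reachable_trans[OF reachable_step[OF reachable_refl]] by metis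
  qed (simp add: reachable_refl)
 qed
 fix u v assume "u \<in> verts G" "v \<in> verts G"
 thus "v \<in> reachable (edges G) u" using up reachable_sym reachable_trans by metis
next
 assume "\<exists>vs. is_cycle (edges G) vs"
 then obtain vs where vs: "is_cycle (edges G) vs" by blast
 define n where "n = length vs"
 have n: "3 \<le> n" "distinct vs" and e: "\<And>i. i < n \<Longrightarrow> {vs ! i, vs ! (Suc i mod n)} \<in> edges G"
  using vs unfolding is_cycle_def n_def by auto
 obtain i where i: "i < n" "\<And>j. j < n \<Longrightarrow> dep (vs ! j) \<le> dep (vs ! i)"
 proof -
  have "finite ((\<lambda>j. dep (vs ! j)) ` {..<n})" "(\<lambda>j. dep (vs ! j)) ` {..<n} \<noteq> {}" using n by (auto simp: lessThan_empty_iff)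
  from Max_in[OF this] obtain i where "i < n" "dep (vs ! i) = Max ((\<lambda>j. dep (vs ! j)) ` {..<n})" by auto
  thus thesis by (intro that[of i]) auto
 qed
 define j where "j = Suc i mod n"
 define l where "l = (i + n - 1) mod n"
 have jl: "j < n" "l < n" using n by (auto simp: j_def l_def)
 have li: "Suc l mod n = i"
 proof -
  have "Suc l mod n = (Suc (i + n - 1)) mod n" unfolding l_def by (simp add: mod_Suc_eq)
  also have "Suc (i + n - 1) = i + n" using n by simp
  finally show ?thesis using i by simp
 qed
 have jne: "j \<noteq> l"
 proof (cases "Suc i < n")
  case True
  hence j: "j = Suc i" by (simp add: j_def)
  show ?thesis
  proof (cases "i = 0")
   case True
   hence "l = n - 1" using n by (simp add: l_def)
   thus ?thesis using j True n by simp
  next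
   case False
   hence eq: "i + n - 1 = (i - 1) + n" by simp
   have "l = i - 1" unfolding l_def eq using i by simp
   thus ?thesis using j by simp
  qed
 next
  case False
  hence "i = n - 1" using i by simp
  hence "j = 0" and eq: "i + n - 1 = (n - 2) + n" using n by (auto simp: j_def)
  have "l = n - 2" unfolding l_def eq mod_add_self2 using n by simp
  thus ?thesis using \<open>j = 0\<close> n by simp
 qed
 have nb: "y = par (vs ! i)" if "{vs ! i, y} \<in> edges G" "dep y \<le> dep (vs ! i)" for y
  using that chD[of y "vs ! i"] chD[of "vs ! i" y] unfolding edge_iff by auto
 have "vs ! j = par (vs ! i)" using e[OF i(1)] i(2)[OF jl(1)] by (intro nb) (auto simp: j_def)
 moreover have "vs ! l = par (vs ! i)" using e[OF jl(2)] i(2)[OF jl(2)] li by (intro nb) (auto simp: insert_commute)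
 ultimately have "vs ! j = vs ! l" by simp
 thus False using nth_eq_iff_index_eq[OF n(2), of j l] jl jne by (simp add: n_def)
qed

end

section \<open>Matchings of rooted plabic trees\<close>

text \<open>\<open>bipartite_plabic_tree\<close> without the rotation system. Planarity is kept
  apart in a combinatorial form that passes to half trees without constructing embeddings of
  them.\<close>

definition plabic_tree :: "'v plabic \<Rightarrow> bool" where
 "plabic_tree G \<longleftrightarrow> is_tree G \<and> distinct (bdry G) \<and> set (bdry G) \<subseteq> verts G \<and> white G \<subseteq> internal G \<and>
   (\<forall>e\<in>edges G. card (e \<inter> white G) = 1) \<and> (\<forall>v\<in>set (bdry G). degree G v = 1) \<and>
   (\<forall>v\<in>internal G. degree G v \<noteq> 1)"

abbreviation matchings :: "'v plabic \<Rightarrow> nat set \<Rightarrow> 'v set set set" where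
 "matchings G I \<equiv> {M. almost_perfect_matching G M \<and> matching_boundary G M = I}"

locale rooted_plabic = rooted G r par dep for G :: "'v plabic" and r par dep +
 assumes plabic: "plabic_tree G" and r_bdry: "r \<in> set (bdry G)"

lemma plabic_tree_rooted:
 assumes "plabic_tree G" "r \<in> set (bdry G)"
 shows "\<exists>par dep. rooted_plabic G r par dep"
proof -
 have "is_tree G" "r \<in> verts G" using assms by (auto simp: plabic_tree_def)
 from tree_rooted[OF this] obtain par dep where "rooted G r par dep" by (elim exE)
 hence "rooted_plabic G r par dep" using assms unfolding rooted_plabic_def rooted_plabic_axioms_def by simp
 thus ?thesis by (intro exI)
qed

section \<open>Counts of boundary vertices below an edge\<close>

context rooted_plabic
begin

lemma bdry_distinct: "distinct (bdry G)" and bdry_sub: "set (bdry G) \<subseteq> verts G"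
 and white_internal: "white G \<subseteq> internal G"
 using plabic by (auto simp: plabic_tree_def)

lemma bip: "x \<in> verts G - {r} \<Longrightarrow> (x \<in> white G) \<noteq> (par x \<in> white G)"
proof -
 assume x: "x \<in> verts G - {r}"
 hence "{x, par x} \<in> edges G" using edges_eq by auto
 hence "card ({x, par x} \<inter> white G) = 1" using plabic by (auto simp: plabic_tree_def)
 moreover have "{x, par x} \<inter> white G = (if x \<in> white G then {x} else {}) \<union> (if par x \<in> white G then {par x} else {})"
  by auto
 ultimately show ?thesis using par_neq[OF x] by (auto split: if_splits)
qed

lemma bip_ch: "c \<in> ch v \<Longrightarrow> (c \<in> white G) \<noteq> (v \<in> white G)"
 using bip[of c] chD[of c v] by auto

lemma bdry_not_white: "b \<in> set (bdry G) \<Longrightarrow> b \<notin> white G"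
 using white_internal by (auto simp: internal_def)

lemma bdry_no_ch: "b \<in> set (bdry G) \<Longrightarrow> b \<noteq> r \<Longrightarrow> ch b = {}"
proof -
 assume b: "b \<in> set (bdry G)" "b \<noteq> r"
 have "degree G b = 1" using plabic b by (simp add: plabic_tree_def)
 hence "card (ch b) = 0" using degree_eq[of b] b bdry_sub by auto
 thus ?thesis by simp
qed

definition wtop :: 'v where "wtop = (THE w. ch r = {w})"

lemma ch_r: "ch r = {wtop}"
proof -
 have "degree G r = 1" using plabic r_bdry by (simp add: plabic_tree_def)
 hence "card (ch r) = 1" using degree_eq[OF rV] by simp
 then obtain w where w: "ch r = {w}" by (auto simp: card_1_singleton_iff)
 hence "wtop = w" unfolding wtop_def by (intro the_equality) auto
 thus ?thesis using w by simp
qed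

lemma wtop: "wtop \<in> verts G - {r}" "wtop \<in> ch r" "wtop \<in> white G"
proof -
 show t: "wtop \<in> ch r" using ch_r by simp
 thus "wtop \<in> verts G - {r}" using chD by blast
 show "wtop \<in> white G" using bip_ch[OF t] bdry_not_white[OF r_bdry] by blast
qed

lemma internalD: "v \<in> internal G \<Longrightarrow> v \<in> verts G - {r} \<and> v \<notin> set (bdry G)"
 using r_bdry by (auto simp: internal_def)

lemma internal_ch: "v \<in> internal G \<Longrightarrow> ch v \<noteq> {}"
proof
 assume v: "v \<in> internal G" "ch v = {}"
 hence "degree G v = 1" using degree_eq[of v] internalD[OF v(1)] by simp
 thus False using plabic v(1) by (auto simp: plabic_tree_def)
qed

text \<open>\<open>kap x + 1\<close> is the k-statistic of the half tree on the lower side of the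
  edge above \<open>x\<close>.\<close>

definition kap :: "'v \<Rightarrow> nat" where
 "kap x = (\<Sum>b\<in>desc x \<inter> black_internal G. degree G b - 2)"

definition D :: "'v \<Rightarrow> nat set" where
 "D x = {i. i < length (bdry G) \<and> bdry G ! i \<in> desc x}"

definition ri :: nat where "ri = (THE i. i < length (bdry G) \<and> bdry G ! i = r)"

lemma ri: "ri < length (bdry G)" "bdry G ! ri = r"
 and ri_iff: "i < length (bdry G) \<Longrightarrow> bdry G ! i = r \<longleftrightarrow> i = ri"
proof -
 obtain i where i: "i < length (bdry G)" "bdry G ! i = r" using r_bdry by (auto simp: in_set_conv_nth)
 have "j = i" if "j < length (bdry G)" "bdry G ! j = r" for j
  using that i nth_eq_iff_index_eq[OF bdry_distinct] by metis
 hence "\<exists>!i. i < length (bdry G) \<and> bdry G ! i = r" using i by blast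
 from theI'[OF this] show *: "ri < length (bdry G)" "bdry G ! ri = r" unfolding ri_def by auto
 show "bdry G ! i = r \<longleftrightarrow> i = ri" if "i < length (bdry G)" for i
  using that * nth_eq_iff_index_eq[OF bdry_distinct] by metis
qed

lemma finite_D [simp]: "finite (D x)"
 by (simp add: D_def)

lemma D_sub: "D x \<subseteq> {..<length (bdry G)}"
 by (auto simp: D_def)

lemma desc_no_ch: "x \<in> verts G \<Longrightarrow> ch x = {} \<Longrightarrow> desc x = {x}"
 using desc_unfold by auto

lemma D_leaf: "i < length (bdry G) \<Longrightarrow> i \<noteq> ri \<Longrightarrow> D (bdry G ! i) = {i}"
proof -
 assume i: "i < length (bdry G)" "i \<noteq> ri"
 hence "ch (bdry G ! i) = {}" "bdry G ! i \<in> verts G" using bdry_no_ch ri_iff bdry_sub nth_mem by blast+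
 hence "desc (bdry G ! i) = {bdry G ! i}" by (intro desc_no_ch)
 thus ?thesis using i nth_eq_iff_index_eq[OF bdry_distinct] by (auto simp: D_def)
qed

lemma D_internal: "v \<in> verts G \<Longrightarrow> v \<notin> set (bdry G) \<Longrightarrow> D v = (\<Union>c\<in>ch v. D c)"
proof (rule Set.set_eqI)
 fix i assume v: "v \<in> verts G" "v \<notin> set (bdry G)"
 have "i < length (bdry G) \<Longrightarrow> bdry G ! i \<noteq> v" using v(2) nth_mem[of i "bdry G"] by auto
 thus "i \<in> D v \<longleftrightarrow> i \<in> (\<Union>c\<in>ch v. D c)" unfolding D_def desc_unfold[OF v(1)] by auto
qed

lemma D_disjoint: "c \<in> ch x \<Longrightarrow> c' \<in> ch x \<Longrightarrow> c \<noteq> c' \<Longrightarrow> D c \<inter> D c' = {}"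
 using desc_disjoint[of c x c'] by (auto simp: D_def)

lemma D_wtop: "D wtop = {..<length (bdry G)} - {ri}"
proof -
 have d: "verts G = insert r (desc wtop)" using desc_unfold[OF rV] by (simp add: desc_root ch_r)
 have rn: "r \<notin> desc wtop" using root_not_desc wtop by blast
 show ?thesis
 proof (rule Set.set_eqI)
  fix i
  show "i \<in> D wtop \<longleftrightarrow> i \<in> {..<length (bdry G)} - {ri}"
  proof (cases "i < length (bdry G)")
   case True
   hence "bdry G ! i = r \<or> bdry G ! i \<in> desc wtop" using d bdry_sub nth_mem[OF True] by (metis insertE subsetD)
   thus ?thesis using True rn ri_iff[OF True] by (auto simp: D_def)
  qed (simp add: D_def)
 qed
qed

lemma D_mono: "y \<in> desc x \<Longrightarrow> D y \<subseteq> D x"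
 using desc_trans by (auto simp: D_def)

lemma ri_notin_D: "x \<in> verts G - {r} \<Longrightarrow> ri \<notin> D x"
 using root_not_desc ri by (auto simp: D_def)

lemma D_nonempty: "x \<in> verts G - {r} \<Longrightarrow> D x \<noteq> {}"
proof -
 assume "x \<in> verts G - {r}"
 hence "x \<in> verts G" "x \<noteq> r" by auto
 thus ?thesis
 proof (induction x rule: tree_induct)
  case (step x)
  show ?case
  proof (cases "x \<in> set (bdry G)")
   case True
   then obtain i where "i < length (bdry G)" "x = bdry G ! i" by (auto simp: in_set_conv_nth)
   thus ?thesis using step desc_refl[of x] by (auto simp: D_def)
  next
   case False
   hence "x \<in> internal G" using step by (simp add: internal_def)
   then obtain c where c: "c \<in> ch x" using internal_ch by blast
   hence "D c \<noteq> {}" using step chD[OF c] by blast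
   moreover have "D c \<subseteq> D x" using D_internal[OF step(1) False] c by blast
   ultimately show ?thesis by blast
  qed
 qed
qed

lemma kap_leaf: "b \<in> set (bdry G) \<Longrightarrow> b \<noteq> r \<Longrightarrow> kap b = 0"
 using desc_no_ch[of b] bdry_no_ch[of b] bdry_sub by (auto simp: kap_def black_internal_def internal_def)

lemma kap_rec:
 assumes v: "v \<in> verts G"
 shows "kap v = (\<Sum>c\<in>ch v. kap c) + (if v \<in> black_internal G then degree G v - 2 else 0)"
proof -
 let ?B = "black_internal G" and ?f = "\<lambda>b. degree G b - 2"
 have eq: "desc v \<inter> ?B = ({v} \<inter> ?B) \<union> (\<Union>c\<in>ch v. desc c \<inter> ?B)" using desc_unfold[OF v] by auto
 have "kap v = sum ?f ({v} \<inter> ?B) + sum ?f (\<Union>c\<in>ch v. desc c \<inter> ?B)"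
  unfolding kap_def eq using not_desc_child by (intro sum.union_disjoint) auto
 also have "sum ?f (\<Union>c\<in>ch v. desc c \<inter> ?B) = (\<Sum>c\<in>ch v. kap c)"
  unfolding kap_def
 proof (rule sum.UNION_disjoint)
  show "\<forall>i\<in>ch v. \<forall>j\<in>ch v. i \<noteq> j \<longrightarrow> desc i \<inter> ?B \<inter> (desc j \<inter> ?B) = {}" using desc_disjoint by blast
 qed simp_all
 also have "sum ?f ({v} \<inter> ?B) = (if v \<in> ?B then degree G v - 2 else 0)" by auto
 finally show ?thesis by simp
qed

lemma black_degree: "v \<in> black_internal G \<Longrightarrow> degree G v - 2 = card (ch v) - 1"
proof -
 assume "v \<in> black_internal G"
 hence "v \<in> verts G - {r}" using internalD by (simp add: black_internal_def)
 thus ?thesis using degree_eq[of v] by simp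
qed

lemma kap_white: "v \<in> white G \<Longrightarrow> kap v = (\<Sum>c\<in>ch v. kap c)"
 using kap_rec[of v] white_internal internalD[of v] by (auto simp: black_internal_def)

text \<open>Written additively to avoid truncated subtraction. An internal black vertex contributes
  its number of children minus one, because its degree also counts the parent.\<close>

lemma kap_black:
 assumes "v \<in> black_internal G"
 shows "kap v + 1 = (\<Sum>c\<in>ch v. kap c) + card (ch v)"
proof -
 have v: "v \<in> internal G" "v \<in> verts G" using assms internalD by (auto simp: black_internal_def)
 have "card (ch v) > 0" using internal_ch[OF v(1)] by (simp add: card_gt_0_iff)
 thus ?thesis using kap_rec[OF v(2)] black_degree[OF assms] assms by simp
qed

lemma k_stat_kap: "k_stat G = 1 + kap wtop"
proof -
 have d: "verts G = insert r (desc wtop)" using desc_unfold[OF rV] by (simp add: desc_root ch_r)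
 have "black_internal G \<subseteq> desc wtop"
 proof
  fix b assume "b \<in> black_internal G"
  hence "b \<in> verts G" "b \<noteq> r" using internalD by (auto simp: black_internal_def)
  thus "b \<in> desc wtop" using d by blast
 qed
 hence "desc wtop \<inter> black_internal G = black_internal G" by blast
 thus ?thesis by (simp add: k_stat_def kap_def)
qed

text \<open>A matching is encoded by the set of all \<open>x\<close> whose edge to the parent belongs to it.\<close>

definition up_matching :: "'v set \<Rightarrow> bool" where
 "up_matching U \<longleftrightarrow> U \<subseteq> verts G - {r} \<and> (\<forall>v\<in>internal G. card (ch v \<inter> U) + of_bool (v \<in> U) = 1)"

text \<open>The root has no edge upwards; it is covered when the edge above its only child
  \<open>wtop\<close> is.\<close>

definition up_boundary :: "'v set \<Rightarrow> nat set" where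
 "up_boundary U = {i. i < length (bdry G) \<and> (if i = ri then wtop \<in> U else bdry G ! i \<in> U)}"

definition up_edges :: "'v set \<Rightarrow> 'v set set" where
 "up_edges U = (\<lambda>x. {x, par x}) ` U"

lemma up_edge_inj: "inj_on (\<lambda>x. {x, par x}) (verts G - {r})"
proof (rule inj_onI)
 fix x y assume xy: "x \<in> verts G - {r}" "y \<in> verts G - {r}" "{x, par x} = {y, par y}"
 show "x = y"
 proof (rule ccontr)
  assume "x \<noteq> y"
  hence "x = par y" "y = par x" using xy(3) by (auto simp: doubleton_eq_iff)
  thus False using dep_par[OF xy(1)] dep_par[OF xy(2)] by simp
 qed
qed

lemma up_edges_containing:
 assumes "U \<subseteq> verts G - {r}"
 shows "{e \<in> up_edges U. v \<in> e} = (\<lambda>x. {x, par x}) ` ((ch v \<inter> U) \<union> ({v} \<inter> U))"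
proof
 show "{e \<in> up_edges U. v \<in> e} \<subseteq> (\<lambda>x. {x, par x}) ` ((ch v \<inter> U) \<union> ({v} \<inter> U))"
 proof
  fix e assume "e \<in> {e \<in> up_edges U. v \<in> e}"
  then obtain x where x: "x \<in> U" "e = {x, par x}" "v = x \<or> v = par x" by (auto simp: up_edges_def)
  hence "x \<in> (ch v \<inter> U) \<union> ({v} \<inter> U)" using assms by (auto simp: ch_def)
  thus "e \<in> (\<lambda>x. {x, par x}) ` ((ch v \<inter> U) \<union> ({v} \<inter> U))" using x(2) by blast
 qed
 show "(\<lambda>x. {x, par x}) ` ((ch v \<inter> U) \<union> ({v} \<inter> U)) \<subseteq> {e \<in> up_edges U. v \<in> e}"
  by (auto simp: up_edges_def ch_def)
qed

lemma card_up_edges_containing: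
 assumes U: "U \<subseteq> verts G - {r}" and v: "v \<in> verts G"
 shows "card {e \<in> up_edges U. v \<in> e} = card (ch v \<inter> U) + of_bool (v \<in> U)"
proof -
 have "card {e \<in> up_edges U. v \<in> e} = card ((ch v \<inter> U) \<union> ({v} \<inter> U))"
  unfolding up_edges_containing[OF U]
  by (rule card_image[OF inj_on_subset[OF up_edge_inj]]) (use U in auto)
 also have "\<dots> = card (ch v \<inter> U) + card ({v} \<inter> U)"
  using not_desc_child[of v v] desc_refl[OF v] by (intro card_Un_disjoint) auto
 finally show ?thesis by auto
qed

lemma card_1_iff_ex1: "card {e \<in> M. v \<in> e} = 1 \<longleftrightarrow> (\<exists>!e. e \<in> M \<and> v \<in> e)"
proof -
 have "card {e \<in> M. v \<in> e} = 1 \<longleftrightarrow> (\<exists>e. {e \<in> M. v \<in> e} = {e})" by (simp add: card_1_singleton_iff)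
 also have "\<dots> \<longleftrightarrow> (\<exists>!e. e \<in> M \<and> v \<in> e)"
 proof
  assume "\<exists>e. {e \<in> M. v \<in> e} = {e}"
  then obtain e where e: "{e \<in> M. v \<in> e} = {e}" by blast
  have iff: "e' \<in> M \<and> v \<in> e' \<longleftrightarrow> e' = e" for e' using arg_cong[OF e, of "\<lambda>S. e' \<in> S"] by simp
  show "\<exists>!e. e \<in> M \<and> v \<in> e" unfolding iff by simp
 next
  assume "\<exists>!e. e \<in> M \<and> v \<in> e"
  then obtain e where e: "e \<in> M \<and> v \<in> e" and u: "\<forall>e'. e' \<in> M \<and> v \<in> e' \<longrightarrow> e' = e" by (rule ex1E)
  have "{e \<in> M. v \<in> e} = {e}"
  proof (intro Set.set_eqI iffI)
   fix x assume "x \<in> {e \<in> M. v \<in> e}"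
   hence "x = e" using u[THEN spec, of x] by simp
   thus "x \<in> {e}" by simp
  next
   fix x assume "x \<in> {e}"
   thus "x \<in> {e \<in> M. v \<in> e}" using e by simp
  qed
  thus "\<exists>e. {e \<in> M. v \<in> e} = {e}" by blast
 qed
 finally show ?thesis .
qed

lemma up_edges_matching:
 assumes U: "U \<subseteq> verts G - {r}"
 shows "almost_perfect_matching G (up_edges U) \<longleftrightarrow> up_matching U"
proof
 assume "almost_perfect_matching G (up_edges U)"
 hence m: "\<forall>v\<in>internal G. \<exists>!e. e \<in> up_edges U \<and> v \<in> e" by (simp add: almost_perfect_matching_def)
 have "card (ch v \<inter> U) + of_bool (v \<in> U) = 1" if v: "v \<in> internal G" for v
  using card_up_edges_containing[OF U, of v] internalD[OF v] card_1_iff_ex1[of "up_edges U" v] m v by simp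
 thus "up_matching U" using U by (simp add: up_matching_def)
next
 assume m: "up_matching U"
 show "almost_perfect_matching G (up_edges U)" unfolding almost_perfect_matching_def
 proof (intro conjI ballI impI)
  show "up_edges U \<subseteq> edges G" using U by (auto simp: up_edges_def edges_eq)
  show ex: "\<exists>!e. e \<in> up_edges U \<and> v \<in> e" if v: "v \<in> internal G" for v
   using card_up_edges_containing[OF U, of v] internalD[OF v] card_1_iff_ex1[of "up_edges U" v] m v
   unfolding up_matching_def by simp
  have "finite U" using U fin finite_subset by blast
  hence finE: "finite (up_edges U)" by (simp add: up_edges_def)
  fix e f assume ef: "e \<in> up_edges U" "f \<in> up_edges U" "e \<noteq> f"
  show "e \<inter> f = {}"
  proof (rule ccontr)
   assume "e \<inter> f \<noteq> {}"
   then obtain v where v: "v \<in> e" "v \<in> f" by blast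
   have "v \<in> verts G" using v(1) ef(1) U par_in by (auto simp: up_edges_def)
   have "v \<notin> internal G" using ex[of v] ef v by blast
   hence vb: "v \<in> set (bdry G)" using \<open>v \<in> verts G\<close> by (simp add: internal_def)
   have "{e, f} \<subseteq> {e \<in> up_edges U. v \<in> e}" using ef v by blast
   hence "card {e, f} \<le> card {e \<in> up_edges U. v \<in> e}"
    using finE by (intro card_mono) simp_all
   hence "2 \<le> card (ch v \<inter> U) + of_bool (v \<in> U)"
    using card_up_edges_containing[OF U \<open>v \<in> verts G\<close>] ef(3) by simp
   moreover have "card (ch v \<inter> U) + of_bool (v \<in> U) \<le> 1"
   proof (cases "v = r")
    case True
    hence "v \<notin> U" using U by auto
    moreover have "card (ch v \<inter> U) \<le> card {wtop}" using True ch_r by (intro card_mono) auto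
    ultimately show ?thesis by simp
   next
    case False
    thus ?thesis using bdry_no_ch[OF vb] by simp
   qed
   ultimately show False by simp
  qed
 qed
qed

lemma matching_up_edges:
 assumes "almost_perfect_matching G M"
 shows "\<exists>U\<subseteq>verts G - {r}. M = up_edges U"
proof -
 have "M \<subseteq> (\<lambda>x. {x, par x}) ` (verts G - {r})" using assms by (auto simp: almost_perfect_matching_def edges_eq)
 then obtain U where "U \<subseteq> verts G - {r}" "M = (\<lambda>x. {x, par x}) ` U" by (rule subset_imageE)
 thus ?thesis unfolding up_edges_def by blast
qed

lemma up_edges_boundary:
 assumes U: "U \<subseteq> verts G - {r}"
 shows "matching_boundary G (up_edges U) = up_boundary U"
proof -
 have "bdry G ! i \<in> \<Union>(up_edges U) \<longleftrightarrow> (if i = ri then wtop \<in> U else bdry G ! i \<in> U)" if i: "i < length (bdry G)" for i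
 proof -
  have b: "bdry G ! i \<in> set (bdry G)" using i by simp
  have "bdry G ! i \<in> \<Union>(up_edges U) \<longleftrightarrow> ch (bdry G ! i) \<inter> U \<noteq> {} \<or> bdry G ! i \<in> U"
  proof
   assume "bdry G ! i \<in> \<Union>(up_edges U)"
   then obtain x where x: "x \<in> U" "bdry G ! i = x \<or> bdry G ! i = par x" unfolding up_edges_def by blast
   show "ch (bdry G ! i) \<inter> U \<noteq> {} \<or> bdry G ! i \<in> U"
   proof (cases "bdry G ! i = x")
    case False
    hence "x \<in> ch (bdry G ! i)" using x U by (auto simp: ch_def)
    thus ?thesis using x(1) by blast
   qed (use x(1) in simp)
  next
   assume "ch (bdry G ! i) \<inter> U \<noteq> {} \<or> bdry G ! i \<in> U"
   then obtain x where x: "x \<in> U" "bdry G ! i \<in> {x, par x}"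
   proof
    assume "ch (bdry G ! i) \<inter> U \<noteq> {}"
    then obtain x where "x \<in> U" "x \<in> ch (bdry G ! i)" by blast
    thus thesis using that[of x] chD by simp
   next
    assume "bdry G ! i \<in> U"
    thus thesis using that[of "bdry G ! i"] by simp
   qed
   thus "bdry G ! i \<in> \<Union>(up_edges U)"
    by (intro UnionI[of "{x, par x}"]) (simp_all add: up_edges_def)
  qed
  moreover have "ch (bdry G ! i) = (if i = ri then {wtop} else {})"
   using ri_iff[OF i] ch_r bdry_no_ch[OF b] ri by auto
  moreover have "r \<notin> U" using U by auto
  ultimately show ?thesis using ri_iff[OF i] by auto
 qed
 thus ?thesis unfolding matching_boundary_def up_boundary_def by (intro Collect_cong conj_cong refl)
qed

lemma up_edges_inj: "inj_on up_edges (Pow (verts G - {r}))"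
 unfolding up_edges_def using up_edge_inj by (rule inj_on_image_Pow)

lemma matchings_bij:
 "bij_betw up_edges {U. up_matching U \<and> up_boundary U = I}
   (matchings G I)"
 unfolding bij_betw_def
proof
 have sub: "U \<subseteq> verts G - {r}" if "up_matching U" for U using that by (simp add: up_matching_def)
 show "inj_on up_edges {U. up_matching U \<and> up_boundary U = I}"
  by (rule inj_on_subset[OF up_edges_inj]) (use sub in auto)
 show "up_edges ` {U. up_matching U \<and> up_boundary U = I} = (matchings G I)"
 proof
  show "up_edges ` {U. up_matching U \<and> up_boundary U = I} \<subseteq> (matchings G I)"
   using sub up_edges_matching up_edges_boundary by auto
  show "(matchings G I) \<subseteq> up_edges ` {U. up_matching U \<and> up_boundary U = I}"
  proof
   fix M assume M: "M \<in> (matchings G I)"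
   then obtain U where U: "U \<subseteq> verts G - {r}" "M = up_edges U" using matching_up_edges by blast
   hence "up_matching U" "up_boundary U = I" using M up_edges_matching[OF U(1)] up_edges_boundary[OF U(1)] by auto
   thus "M \<in> up_edges ` {U. up_matching U \<and> up_boundary U = I}" using U by blast
  qed
 qed
qed

lemma card_D_Int:
 assumes v: "v \<in> internal G"
 shows "card (I \<inter> D v) = (\<Sum>c\<in>ch v. card (I \<inter> D c))"
proof -
 have "I \<inter> D v = (\<Union>c\<in>ch v. I \<inter> D c)" using D_internal[of v] internalD[OF v] by auto
 also have "card \<dots> = (\<Sum>c\<in>ch v. card (I \<inter> D c))"
  using D_disjoint by (intro card_UN_disjoint) (simp_all, blast)
 finally show ?thesis .
qed

text \<open>Induction from the leaves, using that exactly one edge at each internal vertex is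
  matched. The count below an edge takes one of two consecutive values and tells whether the edge is
  matched; the meaning of the larger value alternates with the colour of \<open>x\<close>.\<close>

lemma up_boundary_card:
 assumes U: "up_matching U" and x: "x \<in> verts G - {r}"
 shows "card (up_boundary U \<inter> D x) = kap x + of_bool ((x \<in> U) \<noteq> (x \<in> white G))"
proof -
 have "x \<in> verts G" "x \<noteq> r" using x by auto
 thus ?thesis
 proof (induction x rule: tree_induct)
  case (step x)
  have IH: "card (up_boundary U \<inter> D c) = kap c + of_bool ((c \<in> U) \<noteq> (c \<in> white G))" if "c \<in> ch x" for c
   using step(2)[OF that] chD[OF that] by simp
  show ?case
  proof (cases "x \<in> internal G")
   case False
   hence xb: "x \<in> set (bdry G)" using step by (simp add: internal_def)
   then obtain i where i: "i < length (bdry G)" "x = bdry G ! i" by (auto simp: in_set_conv_nth)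
   have "i \<noteq> ri" using i step(3) ri by auto
   hence "up_boundary U \<inter> D x = (if x \<in> U then {i} else {})"
    unfolding i(2) D_leaf[OF i(1) \<open>i \<noteq> ri\<close>] using i by (auto simp: up_boundary_def)
   thus ?thesis using kap_leaf[OF xb step(3)] bdry_not_white[OF xb] by simp
  next
   case True
   have one: "card (ch x \<inter> U) + of_bool (x \<in> U) = 1" using U True by (simp add: up_matching_def)
   have cU: "card (ch x \<inter> U) = (\<Sum>c\<in>ch x. of_bool (c \<in> U))" by (simp add: sum.inter_restrict[symmetric] Int_def)
   show ?thesis
   proof (cases "x \<in> white G")
    case True
    have "card (up_boundary U \<inter> D x) = (\<Sum>c\<in>ch x. kap c + of_bool (c \<in> U))"
     unfolding card_D_Int[OF \<open>x \<in> internal G\<close>] using IH bip_ch[of _ x] True by (intro sum.cong refl) simp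
    hence "card (up_boundary U \<inter> D x) = kap x + card (ch x \<inter> U)"
     unfolding sum.distrib cU kap_white[OF True] .
    thus ?thesis using one True by (cases "x \<in> U") simp_all
   next
    case False
    hence bl: "x \<in> black_internal G" using True by (simp add: black_internal_def)
    have "card (up_boundary U \<inter> D x) + card (ch x \<inter> U) = (\<Sum>c\<in>ch x. kap c + 1)"
     unfolding card_D_Int[OF \<open>x \<in> internal G\<close>] cU sum.distrib[symmetric]
     using IH bip_ch[of _ x] False by (intro sum.cong refl) simp
    hence "card (up_boundary U \<inter> D x) + card (ch x \<inter> U) = kap x + 1"
     unfolding kap_black[OF bl] sum.distrib[of kap "\<lambda>_. 1"] by simp
    thus ?thesis using one False by (cases "x \<in> U") simp_all
   qed
  qed
 qed
qed

section \<open>Bases and the unique matching of a basis\<close>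

abbreviation tight :: "('v \<Rightarrow> nat) \<Rightarrow> nat set \<Rightarrow> bool" where
 "tight \<kappa> I \<equiv> \<forall>x\<in>verts G - {r}. \<kappa> x \<le> card (I \<inter> D x) \<and> card (I \<inter> D x) \<le> \<kappa> x + 1"

text \<open>The counts that are necessary for the boundary of a matching by
  \<open>up_boundary_card\<close>. They are also sufficient, so the good sets are the bases of the
  positroid.\<close>

definition good :: "nat set \<Rightarrow> bool" where
 "good I \<longleftrightarrow> I \<subseteq> {..<length (bdry G)} \<and> card I = k_stat G \<and>
   (tight kap I)"

lemma split_ri: "I \<subseteq> {..<length (bdry G)} \<Longrightarrow> card I = card (I \<inter> D wtop) + of_bool (ri \<in> I)"
proof -
 assume I: "I \<subseteq> {..<length (bdry G)}"
 hence fI: "finite I" using finite_subset by blast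
 have "I = (I \<inter> D wtop) \<union> (I \<inter> {ri})" using I D_wtop by auto
 hence "card I = card (I \<inter> D wtop) + card (I \<inter> {ri})"
  using D_wtop by (subst card_Un_disjoint[symmetric]) auto
 thus ?thesis by auto
qed

lemma up_boundary_good: "up_matching U \<Longrightarrow> good (up_boundary U)"
 unfolding good_def
proof (intro conjI ballI)
 assume U: "up_matching U"
 show sub: "up_boundary U \<subseteq> {..<length (bdry G)}" by (auto simp: up_boundary_def)
 have "ri \<in> up_boundary U \<longleftrightarrow> wtop \<in> U" using ri by (auto simp: up_boundary_def)
 thus "card (up_boundary U) = k_stat G"
  using split_ri[OF sub] up_boundary_card[OF U wtop(1)] wtop(3) k_stat_kap by auto
 fix x assume "x \<in> verts G - {r}"
 thus "kap x \<le> card (up_boundary U \<inter> D x)" "card (up_boundary U \<inter> D x) \<le> kap x + 1"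
  using up_boundary_card[OF U] by auto
qed

text \<open>The counts decide edge by edge what is matched, hence the matching is unique. In
  particular every nonzero minor of a point of the cell is a single monomial in the weights.\<close>

lemma good_up_matching:
 assumes I: "good I"
 shows "{U. up_matching U \<and> up_boundary U = I} = {{x \<in> verts G - {r}. (card (I \<inter> D x) = kap x + 1) \<noteq> (x \<in> white G)}}"
proof -
 define U0 where "U0 = {x \<in> verts G - {r}. (card (I \<inter> D x) = kap x + 1) \<noteq> (x \<in> white G)}"
 have U0: "x \<in> U0 \<longleftrightarrow> (card (I \<inter> D x) = kap x + 1) \<noteq> (x \<in> white G)" if "x \<in> verts G - {r}" for x
  using that by (auto simp: U0_def)
 have U0sub: "U0 \<subseteq> verts G - {r}" by (auto simp: U0_def)
 have c: "card (I \<inter> D x) = kap x + of_bool ((x \<in> U0) \<noteq> (x \<in> white G))" if x: "x \<in> verts G - {r}" for x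
 proof -
  have b: "kap x \<le> card (I \<inter> D x)" "card (I \<inter> D x) \<le> kap x + 1" using I x by (simp_all add: good_def)
  have "(x \<in> U0) \<noteq> (x \<in> white G) \<longleftrightarrow> card (I \<inter> D x) = kap x + 1" using U0[OF x] by blast
  thus ?thesis using b by (cases "card (I \<inter> D x) = kap x + 1") simp_all
 qed
 have Isub: "I \<subseteq> {..<length (bdry G)}" and Ik: "card I = k_stat G" using I by (auto simp: good_def)
 have "card (ch v \<inter> U0) + of_bool (v \<in> U0) = 1" if v: "v \<in> internal G" for v
 proof -
  have vV: "v \<in> verts G - {r}" using internalD[OF v] by simp
  have cV: "c \<in> verts G - {r}" if "c \<in> ch v" for c using chD[OF that] by simp
  have cU: "card (ch v \<inter> U0) = (\<Sum>c\<in>ch v. of_bool (c \<in> U0))" by (simp add: sum.inter_restrict[symmetric] Int_def)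
  have main: "card (I \<inter> D v) = (\<Sum>c\<in>ch v. kap c + of_bool ((c \<in> U0) \<noteq> (c \<in> white G)))"
   using card_D_Int[OF v, of I] c[OF cV] by simp
  show ?thesis
  proof (cases "v \<in> white G")
   case True
   have "(\<Sum>c\<in>ch v. kap c + of_bool ((c \<in> U0) \<noteq> (c \<in> white G))) = (\<Sum>c\<in>ch v. kap c + of_bool (c \<in> U0))"
    using bip_ch[of _ v] True by (intro sum.cong refl) simp
   hence "card (I \<inter> D v) = kap v + card (ch v \<inter> U0)"
    unfolding main cU kap_white[OF True] sum.distrib[symmetric] .
   thus ?thesis using c[OF vV] True by (cases "v \<in> U0") simp_all
  next
   case False
   hence bl: "v \<in> black_internal G" using v by (simp add: black_internal_def)
   have "(\<Sum>c\<in>ch v. kap c + of_bool ((c \<in> U0) \<noteq> (c \<in> white G))) + card (ch v \<inter> U0) = (\<Sum>c\<in>ch v. kap c + 1)"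
    unfolding cU sum.distrib[symmetric] using bip_ch[of _ v] False by (intro sum.cong refl) simp
   hence "card (I \<inter> D v) + card (ch v \<inter> U0) = kap v + 1"
    unfolding main kap_black[OF bl] sum.distrib[of kap "\<lambda>_. 1"] by simp
   thus ?thesis using c[OF vV] False by (cases "v \<in> U0") simp_all
  qed
 qed
 hence m: "up_matching U0" using U0sub unfolding up_matching_def by blast
 have b: "up_boundary U0 = I"
 proof (rule Set.set_eqI)
  fix i
  show "i \<in> up_boundary U0 \<longleftrightarrow> i \<in> I"
  proof (cases "i < length (bdry G)")
   case True
   show ?thesis
   proof (cases "i = ri")
    case True
    have "card (I \<inter> D wtop) = kap wtop + of_bool (wtop \<notin> U0)" using c[OF wtop(1)] wtop(3) by simp
    hence "i \<in> I \<longleftrightarrow> wtop \<in> U0" using split_ri[OF Isub] Ik k_stat_kap True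
     by (cases "ri \<in> I"; cases "wtop \<in> U0") simp_all
    thus ?thesis using True ri by (simp add: up_boundary_def)
   next
    case False
    let ?b = "bdry G ! i"
    have b: "?b \<in> set (bdry G)" "?b \<noteq> r" using True ri_iff[OF True] False by simp_all
    hence bV: "?b \<in> verts G - {r}" using bdry_sub by blast
    have "card (I \<inter> {i}) = of_bool (?b \<in> U0)"
     using c[OF bV] unfolding D_leaf[OF True False] kap_leaf[OF b] using bdry_not_white[OF b(1)] by simp
    hence "i \<in> I \<longleftrightarrow> ?b \<in> U0" by (cases "i \<in> I"; cases "?b \<in> U0") simp_all
    thus ?thesis using True False by (simp add: up_boundary_def)
   qed
  next
   case False
   thus ?thesis using Isub by (auto simp: up_boundary_def)
  qed
 qed
 have "U = U0" if U: "up_matching U" "up_boundary U = I" for U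
 proof -
  have "x \<in> U \<longleftrightarrow> x \<in> U0" if x: "x \<in> verts G - {r}" for x
   using up_boundary_card[OF U(1) x] unfolding U(2) c[OF x]
   by (cases "x \<in> white G"; cases "x \<in> U"; cases "x \<in> U0") simp_all
  thus ?thesis using U(1) U0sub unfolding up_matching_def by blast
 qed
 hence "{U. up_matching U \<and> up_boundary U = I} = {U0}" using m b by blast
 thus ?thesis by (simp only: U0_def)
qed

text \<open>The vertex factors are found from the root downwards by division. No consistency
  condition arises because there are no cycles.\<close>

lemma gauge:
 fixes w :: "'v set \<Rightarrow> real"
 assumes w: "\<And>e. e \<in> edges G \<Longrightarrow> 0 < w e"
 shows "\<exists>g. (\<forall>x\<in>verts G. 0 < g x) \<and> (\<forall>x\<in>verts G - {r}. w {x, par x} = g x * g (par x))"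
proof -
 obtain g where g: "g r = 1" "\<And>x. x \<in> verts G - {r} \<Longrightarrow> g x = w {x, par x} / g (par x)"
  using recursion[of 1 "\<lambda>x y. w {x, par x} / y"] by blast
 have we: "0 < w {x, par x}" if "x \<in> verts G - {r}" for x using that by (intro w) (auto simp: edges_eq)
 have pos: "0 < g x" if "x \<in> verts G" for x
  using that
 proof (induction "dep x" arbitrary: x rule: less_induct)
  case less
  show ?case
  proof (cases "x = r")
   case False
   hence x: "x \<in> verts G - {r}" using less by simp
   thus ?thesis using g(2)[OF x] we[OF x] less(1)[of "par x"] dep_par[OF x] par_in[OF x] by simp
  qed (simp add: g)
 qed
 have "w {x, par x} = g x * g (par x)" if x: "x \<in> verts G - {r}" for x
  using g(2)[OF x] pos[OF par_in[OF x]] by simp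
 thus ?thesis using pos by blast
qed

text \<open>Each internal vertex is covered exactly once by a matching, so the internal factors give
  the same constant for all matchings and only the covered boundary vertices distinguish
  them.\<close>

lemma prod_gauge:
 fixes g :: "'v \<Rightarrow> real"
 assumes U: "up_matching U"
 shows "(\<Prod>x\<in>U. g x * g (par x)) = (\<Prod>v\<in>internal G. g v) * (\<Prod>i\<in>up_boundary U. g (bdry G ! i))"
proof -
 have Usub: "U \<subseteq> verts G - {r}" using U by (simp add: up_matching_def)
 have finU: "finite U" using Usub fin finite_subset by blast
 have "(\<Prod>x\<in>U. g (par x)) = (\<Prod>v\<in>verts G. \<Prod>x\<in>{x \<in> U. par x = v}. g (par x))"
  using Usub par_in by (intro prod.group[symmetric] finU fin) auto
 also have "\<dots> = (\<Prod>v\<in>verts G. g v ^ card (ch v \<inter> U))"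
 proof (intro prod.cong refl)
  fix v
  have "{x \<in> U. par x = v} = ch v \<inter> U" using Usub by (auto simp: ch_def)
  thus "(\<Prod>x\<in>{x \<in> U. par x = v}. g (par x)) = g v ^ card (ch v \<inter> U)"
   by (simp add: ch_def)
 qed
 finally have p1: "(\<Prod>x\<in>U. g (par x)) = (\<Prod>v\<in>verts G. g v ^ card (ch v \<inter> U))" .
 have "(\<Prod>x\<in>U. g x) = (\<Prod>v\<in>verts G. g v ^ of_bool (v \<in> U))"
  using Usub fin by (intro prod.mono_neutral_cong_left) auto
 hence "(\<Prod>x\<in>U. g x * g (par x)) = (\<Prod>v\<in>verts G. g v ^ (card (ch v \<inter> U) + of_bool (v \<in> U)))"
  using p1 by (simp add: prod.distrib power_add mult.commute)
 also have "verts G = internal G \<union> set (bdry G)" using bdry_sub by (auto simp: internal_def)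
 also have "(\<Prod>v\<in>internal G \<union> set (bdry G). g v ^ (card (ch v \<inter> U) + of_bool (v \<in> U))) =
  (\<Prod>v\<in>internal G. g v ^ (card (ch v \<inter> U) + of_bool (v \<in> U))) * (\<Prod>v\<in>set (bdry G). g v ^ (card (ch v \<inter> U) + of_bool (v \<in> U)))"
  using fin by (intro prod.union_disjoint) (auto simp: internal_def)
 also have "(\<Prod>v\<in>internal G. g v ^ (card (ch v \<inter> U) + of_bool (v \<in> U))) = (\<Prod>v\<in>internal G. g v)"
  using U by (intro prod.cong refl) (simp add: up_matching_def)
 also have "(\<Prod>v\<in>set (bdry G). g v ^ (card (ch v \<inter> U) + of_bool (v \<in> U))) =
  (\<Prod>i<length (bdry G). g (bdry G ! i) ^ (card (ch (bdry G ! i) \<inter> U) + of_bool (bdry G ! i \<in> U)))"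
  using bij_betw_nth[OF bdry_distinct refl refl] by (rule prod.reindex_bij_betw[symmetric])
 also have "\<dots> = (\<Prod>i<length (bdry G). if i \<in> up_boundary U then g (bdry G ! i) else 1)"
 proof (intro prod.cong refl)
  fix i assume "i \<in> {..<length (bdry G)}"
  hence i: "i < length (bdry G)" by simp
  have "r \<notin> U" using Usub by auto
  hence "card (ch (bdry G ! i) \<inter> U) + of_bool (bdry G ! i \<in> U) = of_bool (i \<in> up_boundary U)"
   using ri_iff[OF i] ch_r bdry_no_ch[of "bdry G ! i"] i ri by (auto simp: up_boundary_def)
  thus "g (bdry G ! i) ^ (card (ch (bdry G ! i) \<inter> U) + of_bool (bdry G ! i \<in> U)) =
   (if i \<in> up_boundary U then g (bdry G ! i) else 1)" by simp
 qed
 also have "\<dots> = (\<Prod>i\<in>up_boundary U. g (bdry G ! i))"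
  by (rule prod.mono_neutral_cong_right) (auto simp: up_boundary_def)
 finally show ?thesis .
qed

text \<open>On a tree the edge weights enter only through boundary scalings.\<close>

lemma matching_sum:
 fixes w :: "'v set \<Rightarrow> real"
 assumes w: "\<And>e. e \<in> edges G \<Longrightarrow> 0 < w e"
 shows "\<exists>c t. 0 < c \<and> (\<forall>i. 0 < t i) \<and> (\<forall>I. (\<Sum>M\<in>matchings G I. \<Prod>e\<in>M. w e) =
  (if good I then c * (\<Prod>i\<in>I. t i) else 0))"
proof -
 obtain g where g: "\<forall>x\<in>verts G. 0 < g x" "\<forall>x\<in>verts G - {r}. w {x, par x} = g x * g (par x)" using gauge[of w] w by blast
 define c where "c = (\<Prod>v\<in>internal G. g v)"
 define t where "t = (\<lambda>i. if i < length (bdry G) then g (bdry G ! i) else 1)"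
 have "0 < c" unfolding c_def using g(1) internalD by (intro prod_pos) auto
 moreover have "0 < t i" for i using g(1) bdry_sub nth_mem[of i "bdry G"] by (auto simp: t_def subset_iff)
 moreover have "(\<Sum>M\<in>matchings G I. \<Prod>e\<in>M. w e) =
  (if good I then c * (\<Prod>i\<in>I. t i) else 0)" for I
 proof -
  have W: "(\<Prod>e\<in>up_edges U. w e) = c * (\<Prod>i\<in>I. t i)" if U: "up_matching U" "up_boundary U = I" for U
  proof -
   have Usub: "U \<subseteq> verts G - {r}" using U by (simp add: up_matching_def)
   have "(\<Prod>e\<in>up_edges U. w e) = (\<Prod>x\<in>U. w {x, par x})"
    unfolding up_edges_def using inj_on_subset[OF up_edge_inj Usub] by (simp add: prod.reindex)
   also have "\<dots> = (\<Prod>x\<in>U. g x * g (par x))" using g(2) Usub by (intro prod.cong refl) auto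
   also have "\<dots> = c * (\<Prod>i\<in>up_boundary U. g (bdry G ! i))" unfolding c_def by (rule prod_gauge[OF U(1)])
   also have "(\<Prod>i\<in>up_boundary U. g (bdry G ! i)) = (\<Prod>i\<in>I. t i)"
    unfolding U(2)[symmetric] by (intro prod.cong refl) (auto simp: t_def up_boundary_def)
   finally show ?thesis .
  qed
  have "(\<Sum>M\<in>matchings G I. \<Prod>e\<in>M. w e) =
   (\<Sum>U | up_matching U \<and> up_boundary U = I. \<Prod>e\<in>up_edges U. w e)"
   using matchings_bij by (rule sum.reindex_bij_betw[symmetric])
  also have "\<dots> = (\<Sum>U | up_matching U \<and> up_boundary U = I. c * (\<Prod>i\<in>I. t i))"
   using W by (intro sum.cong refl) auto
  also have "\<dots> = (if good I then c * (\<Prod>i\<in>I. t i) else 0)"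
  proof (cases "good I")
   case True
   thus ?thesis by (simp add: good_up_matching)
  next
   case False
   hence "{U. up_matching U \<and> up_boundary U = I} = {}" using up_boundary_good by blast
   thus ?thesis using False by (simp only: sum.empty if_False)
  qed
  finally show ?thesis .
 qed
 ultimately show ?thesis by blast
qed

lemma good_iff_matching: "good I \<longleftrightarrow> (\<exists>M. almost_perfect_matching G M \<and> matching_boundary G M = I)"
proof
 assume "good I"
 then obtain U where "up_matching U" "up_boundary U = I" using good_up_matching by blast
 thus "\<exists>M. almost_perfect_matching G M \<and> matching_boundary G M = I"
  using matchings_bij[of I] by (auto simp: bij_betw_def)
next
 assume "\<exists>M. almost_perfect_matching G M \<and> matching_boundary G M = I"
 then obtain U where "up_matching U" "up_boundary U = I" using matchings_bij[of I] by (auto simp: bij_betw_def)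
 thus "good I" using up_boundary_good by blast
qed

end

section \<open>Exchange of bases and partition into bases\<close>

lemma partition_with_sizes:
 assumes "finite C" "finite S" "(\<Sum>c\<in>C. f c) = card S"
 shows "\<exists>A. (\<forall>c\<in>C. A c \<subseteq> S \<and> card (A c) = f c) \<and> (\<forall>s\<in>S. \<exists>!c. c \<in> C \<and> s \<in> A c)"
 using assms
proof (induction C arbitrary: S rule: finite_induct)
 case empty
 thus ?case by simp
next
 case (insert c C)
 have "f c \<le> card S" using insert by simp
 then obtain T where T: "T \<subseteq> S" "card T = f c" by (metis obtain_subset_with_card_n)
 have finT: "finite T" using T insert.prems finite_subset by blast
 have "(\<Sum>c\<in>C. f c) = card (S - T)" using insert T finT by (simp add: card_Diff_subset)
 hence "\<exists>A. (\<forall>c\<in>C. A c \<subseteq> S - T \<and> card (A c) = f c) \<and> (\<forall>s\<in>S - T. \<exists>!c. c \<in> C \<and> s \<in> A c)"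
  using insert.prems by (intro insert.IH) simp_all
 then obtain A where A0: "\<forall>c\<in>C. A c \<subseteq> S - T \<and> card (A c) = f c" "\<forall>s\<in>S - T. \<exists>!c. c \<in> C \<and> s \<in> A c"
  by (elim exE conjE)
 note A = bspec[OF A0(1)] bspec[OF A0(2)]
 define A' where "A' = A(c := T)"
 have A'c: "A' c = T" and A'C: "\<And>c'. c' \<in> C \<Longrightarrow> A' c' = A c'" using insert.hyps by (auto simp: A'_def)
 show ?case
 proof (intro exI[of _ A'] conjI ballI)
  fix c' assume c': "c' \<in> insert c C"
  have "A' c' \<subseteq> S \<and> card (A' c') = f c'"
  proof (cases "c' = c")
   case True
   thus ?thesis using T A'c by simp
  next
   case False
   hence "c' \<in> C" using c' by simp
   thus ?thesis using A(1)[of c'] A'C[of c'] by auto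
  qed
  thus "A' c' \<subseteq> S" "card (A' c') = f c'" by auto
 next
  fix s assume s: "s \<in> S"
  show "\<exists>!c'. c' \<in> insert c C \<and> s \<in> A' c'"
  proof (cases "s \<in> T")
   case True
   have "c' = c" if "c' \<in> insert c C" "s \<in> A' c'" for c'
    using that True A(1)[of c'] A'C[of c'] by auto
   thus ?thesis using True A'c by (intro ex1I[of _ c]) auto
  next
   case False
   hence "\<exists>!c. c \<in> C \<and> s \<in> A c" using A(2)[of s] s by simp
   then obtain c' where c': "c' \<in> C \<and> s \<in> A c'" "\<forall>c''. c'' \<in> C \<and> s \<in> A c'' \<longrightarrow> c'' = c'" by (rule ex1E)
   show ?thesis
   proof (rule ex1I[of _ c'])
    show "c' \<in> insert c C \<and> s \<in> A' c'" using c'(1) A'C[of c'] by simp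
    fix c'' assume "c'' \<in> insert c C \<and> s \<in> A' c''"
    hence "c'' \<in> C \<and> s \<in> A c''" using A'C[of c''] A'c False by auto
    thus "c'' = c'" using c'(2) by simp
   qed
  qed
 qed
qed

context rooted_plabic
begin

text \<open>Flip a matching along the path from the root to a leaf; the favourite child of a vertex is
 matched to it unless the vertex is matched upwards.\<close>

lemma basis_exchange:
 assumes j: "j < length (bdry G)" "j \<noteq> ri"
 shows "\<exists>I. good I \<and> ri \<in> I \<and> j \<notin> I \<and> good (insert j (I - {ri}))"
proof -
 define b where "b = bdry G ! j"
 have b: "b \<in> set (bdry G)" "b \<noteq> r" "b \<in> verts G" using j ri_iff bdry_sub by (auto simp: b_def)
 \<comment> \<open>The favourite child leads towards \<open>b\<close> whenever \<open>b\<close> lies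
   below.\<close>
 define fav where "fav = (\<lambda>v. SOME c. c \<in> ch v \<and> (b \<in> desc v \<longrightarrow> b \<in> desc c))"
 have fav: "fav v \<in> ch v" "b \<in> desc v \<Longrightarrow> b \<in> desc (fav v)" if v: "v \<in> internal G \<or> v = r" for v
 proof -
  have ne: "ch v \<noteq> {}" using v internal_ch wtop by auto
  have vV: "v \<in> verts G" using v internalD rV by blast
  have vb: "v \<noteq> b" using v internalD b by blast
  have "\<exists>c. c \<in> ch v \<and> (b \<in> desc v \<longrightarrow> b \<in> desc c)"
   using ne desc_unfold[OF vV] vb by auto
  from someI_ex[OF this] show "fav v \<in> ch v" "b \<in> desc v \<Longrightarrow> b \<in> desc (fav v)" unfolding fav_def by auto
 qed
 have ex: "\<exists>s. s r = s0 \<and> (\<forall>x\<in>verts G - {r}. s x = (\<not> s (par x) \<and> x = fav (par x)))" for s0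
  by (rule recursion[of s0 "\<lambda>x sp. \<not> sp \<and> x = fav (par x)"])
 \<comment> \<open>\<open>s x\<close> says that the edge above \<open>x\<close> is matched. The
   value at the root is fictitious: with \<open>False\<close> the root is matched to
   \<open>wtop\<close>, with \<open>True\<close> it is left uncovered.\<close>
 obtain s where s: "s r = False" "\<And>x. x \<in> verts G - {r} \<Longrightarrow> s x = (\<not> s (par x) \<and> x = fav (par x))"
  using ex[of False] by blast
 obtain s' where s': "s' r = True" "\<And>x. x \<in> verts G - {r} \<Longrightarrow> s' x = (\<not> s' (par x) \<and> x = fav (par x))"
  using ex[of True] by blast
 have matching: "up_matching {x \<in> verts G - {r}. t x}"
  if t: "\<And>x. x \<in> verts G - {r} \<Longrightarrow> t x = (\<not> t (par x) \<and> x = fav (par x))" for t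
  unfolding up_matching_def
 proof (intro conjI ballI)
  fix v assume v: "v \<in> internal G"
  have "ch v \<inter> {x \<in> verts G - {r}. t x} = (if t v then {} else {fav v})"
   using fav(1)[of v] v t chD[of _ v] by auto
  thus "card (ch v \<inter> {x \<in> verts G - {r}. t x}) + of_bool (v \<in> {x \<in> verts G - {r}. t x}) = 1"
   using internalD[OF v] by auto
 qed auto
 have par_ok: "par x \<in> internal G \<or> par x = r" if x: "x \<in> verts G - {r}" for x
 proof -
  have "x \<in> ch (par x)" using x by (simp add: ch_def)
  thus ?thesis using bdry_no_ch[of "par x"] par_in[OF x] by (auto simp: internal_def)
 qed
 have fav_unique: "x = fav (par x)" if x: "x \<in> verts G - {r}" "b \<in> desc x" for x
 proof -
  have xc: "x \<in> ch (par x)" using x by (simp add: ch_def)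
  hence "b \<in> desc (par x)" using desc_child[OF xc] par_in[OF x(1)] x(2) by blast
  thus ?thesis using fav[OF par_ok[OF x(1)]] xc x(2) desc_disjoint by blast
 qed
 \<comment> \<open>Along the path from the root to \<open>b\<close> the two matchings are
   complementary, and the colours tell which edges belong to which; off the path they coincide,
   because a vertex hanging off the path is not a favourite child.\<close>
 have path: "(b \<in> desc x \<longrightarrow> s x = (x \<in> white G) \<and> s' x = (x \<notin> white G)) \<and> (b \<notin> desc x \<longrightarrow> s x = s' x)"
  if "x \<in> verts G" for x
  using that
 proof (induction "dep x" arbitrary: x rule: less_induct)
  case less
  show ?case
  proof (cases "x = r")
   case True
   thus ?thesis using s(1) s'(1) bdry_not_white[OF r_bdry] b desc_root by simp
  next
   case False
   hence x: "x \<in> verts G - {r}" using less by simp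
   have xc: "x \<in> ch (par x)" using x by (simp add: ch_def)
   have IH: "(b \<in> desc (par x) \<longrightarrow> s (par x) = (par x \<in> white G) \<and> s' (par x) = (par x \<notin> white G)) \<and>
    (b \<notin> desc (par x) \<longrightarrow> s (par x) = s' (par x))"
    using less(1)[of "par x"] dep_par[OF x] par_in[OF x] by simp
   show ?thesis
   proof (cases "b \<in> desc x")
    case True
    hence "b \<in> desc (par x)" using desc_child[OF xc] par_in[OF x] by blast
    thus ?thesis using True fav_unique[OF x True] IH s(2)[OF x] s'(2)[OF x] bip[OF x] by auto
   next
    case False
    show ?thesis
    proof (cases "b \<in> desc (par x)")
     case True
     hence "x \<noteq> fav (par x)" using fav(2)[OF par_ok[OF x]] False by auto
     thus ?thesis using False s(2)[OF x] s'(2)[OF x] by simp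
    next
     case nf: False
     hence "s x = s' x" using IH s(2)[OF x] s'(2)[OF x] by simp
     thus ?thesis using False by simp
    qed
   qed
  qed
 qed
 define U where "U = {x \<in> verts G - {r}. s x}"
 define U' where "U' = {x \<in> verts G - {r}. s' x}"
 have UU: "up_matching U" "up_matching U'" unfolding U_def U'_def using s(2) s'(2) by (intro matching; blast)+
 have "wtop \<in> U" "wtop \<notin> U'"
  using s(2)[OF wtop(1)] s'(2)[OF wtop(1)] s(1) s'(1) wtop fav(1)[of r] ch_r chD[OF wtop(2)] by (auto simp: U_def U'_def)
 hence ri: "ri \<in> up_boundary U" "ri \<notin> up_boundary U'" using ri by (auto simp: up_boundary_def)
 have bw: "b \<notin> U" "b \<in> U'" using path[OF b(3)] desc_refl[OF b(3)] bdry_not_white[OF b(1)] b by (auto simp: U_def U'_def)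
 hence j': "j \<notin> up_boundary U" "j \<in> up_boundary U'" using j by (auto simp: up_boundary_def b_def)
 have eqU: "i \<in> up_boundary U \<longleftrightarrow> i \<in> up_boundary U'" if i: "i \<noteq> ri" "i \<noteq> j" for i
 proof (cases "i < length (bdry G)")
  case True
  let ?x = "bdry G ! i"
  have x: "?x \<in> set (bdry G)" "?x \<noteq> r" "?x \<in> verts G" using True ri_iff i bdry_sub by auto
  have "desc ?x = {?x}" using desc_no_ch[OF x(3)] bdry_no_ch[OF x(1,2)] by simp
  hence "b \<notin> desc ?x" using i j True nth_eq_iff_index_eq[OF bdry_distinct] by (auto simp: b_def)
  hence "s ?x = s' ?x" using path[OF x(3)] by simp
  thus ?thesis using i by (auto simp: up_boundary_def U_def U'_def)
 qed (auto simp: up_boundary_def)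
 have "up_boundary U' = insert j (up_boundary U - {ri})"
 proof (rule Set.set_eqI)
  fix i
  show "i \<in> up_boundary U' \<longleftrightarrow> i \<in> insert j (up_boundary U - {ri})"
   using eqU[of i] ri j' by (cases "i = ri"; cases "i = j") simp_all
 qed
 thus ?thesis using up_boundary_good[OF UU(1)] up_boundary_good[OF UU(2)] ri j' by (intro exI[of _ "up_boundary U"]) simp
qed

lemma exists_good: "\<exists>I. good I"
proof -
 obtain i where "i \<in> D wtop" using D_nonempty[OF wtop(1)] by blast
 thus ?thesis using basis_exchange[of i] D_wtop by auto
qed

lemma card_D_internal: "v \<in> internal G \<Longrightarrow> card (D v) = (\<Sum>c\<in>ch v. card (D c))"
 using card_D_Int[of v UNIV] by simp

text \<open>Balancedness says that the number of colours still to be used below an edge is feasible, so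
 the colours can be distributed from the root downwards.\<close>

lemma basis_partition:
 assumes bal: "\<And>x. x \<in> verts G - {r} \<Longrightarrow> m * kap x < card (D x) \<and> card (D x) \<le> m * (kap x + 1)"
  and n: "length (bdry G) = m * k_stat G + 1"
 shows "\<exists>I. (\<forall>l<m. good (I l) \<and> ri \<notin> I l) \<and> (\<forall>i<length (bdry G). i \<noteq> ri \<longrightarrow> (\<exists>!l. l < m \<and> i \<in> I l))"
proof -
 \<comment> \<open>If \<open>m\<close> good sets partition \<open>D x\<close>, then
   \<open>g x\<close> of them meet it in \<open>kap x + 1\<close> elements and the others in
   \<open>kap x\<close>.\<close>
 define g where "g = (\<lambda>x. card (D x) - m * kap x)"
 have g: "card (D x) = m * kap x + g x" "1 \<le> g x" "g x \<le> m" if "x \<in> verts G - {r}" for x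
  using bal[OF that] by (auto simp: g_def algebra_simps)
 \<comment> \<open>The number of colours whose matching uses the edge above \<open>x\<close>; by
   \<open>up_boundary_card\<close> the larger count means a matched edge below a white vertex but an
   unmatched one above it.\<close>
 define f where "f = (\<lambda>x. if x \<in> white G then m - g x else g x)"
 have f_le: "f x \<le> m" if "x \<in> verts G - {r}" for x using g[OF that] by (auto simp: f_def)
 have chV: "c \<in> verts G - {r}" if "c \<in> ch v" for c v using chD[OF that] by simp
 have f_sum: "(\<Sum>c\<in>ch v. f c) = m - f v" if v: "v \<in> internal G" for v
 proof -
  have vV: "v \<in> verts G - {r}" using internalD[OF v] by simp
  have "m * kap v + g v = (\<Sum>c\<in>ch v. m * kap c + g c)"
   using card_D_internal[OF v] g(1)[OF vV] g(1)[OF chV] by simp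
  hence gs: "m * kap v + g v = m * (\<Sum>c\<in>ch v. kap c) + (\<Sum>c\<in>ch v. g c)"
   by (simp add: sum.distrib sum_distrib_left)
  show ?thesis
  proof (cases "v \<in> white G")
   case True
   have "(\<Sum>c\<in>ch v. f c) = (\<Sum>c\<in>ch v. g c)" using bip_ch[of _ v] True by (intro sum.cong refl) (simp add: f_def)
   thus ?thesis using gs g[OF vV] kap_white[OF True] True by (simp add: f_def)
  next
   case False
   hence bl: "v \<in> black_internal G" using v by (simp add: black_internal_def)
   have "(\<Sum>c\<in>ch v. f c) = (\<Sum>c\<in>ch v. m - g c)" using bip_ch[of _ v] False by (intro sum.cong refl) (simp add: f_def)
   also have "\<dots> = (\<Sum>c\<in>ch v. m) - (\<Sum>c\<in>ch v. g c)" using g(3)[OF chV] by (intro sum_subtractf_nat) simp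
   finally have fs: "(\<Sum>c\<in>ch v. f c) = m * card (ch v) - (\<Sum>c\<in>ch v. g c)" by (simp add: mult.commute)
   have "m * (kap v + 1) + g v = m * (\<Sum>c\<in>ch v. kap c) + (\<Sum>c\<in>ch v. g c) + m" using gs by simp
   hence "m * (\<Sum>c\<in>ch v. kap c) + m * card (ch v) + g v = m * (\<Sum>c\<in>ch v. kap c) + (\<Sum>c\<in>ch v. g c) + m"
    unfolding kap_black[OF bl] by (simp add: distrib_left)
   hence "m * card (ch v) + g v = (\<Sum>c\<in>ch v. g c) + m" by simp
   thus ?thesis using fs g[OF vV] False by (simp add: f_def)
  qed
 qed
 have f_top: "f wtop = 0"
 proof -
  have "card (D wtop) = m * k_stat G" using D_wtop n ri by simp
  hence "g wtop = m" unfolding g_def k_stat_kap by simp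
  thus ?thesis using wtop by (simp add: f_def)
 qed
 \<comment> \<open>\<open>K\<close> is the set of colours in use above \<open>v\<close>. Every other
   colour has to be handed to exactly one child, and \<open>f_sum\<close> shows that the required
   sizes add up.\<close>
 define asg where "asg = (\<lambda>v K. SOME A. (\<forall>c\<in>ch v. A c \<subseteq> {..<m} - K \<and> card (A c) = f c) \<and>
  (\<forall>s\<in>{..<m} - K. \<exists>!c. c \<in> ch v \<and> s \<in> A c))"
 have asg: "(\<forall>c\<in>ch v. asg v K c \<subseteq> {..<m} - K \<and> card (asg v K c) = f c) \<and>
  (\<forall>s\<in>{..<m} - K. \<exists>!c. c \<in> ch v \<and> s \<in> asg v K c)" if v: "v \<in> internal G" "K \<subseteq> {..<m}" "card K = f v" for v K
 proof -
  have "card ({..<m} - K) = m - f v" using v by (simp add: card_Diff_subset finite_subset)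
  hence "\<exists>A. (\<forall>c\<in>ch v. A c \<subseteq> {..<m} - K \<and> card (A c) = f c) \<and> (\<forall>s\<in>{..<m} - K. \<exists>!c. c \<in> ch v \<and> s \<in> A c)"
   using f_sum[OF v(1)] by (intro partition_with_sizes) simp_all
  from someI_ex[OF this] show ?thesis unfolding asg_def .
 qed
 obtain col where col: "\<And>x. x \<in> verts G - {r} \<Longrightarrow> col x = (if par x = r then {} else asg (par x) (col (par x)) x)"
  using recursion[of "{}" "\<lambda>x K. if par x = r then {} else asg (par x) K x"] by blast
 have par_int: "par x \<in> internal G" if x: "x \<in> verts G - {r}" "par x \<noteq> r" for x
 proof -
  have "x \<in> ch (par x)" using x by (simp add: ch_def)
  thus ?thesis using bdry_no_ch[of "par x"] par_in[OF x(1)] x(2) by (auto simp: internal_def)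
 qed
 have col_ok: "col x \<subseteq> {..<m} \<and> card (col x) = f x" if "x \<in> verts G - {r}" for x
  using that
 proof (induction "dep x" arbitrary: x rule: less_induct)
  case less
  show ?case
  proof (cases "par x = r")
   case True
   hence "x = wtop" using less(2) ch_r by (auto simp: ch_def)
   thus ?thesis using col[OF less(2)] True f_top by simp
  next
   case False
   have p: "par x \<in> verts G - {r}" using False par_in[OF less(2)] by simp
   have xc: "x \<in> ch (par x)" using less(2) by (simp add: ch_def)
   have "col (par x) \<subseteq> {..<m} \<and> card (col (par x)) = f (par x)"
    using less(1)[of "par x"] dep_par[OF less(2)] p by simp
   hence "asg (par x) (col (par x)) x \<subseteq> {..<m} - col (par x) \<and> card (asg (par x) (col (par x)) x) = f x"
    using bspec[OF conjunct1[OF asg[OF par_int[OF less(2) False]]] xc] by simp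
   thus ?thesis using col[OF less(2)] False by auto
  qed
 qed
 define U where "U = (\<lambda>l. {x \<in> verts G - {r}. l \<in> col x})"
 have UM: "up_matching (U l)" if l: "l < m" for l
  unfolding up_matching_def
 proof (intro conjI ballI)
  show "U l \<subseteq> verts G - {r}" by (auto simp: U_def)
  fix v assume v: "v \<in> internal G"
  have vV: "v \<in> verts G - {r}" using internalD[OF v] by simp
  note A = asg[OF v conjunct1[OF col_ok[OF vV]] conjunct2[OF col_ok[OF vV]]]
  have colc: "col c = asg v (col v) c" if "c \<in> ch v" for c
   using col[OF chV[OF that]] chD[OF that] vV by simp
  have chU: "ch v \<inter> U l = {c \<in> ch v. l \<in> asg v (col v) c}" using colc chV by (auto simp: U_def)
  show "card (ch v \<inter> U l) + of_bool (v \<in> U l) = 1"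
  proof (cases "l \<in> col v")
   case True
   hence "\<forall>c\<in>ch v. l \<notin> asg v (col v) c" using conjunct1[OF A] by blast
   hence "ch v \<inter> U l = {}" unfolding chU by simp
   thus ?thesis using True vV by (simp add: U_def)
  next
   case False
   hence "\<exists>!c. c \<in> ch v \<and> l \<in> asg v (col v) c" using conjunct2[OF A] l by simp
   then obtain c where c: "c \<in> ch v \<and> l \<in> asg v (col v) c" and u: "\<forall>c'. c' \<in> ch v \<and> l \<in> asg v (col v) c' \<longrightarrow> c' = c"
    by (rule ex1E)
   have "ch v \<inter> U l = {c}"
   proof (intro Set.set_eqI iffI)
    fix c' assume "c' \<in> ch v \<inter> U l"
    thus "c' \<in> {c}" using u[THEN spec, of c'] unfolding chU by simp
   next
    fix c' assume "c' \<in> {c}"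
    thus "c' \<in> ch v \<inter> U l" using c unfolding chU by simp
   qed
   thus ?thesis using False by (simp add: U_def)
  qed
 qed
 have "ri \<notin> up_boundary (U l)" for l
  using col[OF wtop(1)] chD[OF wtop(2)] by (auto simp: up_boundary_def U_def)
 moreover have "\<exists>!l. l < m \<and> i \<in> up_boundary (U l)" if i: "i < length (bdry G)" "i \<noteq> ri" for i
 proof -
  let ?b = "bdry G ! i"
  have b: "?b \<in> set (bdry G)" "?b \<noteq> r" using i ri_iff[OF i(1)] by simp_all
  hence bV: "?b \<in> verts G - {r}" using bdry_sub by blast
  have "f ?b = 1" using bdry_not_white[OF b(1)] D_leaf[OF i] kap_leaf[OF b] by (simp add: f_def g_def)
  then obtain l where l: "col ?b = {l}" "l < m" using col_ok[OF bV] by (auto simp: card_1_singleton_iff)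
  have "i \<in> up_boundary (U l') \<longleftrightarrow> l' = l" for l' using i bV l by (auto simp: up_boundary_def U_def)
  thus ?thesis using l(2) by auto
 qed
 ultimately show ?thesis using up_boundary_good[OF UM]
  by (intro exI[of _ "\<lambda>l. up_boundary (U l)"] conjI allI impI) simp_all
qed

end

section \<open>Planarity and signs of minors\<close>

definition set_minor :: "nat \<Rightarrow> (nat \<Rightarrow> nat \<Rightarrow> real) \<Rightarrow> nat set \<Rightarrow> real" where
 "set_minor k f I = det (mat k k (\<lambda>(a, b). f a (sorted_list_of_set I ! b)))"

lemma det_scale_columns:
 fixes h :: "nat \<Rightarrow> nat \<Rightarrow> real"
 shows "det (mat k k (\<lambda>(a, b). h a b * s b)) = det (mat k k (\<lambda>(a, b). h a b)) * (\<Prod>b<k. s b)"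
proof -
 have "det (mat k k (\<lambda>(a, b). h a b * s b)) = (\<Sum>p | p permutes {0..<k}. signof p * (\<Prod>i<k. h (p i) i * s i))"
  by (subst det_col[of _ k]) (auto intro!: sum.cong prod.cong simp: permutes_in_image[of _ "{0..<k}"])
 also have "\<dots> = (\<Sum>p | p permutes {0..<k}. signof p * (\<Prod>i<k. h (p i) i)) * (\<Prod>b<k. s b)"
  by (simp add: sum_distrib_right prod.distrib mult.assoc)
 also have "(\<Sum>p | p permutes {0..<k}. signof p * (\<Prod>i<k. h (p i) i)) = det (mat k k (\<lambda>(a, b). h a b))"
  by (subst det_col[of _ k]) (auto intro!: sum.cong prod.cong simp: permutes_in_image[of _ "{0..<k}"])
 finally show ?thesis .
qed

lemma det_zero_column:
 fixes A :: "real mat"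
 assumes "A \<in> carrier_mat n n" "j < n" "\<And>i. i < n \<Longrightarrow> A $$ (i, j) = 0"
 shows "det A = 0"
 unfolding laplace_expansion_column[OF assms(1,2)] using assms(3) by simp

text \<open>The new last row is the indicator of the class. Erasing the old entries of
  \<open>Y\<close> makes the two parts independent of each other, so that one column from each may
  now occur in a nonzero minor.\<close>

definition split_cols :: "nat \<Rightarrow> nat set \<Rightarrow> nat set \<Rightarrow> (nat \<Rightarrow> nat \<Rightarrow> real) \<Rightarrow> nat \<Rightarrow> nat \<Rightarrow> real" where
 "split_cols k X Y f a j =
   (if a = k then of_bool (j \<in> X \<union> Y)
   else if j \<in> Y then 0 else if \<forall>t\<in>X \<union> Y. t < j then - f a j else f a j)"

text \<open>Splitting a class of equal columns into two neighbouring classes, at the expense of one more row.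
 The sign of the columns to the right absorbs the sign of the expansion along the new row.\<close>

lemma set_minor_split:
 assumes I: "finite I" "card I = Suc k" and XY: "finite X" "finite Y" "X \<noteq> {}" "Y \<noteq> {}"
  and less: "\<And>x y. x \<in> X \<Longrightarrow> y \<in> Y \<Longrightarrow> x < y"
  and convex: "\<And>j. j \<in> I - (X \<union> Y) \<Longrightarrow> (\<forall>t\<in>X \<union> Y. t < j) \<or> (\<forall>t\<in>X \<union> Y. j < t)"
  and const: "\<And>a j j'. a < k \<Longrightarrow> j \<in> X \<union> Y \<Longrightarrow> j' \<in> X \<union> Y \<Longrightarrow> f a j = f a j'"
 shows "set_minor (Suc k) (split_cols k X Y f) I =
  (if card (I \<inter> X) \<le> 1 \<and> card (I \<inter> Y) \<le> 1 \<and> I \<inter> (X \<union> Y) \<noteq> {}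
   then set_minor k f (I - {Max (I \<inter> (X \<union> Y))}) else 0)"
proof -
 let ?T = "X \<union> Y" and ?f = "split_cols k X Y f"
 define xs where "xs = sorted_list_of_set I"
 have xs: "length xs = Suc k" "distinct xs" "set xs = I" "sorted xs" using I by (auto simp: xs_def)
 define M where "M = mat (Suc k) (Suc k) (\<lambda>(a, b). ?f a (xs ! b))"
 have M: "M \<in> carrier_mat (Suc k) (Suc k)" by (simp add: M_def)
 have det: "set_minor (Suc k) ?f I = det M" by (simp add: set_minor_def M_def xs_def)
 have lap: "det M = (\<Sum>b<Suc k. M $$ (k, b) * cofactor M k b)" by (rule laplace_expansion_row[OF M]) simp
 have Mk: "M $$ (k, b) = of_bool (xs ! b \<in> ?T)" if "b < Suc k" for b using that by (simp add: M_def split_cols_def)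
 \<comment> \<open>Two indices from the same part give equal columns.\<close>
 have same: "det M = 0" if S: "S = X \<or> S = Y" and c: "\<not> card (I \<inter> S) \<le> 1" for S
 proof -
  have "finite (I \<inter> S)" using I by simp
  then obtain i i' where i: "i \<in> I \<inter> S" "i' \<in> I \<inter> S" "i \<noteq> i'"
   using c card_le_Suc0_iff_eq[of "I \<inter> S"] by auto
  obtain b b' where b: "b < Suc k" "xs ! b = i" "b' < Suc k" "xs ! b' = i'"
   using i xs by (metis IntD1 in_set_conv_nth)
  have "?f a i = ?f a i'" if "a < Suc k" for a
  proof (cases "a = k")
   case True
   thus ?thesis using i S by (auto simp: split_cols_def)
  next
   case False
   hence a: "a < k" using that by simp
   show ?thesis
   proof (cases "S = Y")
    case True
    thus ?thesis using i a by (simp add: split_cols_def)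
   next
    case False
    hence iX: "i \<in> X" "i' \<in> X" using i S by auto
    moreover have "i \<notin> Y" "i' \<notin> Y" using less iX by blast+
    moreover have "f a i = f a i'" using const[OF a] iX by blast
    ultimately show ?thesis using a iX by (auto simp: split_cols_def)
   qed
  qed
  hence "col M b = col M b'" using b by (intro eq_vecI) (auto simp: M_def)
  moreover have "b \<noteq> b'" using b i by blast
  ultimately show ?thesis using det_identical_columns[OF M] b by blast
 qed
 show ?thesis
 proof (cases "card (I \<inter> X) \<le> 1 \<and> card (I \<inter> Y) \<le> 1 \<and> I \<inter> ?T \<noteq> {}")
  case False
  have "det M = 0"
  proof (cases "I \<inter> ?T = {}")
   case True
   have "M $$ (k, b) = 0" if "b < Suc k" for b
   proof -
    have "xs ! b \<in> I" using xs that by (metis nth_mem)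
    thus ?thesis using Mk[OF that] True by auto
   qed
   thus ?thesis unfolding lap by simp
  next
   case ne: False
   thus ?thesis using False same[of X] same[of Y] by auto
  qed
  thus ?thesis unfolding det using False by (simp only: if_False)
 next
  case True
  define z where "z = Max (I \<inter> ?T)"
  have finT: "finite (I \<inter> ?T)" using I by simp
  have z: "z \<in> I" "z \<in> ?T" using Max_in[OF finT] True by (auto simp: z_def)
  have zmax: "i \<le> z" if "i \<in> I" "i \<in> ?T" for i using Max_ge[OF finT] that by (simp add: z_def)
  have uniq: "i = i'" if "S = X \<or> S = Y" "i \<in> I \<inter> S" "i' \<in> I \<inter> S" for S i i'
  proof -
   have "card (I \<inter> S) \<le> Suc 0" using True that(1) by auto
   thus ?thesis using card_le_Suc0_iff_eq[of "I \<inter> S"] I that by auto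
  qed
  obtain l1 l2 where l: "xs = l1 @ z # l2" using z xs by (metis split_list)
  define c0 where "c0 = length l1"
  have c0: "c0 < Suc k" "xs ! c0 = z" using xs l by (auto simp: c0_def nth_append)
  have ys: "sorted_list_of_set (I - {z}) = l1 @ l2"
  proof -
   have "sorted_list_of_set (I - {z}) = remove1 z xs" using I by (simp add: xs_def sorted_list_of_set_remove)
   also have "\<dots> = l1 @ l2" using xs l by (simp add: remove1_append)
   finally show ?thesis .
  qed
  have l1z: "i < z" if "i \<in> set l1" for i using that xs l by (auto simp: sorted_append less_le)
  have l2z: "z < i" if "i \<in> set l2" for i using that xs l by (auto simp: sorted_append less_le)
  \<comment> \<open>In the expansion along the new row only the largest index \<open>z\<close> of
    the class counts: deleting another one leaves the column of \<open>z\<close>, which then belongs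
    to \<open>Y\<close> and is zero in the old rows.\<close>
  have other: "M $$ (k, b) * cofactor M k b = 0" if b: "b < Suc k" "b \<noteq> c0" for b
  proof (cases "xs ! b \<in> ?T")
   case True
   have ib: "xs ! b \<in> I" using xs b by (metis nth_mem)
   have "xs ! b \<noteq> z" using b c0 xs nth_eq_iff_index_eq by metis
   hence zY: "z \<in> Y" and "xs ! b \<in> X"
    using uniq[of X "xs ! b" z] uniq[of Y "xs ! b" z] zmax[OF ib True] True z ib less[of z "xs ! b"] by auto
   define j where "j = (if c0 < b then c0 else c0 - 1)"
   have j: "j < k" "(if j < b then j else Suc j) = c0" using b c0 by (auto simp: j_def)
   have "det (mat_delete M k b) = 0"
   proof (rule det_zero_column)
    show "mat_delete M k b \<in> carrier_mat k k" using mat_delete_carrier[OF M, of k b] by simp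
    show "j < k" by (rule j(1))
    fix i assume i: "i < k"
    have "mat_delete M k b $$ (i, j) = M $$ (i, c0)" unfolding mat_delete_def using M i j by simp
    also have "\<dots> = 0" using i c0 zY by (simp add: M_def split_cols_def)
    finally show "mat_delete M k b $$ (i, j) = 0" .
   qed
   thus ?thesis by (simp add: cofactor_def)
  qed (use Mk[OF b(1)] in simp)
  have "det M = (\<Sum>b\<in>{c0}. M $$ (k, b) * cofactor M k b)"
   unfolding lap using other c0 by (intro sum.mono_neutral_right) auto
  note d = this
  have detM: "det M = (-1) ^ (k + c0) * det (mat_delete M k c0)"
  proof -
   have "M $$ (k, c0) = 1" using Mk[OF c0(1)] z(2) unfolding c0(2) by (simp only: of_bool_eq)
   thus ?thesis using d by (simp add: cofactor_def)
  qed
  have "mat_delete M k c0 = mat k k (\<lambda>(a, b). f a ((l1 @ l2) ! b) * (if b < c0 then 1 else -1))"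
  proof (rule eq_matI)
   fix a b assume "a < dim_row (mat k k (\<lambda>(a, b). f a ((l1 @ l2) ! b) * (if b < c0 then 1 else -1)))"
    "b < dim_col (mat k k (\<lambda>(a, b). f a ((l1 @ l2) ! b) * (if b < c0 then 1 else -1)))"
   hence ab: "a < k" "b < k" by auto
   have len: "length l1 + length l2 = k" using xs l by simp
   have nthxs: "xs ! (if b < c0 then b else Suc b) = (l1 @ l2) ! b"
    unfolding l by (auto simp: nth_append c0_def Suc_diff_le)
   have mem: "(l1 @ l2) ! b \<in> (if b < c0 then set l1 else set l2)"
    using ab len by (auto simp: nth_append c0_def)
   have "mat_delete M k c0 $$ (a, b) = ?f a ((l1 @ l2) ! b)"
    unfolding mat_delete_def using M ab nthxs by (auto simp: M_def)
   also have "\<dots> = f a ((l1 @ l2) ! b) * (if b < c0 then 1 else -1)"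
   proof (cases "b < c0")
    case True
    let ?i = "(l1 @ l2) ! b"
    have i: "?i \<in> I" "?i < z" using mem True l1z xs l by auto
    have "?i \<notin> Y"
    proof
     assume Y: "?i \<in> Y"
     from z(2) show False
     proof
      assume "z \<in> X"
      thus False using less[of z ?i] Y i(2) by simp
     next
      assume "z \<in> Y"
      thus False using uniq[of Y ?i z] i z(1) Y by simp
     qed
    qed
    moreover have "\<not> (\<forall>t\<in>?T. t < ?i)" using i(2) z(2) by (meson less_asym)
    ultimately show ?thesis using ab True by (simp only: split_cols_def if_False) simp
   next
    case False
    let ?i = "(l1 @ l2) ! b"
    have i: "?i \<in> I" "z < ?i" using mem False l2z xs l by auto
    have nT: "?i \<notin> ?T" using zmax[of ?i] i by auto
    hence "\<forall>t\<in>?T. t < ?i" using convex[of ?i] i z(2) by (meson DiffI less_asym)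
    thus ?thesis using ab False nT by (simp add: split_cols_def)
   qed
   finally show "mat_delete M k c0 $$ (a, b) = mat k k (\<lambda>(a, b). f a ((l1 @ l2) ! b) * (if b < c0 then 1 else -1)) $$ (a, b)"
    using ab by simp
  qed (use mat_delete_carrier[OF M, of k c0] in auto)
  hence "det (mat_delete M k c0) = det (mat k k (\<lambda>(a, b). f a ((l1 @ l2) ! b))) * (\<Prod>b<k. if b < c0 then 1 else -1)"
   by (simp add: det_scale_columns)
  \<comment> \<open>The \<open>k - c0\<close> columns right of \<open>z\<close> carry a minus sign,
    which together with the cofactor sign of position \<open>(k, c0)\<close> gives
    \<open>(-1) ^ (2 * k)\<close>.\<close>
  also have "(\<Prod>b<k. if b < c0 then 1 else (-1 :: real)) = (-1) ^ (k - c0)"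
  proof -
   have "(\<Prod>b<k. if b < c0 then 1 else (-1 :: real)) = (\<Prod>b\<in>{c0..<k}. -1)"
    by (intro prod.mono_neutral_cong_right) auto
   thus ?thesis by simp
  qed
  also have "det (mat k k (\<lambda>(a, b). f a ((l1 @ l2) ! b))) = set_minor k f (I - {z})"
   by (simp add: set_minor_def ys)
  finally have "det M = ((-1) ^ (k + c0) * (-1) ^ (k - c0)) * set_minor k f (I - {z})" unfolding detM by simp
  also have "(-1) ^ (k + c0) * (-1) ^ (k - c0) = (1 :: real)"
  proof -
   have "k + c0 + (k - c0) = 2 * k" using c0 by simp
   thus ?thesis by (metis power_add power_minus1_even)
  qed
  finally show ?thesis unfolding det z_def[symmetric] if_P[OF True] by simp
 qed
qed

text \<open>No four indices alternate between inside and outside: the set described by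
  \<open>P\<close> is an interval in the cyclic order.\<close>

definition noncrossing :: "nat \<Rightarrow> (nat \<Rightarrow> bool) \<Rightarrow> bool" where
 "noncrossing n P \<longleftrightarrow> (\<forall>i j k l. i < j \<longrightarrow> j < k \<longrightarrow> k < l \<longrightarrow> l < n \<longrightarrow> P i = P k \<longrightarrow> P j = P l \<longrightarrow> P i = P j)"

text \<open>With the root at index 0 no \<open>D x\<close> contains 0, and a cyclic interval that
  avoids 0 is an interval in the linear order, as sorted minors require.\<close>

locale planar_rooted_plabic = rooted_plabic G r par dep for G :: "'v plabic" and r par dep +
 assumes ri0: "ri = 0"
  and noncrossing: "x \<in> verts G - {r} \<Longrightarrow> noncrossing (length (bdry G)) (\<lambda>i. bdry G ! i \<in> desc x)"
begin

lemma D_convex: "x \<in> verts G - {r} \<Longrightarrow> i \<in> D x \<Longrightarrow> l \<in> D x \<Longrightarrow> i \<le> j \<Longrightarrow> j \<le> l \<Longrightarrow> j \<in> D x"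
proof (rule ccontr)
 assume x: "x \<in> verts G - {r}" and il: "i \<in> D x" "l \<in> D x" "i \<le> j" "j \<le> l" and j: "j \<notin> D x"
 have z: "0 \<notin> D x" using ri_notin_D[OF x] ri0 by simp
 have ln: "l < length (bdry G)" using il(2) by (simp add: D_def)
 have ne: "i \<noteq> 0" "i \<noteq> j" "j \<noteq> l" using il j z by metis+
 hence lt: "0 < i" "i < j" "j < l" using il by auto
 have "bdry G ! 0 \<notin> desc x" "bdry G ! i \<in> desc x" "bdry G ! j \<notin> desc x" "bdry G ! l \<in> desc x"
  using z j il ln lt by (auto simp: D_def)
 thus False
  using noncrossing[OF x, unfolded noncrossing_def, rule_format, OF lt ln] by simp
qed

lemma desc_comparable: "y \<in> desc x \<Longrightarrow> y \<in> desc v \<Longrightarrow> x \<in> desc v \<or> v \<in> desc x"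
proof (induction "dep y" arbitrary: y rule: less_induct)
 case less
 show ?case
 proof (cases "y = x \<or> y = v")
  case False
  hence "y \<in> verts G - {r}" "par y \<in> desc x" "par y \<in> desc v" using desc_par less by blast+
  thus ?thesis using less(1)[of "par y"] dep_par[of y] by simp
 qed (use less in auto)
qed

lemma D_disjoint_incomparable: "x \<notin> desc v \<Longrightarrow> v \<notin> desc x \<Longrightarrow> D x \<inter> D v = {}"
 using desc_comparable by (auto simp: D_def)

text \<open>An intermediate stage of the construction: \<open>\<kappa>\<close> is the part of
  \<open>kap\<close> produced so far, and \<open>R\<close> collects the intervals whose columns are
  still equal. Such a class can contribute at most one column to a nonzero minor, hence the second
  condition.\<close>

definition realizable :: "nat \<Rightarrow> ('v \<Rightarrow> nat) \<Rightarrow> nat set set \<Rightarrow> bool" where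
 "realizable K \<kappa> R \<longleftrightarrow> (\<exists>f. (\<forall>Q\<in>R. \<forall>a<K. \<forall>j\<in>Q. \<forall>j'\<in>Q. f a j = f a j') \<and>
   (\<forall>I\<subseteq>{..<length (bdry G)}. card I = K \<longrightarrow> set_minor K f I = of_bool
    ((tight \<kappa> I) \<and> (\<forall>Q\<in>R. card (I \<inter> Q) \<le> 1))))"

text \<open>Deleting the largest element of \<open>I\<close> in the class turns the conditions for
  the two parts into those for the whole class: sides that contain the class lose one element,
  disjoint sides lose none, and sides inside one part only demand at most one element. The
  hypothesis \<open>meets\<close> is there because the minor vanishes for sets that miss the
  class.\<close>

lemma realizable_split:
 assumes real: "realizable K \<kappa> (insert (X \<union> Y) R)"
  and XY: "X \<subseteq> {..<length (bdry G)}" "Y \<subseteq> {..<length (bdry G)}" "X \<noteq> {}" "Y \<noteq> {}"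
  and less: "\<And>x y. x \<in> X \<Longrightarrow> y \<in> Y \<Longrightarrow> x < y"
  and convT: "\<And>i j l. i \<in> X \<union> Y \<Longrightarrow> l \<in> X \<union> Y \<Longrightarrow> i \<le> j \<Longrightarrow> j \<le> l \<Longrightarrow> j \<in> X \<union> Y"
  and Q: "\<And>Q. Q \<in> R \<Longrightarrow> Q \<inter> (X \<union> Y) = {}"
   "\<And>Q i j l. Q \<in> R \<Longrightarrow> i \<in> Q \<Longrightarrow> l \<in> Q \<Longrightarrow> i \<le> j \<Longrightarrow> j \<le> l \<Longrightarrow> j \<in> Q"
  and cases: "\<And>x. x \<in> verts G - {r} \<Longrightarrow> X \<union> Y \<subseteq> D x \<or> ((D x \<subseteq> X \<or> D x \<subseteq> Y) \<and> \<kappa> x = 0) \<or> D x \<inter> (X \<union> Y) = {}"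
  and \<kappa>': "\<And>x. x \<in> verts G - {r} \<Longrightarrow> \<kappa>' x = \<kappa> x + of_bool (X \<union> Y \<subseteq> D x)"
  and meets: "\<And>I. I \<subseteq> {..<length (bdry G)} \<Longrightarrow> \<forall>x\<in>verts G - {r}. \<kappa>' x \<le> card (I \<inter> D x) \<Longrightarrow>
   \<forall>Q\<in>R. card (I \<inter> Q) \<le> 1 \<Longrightarrow> I \<inter> (X \<union> Y) \<noteq> {}"
 shows "realizable (Suc K) \<kappa>' (insert X (insert Y R))"
proof -
 let ?T = "X \<union> Y" and ?n = "length (bdry G)"
 let ?c = "\<lambda>\<kappa> R I. (tight \<kappa> I) \<and> (\<forall>Q\<in>R. card (I \<inter> Q) \<le> 1)"
 obtain f where f: "\<forall>Q\<in>insert ?T R. \<forall>a<K. \<forall>j\<in>Q. \<forall>j'\<in>Q. f a j = f a j'"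
   "\<forall>I\<subseteq>{..<?n}. card I = K \<longrightarrow> set_minor K f I = of_bool (?c \<kappa> (insert ?T R) I)"
  using real unfolding realizable_def by (elim exE conjE)
 have const: "f a j = f a j'" if "Q \<in> insert ?T R" "a < K" "j \<in> Q" "j' \<in> Q" for Q a j j'
  using f(1)[THEN bspec, OF that(1), rule_format, OF that(2-4)] .
 have minor: "set_minor K f I = of_bool (?c \<kappa> (insert ?T R) I)" if "I \<subseteq> {..<?n}" "card I = K" for I
  using f(2)[rule_format, OF that] .
 have fin: "finite X" "finite Y" using XY finite_subset by blast+
 have XYdisj: "X \<inter> Y = {}" using less by blast
 have conv: "(\<forall>t\<in>?T. t < j) \<or> (\<forall>t\<in>?T. j < t)" if "j \<notin> ?T" for j
 proof (rule ccontr)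
  assume "\<not> ?thesis"
  then obtain t t' where "t \<in> ?T" "t' \<in> ?T" "j \<le> t" "t' \<le> j" by (auto simp: not_less)
  thus False using convT[of t' t j] that by blast
 qed
 define f' where "f' = split_cols K X Y f"
 show ?thesis unfolding realizable_def
 proof (intro exI[of _ f'] conjI ballI allI impI)
  fix Q a j j' assume Qin: "Q \<in> insert X (insert Y R)" and a: "a < Suc K" and j: "j \<in> Q" "j' \<in> Q"
  show "f' a j = f' a j'"
  proof (cases "Q \<in> R")
   case True
   have nT: "j \<notin> ?T" "j' \<notin> ?T" using Q(1)[OF True] j by blast+
   have "(\<forall>t\<in>?T. t < j) = (\<forall>t\<in>?T. t < j')"
   proof (rule ccontr)
    assume ne: "(\<forall>t\<in>?T. t < j) \<noteq> (\<forall>t\<in>?T. t < j')"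
    obtain t where t: "t \<in> ?T" using XY by blast
    have "(t < j \<and> j' < t) \<or> (t < j' \<and> j < t)" using ne conv[OF nT(1)] conv[OF nT(2)] t by blast
    hence "t \<in> Q" using Q(2)[OF True j(1) j(2), of t] Q(2)[OF True j(2) j(1), of t] by auto
    thus False using Q(1)[OF True] t by blast
   qed
   moreover have "a < K \<Longrightarrow> f a j = f a j'" using const[of Q a j j'] True j by blast
   ultimately show ?thesis using nT a by (auto simp: f'_def split_cols_def)
  next
   case False
   hence "Q = X \<or> Q = Y" using Qin by blast
   thus ?thesis
   proof
    assume "Q = Y"
    thus ?thesis using j a by (simp add: f'_def split_cols_def)
   next
    assume QX: "Q = X"
    hence "j \<notin> Y" "j' \<notin> Y" using j XYdisj by blast+
    moreover have "\<not> (\<forall>t\<in>?T. t < j)" "\<not> (\<forall>t\<in>?T. t < j')" using j QX by blast+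
    moreover have "a < K \<Longrightarrow> f a j = f a j'" using const[of ?T a j j'] j QX by blast
    ultimately show ?thesis using j QX a by (auto simp: f'_def split_cols_def)
   qed
  qed
 next
  fix I assume I: "I \<subseteq> {..<?n}" and cI: "card I = Suc K"
  have finI: "finite I" using I finite_subset by blast
  define z where "z = Max (I \<inter> ?T)"
  have "set_minor (Suc K) f' I = (if card (I \<inter> X) \<le> 1 \<and> card (I \<inter> Y) \<le> 1 \<and> I \<inter> ?T \<noteq> {} then set_minor K f (I - {z}) else 0)"
   unfolding f'_def z_def
   by (rule set_minor_split[OF finI cI fin XY(3,4) less _ const[OF insertI1]]) (use conv in blast)+
  also have "\<dots> = of_bool (?c \<kappa>' (insert X (insert Y R)) I)"
  proof (cases "card (I \<inter> X) \<le> 1 \<and> card (I \<inter> Y) \<le> 1 \<and> I \<inter> ?T \<noteq> {}")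
   case False
   hence "\<not> ?c \<kappa>' (insert X (insert Y R)) I" using meets[OF I] by blast
   thus ?thesis using False by (simp only: if_False of_bool_eq)
  next
   case True
   have z: "z \<in> I" "z \<in> ?T" using Max_in[of "I \<inter> ?T"] finI True by (auto simp: z_def)
   have sub: "card ((I - {z}) \<inter> S) + 1 = card (I \<inter> S)" if "?T \<subseteq> S" for S
   proof -
    have "(I - {z}) \<inter> S = I \<inter> S - {z}" "z \<in> I \<inter> S" using that z by auto
    moreover have "card (I \<inter> S) > 0" using finI \<open>z \<in> I \<inter> S\<close> by (auto simp: card_gt_0_iff)
    ultimately show ?thesis using finI by (simp add: card_Diff_singleton)
   qed
   have same: "card ((I - {z}) \<inter> S) = card (I \<inter> S)" if "S \<inter> ?T = {}" for S
   proof -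
    have "(I - {z}) \<inter> S = I \<inter> S" using that z by auto
    thus ?thesis by simp
   qed
   have small: "card (I \<inter> S) \<le> 1 \<and> card ((I - {z}) \<inter> S) \<le> 1" if "S \<subseteq> X \<or> S \<subseteq> Y" for S
   proof -
    have "card ((I - {z}) \<inter> S) \<le> card (I \<inter> S)" using finI by (intro card_mono) auto
    moreover have "card (I \<inter> S) \<le> card (I \<inter> X) \<or> card (I \<inter> S) \<le> card (I \<inter> Y)"
     using that finI by (auto intro!: card_mono)
    ultimately show ?thesis using True by auto
   qed
   have xs: "(\<kappa> x \<le> card ((I - {z}) \<inter> D x) \<and> card ((I - {z}) \<inter> D x) \<le> \<kappa> x + 1) \<longleftrightarrow>
     (\<kappa>' x \<le> card (I \<inter> D x) \<and> card (I \<inter> D x) \<le> \<kappa>' x + 1)" if x: "x \<in> verts G - {r}" for x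
   proof (cases "?T \<subseteq> D x")
    case True
    thus ?thesis using sub[OF True] \<kappa>'[OF x] by auto
   next
    case False
    hence eq: "\<kappa>' x = \<kappa> x" using \<kappa>'[OF x] by simp
    have "((D x \<subseteq> X \<or> D x \<subseteq> Y) \<and> \<kappa> x = 0) \<or> D x \<inter> ?T = {}" using cases[OF x] False by (simp only: simp_thms)
    thus ?thesis
    proof
     assume "(D x \<subseteq> X \<or> D x \<subseteq> Y) \<and> \<kappa> x = 0"
     thus ?thesis using small[of "D x"] eq by simp
    next
     assume "D x \<inter> ?T = {}"
     thus ?thesis using same eq by simp
    qed
   qed
   have "card (I \<inter> ?T) \<le> card (I \<inter> X) + card (I \<inter> Y)" using card_Un_le[of "I \<inter> X" "I \<inter> Y"] by (simp add: Int_Un_distrib)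
   hence Tle: "card ((I - {z}) \<inter> ?T) \<le> 1" using sub[of ?T] True by auto
   have Rs: "card ((I - {z}) \<inter> S) = card (I \<inter> S)" if "S \<in> R" for S using same[OF Q(1)[OF that]] .
   have eqc: "?c \<kappa> (insert ?T R) (I - {z}) \<longleftrightarrow> ?c \<kappa>' (insert X (insert Y R)) I"
   proof (rule conj_cong)
    show "(\<forall>x\<in>verts G - {r}. \<kappa> x \<le> card ((I - {z}) \<inter> D x) \<and> card ((I - {z}) \<inter> D x) \<le> \<kappa> x + 1) =
      (tight \<kappa>' I)"
     by (rule ball_cong[OF refl xs])
    have "(\<forall>Q\<in>R. card ((I - {z}) \<inter> Q) \<le> 1) = (\<forall>Q\<in>R. card (I \<inter> Q) \<le> 1)"
     by (rule ball_cong[OF refl]) (simp only: Rs)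
    thus "(\<forall>Q\<in>insert ?T R. card ((I - {z}) \<inter> Q) \<le> 1) = (\<forall>Q\<in>insert X (insert Y R). card (I \<inter> Q) \<le> 1)"
     unfolding ball_simps(7) using Tle True by (simp only: simp_thms)
   qed
   have "set_minor K f (I - {z}) = of_bool (?c \<kappa> (insert ?T R) (I - {z}))"
    using I cI z(1) finI by (intro minor) auto
   thus ?thesis unfolding if_P[OF True] eqc .
  qed
  finally show "set_minor (Suc K) f' I = of_bool (?c \<kappa>' (insert X (insert Y R)) I)" .
 qed
qed

text \<open>The summands of \<open>kap\<close> that come from the opened part \<open>S\<close>; for
  all internal vertices it is \<open>kap\<close>.\<close>

definition sk :: "'v set \<Rightarrow> 'v \<Rightarrow> nat" where
 "sk S x = (\<Sum>b\<in>desc x \<inter> (S \<inter> black_internal G). degree G b - 2)"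

text \<open>The vertices at which the opened part of the tree ends; the sides below them are the
  current classes of equal columns.\<close>

definition frontier :: "'v set \<Rightarrow> 'v set" where
 "frontier S = {o' \<in> verts G - {r} - S. par o' \<in> insert r S}"

lemma par_closed_up:
 assumes "\<forall>v\<in>S. par v \<in> insert r S" "y \<in> S" "y \<in> desc x" "x \<in> verts G - {r}"
 shows "x \<in> S"
 using assms(2,3)
proof (induction "dep y" arbitrary: y rule: less_induct)
 case less
 show ?case
 proof (cases "y = x")
  case False
  hence y: "y \<in> verts G - {r}" "par y \<in> desc x" using desc_par less by blast+
  hence "par y \<in> S" using bspec[OF assms(1) less(2)] root_not_desc[OF assms(4)] by auto
  thus ?thesis using less(1)[of "par y"] dep_par[OF y(1)] y(2) by simp
 qed (use less in simp)
qed

text \<open>A black vertex with \<open>c\<close> children adds up to \<open>c - 1\<close> rows, each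
  of which detaches the interval of one child. \<open>C\<close> contains the children whose
  intervals still form one class, and convexity of their union is carried along for the next
  split.\<close>

lemma realizable_black:
 assumes real: "realizable K \<kappa> (insert (D v) R)"
  and v: "v \<in> verts G - {r}" "v \<notin> set (bdry G)"
  and \<kappa>0: "\<And>x. x \<in> desc v \<Longrightarrow> \<kappa> x = 0"
  and R: "\<And>Q. Q \<in> R \<Longrightarrow> Q \<inter> D v = {}" "\<And>Q i j l. Q \<in> R \<Longrightarrow> i \<in> Q \<Longrightarrow> l \<in> Q \<Longrightarrow> i \<le> j \<Longrightarrow> j \<le> l \<Longrightarrow> j \<in> Q"
  and j: "j < card (ch v)"
 shows "\<exists>C\<subseteq>ch v. card C + j = card (ch v) \<and>
  realizable (K + j) (\<lambda>x. \<kappa> x + j * of_bool (v \<in> desc x)) (insert (\<Union> (D ` C)) (R \<union> D ` (ch v - C))) \<and>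
  (\<forall>i\<in>\<Union> (D ` C). \<forall>l\<in>\<Union> (D ` C). \<forall>j. i \<le> j \<longrightarrow> j \<le> l \<longrightarrow> j \<in> \<Union> (D ` C))"
 using j
proof (induction j)
 case 0
 have eq: "\<Union> (D ` ch v) = D v" using D_internal v by simp
 have "realizable (K + 0) (\<lambda>x. \<kappa> x + 0 * of_bool (v \<in> desc x)) (insert (\<Union> (D ` ch v)) (R \<union> D ` (ch v - ch v)))"
  using real by (simp add: eq)
 moreover have "j \<in> \<Union> (D ` ch v)" if "i \<in> \<Union> (D ` ch v)" "l \<in> \<Union> (D ` ch v)" "i \<le> j" "j \<le> l" for i j l
  using that unfolding eq by (rule D_convex[OF v(1)])
 ultimately show ?case by (intro exI[of _ "ch v"] conjI ballI allI impI subset_refl add_0_right)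
next
 case (Suc j)
 hence "j < card (ch v)" by simp
 from Suc.IH[OF this] obtain C where all: "C \<subseteq> ch v \<and> card C + j = card (ch v) \<and>
  realizable (K + j) (\<lambda>x. \<kappa> x + j * of_bool (v \<in> desc x)) (insert (\<Union> (D ` C)) (R \<union> D ` (ch v - C))) \<and>
  (\<forall>i\<in>\<Union> (D ` C). \<forall>l\<in>\<Union> (D ` C). \<forall>j. i \<le> j \<longrightarrow> j \<le> l \<longrightarrow> j \<in> \<Union> (D ` C))" ..
 note C = all[THEN conjunct1] all[THEN conjunct2, THEN conjunct1]
 note re = all[THEN conjunct2, THEN conjunct2, THEN conjunct1]
 note cv = all[THEN conjunct2, THEN conjunct2, THEN conjunct2]
 have finC: "finite C" using finite_subset[OF C(1) finite_ch] .
 have cC: "2 \<le> card C" using C Suc(2) by simp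
 let ?T = "\<Union> (D ` C)"
 have chV: "c \<in> verts G - {r}" if "c \<in> ch v" for c using chD[OF that] by simp
 have vD: "D v = \<Union> (D ` ch v)" using D_internal v by simp
 have "C \<noteq> {}" using cC by auto
 then obtain c1 where "c1 \<in> C" by blast
 hence neT: "?T \<noteq> {}" using D_nonempty[of c1] chV C by blast
 have finT: "finite ?T" using finC by simp
 \<comment> \<open>The child with the rightmost interval is detached, so that the rest lies entirely
   to its left.\<close>
 obtain c where c: "c \<in> C" "Max ?T \<in> D c" using Max_in[OF finT neT] by blast
 define X where "X = \<Union> (D ` (C - {c}))"
 have T: "X \<union> D c = ?T" using c(1) by (auto simp: X_def)
 have disj: "D a \<inter> D b = {}" if "a \<in> ch v" "b \<in> ch v" "a \<noteq> b" for a b using D_disjoint that by blast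
 have XD: "X \<inter> D c = {}" using disj C c(1) unfolding X_def by blast
 have "card (C - {c}) \<ge> 1" using cC c finC by simp
 then obtain c2 where c2: "c2 \<in> C" "c2 \<noteq> c" by (metis card.empty Diff_iff ex_in_conv insertI1 not_one_le_zero)
 have neX: "X \<noteq> {}" using D_nonempty[of c2] chV C c2 by (auto simp: X_def)
 have less: "x < y" if x: "x \<in> X" and y: "y \<in> D c" for x y
 proof (rule ccontr)
  assume "\<not> x < y"
  moreover have "x \<le> Max ?T" using finT T x by (intro Max_ge) blast+
  ultimately have "x \<in> D c" using D_convex[OF chV y c(2), of x] C c by auto
  thus False using XD x by blast
 qed
 have subn: "?T \<subseteq> {..<length (bdry G)}" using D_sub by blast
 have child: "\<exists>a\<in>ch v. x \<in> desc a" if "x \<in> desc v" "x \<noteq> v" for x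
  using that desc_unfold[of v] v by auto
 have TD: "?T \<subseteq> D v" using vD C by blast
 let ?R = "R \<union> D ` (ch v - C)"
 have "realizable (Suc (K + j)) (\<lambda>x. \<kappa> x + Suc j * of_bool (v \<in> desc x)) (insert X (insert (D c) ?R))"
 proof (rule realizable_split[where X = X and Y = "D c", unfolded T, OF re])
  show "X \<subseteq> {..<length (bdry G)}" "D c \<subseteq> {..<length (bdry G)}" using subn T by blast+
  show "X \<noteq> {}" "D c \<noteq> {}" using neX c by blast+
  show "\<And>x y. x \<in> X \<Longrightarrow> y \<in> D c \<Longrightarrow> x < y" by (rule less)
  show "\<And>i j l. i \<in> ?T \<Longrightarrow> l \<in> ?T \<Longrightarrow> i \<le> j \<Longrightarrow> j \<le> l \<Longrightarrow> j \<in> ?T" using cv by blast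
  show "Q \<inter> ?T = {}" if "Q \<in> ?R" for Q
   using that
  proof
   assume "Q \<in> R" thus ?thesis using R(1) TD by blast
  next
   assume "Q \<in> D ` (ch v - C)" thus ?thesis using disj C by blast
  qed
  show "j \<in> Q" if "Q \<in> ?R" "i \<in> Q" "l \<in> Q" "i \<le> j" "j \<le> l" for Q i j l
   using that(1)
  proof
   assume "Q \<in> R" thus ?thesis using R(2) that by blast
  next
   assume "Q \<in> D ` (ch v - C)" thus ?thesis using D_convex[of _ i l j] chV that by blast
  qed
  fix x assume x: "x \<in> verts G - {r}"
  have trich: "v \<in> desc x \<or> (\<exists>a\<in>ch v. x \<in> desc a) \<or> D x \<inter> D v = {}"
  proof (cases "v \<in> desc x")
   case False
   hence "x \<noteq> v" using desc_refl v by blast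
   thus ?thesis using D_disjoint_incomparable[of x v] False child by blast
  qed simp
  have part: "D x \<subseteq> X \<or> D x \<subseteq> D c \<or> D x \<inter> ?T = {}" if a: "a \<in> ch v" "x \<in> desc a" for a
  proof (cases "a \<in> C")
   case True
   thus ?thesis using D_mono[OF a(2)] by (cases "a = c") (auto simp: X_def)
  next
   case False
   have "D a \<inter> ?T = {}"
   proof -
    have "D a \<inter> D b = {}" if "b \<in> C" for b using that False a(1) C disj[of a b] by blast
    thus ?thesis by blast
   qed
   thus ?thesis using D_mono[OF a(2)] by blast
  qed
  show "?T \<subseteq> D x \<or> ((D x \<subseteq> X \<or> D x \<subseteq> D c) \<and> \<kappa> x + j * of_bool (v \<in> desc x) = 0) \<or> D x \<inter> ?T = {}"
   using trich
  proof (elim disjE bexE)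
   assume "v \<in> desc x"
   thus ?thesis using D_mono[of v x] TD by blast
  next
   fix a assume a: "a \<in> ch v" "x \<in> desc a"
   have xv: "x \<in> desc v" using a desc_child[of a v] v by blast
   have "v \<notin> desc x"
   proof
    assume "v \<in> desc x"
    hence "v \<in> desc a" using desc_trans[OF a(2)] by blast
    thus False using not_desc_child a by blast
   qed
   hence "\<kappa> x + j * of_bool (v \<in> desc x) = 0" using \<kappa>0[OF xv] by simp
   thus ?thesis using part[OF a] by blast
  next
   assume "D x \<inter> D v = {}"
   thus ?thesis using TD by blast
  qed
  have "v \<in> desc x \<longleftrightarrow> ?T \<subseteq> D x"
  proof
   assume "v \<in> desc x"
   thus "?T \<subseteq> D x" using D_mono[of v x] TD by blast
  next
   assume sub: "?T \<subseteq> D x"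
   from trich show "v \<in> desc x"
   proof (elim disjE bexE)
    fix a assume a: "a \<in> ch v" "x \<in> desc a"
    have c': "D c \<noteq> {}" using c(2) by blast
    from part[OF a] have False
    proof (elim disjE)
     assume "D x \<subseteq> X"
     thus False using sub T XD c' by blast
    next
     assume "D x \<subseteq> D c"
     thus False using sub T XD neX by blast
    next
     assume "D x \<inter> ?T = {}"
     thus False using sub neT by blast
    qed
    thus ?thesis ..
   next
    assume "D x \<inter> D v = {}"
    thus ?thesis using sub TD neT by blast
   qed
  qed
  thus "\<kappa> x + Suc j * of_bool (v \<in> desc x) = \<kappa> x + j * of_bool (v \<in> desc x) + of_bool (?T \<subseteq> D x)"
   by simp
 next
  fix I assume I: "I \<subseteq> {..<length (bdry G)}"
   and ge: "\<forall>x\<in>verts G - {r}. \<kappa> x + Suc j * of_bool (v \<in> desc x) \<le> card (I \<inter> D x)"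
   and le: "\<forall>Q\<in>?R. card (I \<inter> Q) \<le> 1"
  \<comment> \<open>Each of the \<open>j\<close> children already detached meets \<open>I\<close> at
    most once, which falls short of the \<open>Suc j\<close> elements demanded below
    \<open>v\<close>.\<close>
  show "I \<inter> ?T \<noteq> {}"
  proof
   assume e: "I \<inter> ?T = {}"
   have "v \<in> desc v" using desc_refl v by simp
   hence "Suc j \<le> card (I \<inter> D v)" using bspec[OF ge v(1)] by simp
   also have "I \<inter> D v = (\<Union>a\<in>ch v - C. I \<inter> D a)" using vD e by blast
   also have "card \<dots> \<le> (\<Sum>a\<in>ch v - C. card (I \<inter> D a))" by (rule card_UN_le) simp
   also have "\<dots> \<le> (\<Sum>a\<in>ch v - C. 1)" using le by (intro sum_mono) blast
   also have "\<dots> = j" using C finC by (simp add: card_Diff_subset)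
   finally show False by simp
  qed
 qed
 moreover have "insert X (insert (D c) ?R) = insert (\<Union> (D ` (C - {c}))) (R \<union> D ` (ch v - (C - {c})))"
  using c(1) C(1) by (auto simp: X_def)
 ultimately have res: "realizable (K + Suc j) (\<lambda>x. \<kappa> x + Suc j * of_bool (v \<in> desc x)) (insert (\<Union> (D ` (C - {c}))) (R \<union> D ` (ch v - (C - {c}))))"
  by (simp only: add_Suc_right)
 have conv: "i' \<in> X" if "i \<in> X" "l \<in> X" "i \<le> i'" "i' \<le> l" for i i' l
 proof -
  have "i \<in> ?T" "l \<in> ?T" using T that by blast+
  hence "i' \<in> X \<union> D c" using cv[rule_format, of i l i'] that unfolding T by simp
  thus ?thesis using less[of l i'] that by auto
 qed
 have "card (C - {c}) + Suc j = card (ch v)" using C(2) c(1) finC cC by simp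
 thus ?case using res conv[unfolded X_def] C(1)
  by (intro exI[of _ "C - {c}"] conjI ballI allI impI) (assumption | blast)+
qed

text \<open>The tree is opened from the root by adding a deepest vertex, starting from a single row
  of ones. Black vertices use \<open>realizable_black\<close>. At a white vertex the matrix stays
  the same: its class is replaced by the classes of its children, and the count at the vertex itself
  goes on to allow at most one element.\<close>

lemma realizable_frontier:
 "S \<subseteq> internal G \<Longrightarrow> \<forall>v\<in>S. par v \<in> insert r S \<Longrightarrow>
  realizable (1 + (\<Sum>b\<in>S \<inter> black_internal G. degree G b - 2)) (sk S) (D ` frontier S)"
proof (induction "card S" arbitrary: S)
 case 0
 have finV: "finite (internal G)" using fin by (simp add: internal_def)
 hence S: "S = {}" using 0 finite_subset by fastforce
 have "frontier {} = ch r" by (auto simp: frontier_def ch_def)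
 hence f: "D ` frontier S = {D wtop}" using ch_r S by simp
 show ?case unfolding f realizable_def
 proof (intro exI[of _ "\<lambda>a j. 1"] conjI ballI allI impI refl)
  fix I assume I: "I \<subseteq> {..<length (bdry G)}" "card I = 1 + (\<Sum>b\<in>S \<inter> black_internal G. degree G b - 2)"
  hence cI: "card I = 1" "finite I" using S finite_subset by auto
  have "card (I \<inter> Q) \<le> 1" for Q using card_mono[of I "I \<inter> Q"] cI by auto
  thus "set_minor (1 + (\<Sum>b\<in>S \<inter> black_internal G. degree G b - 2)) (\<lambda>a j. 1) I = of_bool ((tight (sk S) I) \<and> (\<forall>Q\<in>{D wtop}. card (I \<inter> Q) \<le> 1))"
   using S by (simp add: set_minor_def sk_def det_single)
 qed
next
 case (Suc n)
 have finS: "finite S" using Suc(2) card.infinite by fastforce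
 have neS: "S \<noteq> {}" using Suc(2) by auto
 have "Max (dep ` S) \<in> dep ` S" using finS neS by (intro Max_in) auto
 then obtain v where v: "v \<in> S" "dep v = Max (dep ` S)" by force
 have vmax: "dep x \<le> dep v" if "x \<in> S" for x unfolding v(2) using finS that by simp
 have vI: "v \<in> internal G" using v(1) Suc by blast
 have vV: "v \<in> verts G - {r}" "v \<notin> set (bdry G)" using internalD[OF vI] by auto
 define S' where "S' = S - {v}"
 have SS: "S = insert v S'" "v \<notin> S'" using v by (auto simp: S'_def)
 have below: "x \<notin> S'" if "x \<in> desc v" for x
 proof
  assume x: "x \<in> S'"
  hence "x \<noteq> v" using SS by blast
  hence "dep v < dep x" using desc_par[OF that] by simp
  thus False using vmax[of x] x SS by simp
 qed
 have cl': "\<forall>x\<in>S'. par x \<in> insert r S'"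
 proof
  fix x assume x: "x \<in> S'"
  hence xS: "x \<in> S" "x \<in> verts G - {r}" using SS Suc(3) internalD by blast+
  have "par x \<noteq> v" using dep_par[OF xS(2)] vmax[OF xS(1)] by auto
  thus "par x \<in> insert r S'" using Suc(4) xS SS by auto
 qed
 define K where "K = 1 + (\<Sum>b\<in>S' \<inter> black_internal G. degree G b - 2)"
 have IH: "realizable K (sk S') (D ` frontier S')"
  unfolding K_def
 proof (rule Suc.hyps(1)[OF _ _ cl'])
  show "n = card S'" using Suc(2) v(1) finS by (simp add: S'_def)
  show "S' \<subseteq> internal G" using Suc(3) by (auto simp: S'_def)
 qed
 have "par v \<in> insert r S" using bspec[OF Suc(4) v(1)] .
 hence "par v \<in> insert r S'" using par_neq[OF vV(1)] unfolding S'_def by simp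
 hence vF: "v \<in> frontier S'" using vV(1) SS(2) unfolding frontier_def by simp
 define F where "F = frontier S' - {v}"
 have F': "frontier S' = insert v F" using vF by (auto simp: F_def)
 have chS: "c \<notin> S" if "c \<in> ch v" for c using chD[OF that] vmax[of c] by auto
 have F: "frontier S = F \<union> ch v"
 proof (rule Set.set_eqI)
  fix x
  have "x \<in> S \<longleftrightarrow> x = v \<or> x \<in> S'" using SS(1) by simp
  moreover have "par x \<in> insert r S \<longleftrightarrow> par x = v \<or> par x \<in> insert r S'" using SS(1) by auto
  moreover have "x \<in> ch v \<longleftrightarrow> x \<in> verts G - {r} \<and> par x = v" by (simp add: ch_def)
  moreover have "x \<in> ch v \<Longrightarrow> x \<notin> S" using chS .
  moreover have "par v \<noteq> v" using par_neq[OF vV(1)] .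
  moreover have "x \<in> F \<longleftrightarrow> x \<noteq> v \<and> x \<in> verts G - {r} \<and> x \<notin> S' \<and> par x \<in> insert r S'"
   unfolding F_def frontier_def by blast
  moreover have "x \<in> frontier S \<longleftrightarrow> x \<in> verts G - {r} \<and> x \<notin> S \<and> par x \<in> insert r S"
   unfolding frontier_def by blast
  ultimately show "x \<in> frontier S \<longleftrightarrow> x \<in> F \<union> ch v" by (simp only: Un_iff) argo
 qed
 have real: "realizable K (sk S') (insert (D v) (D ` F))" using IH F' by simp
 have Fv: "o' \<in> verts G - {r}" "D o' \<inter> D v = {}" if "o' \<in> F" for o'
 proof -
  show V: "o' \<in> verts G - {r}" using that by (auto simp: F_def frontier_def)
  have o': "o' \<notin> S'" "o' \<noteq> v" "par o' \<in> insert r S'" using that by (auto simp: F_def frontier_def)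
  have a: "o' \<notin> desc v"
  proof
   assume "o' \<in> desc v"
   hence "par o' \<in> desc v" using desc_par o' by blast
   thus False using o'(3) below[of "par o'"] root_not_desc[OF vV(1)] by auto
  qed
  have "v \<notin> desc o'"
  proof
   assume "v \<in> desc o'"
   hence "o' \<in> S" using par_closed_up[OF Suc(4) v(1) _ V] by simp
   thus False using o'(1,2) unfolding S'_def by simp
  qed
  thus "D o' \<inter> D v = {}" using a by (rule D_disjoint_incomparable[rotated])
 qed
 have fS': "finite S'" using finS SS by simp
 have skv: "sk S x = sk S' x + (if v \<in> black_internal G then degree G v - 2 else 0) * of_bool (v \<in> desc x)" for x
 proof -
  have "desc x \<inter> (S \<inter> black_internal G) = (desc x \<inter> (S' \<inter> black_internal G)) \<union> (if v \<in> black_internal G \<and> v \<in> desc x then {v} else {})"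
   unfolding S'_def using v(1) by auto
  thus ?thesis unfolding sk_def using SS(2) by auto
 qed
 have Kv: "1 + (\<Sum>b\<in>S \<inter> black_internal G. degree G b - 2) = K + (if v \<in> black_internal G then degree G v - 2 else 0)"
 proof -
  have "S \<inter> black_internal G = (S' \<inter> black_internal G) \<union> (if v \<in> black_internal G then {v} else {})"
   unfolding S'_def using v(1) by auto
  thus ?thesis unfolding K_def using SS(2) fS' by auto
 qed
 have sk0: "sk S' x = 0" if "x \<in> desc v" for x
 proof -
  have "desc x \<inter> S' = {}" using below desc_trans[OF that] by blast
  hence "desc x \<inter> (S' \<inter> black_internal G) = {}" by blast
  thus ?thesis unfolding sk_def by (simp only: sum.empty)
 qed
 have vv: "v \<in> desc v" using vV desc_refl by simp
 show ?case
 proof (cases "v \<in> black_internal G")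
  case True
  let ?j = "card (ch v) - 1"
  have ne: "card (ch v) > 0" using internal_ch[OF vI] by (simp add: card_gt_0_iff)
  have "\<exists>C\<subseteq>ch v. card C + ?j = card (ch v) \<and>
   realizable (K + ?j) (\<lambda>x. sk S' x + ?j * of_bool (v \<in> desc x)) (insert (\<Union> (D ` C)) (D ` F \<union> D ` (ch v - C))) \<and>
   (\<forall>i\<in>\<Union> (D ` C). \<forall>l\<in>\<Union> (D ` C). \<forall>j. i \<le> j \<longrightarrow> j \<le> l \<longrightarrow> j \<in> \<Union> (D ` C))"
  proof (rule realizable_black[OF real vV sk0])
   show "Q \<inter> D v = {}" if "Q \<in> D ` F" for Q using that Fv(2) by blast
   show "j \<in> Q" if "Q \<in> D ` F" "i \<in> Q" "l \<in> Q" "i \<le> j" "j \<le> l" for Q i j l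
    using that Fv(1) D_convex[of _ i l j] by blast
  qed (use ne in simp_all)
  then obtain C where C: "C \<subseteq> ch v" "card C + ?j = card (ch v)"
   "realizable (K + ?j) (\<lambda>x. sk S' x + ?j * of_bool (v \<in> desc x)) (insert (\<Union> (D ` C)) (D ` F \<union> D ` (ch v - C)))"
   by (elim exE conjE)
  have "card C = 1" using C ne by simp
  then obtain c where c: "C = {c}" by (auto simp: card_1_singleton_iff)
  have "insert (\<Union> (D ` C)) (D ` F \<union> D ` (ch v - C)) = D ` frontier S"
   using C(1) unfolding c F by auto
  moreover have "(\<lambda>x. sk S' x + ?j * of_bool (v \<in> desc x)) = sk S"
   by (rule ext) (simp only: skv if_P[OF True] black_degree[OF True])
  moreover have "1 + (\<Sum>b\<in>S \<inter> black_internal G. degree G b - 2) = K + ?j"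
   by (simp only: Kv if_P[OF True] black_degree[OF True])
  ultimately show ?thesis using C(3) by (simp only:)
 next
  case False
  have skS: "sk S = sk S'" by (rule ext) (simp only: skv if_not_P[OF False] mult_0 add_0_right)
  have KS: "1 + (\<Sum>b\<in>S \<inter> black_internal G. degree G b - 2) = K" by (simp only: Kv if_not_P[OF False] add_0_right)
  have Dc: "D c \<subseteq> D v" if "c \<in> ch v" for c using that D_internal[of v] vV by blast
  have chV: "c \<in> verts G - {r}" "c \<in> desc v" if "c \<in> ch v" for c
   using chD[OF that] desc_child[OF that] desc_refl[of c] vV by auto
  from real obtain f where f: "\<forall>Q\<in>insert (D v) (D ` F). \<forall>a<K. \<forall>j\<in>Q. \<forall>j'\<in>Q. f a j = f a j'"
   "\<forall>I\<subseteq>{..<length (bdry G)}. card I = K \<longrightarrow> set_minor K f I = of_bool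
    ((tight (sk S') I) \<and> (\<forall>Q\<in>insert (D v) (D ` F). card (I \<inter> Q) \<le> 1))"
   unfolding realizable_def by (elim exE conjE)
  show ?thesis unfolding skS KS F realizable_def
  proof (intro exI[of _ f] conjI ballI allI impI)
   fix Q a j j' assume Q: "Q \<in> D ` (F \<union> ch v)" and a: "a < K" and j: "j \<in> Q" "j' \<in> Q"
   show "f a j = f a j'"
   proof (cases "Q \<in> D ` F")
    case True
    thus ?thesis using f(1) a j by blast
   next
    case False
    hence "Q \<subseteq> D v" using Q Dc by blast
    thus ?thesis using bspec[OF f(1), of "D v"] a j by blast
   qed
  next
   fix I assume I: "I \<subseteq> {..<length (bdry G)}" "card I = K"
   let ?P = "tight (sk S') I"
   have small: "card (I \<inter> D x) \<le> 1" if "?P" "x \<in> verts G - {r}" "x \<in> desc v" for x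
    using bspec[OF that(1,2)] sk0[OF that(3)] by simp
   have "(?P \<and> (\<forall>Q\<in>insert (D v) (D ` F). card (I \<inter> Q) \<le> 1)) = (?P \<and> (\<forall>Q\<in>D ` (F \<union> ch v). card (I \<inter> Q) \<le> 1))"
   proof (rule conj_cong[OF refl])
    assume P: ?P
    have "card (I \<inter> D v) \<le> 1" using small[OF P vV(1) vv] .
    moreover have "\<forall>Q\<in>D ` ch v. card (I \<inter> Q) \<le> 1" using small[OF P] chV by auto
    ultimately show "(\<forall>Q\<in>insert (D v) (D ` F). card (I \<inter> Q) \<le> 1) = (\<forall>Q\<in>D ` (F \<union> ch v). card (I \<inter> Q) \<le> 1)"
     unfolding image_Un ball_Un by simp
   qed
   thus "set_minor K f I = of_bool (?P \<and> (\<forall>Q\<in>D ` (F \<union> ch v). card (I \<inter> Q) \<le> 1))"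
    using f(2) I by simp
  qed
 qed
qed

text \<open>Once every internal vertex is opened, the classes are single boundary vertices and
  impose nothing; only the counts defining \<open>good\<close> remain.\<close>

lemma realization:
 "\<exists>f. \<forall>I\<subseteq>{..<length (bdry G)}. card I = k_stat G \<longrightarrow> set_minor (k_stat G) f I = of_bool (good I)"
proof -
 have par: "\<forall>v\<in>internal G. par v \<in> insert r (internal G)"
 proof
  fix v assume "v \<in> internal G"
  hence v: "v \<in> verts G - {r}" using internalD by blast
  hence "v \<in> ch (par v)" by (simp add: ch_def)
  hence "par v \<in> set (bdry G) \<Longrightarrow> par v = r" using bdry_no_ch by blast
  thus "par v \<in> insert r (internal G)" using par_in[OF v] by (auto simp: internal_def)
 qed
 have BI: "internal G \<inter> black_internal G = black_internal G" by (auto simp: black_internal_def)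
 have sk: "sk (internal G) = kap" by (rule ext) (simp add: sk_def kap_def BI)
 have K: "1 + (\<Sum>b\<in>internal G \<inter> black_internal G. degree G b - 2) = k_stat G" by (simp only: k_stat_def BI)
 have one: "card (I \<inter> Q) \<le> 1" if q: "Q \<in> D ` frontier (internal G)" for I Q
 proof -
  obtain o' where o': "Q = D o'" "o' \<in> frontier (internal G)" using q by (rule imageE)
  hence o'': "o' \<in> verts G - {r}" "o' \<in> set (bdry G)" by (auto simp: frontier_def internal_def)
  then obtain i where i: "i < length (bdry G)" "o' = bdry G ! i" by (auto simp: in_set_conv_nth)
  hence "Q = {i}" using D_leaf[of i] ri ri_iff[of i] o'(1) o''(1) by auto
  thus ?thesis using card_mono[of "{i}" "I \<inter> {i}"] by simp
 qed
 obtain f where f: "\<forall>I\<subseteq>{..<length (bdry G)}. card I = k_stat G \<longrightarrow> set_minor (k_stat G) f I = of_bool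
    ((tight kap I) \<and> (\<forall>Q\<in>D ` frontier (internal G). card (I \<inter> Q) \<le> 1))"
  using realizable_frontier[OF subset_refl par, unfolded K sk realizable_def] by (elim exE conjE)
 show ?thesis
 proof (intro exI[of _ f] allI impI)
  fix I assume I: "I \<subseteq> {..<length (bdry G)}" "card I = k_stat G"
  have g: "good I \<longleftrightarrow> (tight kap I)"
   unfolding good_def using I by simp
  show "set_minor (k_stat G) f I = of_bool (good I)"
   unfolding g using f[rule_format, OF I] one by simp
 qed
qed

end

section \<open>Edge sides of a tree in the disk\<close>

lemma cyclic_on_inj: "cyclic_on f S \<Longrightarrow> inj_on f S"
proof -
 assume c: "cyclic_on f S"
 have "S \<subseteq> f ` S"
 proof
  fix t assume t: "t \<in> S"
  hence S: "S = orbit f t" using c unfolding cyclic_on_alldef by (elim conjE) (erule bspec)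
  hence "t \<in> orbit f t" using t by (simp only:)
  thus "t \<in> f ` S"
  proof cases
   case base
   thus ?thesis using t by (metis imageI)
  next
   case (step y)
   hence "y \<in> S" using S by (simp only:)
   thus ?thesis using step(1) by (rule_tac image_eqI)
  qed
 qed
 thus ?thesis using finite_cyclic_on[OF c] by (rule_tac finite_surj_inj)
qed

lemma first_change:
 fixes Q :: "nat \<Rightarrow> bool"
 shows "Q a \<Longrightarrow> \<not> Q b \<Longrightarrow> a < b \<Longrightarrow> \<exists>c. a \<le> c \<and> c < b \<and> Q c \<and> \<not> Q (Suc c)"
proof (induction b)
 case (Suc b)
 show ?case
 proof (cases "Q b")
  case True
  thus ?thesis using Suc by (intro exI[of _ b]) simp
 next
  case False
  hence "a < b" using Suc by (cases "a = b") auto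
  thus ?thesis using Suc.IH[OF Suc.prems(1) False] by (metis less_SucI)
 qed
qed simp

text \<open>Each side of each edge cuts out a cyclic interval of boundary vertices. This is all that
  is kept of the embedding.\<close>

definition planar :: "'v plabic \<Rightarrow> bool" where
 "planar G \<longleftrightarrow> (\<forall>u v. {u, v} \<in> edges G \<longrightarrow>
   noncrossing (length (bdry G)) (\<lambda>i. bdry G ! i \<in> reachable (edges G - {{u, v}}) u))"

text \<open>An alternating pattern forces two different places at which \<open>P\<close> is left.
  One of them may lie beyond the end of the list, which is why indices run past \<open>n\<close> and
  are reduced modulo \<open>n\<close>.\<close>

lemma noncrossing_if_one_change:
 assumes one: "\<And>c d. c < n \<Longrightarrow> d < n \<Longrightarrow> P c \<Longrightarrow> \<not> P (Suc c mod n) \<Longrightarrow> P d \<Longrightarrow> \<not> P (Suc d mod n) \<Longrightarrow> c = d"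
 shows "noncrossing n P"
 unfolding noncrossing_def
proof (intro allI impI, rule ccontr)
 fix i j k l assume o: "i < j" "j < k" "k < l" "l < n" and e: "P i = P k" "P j = P l" "P i \<noteq> P j"
 let ?Q = "\<lambda>c. P (c mod n)"
 have two: False if c: "a \<le> c" "c < b" "?Q c" "\<not> ?Q (Suc c)" and d: "a' \<le> d" "d < b'" "?Q d" "\<not> ?Q (Suc d)"
  and r: "b \<le> a'" "b' \<le> a + n" for a b a' b' c d
 proof -
  have n0: "0 < n" using o by simp
  have "c mod n = d mod n"
   using c(3,4) d(3,4) n0 by (intro one) (simp_all add: mod_Suc_eq)
  moreover have "c < d" "d < c + n" using c d r by auto
  ultimately show False by (metis (no_types, lifting) add_diff_cancel_left' dvd_imp_le less_imp_le_nat linorder_not_less mod_eq_dvd_iff_nat zero_less_diff le_add_diff_inverse nat_add_left_cancel_less)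
 qed
 show False
 proof (cases "P i")
  case True
  hence "\<not> P j" "P k" "\<not> P l" using e by auto
  then obtain c d where "i \<le> c" "c < j" "?Q c" "\<not> ?Q (Suc c)" "k \<le> d" "d < l" "?Q d" "\<not> ?Q (Suc d)"
   using first_change[of ?Q i j] first_change[of ?Q k l] True o by auto
  thus False using two[of i c j k d l] o by simp
 next
  case False
  hence "P j" "\<not> P k" "P l" using e by auto
  moreover have "(i + n) mod n = i" using o by simp
  ultimately obtain c d where "j \<le> c" "c < k" "?Q c" "\<not> ?Q (Suc c)" "l \<le> d" "d < i + n" "?Q d" "\<not> ?Q (Suc d)"
   using first_change[of ?Q j k] first_change[of ?Q l "i + n"] False o by auto
  thus False using two[of j c k l d "i + n"] o by simp
 qed
qed

text \<open>The walk around the tree uses each oriented edge once, so it leaves each side of an edge once.\<close>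

lemma disk_embedding_planar:
 assumes P: "plabic_tree G" and rot: "disk_embedding G rot"
 shows "planar G"
 unfolding planar_def
proof (intro allI impI)
 fix u v assume uv: "{u, v} \<in> edges G"
 let ?n = "length (bdry G)" and ?b = "\<lambda>i. bdry G ! i" and ?\<phi> = "face_step rot"
 let ?E = "edges G - {{u, v}}"
 let ?S = "reachable ?E u"
 have tree: "is_tree G" and dist: "distinct (bdry G)" and sub: "set (bdry G) \<subseteq> verts G"
  and deg: "\<forall>v\<in>set (bdry G). degree G v = 1" using P by (simp_all add: plabic_tree_def)
 have EV: "x \<in> verts G" "y \<in> verts G" if "{x, y} \<in> edges G" for x y
  using that tree unfolding is_tree_def by blast+
 have vS: "v \<notin> ?S" using tree_edge_separates[OF tree uv] .
 have cyc: "cyclic_on (rot y) (nbrs G y)" if "{x, y} \<in> edges G" for x y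
 proof -
  have "x \<in> nbrs G y" using that by (simp add: nbrs_def insert_commute)
  thus ?thesis using rot EV(2)[OF that] unfolding disk_embedding_def by blast
 qed
 define Ds where "Ds = {(x, y). {x, y} \<in> edges G}"
 have stepD: "?\<phi> d \<in> Ds" if "d \<in> Ds" for d
 proof -
  obtain x y where d: "d = (x, y)" by (cases d)
  hence e: "{x, y} \<in> edges G" using that by (simp add: Ds_def)
  hence "rot y x \<in> nbrs G y" using cyclic_on_inI[OF cyc[OF e]] by (simp add: nbrs_def insert_commute)
  thus ?thesis by (simp add: d face_step_def Ds_def nbrs_def)
 qed
 \<comment> \<open>The rotation at a vertex is injective on its neighbours, hence the walk is
   reversible on oriented edges.\<close>
 have inj: "d = d'" if dd: "d \<in> Ds" "d' \<in> Ds" "?\<phi> d = ?\<phi> d'" for d d'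
 proof -
  obtain x y x' y' where d: "d = (x, y)" "d' = (x', y')" by (cases d, cases d')
  hence e: "{x, y} \<in> edges G" "{x', y'} \<in> edges G" and y: "y = y'" "rot y x = rot y x'"
   using dd by (auto simp add: Ds_def face_step_def)
  have "x \<in> nbrs G y" "x' \<in> nbrs G y" using e y(1) by (simp_all add: nbrs_def insert_commute)
  hence "x = x'" using inj_onD[OF cyclic_on_inj[OF cyc[OF e(1)]] y(2)] by simp
  thus ?thesis using d y by simp
 qed
 have powD: "(?\<phi> ^^ s) d \<in> Ds" if "d \<in> Ds" for s d using that stepD by (induction s) auto
 have injp: "d = d'" if "d \<in> Ds" "d' \<in> Ds" "(?\<phi> ^^ s) d = (?\<phi> ^^ s) d'" for s d d'
  using that(3)
 proof (induction s)
  case (Suc s)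
  thus ?case using inj[OF powD[OF that(1)] powD[OF that(2)], of s s] by simp
 qed simp
 have fst_step: "fst (?\<phi> d) = snd d" for d by (simp add: face_step_def split: prod.splits)
 have "\<exists>d r. fst d = ?b i \<and> d \<in> Ds \<and> snd ((?\<phi> ^^ r) d) = ?b (Suc i mod ?n) \<and>
   (\<forall>s<r. snd ((?\<phi> ^^ s) d) \<notin> set (bdry G))" if i: "i < ?n" for i
 proof -
  have "card (nbrs G (?b i)) = 1" using deg nth_mem[OF i] by (simp add: degree_def)
  then obtain y where y: "y \<in> nbrs G (?b i)" by (metis card.empty ex_in_conv zero_neq_one)
  then obtain r where r: "snd ((?\<phi> ^^ r) (?b i, y)) = ?b (Suc i mod ?n)" "\<forall>s<r. snd ((?\<phi> ^^ s) (?b i, y)) \<notin> set (bdry G)"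
   using rot[unfolded disk_embedding_def, THEN conjunct2, rule_format, OF i y] by (elim exE conjE)
  have "(?b i, y) \<in> Ds" using y by (simp add: nbrs_def Ds_def)
  thus ?thesis using r by (intro exI[of _ "(?b i, y)"] exI[of _ r] conjI) simp_all
 qed
 then obtain d r where dr: "\<And>i. i < ?n \<Longrightarrow> fst (d i) = ?b i \<and> d i \<in> Ds \<and> snd ((?\<phi> ^^ r i) (d i)) = ?b (Suc i mod ?n) \<and>
   (\<forall>s<r i. snd ((?\<phi> ^^ s) (d i)) \<notin> set (bdry G))" by metis
 have dD: "d i \<in> Ds" and df: "fst (d i) = ?b i" and dl: "snd ((?\<phi> ^^ r i) (d i)) = ?b (Suc i mod ?n)" if "i < ?n" for i
  using dr[OF that] by simp_all
 have dm: "snd ((?\<phi> ^^ s) (d i)) \<notin> set (bdry G)" if "i < ?n" "s < r i" for i s using dr[OF that(1)] that(2) by simp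
 \<comment> \<open>The removed edge is the only one that leaves the side of \<open>u\<close>, so a
   stretch of the walk that starts there and ends outside traverses it from \<open>u\<close> to
   \<open>v\<close>.\<close>
 have cross: "\<exists>s\<le>r i. (?\<phi> ^^ s) (d i) = (u, v)" if i: "i < ?n" "?b i \<in> ?S" "?b (Suc i mod ?n) \<notin> ?S" for i
 proof -
  define x where "x = (\<lambda>s. fst ((?\<phi> ^^ s) (d i)))"
  have xs: "x (Suc s) = snd ((?\<phi> ^^ s) (d i))" for s by (simp add: x_def fst_step)
  have "x 0 \<in> ?S" "x (Suc (r i)) \<notin> ?S" using df[OF i(1)] dl[OF i(1)] i xs[of "r i"] by (simp_all add: x_def)
  from first_change[of "\<lambda>s. x s \<in> ?S", OF this] obtain s where s: "s < Suc (r i)" "x s \<in> ?S" "x (Suc s) \<notin> ?S" by auto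
  have e: "{x s, x (Suc s)} \<in> edges G"
   using powD[OF dD[OF i(1)], of s] unfolding xs x_def by (simp add: Ds_def case_prod_beta fst_step)
  have "{x s, x (Suc s)} = {u, v}"
   using reachable_step[OF s(2), of "x (Suc s)"] s(3) e by blast
  hence "x s = u" "x (Suc s) = v" using s(2) vS by (auto simp: doubleton_eq_iff)
  hence "(?\<phi> ^^ s) (d i) = (u, v)" using xs[of s] by (simp add: x_def prod_eq_iff)
  thus ?thesis using s(1) by (intro exI[of _ s]) simp
 qed
 \<comment> \<open>Stretches of the walk for different boundary vertices share no oriented edge:
   walking back from a common edge, the start of one stretch would appear in the interior of the
   other, which contains no boundary vertex.\<close>
 have disj: "i = j" if h: "i < ?n" "j < ?n" "s \<le> s'" "s' \<le> r j" "(?\<phi> ^^ s) (d i) = (?\<phi> ^^ s') (d j)" for i j s s'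
 proof -
  have "(?\<phi> ^^ s') (d j) = (?\<phi> ^^ s) ((?\<phi> ^^ (s' - s)) (d j))"
   using h(3) by (simp flip: funpow_add[unfolded o_def, THEN fun_cong])
  hence eq: "d i = (?\<phi> ^^ (s' - s)) (d j)" using injp[OF dD[OF h(1)] powD[OF dD[OF h(2)]]] h(5) by simp
  have "s' - s = 0"
  proof (rule ccontr)
   assume "s' - s \<noteq> 0"
   then obtain t where t: "s' - s = Suc t" by (cases "s' - s") auto
   hence "?b i = snd ((?\<phi> ^^ t) (d j))" using df[OF h(1)] eq by (simp add: fst_step)
   moreover have "t < r j" using t h(4) by simp
   ultimately show False using dm[OF h(2)] nth_mem[OF h(1)] by metis
  qed
  hence "d i = d j" using eq by simp
  hence "?b i = ?b j" using df[OF h(1)] df[OF h(2)] by simp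
  thus ?thesis using nth_eq_iff_index_eq[OF dist h(1,2)] by simp
 qed
 show "noncrossing ?n (\<lambda>i. ?b i \<in> ?S)"
 proof (rule noncrossing_if_one_change)
  fix i j assume i: "i < ?n" "?b i \<in> ?S" "?b (Suc i mod ?n) \<notin> ?S" and j: "j < ?n" "?b j \<in> ?S" "?b (Suc j mod ?n) \<notin> ?S"
  obtain s where s: "s \<le> r i" "(?\<phi> ^^ s) (d i) = (u, v)" using cross[OF i] by blast
  obtain s' where s': "s' \<le> r j" "(?\<phi> ^^ s') (d j) = (u, v)" using cross[OF j] by blast
  show "i = j"
  proof (cases "s \<le> s'")
   case True
   thus ?thesis using disj[OF i(1) j(1) True s'(1)] s s' by simp
  next
   case False
   hence "s' \<le> s" by simp
   thus ?thesis using disj[OF j(1) i(1) _ s(1)] s s' by simp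
  qed
 qed
qed

lemma bipartite_plabic_tree_planar:
 assumes "bipartite_plabic_tree G"
 shows "plabic_tree G" "planar G"
proof -
 show p: "plabic_tree G" using assms unfolding bipartite_plabic_tree_def plabic_tree_def by (elim conjE) (intro conjI)
 obtain rot where "disk_embedding G rot" using assms unfolding bipartite_plabic_tree_def by (elim conjE exE)
 thus "planar G" by (rule disk_embedding_planar[OF p])
qed

section \<open>Planarity of half trees\<close>

lemma noncrossing_not: "noncrossing n (\<lambda>i. \<not> P i) \<longleftrightarrow> noncrossing n P"
 unfolding noncrossing_def by (simp only: not_iff simp_thms)

lemma noncrossing_subseq:
 assumes "noncrossing n P" "strict_mono_on {..<m} h" "\<And>i. i < m \<Longrightarrow> h i < n" "\<And>i. i < m \<Longrightarrow> Q i = P (h i)"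
 shows "noncrossing m Q"
 unfolding noncrossing_def
proof (intro allI impI)
 fix i j k l assume o: "i < j" "j < k" "k < l" "l < m" and e: "Q i = Q k" "Q j = Q l"
 have "h i < h j" "h j < h k" "h k < h l" "h l < n" using o assms(2,3) by (auto simp: strict_mono_on_def)
 hence "P (h i) = P (h k) \<longrightarrow> P (h j) = P (h l) \<longrightarrow> P (h i) = P (h j)"
  using assms(1) unfolding noncrossing_def by meson
 thus "Q i = Q j" using e assms(4) o by simp
qed

lemma remdups_subseq:
 "\<exists>h. strict_mono_on {..<length (remdups xs)} h \<and> (\<forall>i<length (remdups xs). h i < length xs \<and> remdups xs ! i = xs ! h i)"
proof (induction xs)
 case (Cons x xs)
 then obtain h where h: "strict_mono_on {..<length (remdups xs)} h"
  "\<forall>i<length (remdups xs). h i < length xs \<and> remdups xs ! i = xs ! h i" by (elim exE conjE)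
 show ?case
 proof (cases "x \<in> set xs")
  case True
  thus ?thesis using h by (intro exI[of _ "Suc \<circ> h"]) (auto simp: strict_mono_on_def)
 next
  case False
  thus ?thesis using h
   by (intro exI[of _ "case_nat 0 (Suc \<circ> h)"]) (auto simp: strict_mono_on_def nth_Cons split: nat.splits)
 qed
qed simp

context rooted_plabic
begin

text \<open>It is enough to test the lower sides, because the other side of an edge is the
  complement and \<open>noncrossing\<close> is symmetric under complements.\<close>

lemma planarI:
 assumes nc: "\<And>x. x \<in> verts G - {r} \<Longrightarrow> noncrossing (length (bdry G)) (\<lambda>i. bdry G ! i \<in> desc x)"
 shows "planar G"
 unfolding planar_def
proof (intro allI impI)
 fix a b assume "{a, b} \<in> edges G"
 then consider "a \<in> ch b" | "b \<in> ch a" using edge_iff[of a b] by auto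
 thus "noncrossing (length (bdry G)) (\<lambda>i. bdry G ! i \<in> reachable (edges G - {{a, b}}) a)"
 proof cases
  case 1
  hence a: "a \<in> verts G - {r}" "par a = b" using chD by auto
  thus ?thesis using reachable_desc[OF a(1)] nc[OF a(1)] by simp
 next
  case 2
  hence b: "b \<in> verts G - {r}" "par b = a" using chD by auto
  have "reachable (edges G - {{a, b}}) a = verts G - desc b" using reachable_par[OF b(1)] b(2) by (simp add: insert_commute)
  moreover have "bdry G ! i \<in> verts G" if "i < length (bdry G)" for i using that bdry_sub nth_mem by blast
  ultimately have "noncrossing (length (bdry G)) (\<lambda>i. \<not> (bdry G ! i \<in> reachable (edges G - {{a, b}}) a))"
   using nc[OF b(1)] by (rule_tac noncrossing_subseq[where h = id]) (auto simp: strict_mono_on_def)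
  thus ?thesis unfolding noncrossing_not .
 qed
qed

lemma planarD: "planar G \<Longrightarrow> x \<in> verts G - {r} \<Longrightarrow> noncrossing (length (bdry G)) (\<lambda>i. bdry G ! i \<in> desc x)"
 using reachable_desc[of x] edges_eq unfolding planar_def by force

lemma planar_rooted: "planar G \<Longrightarrow> ri = 0 \<Longrightarrow> planar_rooted_plabic G r par dep"
 using planarD rooted_plabic_axioms unfolding planar_rooted_plabic_def planar_rooted_plabic_axioms_def by blast

end

text \<open>If the first rooting directs the edge the other way, the tree is rooted anew at a
  boundary vertex below \<open>v\<close>; such a vertex exists by \<open>D_nonempty\<close>.\<close>

lemma edge_rooting:
 assumes P: "plabic_tree G" and ne: "bdry G \<noteq> []" and uv: "{u, v} \<in> edges G"
 shows "\<exists>r par dep. rooted_plabic G r par dep \<and> u \<in> verts G - {r} \<and> par u = v"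
proof -
 obtain r0 where "r0 \<in> set (bdry G)" using ne by (cases "bdry G") auto
 from plabic_tree_rooted[OF P this] obtain par0 dep0 where R0: "rooted_plabic G r0 par0 dep0" by (elim exE)
 interpret R0: rooted_plabic G r0 par0 dep0 by (rule R0)
 consider "u \<in> R0.ch v" | "v \<in> R0.ch u" using R0.edge_iff[of u v] uv by auto
 thus ?thesis
 proof cases
  case 1
  thus ?thesis using R0.chD[OF 1] R0 by (intro exI[of _ r0] exI[of _ par0] exI[of _ dep0]) simp
 next
  case 2
  hence v: "v \<in> verts G - {r0}" "par0 v = u" using R0.chD[OF 2] by simp_all
  obtain i where "i \<in> R0.D v" using R0.D_nonempty[OF v(1)] by blast
  then obtain b where b: "b \<in> set (bdry G)" "b \<in> R0.desc v" unfolding R0.D_def using nth_mem by blast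
  from plabic_tree_rooted[OF P b(1)] obtain par dep where R: "rooted_plabic G b par dep" by (elim exE)
  interpret R: rooted_plabic G b par dep by (rule R)
  consider "u \<in> R.ch v" | "v \<in> R.ch u" using R.edge_iff[of u v] uv by auto
  thus ?thesis
  proof cases
   case 1
   thus ?thesis using R.chD[OF 1] R by (intro exI[of _ b] exI[of _ par] exI[of _ dep]) simp
  next
   case 2
   hence v': "v \<in> verts G - {b}" "par v = u" using R.chD[OF 2] by simp_all
   have "R.desc v = R0.desc v" using R.reachable_desc[OF v'(1)] R0.reachable_desc[OF v(1)] v v' by simp
   thus ?thesis using b(2) R.root_not_desc[OF v'(1)] by simp
  qed
 qed
qed

context rooted_plabic
begin

text \<open>The half tree is rooted at its new boundary vertex \<open>None\<close>, with the parents
  inherited from \<open>G\<close>. Its topmost vertex \<open>w\<close> is white: either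
  \<open>u\<close> itself or the inserted vertex of degree 2 named after the parent of
  \<open>u\<close>. That vertex is not black, so it does not enter the k-statistic.\<close>

lemma half_tree:
 assumes u: "u \<in> verts G - {r}"
 defines "H \<equiv> half_tree G u (par u)"
 shows "plabic_tree H" "k_stat H = 1 + kap u" "length (bdry H) = card (D u) + 1" "planar G \<Longrightarrow> planar H"
proof -
 define v where "v = par u"
 define S where "S = desc u"
 define w where "w = (if u \<in> white G then u else v)"
 define T where "T = insert w S"
 define f where "f = (\<lambda>b. if b \<in> S then Some b else None)"
 have uS: "u \<in> S" unfolding S_def using desc_refl u by simp
 have rS: "reachable (edges G - {{u, v}}) u = S" unfolding v_def S_def by (rule reachable_desc[OF u])
 have H: "verts H = insert None (Some ` T)" "edges H = insert {Some w, None} ((`) Some ` {e \<in> edges G. e \<subseteq> T})"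
  "white H = Some ` (white G \<inter> T)" "bdry H = remdups (map f (bdry G))"
  using uS unfolding H_def half_tree_def Let_def v_def[symmetric] rS w_def T_def f_def
  by (cases "u \<in> white G"; simp add: insert_absorb)+
 have vne: "v \<notin> S" unfolding S_def v_def using desc_dep[of "par u" u] dep_par[OF u] by auto
 have vG: "v \<in> verts G" unfolding v_def using par_in[OF u] .
 have wwhite: "w \<in> white G" using bip[OF u] by (auto simp: w_def v_def)
 have wI: "w \<in> internal G" using wwhite white_internal by blast
 have wV: "w \<in> verts G - {r}" and wb: "w \<notin> set (bdry G)" using internalD[OF wI] by auto
 have TV: "x \<in> verts G - {r}" if "x \<in> T" for x
  using that wV desc_sub[of u] root_not_desc[OF u] by (auto simp: T_def S_def)
 have wdep: "dep w \<le> dep x" if "x \<in> T" for x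
  using that dep_par[OF u] desc_dep[of x u] by (auto simp: T_def S_def w_def v_def)
 have parT: "par x \<in> T" if "x \<in> T" "x \<noteq> w" for x
 proof (cases "x = u")
  case True
  thus ?thesis using that by (auto simp: w_def T_def v_def split: if_splits)
 next
  case False
  thus ?thesis using that desc_par[of x u] by (auto simp: T_def S_def)
 qed
 have parw: "par w \<notin> T" using wdep[of "par w"] dep_par[OF wV] by auto
 have finT: "finite T" unfolding T_def S_def by simp
 define par' where "par' = (\<lambda>y. case y of None \<Rightarrow> None | Some x \<Rightarrow> if x = w then None else Some (par x))"
 define dep' where "dep' = (\<lambda>y. case y of None \<Rightarrow> 0 | Some x \<Rightarrow> Suc (dep x - dep w))"
 have sides: "{e \<in> edges G. e \<subseteq> T} = {{x, par x} | x. x \<in> T - {w}}"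
 proof (rule Set.set_eqI)
  fix e
  have 1: "e \<in> {{x, par x} | x. x \<in> T - {w}}" if e: "e \<in> edges G" "e \<subseteq> T"
  proof -
   obtain x where x: "x \<in> verts G - {r}" "e = {x, par x}" using e(1) unfolding edges_eq by blast
   hence "x \<in> T" "par x \<in> T" using e(2) by auto
   hence "x \<in> T - {w}" using parw by auto
   thus ?thesis using x(2) by blast
  qed
  have 2: "e \<in> edges G \<and> e \<subseteq> T" if e: "e \<in> {{x, par x} | x. x \<in> T - {w}}"
  proof -
   obtain x where x: "x \<in> T - {w}" "e = {x, par x}" using e by blast
   thus ?thesis using TV[of x] parT[of x] unfolding edges_eq by auto
  qed
  show "e \<in> {e \<in> edges G. e \<subseteq> T} \<longleftrightarrow> e \<in> {{x, par x} | x. x \<in> T - {w}}" using 1 2 by (intro iffI CollectI) simp_all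
 qed
 have wT: "w \<in> T" by (simp add: T_def)
 have vertsH: "verts H - {None} = Some ` T" unfolding H by auto
 interpret H: rooted H None par' dep'
 proof
  show "finite (verts H)" "None \<in> verts H" using finT unfolding H by simp_all
  show "dep' None = 0" by (simp add: dep'_def)
  have "{{x, par' x} |x. x \<in> Some ` T} = insert {Some w, par' (Some w)} {{Some x, par' (Some x)} |x. x \<in> T - {w}}"
   using wT by blast
  also have "{{Some x, par' (Some x)} |x. x \<in> T - {w}} = (`) Some ` {{x, par x} | x. x \<in> T - {w}}"
   unfolding Setcompr_eq_image image_image by (intro image_cong refl) (simp add: par'_def)
  finally show "edges H = {{x, par' x} |x. x \<in> verts H - {None}}"
   unfolding vertsH unfolding H sides by (simp add: par'_def)
  fix x assume "x \<in> verts H - {None}"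
  then obtain y where y: "x = Some y" "y \<in> T" unfolding vertsH by blast
  show "par' x \<in> verts H" using y parT[OF y(2)] unfolding H by (auto simp: par'_def)
  show "dep' x = Suc (dep' (par' x))"
  proof (cases "y = w")
   case False
   thus ?thesis using y dep_par[OF TV[OF y(2)]] wdep[OF parT[OF y(2) False]] by (simp add: par'_def dep'_def)
  qed (simp add: y par'_def dep'_def)
 qed
 have chH: "H.ch (Some x) = Some ` (ch x \<inter> T - {w})" if "x \<in> T" for x
  unfolding H.ch_def vertsH ch_def using TV by (auto simp: par'_def split: if_splits)
 have chN: "H.ch None = {Some w}"
  unfolding H.ch_def vertsH using wT by (auto simp: par'_def split: if_splits)
 have chS: "ch x \<inter> T - {w} = ch x" if "x \<in> S" for x
 proof -
  have "c \<in> T \<and> c \<noteq> w" if c: "c \<in> ch x" for c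
  proof -
   have "c \<in> verts G - {r}" "par c = x" using chD[OF c] by auto
   hence "c \<in> S" "par c \<in> T" using desc_step[of c u] \<open>x \<in> S\<close> by (auto simp: S_def T_def)
   thus ?thesis using parw by (auto simp: T_def)
  qed
  thus ?thesis by blast
 qed
 have degS: "degree H (Some x) = degree G x" if "x \<in> S" for x
 proof -
  have xT: "x \<in> T" using that by (simp add: T_def)
  have "card (H.ch (Some x)) = card (ch x)" unfolding chH[OF xT] chS[OF that] by (simp add: card_image)
  moreover have "Some x \<in> verts H" using xT unfolding H by simp
  ultimately show ?thesis using H.degree_eq[of "Some x"] degree_eq[of x] TV[OF xT] by simp
 qed
 have degN: "degree H None = 1" using H.degree_eq[of None] H.rV by (simp add: chN)
 have degw: "degree H (Some w) = 2" if "w \<notin> S"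
 proof -
  have wv: "w = v" using that uS by (auto simp: w_def)
  have "ch w \<inter> T - {w} = {u}"
  proof (rule Set.set_eqI)
   fix c
   show "c \<in> ch w \<inter> T - {w} \<longleftrightarrow> c \<in> {u}"
   proof
    assume "c \<in> ch w \<inter> T - {w}"
    hence "c \<in> S" "par c = v" using chD[of c w] wv by (auto simp: T_def)
    thus "c \<in> {u}" using desc_par[of c u] vne by (auto simp: S_def)
   next
    assume "c \<in> {u}"
    thus "c \<in> ch w \<inter> T - {w}" using u uS that wv by (auto simp: ch_def v_def T_def)
   qed
  qed
  thus ?thesis using H.degree_eq[of "Some w"] chH[OF wT] wT unfolding H(1) by simp
 qed
 have rb: "r \<notin> S" unfolding S_def using root_not_desc[OF u] .
 have bH: "set (bdry H) = insert None (Some ` (set (bdry G) \<inter> S))"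
 proof -
  have "set (bdry H) = f ` set (bdry G)" unfolding H by simp
  also have "\<dots> = insert None (Some ` (set (bdry G) \<inter> S))"
   using r_bdry rb unfolding f_def by (auto simp: image_iff)
  finally show ?thesis .
 qed
 have iH: "internal H = Some ` (internal G \<inter> T)"
 proof -
  have "set (bdry G) \<inter> T = set (bdry G) \<inter> S" using wb by (auto simp: T_def)
  hence "internal H = Some ` (T - set (bdry G))" unfolding internal_def bH H(1) by blast
  also have "T - set (bdry G) = internal G \<inter> T" using TV by (auto simp: internal_def)
  finally show ?thesis .
 qed
 show PH: "plabic_tree H"
  unfolding plabic_tree_def
 proof (intro conjI ballI)
  show "is_tree H" by (rule H.rooted_is_tree)
  show "distinct (bdry H)" unfolding H by simp
  show "set (bdry H) \<subseteq> verts H" unfolding bH H(1) T_def by auto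
  show "white H \<subseteq> internal H" unfolding iH H(3) using white_internal by blast
  show "card (e \<inter> white H) = 1" if e: "e \<in> edges H" for e
  proof (cases "e = {Some w, None}")
   case True
   hence "e \<inter> white H = {Some w}" unfolding H(3) using wwhite wT by auto
   thus ?thesis by simp
  next
   case False
   then obtain e' where e': "e' \<in> edges G" "e' \<subseteq> T" "e = Some ` e'" using e unfolding H(2) by blast
   have "e \<inter> white H = Some ` (e' \<inter> white G)" unfolding H(3) e'(3) using e'(2) by blast
   hence "card (e \<inter> white H) = card (e' \<inter> white G)" by (simp add: card_image)
   thus ?thesis using plabic e'(1) by (simp add: plabic_tree_def)
  qed
  show "degree H b = 1" if "b \<in> set (bdry H)" for b
  proof (cases b)
   case (Some x)
   hence "x \<in> set (bdry G)" "x \<in> S" using that unfolding bH by auto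
   thus ?thesis using Some degS plabic by (simp add: plabic_tree_def)
  qed (simp add: degN)
  show "degree H b \<noteq> 1" if "b \<in> internal H" for b
  proof -
   obtain x where x: "b = Some x" "x \<in> internal G" "x \<in> T" using \<open>b \<in> internal H\<close> unfolding iH by blast
   show ?thesis
   proof (cases "x \<in> S")
    case True
    thus ?thesis using x degS plabic by (simp add: plabic_tree_def)
   next
    case False
    hence "x = w" using x(3) by (simp add: T_def)
    thus ?thesis using degw False x(1) by simp
   qed
  qed
 qed
 have "black_internal H = Some ` (S \<inter> black_internal G)"
  unfolding black_internal_def iH H(3) using wwhite by (auto simp: T_def)
 hence "k_stat H = 1 + (\<Sum>b\<in>S \<inter> black_internal G. degree H (Some b) - 2)"
  unfolding k_stat_def by (simp add: sum.reindex)
 also have "(\<Sum>b\<in>S \<inter> black_internal G. degree H (Some b) - 2) = kap u"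
  unfolding kap_def S_def[symmetric] using degS by (intro sum.cong refl) simp
 finally show "k_stat H = 1 + kap u" .
 have "length (bdry H) = card (set (bdry H))" unfolding H by (simp add: length_remdups_card_conv)
 also have "\<dots> = Suc (card (set (bdry G) \<inter> S))" unfolding bH by (simp add: card_insert_if card_image)
 also have "set (bdry G) \<inter> S = (\<lambda>i. bdry G ! i) ` D u"
  unfolding D_def S_def[symmetric] by (auto simp: in_set_conv_nth)
 also have "card \<dots> = card (D u)"
  using bdry_distinct by (intro card_image inj_onI) (simp add: D_def nth_eq_iff_index_eq)
 finally show "length (bdry H) = card (D u) + 1" by simp
 show "planar H" if pl: "planar G"
 proof -
  have "None \<in> set (bdry H)" unfolding bH by simp
  then interpret H: rooted_plabic H None par' dep'
   by unfold_locales (rule PH)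
  have desc_iff: "Some y \<in> H.desc (Some x) \<longleftrightarrow> y \<in> desc x" if x: "x \<in> S" and y: "y \<in> T" for x y
  proof -
   have xT: "Some x \<in> verts H - {None}" using x unfolding vertsH T_def by blast
   have xu: "x \<in> desc u" using x by (simp add: S_def)
   show ?thesis using y
   proof (induction "dep y" arbitrary: y rule: less_induct)
    case less
    show ?case
    proof (cases "y = x")
     case True
     thus ?thesis using H.desc_refl[of "Some x"] desc_refl[of x] xT xu desc_sub[of u] by blast
    next
     case nx: False
     show ?thesis
     proof (cases "y = w")
      case True
      have "par' (Some y) = None" using True by (simp add: par'_def)
      hence 1: "Some y \<notin> H.desc (Some x)"
       using H.desc_par[of "Some y" "Some x"] nx H.root_not_desc[OF xT] by auto
      have "y \<notin> desc x"
      proof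
       assume yx: "y \<in> desc x"
       hence "dep x < dep y" using desc_par nx by blast
       thus False using wdep[of x] True x by (simp add: T_def)
      qed
      thus ?thesis using 1 by simp
     next
      case False
      have p: "par' (Some y) = Some (par y)" using False by (simp add: par'_def)
      have yT: "Some y \<in> verts H - {None}" using less(2) unfolding vertsH by blast
      have IH: "Some (par y) \<in> H.desc (Some x) \<longleftrightarrow> par y \<in> desc x"
       using less(1)[of "par y"] dep_par[OF TV[OF less(2)]] parT[OF less(2) False] by simp
      have "Some y \<in> H.desc (Some x) \<longleftrightarrow> Some (par y) \<in> H.desc (Some x)"
       using H.desc_step[OF yT, of "Some x"] H.desc_par[of "Some y" "Some x"] nx unfolding p by auto
      moreover have "y \<in> desc x \<longleftrightarrow> par y \<in> desc x"
       using desc_step[OF TV[OF less(2)], of x] desc_par[of y x] nx by auto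
      ultimately show ?thesis using IH by simp
     qed
    qed
   qed
  qed
  \<comment> \<open>Every side in the half tree corresponds on the boundary to a side in
    \<open>G\<close>, all discarded boundary vertices being merged into \<open>None\<close>. The
    side at an inserted white vertex is that of \<open>u\<close>.\<close>
  have side: "\<exists>x'\<in>verts G - {r}. \<forall>b\<in>set (bdry G). f b \<in> H.desc (Some x) \<longleftrightarrow> b \<in> desc x'" if x: "x \<in> T" for x
  proof (cases "x \<in> S")
   case True
   have xT: "Some x \<in> verts H - {None}" using x unfolding vertsH by blast
   have sub: "desc x \<subseteq> S" using True desc_trans[of x u] by (auto simp: S_def)
   show ?thesis
   proof (intro bexI[of _ x] ballI)
    fix b
    show "f b \<in> H.desc (Some x) \<longleftrightarrow> b \<in> desc x"
    proof (cases "b \<in> S")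
     case bS: True
     thus ?thesis using desc_iff[OF True, of b] by (simp add: f_def T_def)
    next
     case False
     thus ?thesis using H.root_not_desc[OF xT] sub by (auto simp: f_def)
    qed
   qed (use TV[OF x] in simp)
  next
   case False
   hence xw: "x = w" using x by (simp add: T_def)
   have "H.desc None = insert None (H.desc (Some w))" using H.desc_unfold[OF H.rV] by (simp add: chN)
   hence all: "Some ` T \<subseteq> H.desc (Some w)" unfolding H.desc_root H(1) by blast
   have wT': "Some w \<in> verts H - {None}" using wT unfolding vertsH by blast
   show ?thesis
   proof (intro bexI[of _ u] ballI)
    fix b
    show "f b \<in> H.desc (Some x) \<longleftrightarrow> b \<in> desc u"
     using all H.root_not_desc[OF wT'] unfolding xw by (auto simp: f_def S_def[symmetric] T_def)
   qed (rule u)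
  qed
  show ?thesis
  proof (rule H.planarI)
   fix x assume "x \<in> verts H - {None}"
   then obtain x0 where x0: "x = Some x0" "x0 \<in> T" unfolding vertsH by blast
   obtain x' where x': "x' \<in> verts G - {r}" "\<forall>b\<in>set (bdry G). f b \<in> H.desc x \<longleftrightarrow> b \<in> desc x'"
    using side[OF x0(2)] unfolding x0(1) by (elim bexE)
   obtain h where h: "strict_mono_on {..<length (bdry H)} h"
    "\<forall>i<length (bdry H). h i < length (map f (bdry G)) \<and> bdry H ! i = map f (bdry G) ! h i"
    using remdups_subseq[of "map f (bdry G)"] unfolding H(4)[symmetric] by (elim exE conjE)
   show "noncrossing (length (bdry H)) (\<lambda>i. bdry H ! i \<in> H.desc x)"
   proof (rule noncrossing_subseq[OF planarD[OF pl x'(1)] h(1)])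
    fix i assume i: "i < length (bdry H)"
    thus hi: "h i < length (bdry G)" using h(2) by simp
    have "bdry H ! i = f (bdry G ! h i)" using h(2) i hi by simp
    thus "(bdry H ! i \<in> H.desc x) = (bdry G ! h i \<in> desc x')" using x'(2) nth_mem[OF hi] by simp
   qed
  qed
 qed
qed

end

section \<open>The positroid cell of a tree\<close>

text \<open>The factor is the sign of the sorting permutation and thus the same for all matrices,
  which allows minors of two matrices to be compared on sorted lists only.\<close>

lemma lminor_sort:
 assumes "distinct xs"
 shows "\<exists>s. s \<noteq> 0 \<and> (\<forall>A. lminor A xs = s * lminor A (sorted_list_of_set (set xs)))"
proof -
 define ys where "ys = sorted_list_of_set (set xs)"
 define k where "k = length xs"
 have ly: "length ys = k" using assms by (simp add: ys_def k_def distinct_card)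
 have "mset xs = mset ys" using assms set_eq_iff_mset_eq_distinct[of xs ys] by (simp add: ys_def)
 then obtain p where p: "p permutes {..<length ys}" "permute_list p ys = xs" using mset_eq_permutation by blast
 hence p': "p permutes {0..<k}" by (simp add: ly atLeast0LessThan)
 have xs: "xs ! b = ys ! p b" if "b < k" for b
  using p that ly by (auto simp: permute_list_def)
 have pk: "p b < k" if "b < k" for b using permutes_in_image[OF p', of b] that by simp
 have "lminor A xs = signof p * lminor A ys" for A
 proof -
  define N where "N = mat k k (\<lambda>(b, a). A $$ (a, ys ! b))"
  have N: "N \<in> carrier_mat k k" by (simp add: N_def)
  have "mat k k (\<lambda>(a, b). A $$ (a, xs ! b)) = transpose_mat (mat k k (\<lambda>(i, j). N $$ (p i, j)))"
   by (rule eq_matI) (auto simp: N_def xs pk)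
  hence "lminor A xs = det (mat k k (\<lambda>(i, j). N $$ (p i, j)))"
   unfolding lminor_def k_def[symmetric] using det_transpose[of "mat k k (\<lambda>(i, j). N $$ (p i, j))" k] by simp
  also have "\<dots> = signof p * det N" by (rule det_permute_rows[OF N p'])
  also have "N = transpose_mat (mat k k (\<lambda>(a, b). A $$ (a, ys ! b)))" by (rule eq_matI) (auto simp: N_def)
  also have "det \<dots> = lminor A ys"
   unfolding lminor_def ly using det_transpose[of "mat k k (\<lambda>(a, b). A $$ (a, ys ! b))" k] by simp
  finally show ?thesis .
 qed
 moreover have "signof p \<noteq> (0 :: complex)" by (simp add: sign_def)
 ultimately show ?thesis unfolding ys_def by blast
qed

lemma row_span_eq_sorted_minors:
 assumes A: "A \<in> mats_of_rank k n k" and B: "B \<in> carrier_mat k n" and c: "c \<noteq> 0"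
  and eq: "\<And>I. I \<subseteq> {..<n} \<Longrightarrow> card I = k \<Longrightarrow> lminor A (sorted_list_of_set I) = c * lminor B (sorted_list_of_set I)"
 shows "B \<in> mats_of_rank k n k" "row_span n A = row_span n B"
proof -
 have all: "lminor A xs = c * lminor B xs" if xs: "length xs = k" "set xs \<subseteq> {..<n}" for xs
 proof (cases "distinct xs")
  case True
  then obtain s where s: "\<And>A. lminor A xs = s * lminor A (sorted_list_of_set (set xs))"
   using lminor_sort by blast
  have "card (set xs) = k" using True xs distinct_card by blast
  thus ?thesis using eq[OF xs(2)] s[of A] s[of B] by simp
 qed (simp add: lminor_not_distinct)
 have "indep_rows k n A" using A mats_of_rank_iff by blast
 from indep_rows_lminor[OF this] obtain xs where xs: "length xs = k" "set xs \<subseteq> {..<n}" "lminor A xs \<noteq> 0"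
  by (elim exE conjE)
 hence "lminor B xs \<noteq> 0" using all by auto
 thus B': "B \<in> mats_of_rank k n k" using lminor_indep_rows[OF xs(1,2)] B mats_of_rank_iff by blast
 show "row_span n A = row_span n B" by (rule row_span_eq_minors[OF A B' c all])
qed

section \<open>A representing matrix, and the cell as its orbit\<close>

definition basis :: "'v plabic \<Rightarrow> nat set \<Rightarrow> bool" where
 "basis G I \<longleftrightarrow> (\<exists>M. almost_perfect_matching G M \<and> matching_boundary G M = I)"

definition represents :: "'v plabic \<Rightarrow> complex mat \<Rightarrow> bool" where
 "represents G A \<longleftrightarrow> A \<in> carrier_mat (k_stat G) (length (bdry G)) \<and>
   (\<forall>I. I \<subseteq> {..<length (bdry G)} \<longrightarrow> card I = k_stat G \<longrightarrow> lminor A (sorted_list_of_set I) = of_bool (basis G I))"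

lemma (in rooted_plabic) basis_good: "basis G I \<longleftrightarrow> good I"
 unfolding basis_def good_iff_matching ..

lemma bdry_rooting:
 assumes "plabic_tree G" "i < length (bdry G)"
 shows "\<exists>r par dep. rooted_plabic G r par dep \<and> rooted_plabic.ri G r = i"
proof -
 have "bdry G ! i \<in> set (bdry G)" using assms by simp
 from plabic_tree_rooted[OF assms(1) this] obtain par dep where R: "rooted_plabic G (bdry G ! i) par dep" by (elim exE)
 interpret rooted_plabic G "bdry G ! i" par dep by (rule R)
 have "ri = i" using ri_iff[OF assms(2)] by simp
 thus ?thesis using R by blast
qed

lemma basis_subset: "basis G I \<Longrightarrow> I \<subseteq> {..<length (bdry G)}"
 by (auto simp: basis_def matching_boundary_def)

lemma basis_card: "plabic_tree G \<Longrightarrow> bdry G \<noteq> [] \<Longrightarrow> basis G I \<Longrightarrow> card I = k_stat G"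
proof -
 assume "plabic_tree G" "bdry G \<noteq> []" and I: "basis G I"
 then obtain r par dep where "rooted_plabic G r par dep" using bdry_rooting[of G 0] by auto
 then interpret rooted_plabic G r par dep .
 show ?thesis using I unfolding basis_good good_def by simp
qed

lemma represents_ex:
 assumes P: "plabic_tree G" "planar G" and ne: "bdry G \<noteq> []"
 shows "\<exists>A. represents G A"
proof -
 obtain r par dep where R: "rooted_plabic G r par dep" "rooted_plabic.ri G r = 0" using bdry_rooting[OF P(1), of 0] ne by auto
 interpret R: rooted_plabic G r par dep by (rule R)
 interpret planar_rooted_plabic G r par dep by (rule R.planar_rooted[OF P(2) R(2)])
 let ?k = "k_stat G" and ?n = "length (bdry G)"
 obtain f where f: "\<forall>I\<subseteq>{..<?n}. card I = ?k \<longrightarrow> set_minor ?k f I = of_bool (R.good I)" using realization by (elim exE)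
 define A :: "complex mat" where "A = mat ?k ?n (\<lambda>(a, j). of_real (f a j))"
 have "lminor A (sorted_list_of_set I) = of_bool (basis G I)" if I: "I \<subseteq> {..<?n}" "card I = ?k" for I
 proof -
  have fI: "finite I" using I finite_subset by blast
  have len: "length (sorted_list_of_set I) = ?k" using I by simp
  have "sorted_list_of_set I ! b < ?n" if "b < ?k" for b
   using nth_mem[of b "sorted_list_of_set I"] that I(1) len fI by auto
  hence "mat ?k ?k (\<lambda>(a, b). A $$ (a, sorted_list_of_set I ! b)) = map_mat of_real (mat ?k ?k (\<lambda>(a, b). f a (sorted_list_of_set I ! b)))"
   by (intro eq_matI) (auto simp: A_def)
  hence "lminor A (sorted_list_of_set I) = of_real (set_minor ?k f I)"
   unfolding lminor_def len set_minor_def by (simp only: of_real_hom.hom_det)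
  thus ?thesis using f[rule_format, OF I] by (simp add: R.basis_good)
 qed
 hence "represents G A" unfolding represents_def by (simp add: A_def)
 thus ?thesis by blast
qed

lemma represents_nonzero:
 assumes R: "represents G A" and xs: "distinct xs" "basis G (set xs)" and k: "card (set xs) = k_stat G"
 shows "lminor A xs \<noteq> 0"
proof -
 obtain s where "s \<noteq> 0" "\<And>A. lminor A xs = s * lminor A (sorted_list_of_set (set xs))"
  using lminor_sort[OF xs(1)] by blast
 thus ?thesis using R basis_subset[OF xs(2)] k xs(2) unfolding represents_def by simp
qed

lemma represents_indep_rows:
 assumes R: "represents G A" and P: "plabic_tree G" and ne: "bdry G \<noteq> []"
 shows "indep_rows (k_stat G) (length (bdry G)) A"
proof -
 obtain r par dep where "rooted_plabic G r par dep" using bdry_rooting[OF P, of 0] ne by auto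
 then interpret rooted_plabic G r par dep .
 obtain I where I: "basis G I" using exists_good basis_good by blast
 have fI: "finite I" using basis_subset[OF I] finite_subset by blast
 have c: "card I = k_stat G" by (rule basis_card[OF P ne I])
 show ?thesis
  using represents_nonzero[OF R, of "sorted_list_of_set I"] fI I c basis_subset[OF I]
  by (intro lminor_indep_rows[of "sorted_list_of_set I"]) simp_all
qed

lemma prod_sorted: "finite I \<Longrightarrow> card I = k \<Longrightarrow> (\<Prod>b<k. t (sorted_list_of_set I ! b)) = (\<Prod>i\<in>I. t i)"
proof -
 assume I: "finite I" "card I = k"
 have "bij_betw ((!) (sorted_list_of_set I)) {..<k} I" using I by (intro bij_betw_nth) auto
 thus ?thesis by (rule prod.reindex_bij_betw)
qed

text \<open>Edge weights that realize given boundary scalings: the edge at boundary vertex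
  \<open>i\<close> gets \<open>t i\<close>, an edge between internal vertices gets the empty product
  1. As a basis has just one matching, the sum has a single term.\<close>

lemma basis_matching_sum:
 assumes P: "plabic_tree G" and ne: "bdry G \<noteq> []"
 shows "(\<Sum>M\<in>matchings G I.
   \<Prod>e\<in>M. \<Prod>i | i < length (bdry G) \<and> bdry G ! i \<in> e. t i) = (if basis G I then \<Prod>i\<in>I. t i else (0 :: real))"
proof -
 obtain r par dep where "rooted_plabic G r par dep" using bdry_rooting[OF P, of 0] ne by auto
 then interpret rooted_plabic G r par dep .
 let ?S = "(matchings G I)"
 have finE: "finite (edges G)" using fin unfolding edges_eq by simp
 have W: "(\<Prod>e\<in>M. \<Prod>i | i < length (bdry G) \<and> bdry G ! i \<in> e. t i) = (\<Prod>i\<in>I. t i)" if M: "M \<in> ?S" for M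
 proof -
  have sub: "M \<subseteq> edges G" and dis: "\<forall>e\<in>M. \<forall>f\<in>M. e \<noteq> f \<longrightarrow> e \<inter> f = {}" and b: "matching_boundary G M = I"
   using M unfolding almost_perfect_matching_def by simp_all
  have I: "I = (\<Union>e\<in>M. {i. i < length (bdry G) \<and> bdry G ! i \<in> e})" unfolding b[symmetric] matching_boundary_def by auto
  have "finite M" using sub finE finite_subset by blast
  thus ?thesis unfolding I
   using dis by (intro prod.UNION_disjoint[symmetric]) auto
 qed
 have "card ?S = card {U. up_matching U \<and> up_boundary U = I}"
  using bij_betw_same_card[OF matchings_bij[of I]] by simp
 also have "\<dots> = of_bool (basis G I)"
 proof (cases "good I")
  case True
  thus ?thesis using good_up_matching[OF True] basis_good by simp
 next
  case False
  hence "{U. up_matching U \<and> up_boundary U = I} = {}" using up_boundary_good by blast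
  thus ?thesis using False basis_good by (simp only: card.empty of_bool_eq)
 qed
 finally have "card ?S = of_bool (basis G I)" .
 moreover have "(\<Sum>M\<in>?S. \<Prod>e\<in>M. \<Prod>i | i < length (bdry G) \<and> bdry G ! i \<in> e. t i) = (\<Sum>M\<in>?S. \<Prod>i\<in>I. t i)"
  using W by (intro sum.cong refl)
 ultimately show ?thesis by simp
qed

text \<open>Both sides are compared through Pluecker coordinates. The common factor \<open>c\<close>
  produced by \<open>matching_sum\<close> does not affect the row span.\<close>

lemma positroid_cell_pos_orbit:
 assumes P: "plabic_tree G" and ne: "bdry G \<noteq> []" and R: "represents G A0"
 shows "positroid_cell G = pos_orbit (length (bdry G)) A0 (1\<^sub>m (length (bdry G))) all_pos"
proof (rule Set.set_eqI)
 let ?k = "k_stat G" and ?n = "length (bdry G)"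
 let ?V = "\<lambda>t :: nat \<Rightarrow> real. scale A0 (cx t)"
 have A0: "A0 \<in> carrier_mat ?k ?n" using R by (simp add: represents_def)
 have V1: "?V t * 1\<^sub>m ?n = ?V t" for t using right_mult_one_mat[OF scale_carrier[OF A0]] .
 have minor: "lminor (?V t) (sorted_list_of_set I) = of_real (of_bool (basis G I) * (\<Prod>i\<in>I. t i))"
  if I: "I \<subseteq> {..<?n}" "card I = ?k" for I t
 proof -
  have fI: "finite I" using I finite_subset by blast
  thus ?thesis
   using lminor_scale[OF A0, of "sorted_list_of_set I"] I R prod_sorted[OF fI I(2), of "\<lambda>i. of_real (t i) :: complex"]
   by (simp add: represents_def)
 qed
 obtain r par dep where "rooted_plabic G r par dep" using bdry_rooting[OF P, of 0] ne by auto
 then interpret rooted_plabic G r par dep .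
 fix V
 show "V \<in> positroid_cell G \<longleftrightarrow> V \<in> pos_orbit ?n A0 (1\<^sub>m ?n) all_pos"
 proof
  assume "V \<in> positroid_cell G"
  then obtain A w where A: "V = row_span ?n A" "A \<in> mats_of_rank ?k ?n ?k" and w: "\<forall>e\<in>edges G. 0 < w e"
   and mm: "\<forall>I. I \<subseteq> {..<?n} \<longrightarrow> card I = ?k \<longrightarrow> maximal_minor A I = complex_of_real
        (\<Sum>M\<in>matchings G I. \<Prod>e\<in>M. w e)"
   unfolding positroid_cell_def Let_def by (elim CollectE exE conjE)
  have "\<exists>c t. 0 < c \<and> (\<forall>i. 0 < t i) \<and> (\<forall>I. (\<Sum>M\<in>matchings G I. \<Prod>e\<in>M. w e) =
   (if good I then c * (\<Prod>i\<in>I. t i) else 0))" by (rule matching_sum) (use w in simp)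
  then obtain c t where ct: "0 < c" "\<forall>i. 0 < t i" and s: "\<forall>I. (\<Sum>M\<in>matchings G I. \<Prod>e\<in>M. w e) =
   (if good I then c * (\<Prod>i\<in>I. t i) else 0)" by (elim exE conjE)
  have Ac: "A \<in> carrier_mat ?k ?n" using A(2) mats_of_rank_iff by blast
  have eq: "lminor A (sorted_list_of_set I) = of_real c * lminor (?V t) (sorted_list_of_set I)"
   if I: "I \<subseteq> {..<?n}" "card I = ?k" for I
   using mm[rule_format, OF I] unfolding minor[OF I] maximal_minor_lminor[OF Ac I] s[rule_format] basis_good by simp
  have c0: "complex_of_real c \<noteq> 0" using ct by simp
  have "?V t \<in> mats_of_rank ?k ?n ?k" "row_span ?n A = row_span ?n (?V t)"
   using row_span_eq_sorted_minors[OF A(2) scale_carrier[OF A0] c0 eq] by simp_all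
  thus "V \<in> pos_orbit ?n A0 (1\<^sub>m ?n) all_pos"
   unfolding pos_orbit_def V1 A(1) using ct A0 mats_of_rank_iff by auto
 next
  assume "V \<in> pos_orbit ?n A0 (1\<^sub>m ?n) all_pos"
  then obtain t where t: "V = row_span ?n (?V t)" "\<forall>i. 0 < t i" "indep_rows ?k ?n (?V t)"
   unfolding pos_orbit_def V1 using A0 by auto
  define w where "w = (\<lambda>e. \<Prod>i | i < ?n \<and> bdry G ! i \<in> e. t i)"
  have "maximal_minor (?V t) I = complex_of_real
        (\<Sum>M\<in>matchings G I. \<Prod>e\<in>M. w e)" if I: "I \<subseteq> {..<?n}" "card I = ?k" for I
   unfolding maximal_minor_lminor[OF scale_carrier[OF A0] I] minor[OF I] w_def basis_matching_sum[OF P ne] by simp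
  moreover have "?V t \<in> mats_of_rank ?k ?n ?k" using t(3) A0 mats_of_rank_iff by simp
  moreover have "0 < w e" for e unfolding w_def using t(2) by (intro prod_pos) simp
  ultimately show "V \<in> positroid_cell G" unfolding positroid_cell_def Let_def t(1) by blast
 qed
qed

text \<open>The inclusion supplies a square matrix \<open>y\<close> that multiplies each column
  \<open>j\<close> of \<open>A\<close> by \<open>s j\<close>. In the eigenbasis given by the columns
  at \<open>xs\<close>, column \<open>j\<close> can have a nonzero coefficient only at eigenvectors
  with its own eigenvalue.\<close>

lemma row_span_scale_fixed:
 assumes A: "A \<in> carrier_mat k n" and xs: "length xs = k" "set xs \<subseteq> {..<n}" "lminor A xs \<noteq> 0"
  and sub: "row_span n (scale A s) \<subseteq> row_span n A"
  and b: "b < k" and j: "j < n" and nz: "lminor A (xs[b := j]) \<noteq> 0"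
 shows "s j = s (xs ! b)"
proof -
 let ?D = "lminor A xs"
 define c where "c = (\<lambda>b i. lminor A (xs[b := i]))"
 have cr: "?D * A $$ (a, i) = (\<Sum>b<k. A $$ (a, xs ! b) * c b i)" if "a < k" for a i
  using lminor_cramer[OF xs(1,3) that, of i] by (simp add: c_def)
 obtain y where y: "\<forall>a<k. \<forall>j<n. scale A s $$ (a, j) = (\<Sum>b<k. y a b * A $$ (b, j))"
  using sub row_span_subset_iff[OF scale_carrier[OF A] A] by blast
 have y': "(\<Sum>e<k. y a e * A $$ (e, i)) = A $$ (a, i) * s i" if "a < k" "i < n" for a i
  using y that A by simp
 have xn: "xs ! b < n" if "b < k" for b using nth_less[OF xs(2,1)] that .
 have ker: "(\<Sum>b<k. A $$ (a, xs ! b) * ((s j - s (xs ! b)) * c b j)) = 0" if a: "a < k" for a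
 proof -
  have "s j * (\<Sum>b<k. A $$ (a, xs ! b) * c b j) = ?D * (A $$ (a, j) * s j)" using cr[OF a, of j] by simp
  also have "\<dots> = (\<Sum>e<k. y a e * (?D * A $$ (e, j)))" unfolding y'[OF a j, symmetric] sum_distrib_left
   by (intro sum.cong refl) simp
  also have "\<dots> = (\<Sum>e<k. \<Sum>b<k. y a e * (A $$ (e, xs ! b) * c b j))" using cr by (intro sum.cong refl) (simp add: sum_distrib_left)
  also have "\<dots> = (\<Sum>b<k. \<Sum>e<k. y a e * (A $$ (e, xs ! b) * c b j))" by (rule sum.swap)
  also have "\<dots> = (\<Sum>b<k. (\<Sum>e<k. y a e * A $$ (e, xs ! b)) * c b j)" by (simp add: sum_distrib_right mult.assoc)
  also have "\<dots> = (\<Sum>b<k. A $$ (a, xs ! b) * s (xs ! b) * c b j)" using y'[OF a xn] by (intro sum.cong refl) simp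
  finally show ?thesis by (simp add: algebra_simps sum_distrib_left sum_subtractf)
 qed
 have "(s j - s (xs ! b)) * c b j = 0"
 proof (rule ccontr)
  assume ne: "(s j - s (xs ! b)) * c b j \<noteq> 0"
  have "\<exists>z. (\<exists>b<k. z b \<noteq> 0) \<and> (\<forall>a<k. (\<Sum>b<k. A $$ (a, xs ! b) * z b) = 0)"
   using b ne ker by (intro exI[of _ "\<lambda>b. (s j - s (xs ! b)) * c b j"] conjI exI[of _ b] allI impI)
  thus False using xs(3) unfolding lminor_def xs(1) det_zero_iff_columns[of k "\<lambda>a b. A $$ (a, xs ! b)"] by (rule_tac notE)
 qed
 thus ?thesis using nz by (simp add: c_def)
qed

text \<open>By \<open>basis_exchange\<close> some basis contains 0 and remains a basis when 0 is
  replaced by \<open>j\<close>. Hence \<open>row_span_scale_fixed\<close> makes the scaling at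
  \<open>j\<close> equal to the one at 0, which is zero.\<close>

lemma represents_good_proj:
 assumes R: "represents G A0" and P: "plabic_tree G" and ne: "bdry G \<noteq> []"
 shows "good_proj A0 (1\<^sub>m (length (bdry G)))"
proof -
 let ?k = "k_stat G" and ?n = "length (bdry G)"
 have A0: "A0 \<in> carrier_mat ?k ?n" using R by (simp add: represents_def)
 have V1: "A0 * 1\<^sub>m ?n = A0" "scale A0 t * 1\<^sub>m ?n = scale A0 t" for t
  using right_mult_one_mat[OF scale_carrier[OF A0]] right_mult_one_mat[OF A0] by simp_all
 obtain r par dep where rp: "rooted_plabic G r par dep" "rooted_plabic.ri G r = 0" using bdry_rooting[OF P, of 0] ne by auto
 interpret rooted_plabic G r par dep by (rule rp)
 have uj: "u j = 0" if sub: "row_span ?n (scale A0 (\<lambda>l. if l \<in> {1..<?n} then u l else 0)) \<subseteq> row_span ?n A0"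
  and j: "j \<in> {1..<?n}" for u j
 proof -
  obtain I where I: "good I" "0 \<in> I" "j \<notin> I" "good (insert j (I - {0}))"
   using basis_exchange[of j] j rp(2) by auto
  have fI: "finite I" and Isub: "I \<subseteq> {..<?n}" and cI: "card I = ?k" using I(1) finite_subset unfolding good_def by blast+
  define xs where "xs = sorted_list_of_set I"
  have xs: "length xs = ?k" "set xs \<subseteq> {..<?n}" "distinct xs" "set xs = I" using fI cI Isub by (simp_all add: xs_def)
  obtain b where b: "b < ?k" "xs ! b = 0" using I(2) xs by (metis in_set_conv_nth)
  have nz: "lminor A0 xs \<noteq> 0" using represents_nonzero[OF R xs(3)] xs cI I(1) basis_good by simp
  have d: "distinct (xs[b := j])" using xs(3,4) I(3) by (intro distinct_list_update) auto
  have s: "set (xs[b := j]) = insert j (I - {0})"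
   using set_update_distinct[OF xs(3)] b xs by simp
  have "lminor A0 (xs[b := j]) \<noteq> 0"
   using represents_nonzero[OF R d] I(4) basis_good basis_card[OF P ne] s by simp
  from row_span_scale_fixed[OF A0 xs(1,2) nz sub b(1) _ this] show "u j = 0" using j b(2) by simp
 qed
 have d: "dim_row A0 = ?k" "dim_col A0 = ?n" using A0 by auto
 show ?thesis unfolding good_proj_def torus_triv_def index_one_mat(3) d V1 id_apply image_id
  using represents_indep_rows[OF R P ne] by (intro conjI allI impI ballI) (assumption, erule uj)
qed

section \<open>Dimension of the variety and balancedness in numbers\<close>

lemma gr_dim_closure: "gr_dim k n (zariski_gr k n closure_of X) = gr_dim k n X"
 unfolding gr_dim_def by (simp add: closure_of_closure_of)

lemma positroid_dim_eq:
 assumes P: "plabic_tree G" "planar G" and ne: "bdry G \<noteq> []"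
 shows "positroid_dim G = enat (length (bdry G) - 1)"
proof -
 let ?k = "k_stat G" and ?n = "length (bdry G)"
 obtain A0 where R: "represents G A0" using represents_ex[OF P ne] by (elim exE)
 have A0: "A0 \<in> carrier_mat ?k ?n" using R by (simp add: represents_def)
 have n: "0 < ?n" using ne by simp
 have eq: "positroid_dim G = gr_dim ?k ?n (pos_orbit ?n A0 (1\<^sub>m ?n) all_pos)"
  unfolding positroid_dim_def positroid_variety_def gr_dim_closure positroid_cell_pos_orbit[OF P(1) ne R] ..
 have sub: "pos_orbit ?n A0 (1\<^sub>m ?n) all_pos \<subseteq> grassmannian ?k ?n"
 proof
  fix V assume "V \<in> pos_orbit ?n A0 (1\<^sub>m ?n) all_pos"
  then obtain t :: "nat \<Rightarrow> real" where t: "V = row_span ?n (scale A0 (cx t) * 1\<^sub>m ?n)"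
   "indep_rows ?k ?n (scale A0 (cx t) * 1\<^sub>m ?n)"
   unfolding pos_orbit_def using A0 by auto
  thus "V \<in> grassmannian ?k ?n"
   using row_span_in_gr_iff[OF mult_carrier_mat[OF scale_carrier[OF A0] one_carrier_mat]] by simp
 qed
 have "enat (?n - 1) \<le> gr_dim ?k ?n (pos_orbit ?n A0 (1\<^sub>m ?n) all_pos)"
  by (rule pos_orbit_dim_ge[OF A0 one_carrier_mat represents_good_proj[OF R P(1) ne] n sub subset_refl])
 thus ?thesis unfolding eq using pos_orbit_dim_le[OF A0 represents_indep_rows[OF R P(1) ne] n] by (intro antisym)
qed

context rooted_plabic
begin

text \<open>The half tree has \<open>card (D u) + 1\<close> boundary vertices, so the dimension of
  its variety is \<open>card (D u)\<close>, and its k-statistic is \<open>kap u + 1\<close>.\<close>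

lemma half_tree_balanced:
 assumes "planar G" and u: "u \<in> verts G - {r}"
 shows "enat (m * (k_stat (half_tree G u (par u)) - 1)) < positroid_dim (half_tree G u (par u)) \<and>
   positroid_dim (half_tree G u (par u)) \<le> enat (m * k_stat (half_tree G u (par u))) \<longleftrightarrow>
  m * kap u < card (D u) \<and> card (D u) \<le> m * (kap u + 1)"
proof -
 note H = half_tree[OF u]
 have "bdry (half_tree G u (par u)) \<noteq> []" using H(3) by auto
 thus ?thesis using positroid_dim_eq[OF H(1) H(4)[OF assms(1)]] H(2,3) by simp
qed

end

section \<open>Generic points\<close>

lemma dense_open:
 assumes irr: "irred_in T X" and U: "openin (subtopology T X) U" "U \<noteq> {}"
 shows "subtopology T X closure_of U = topspace (subtopology T X)"
proof (rule subset_antisym[OF closure_of_subset_topspace])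
 obtain O2 where O2: "openin T O2" "U = O2 \<inter> X" using U(1) unfolding openin_subtopology by blast
 show "topspace (subtopology T X) \<subseteq> subtopology T X closure_of U"
 proof
  fix x assume x: "x \<in> topspace (subtopology T X)"
  show "x \<in> subtopology T X closure_of U"
   unfolding in_closure_of
  proof (intro conjI allI impI x)
   fix O' assume "x \<in> O' \<and> openin (subtopology T X) O'"
   then obtain O1 where O1: "openin T O1" "O' = O1 \<inter> X" "x \<in> O1 \<inter> X" unfolding openin_subtopology by blast
   have "O1 \<inter> X \<noteq> {}" using O1(3) by blast
   moreover have "O2 \<inter> X \<noteq> {}" using O2 U(2) by simp
   ultimately have "O1 \<inter> O2 \<inter> X \<noteq> {}" using irr O1(1) O2(1) unfolding irred_in_def by simp
   thus "\<exists>y. y \<in> U \<and> y \<in> O'" using O1(2) O2(2) by blast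
  qed
 qed
qed

lemma generically_iff:
 assumes irr: "irred_in T X"
 shows "generically (subtopology T X) P \<longleftrightarrow> (\<exists>U. openin (subtopology T X) U \<and> U \<noteq> {} \<and> (\<forall>x\<in>U. P x))"
proof
 assume "generically (subtopology T X) P"
 then obtain U where U: "openin (subtopology T X) U" "subtopology T X closure_of U = topspace (subtopology T X)" "\<forall>x\<in>U. P x"
  unfolding generically_def by (elim exE conjE)
 have "topspace (subtopology T X) \<noteq> {}" using irr unfolding irred_in_def by auto
 hence "U \<noteq> {}" using U(2) by auto
 thus "\<exists>U. openin (subtopology T X) U \<and> U \<noteq> {} \<and> (\<forall>x\<in>U. P x)" using U by (intro exI[of _ U] conjI)
next
 assume "\<exists>U. openin (subtopology T X) U \<and> U \<noteq> {} \<and> (\<forall>x\<in>U. P x)"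
 then obtain U where U: "openin (subtopology T X) U" "U \<noteq> {}" "\<forall>x\<in>U. P x" by (elim exE conjE)
 show "generically (subtopology T X) P" unfolding generically_def
  using U dense_open[OF irr U(1,2)] by (intro exI[of _ U] conjI)
qed

lemma generically_common:
 assumes irr: "irred_in T X" and P: "generically (subtopology T X) P" and Q: "generically (subtopology T X) Q"
 shows "\<exists>x\<in>X. P x \<and> Q x"
proof -
 obtain U where U: "openin (subtopology T X) U" "U \<noteq> {}" "\<forall>x\<in>U. P x"
  using P unfolding generically_iff[OF irr] by (elim exE conjE)
 obtain V where V: "openin (subtopology T X) V" "V \<noteq> {}" "\<forall>x\<in>V. Q x"
  using Q unfolding generically_iff[OF irr] by (elim exE conjE)
 obtain O1 where O1: "openin T O1" "U = O1 \<inter> X" using U(1) unfolding openin_subtopology by blast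
 obtain O2 where O2: "openin T O2" "V = O2 \<inter> X" using V(1) unfolding openin_subtopology by blast
 have "O1 \<inter> O2 \<inter> X \<noteq> {}" using irr O1 O2 U(2) V(2) unfolding irred_in_def by simp
 then obtain x where "x \<in> O1 \<inter> O2 \<inter> X" by blast
 hence "x \<in> U" "x \<in> V" "x \<in> X" using O1 O2 by auto
 thus ?thesis using U(3) V(3) by (intro bexI[of _ x] conjI) auto
qed

text \<open>One polynomial is added at a time: on the segment between a point that suits the earlier
  ones and a point that suits the new one, a common nonzero point exists.\<close>

lemma mat_polys_common_nonzero:
 assumes "finite S" "\<And>i. i \<in> S \<Longrightarrow> f i \<in> mat_polys r c" "\<And>i. i \<in> S \<Longrightarrow> \<exists>A\<in>carrier_mat r c. f i A \<noteq> 0"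
 shows "\<exists>A\<in>carrier_mat r c. \<forall>i\<in>S. f i A \<noteq> 0"
 using assms
proof (induction S rule: finite_induct)
 case empty
 thus ?case by (intro bexI[of _ "0\<^sub>m r c"]) auto
next
 case (insert i S)
 have "\<exists>A\<in>carrier_mat r c. \<forall>i\<in>S. f i A \<noteq> 0" by (rule insert.IH) (use insert.prems in auto)
 then obtain A where A: "A \<in> carrier_mat r c" "\<forall>i\<in>S. f i A \<noteq> 0" by (elim bexE)
 obtain A' where A': "A' \<in> carrier_mat r c" "f i A' \<noteq> 0" using insert.prems(2)[of i] by auto
 define \<gamma> where "\<gamma> = (\<lambda>s::real. mat r c (\<lambda>p. (1 - of_real s) * A $$ p + of_real s * A' $$ p))"
 have g0: "\<gamma> 0 = A" "\<gamma> 1 = A'" unfolding \<gamma>_def using A A' by (auto intro!: eq_matI)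
 have seg: "\<exists>p. \<forall>s. x (\<gamma> s) = poly p (of_real s)" if x: "x \<in> mat_entries r c" for x
 proof -
  obtain a b where ab: "x = (\<lambda>M. M $$ (a, b))" "a < r" "b < c" using x unfolding mat_entries_def by blast
  show ?thesis unfolding ab(1) \<gamma>_def using ab(2,3)
   by (intro exI[of _ "[:A $$ (a, b), A' $$ (a, b) - A $$ (a, b):]"]) (simp add: algebra_simps)
 qed
 have P: "(\<lambda>M. \<Prod>i\<in>S. f i M) \<in> fpolys (mat_entries r c)" using insert.prems(1) by (intro fpolys_prod) (simp add: mat_polys_eq)
 have F: "f i \<in> fpolys (mat_entries r c)" using insert.prems(1)[of i] by (simp add: mat_polys_eq)
 have "(\<Prod>i\<in>S. f i (\<gamma> 0)) \<noteq> 0" using A(2) insert.hyps(1) by (simp add: g0)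
 moreover have "f i (\<gamma> 1) \<noteq> 0" using A'(2) by (simp add: g0)
 ultimately obtain s where s: "(\<Prod>i\<in>S. f i (\<gamma> s)) \<noteq> 0" "f i (\<gamma> s) \<noteq> 0"
  using fpolys_segment_nonzero[where \<gamma> = \<gamma> and ?s1.0 = 1, OF P F seg] by blast
 thus ?case using insert.hyps(1) by (intro bexI[of _ "\<gamma> s"]) (auto simp: \<gamma>_def)
qed

lemma top_minor_polys: "c \<le> r \<Longrightarrow> (\<lambda>A. lminor A [0..<c]) \<in> mat_polys r c"
proof -
 assume cr: "c \<le> r"
 have "(\<lambda>A. lminor A [0..<c]) \<in> fpolys (mat_entries c c)"
  using lminor_polys[of "[0..<c]" c c] by (simp add: mat_polys_eq atLeast0LessThan)
 hence "(\<lambda>A. lminor A [0..<c]) \<in> fpolys (mat_entries r c)"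
 proof (rule fpolys_compose[where \<phi> = "\<lambda>A. A"])
  fix x assume "x \<in> mat_entries c c"
  then obtain i j where ij: "x = (\<lambda>A. A $$ (i, j))" "i < c" "j < c" unfolding mat_entries_def by blast
  have "i < r" using ij(2) cr by simp
  hence "x \<in> mat_entries r c" unfolding mat_entries_def ij(1) using ij(3) by blast
  thus "(\<lambda>A. x A) \<in> fpolys (mat_entries r c)" by (rule fpolys.gen)
 qed
 thus ?thesis by (simp add: mat_polys_eq)
qed

lemma top_minor_rank:
 assumes A: "A \<in> carrier_mat r c" and cr: "c \<le> r" and nz: "lminor A [0..<c] \<noteq> 0"
 shows "A \<in> mats_of_rank r c (min r c)"
proof -
 have p: "pick {..<c} a = a" if "a < c" for a
  using pick_card_in_set[of a "{..<c}"] that by (simp add: Collect_conj_eq lessThan_def[symmetric] Int_absorb1)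
 have r: "{i. i < dim_row A \<and> i \<in> {..<c}} = {..<c}" and c: "{j. j < dim_col A \<and> j \<in> UNIV} = {..<c}" using A cr by auto
 have "submatrix A {..<c} UNIV = mat c c (\<lambda>(a, b). A $$ (a, [0..<c] ! b))"
  unfolding submatrix_def r c using p by (intro cong_mat) (simp_all add: pick_UNIV)
 hence "det (submatrix A {..<c} UNIV) \<noteq> 0" using nz by (simp add: lminor_def)
 hence "card {j. j < c \<and> j \<in> (UNIV :: nat set)} \<le> vec_space.rank r A" using vec_space.rank_gt_minor[OF A] by blast
 hence "vec_space.rank r A = c" using vec_space.rank_le_nc[OF A] by simp
 thus ?thesis using A cr by (simp add: mats_of_rank_def)
qed

text \<open>Two polynomials and the top square minor have a common nonzero point, and a nonzero top
  minor forces full rank.\<close>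

lemma full_rank_irreducible:
 assumes cr: "c \<le> r"
 shows "irred_in (zariski_mat r c) (mats_of_rank r c (min r c))"
  and "f \<in> mat_polys r c \<Longrightarrow> A \<in> carrier_mat r c \<Longrightarrow> f A \<noteq> 0 \<Longrightarrow> \<exists>A\<in>mats_of_rank r c (min r c). f A \<noteq> 0"
proof -
 define E :: "complex mat" where "E = mat r c (\<lambda>(a, b). of_bool (a = b))"
 have E: "E \<in> carrier_mat r c" by (simp add: E_def)
 have "mat c c (\<lambda>(a, b). E $$ (a, [0..<c] ! b)) = 1\<^sub>m c" using cr by (intro eq_matI) (auto simp: E_def)
 hence Enz: "lminor E [0..<c] \<noteq> 0" by (simp add: lminor_def)
 have three: "\<exists>A\<in>mats_of_rank r c (min r c). f A \<noteq> 0 \<and> g A \<noteq> 0"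
  if fg: "f \<in> mat_polys r c" "g \<in> mat_polys r c" "A1 \<in> carrier_mat r c" "A2 \<in> carrier_mat r c" "f A1 \<noteq> 0" "g A2 \<noteq> 0" for f g A1 A2
 proof -
  define h where "h = (\<lambda>i::nat. if i = 0 then f else if i = 1 then g else (\<lambda>A. lminor A [0..<c]))"
  have "\<exists>A\<in>carrier_mat r c. \<forall>i\<in>{0,1,2}. h i A \<noteq> 0"
  proof (rule mat_polys_common_nonzero)
   show "h i \<in> mat_polys r c" for i using fg top_minor_polys[OF cr] by (simp add: h_def)
   show "\<exists>A\<in>carrier_mat r c. h i A \<noteq> 0" if "i \<in> {0,1,2}" for i using fg E Enz that by (auto simp: h_def)
  qed simp
  then obtain A where A: "A \<in> carrier_mat r c" "\<forall>i\<in>{0,1,2}. h i A \<noteq> 0" by (elim bexE)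
  hence "f A \<noteq> 0" "g A \<noteq> 0" "lminor A [0..<c] \<noteq> 0" by (auto simp: h_def)
  thus ?thesis using top_minor_rank[OF A(1) cr] by (intro bexI[of _ A] conjI)
 qed
 show "\<exists>A\<in>mats_of_rank r c (min r c). f A \<noteq> 0" if "f \<in> mat_polys r c" "A \<in> carrier_mat r c" "f A \<noteq> 0" for f A
  using three[OF that(1,1,2,2,3,3)] by blast
 show "irred_in (zariski_mat r c) (mats_of_rank r c (min r c))"
  unfolding irred_in_def
 proof (intro conjI allI impI)
  show "mats_of_rank r c (min r c) \<subseteq> topspace (zariski_mat r c)" unfolding topspace_zariski_mat mats_of_rank_def by blast
  show "mats_of_rank r c (min r c) \<noteq> {}" using top_minor_rank[OF E cr Enz] by blast
  fix O1 O2 assume O: "openin (zariski_mat r c) O1" "openin (zariski_mat r c) O2"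
   "O1 \<inter> mats_of_rank r c (min r c) \<noteq> {}" "O2 \<inter> mats_of_rank r c (min r c) \<noteq> {}"
  obtain A1 where A1: "A1 \<in> O1" "A1 \<in> carrier_mat r c" using O(3) unfolding mats_of_rank_def by blast
  obtain A2 where A2: "A2 \<in> O2" "A2 \<in> carrier_mat r c" using O(4) unfolding mats_of_rank_def by blast
  obtain f where f: "f \<in> mat_polys r c" "f A1 \<noteq> 0" "\<forall>A\<in>carrier_mat r c. f A \<noteq> 0 \<longrightarrow> A \<in> O1"
   using O(1)[unfolded openin_zariski_mat, THEN conjunct2, THEN bspec, OF A1(1)] by (elim bexE conjE)
  obtain g where g: "g \<in> mat_polys r c" "g A2 \<noteq> 0" "\<forall>A\<in>carrier_mat r c. g A \<noteq> 0 \<longrightarrow> A \<in> O2"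
   using O(2)[unfolded openin_zariski_mat, THEN conjunct2, THEN bspec, OF A2(1)] by (elim bexE conjE)
  obtain A where A: "A \<in> mats_of_rank r c (min r c)" "f A \<noteq> 0" "g A \<noteq> 0"
   using three[OF f(1) g(1) A1(2) A2(2) f(2) g(2)] by blast
  hence "A \<in> carrier_mat r c" unfolding mats_of_rank_def by blast
  hence "A \<in> O1 \<inter> O2 \<inter> mats_of_rank r c (min r c)" using f(3) g(3) A by simp
  thus "O1 \<inter> O2 \<inter> mats_of_rank r c (min r c) \<noteq> {}" by blast
 qed
qed

section \<open>Fibres over a good projection\<close>

lemma mult_clip_polys:
 assumes Z: "Z \<in> carrier_mat n N" and "a < k" "j < N"
 shows "(\<lambda>B. (clip_mat k n B * Z) $$ (a, j)) \<in> fpolys (mat_entries k n)"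
 unfolding mult_mat_index[OF clip_mat_carrier Z assms(2,3)]
 using clip_mat_polys[OF assms(2)] by (intro fpolys_intros) auto

text \<open>In place of a limit argument: containing no nonzero scaling of the rows of
  \<open>A\<close> is an open condition that fails on the whole orbit, hence also on its closure. In
  the limit some entries of \<open>t\<close> may vanish and the scaled rows may span less, which is
  why an inclusion is stated.\<close>

lemma closure_orbit_contains_scaled:
 assumes A: "A \<in> carrier_mat k n" and n: "0 < n" and good: "good_proj A (1\<^sub>m n)"
  and W: "W \<in> zariski_gr k n closure_of pos_orbit n A (1\<^sub>m n) all_pos"
 shows "\<exists>t. (\<exists>i<n. t i \<noteq> 0) \<and> row_span n (scale A t) \<subseteq> W"
proof (rule ccontr)
 assume nW: "\<not> ?thesis"
 define bad where "bad = (\<lambda>W. \<exists>t. (\<exists>i<n. t i \<noteq> 0) \<and> row_span n (scale A t) \<subseteq> W)"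
 have V1: "scale A t * 1\<^sub>m n = scale A t" for t using right_mult_one_mat[OF scale_carrier[OF A]] .
 have tt: "torus_triv n A (1\<^sub>m n) B {..<n} id \<longleftrightarrow> \<not> bad (row_span n B)" for B
 proof -
  have s: "scale A (\<lambda>l. if l \<in> {..<n} then u (id l) else 0) = scale A u" for u
   by (rule scale_cong[OF A]) simp
  show ?thesis unfolding torus_triv_def bad_def V1 s image_id by auto
 qed
 define O' where "O' = {V \<in> grassmannian k n. \<not> bad V}"
 have op: "openin (zariski_gr k n) O'"
  unfolding openin_gr_iff
 proof (intro conjI ballI impI)
  show "O' \<subseteq> grassmannian k n" by (auto simp: O'_def)
  fix B assume B: "B \<in> mats_of_rank k n k" "row_span n B \<in> O'"
  have Bc: "B \<in> carrier_mat k n" "indep_rows k n B" using B(1) mats_of_rank_iff by blast+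
  have "\<exists>D\<in>fpolys (mat_entries k n). D B \<noteq> 0 \<and> (\<forall>x. D x \<noteq> 0 \<longrightarrow> torus_triv n A (1\<^sub>m n) (clip_mat k n x) {..<n} id)"
   by (rule torus_triv_open[OF A, where Z = "\<lambda>_. 1\<^sub>m n" and B = "clip_mat k n"])
    (use Bc B(2) tt in \<open>simp_all add: O'_def clip_mat_polys fpolys.const\<close>)
  then obtain D where D: "D \<in> fpolys (mat_entries k n)" "D B \<noteq> 0" "\<forall>x. D x \<noteq> 0 \<longrightarrow> torus_triv n A (1\<^sub>m n) (clip_mat k n x) {..<n} id"
   by (elim bexE conjE)
  show "\<exists>f\<in>mat_polys k n. f B \<noteq> 0 \<and> (\<forall>A'\<in>mats_of_rank k n k. f A' \<noteq> 0 \<longrightarrow> row_span n A' \<in> O')"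
  proof (intro bexI[of _ D] conjI ballI impI)
   fix A' assume A': "A' \<in> mats_of_rank k n k" "D A' \<noteq> 0"
   hence c: "A' \<in> carrier_mat k n" using mats_of_rank_iff by blast
   have "torus_triv n A (1\<^sub>m n) A' {..<n} id" using D(3)[rule_format, OF A'(2)] clip_mat_id[OF c] by simp
   thus "row_span n A' \<in> O'" unfolding O'_def tt grassmannian_def using A'(1) by blast
  qed (use D in \<open>simp_all add: mat_polys_eq\<close>)
 qed
 have "W \<in> grassmannian k n" using subsetD[OF closure_of_subset_topspace W] unfolding topspace_zariski_gr .
 moreover have "\<not> bad W" using nW unfolding bad_def .
 ultimately have WO: "W \<in> O'" unfolding O'_def by (intro CollectI conjI)
 have "\<forall>T. W \<in> T \<and> openin (zariski_gr k n) T \<longrightarrow> (\<exists>y. y \<in> pos_orbit n A (1\<^sub>m n) all_pos \<and> y \<in> T)"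
  using W unfolding in_closure_of by (rule conjunct2)
 from this[rule_format, OF conjI[OF WO op]] obtain V where "V \<in> pos_orbit n A (1\<^sub>m n) all_pos \<and> V \<in> O'" ..
 hence V: "V \<in> pos_orbit n A (1\<^sub>m n) all_pos" "V \<in> O'" by (rule conjunct1, rule conjunct2)
 from pos_orbit_cases[OF V(1)] obtain t :: "nat \<Rightarrow> real" where t': "V = row_span n (scale A (cx t) * 1\<^sub>m n)" "t \<in> all_pos"
  "indep_rows (dim_row A) n (scale A (cx t) * 1\<^sub>m n)" .
 have t: "V = row_span n (scale A (cx t))" "0 < t 0" using t'(1,2) V1 by simp_all
 have "bad V" unfolding bad_def t(1)
 proof (intro exI[of _ "\<lambda>i. of_real (t i)"] conjI exI[of _ 0] n subset_refl)
  show "complex_of_real (t 0) \<noteq> 0" using t(2) by simp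
 qed
 thus False using V(2) by (simp add: O'_def)
qed

text \<open>Any two points of a fibre contain scalings of \<open>A\<close> whose projections lie in
  the same subspace. For a generic image no such nonzero scaling has a zero entry; then the two
  scalings are proportional, each fills its point by dimension, and the points coincide.\<close>

lemma good_proj_fibre:
 assumes A: "A \<in> carrier_mat k n" and n: "0 < n" and good1: "good_proj A (1\<^sub>m n)"
  and Z: "Z \<in> carrier_mat n N" and good: "good_proj A Z"
 defines "PV \<equiv> (zariski_gr k n closure_of pos_orbit n A (1\<^sub>m n) all_pos)"
 shows "irred_in (zariski_gr k n) PV"
  and "generically (subtopology (zariski_gr k n) PV)
    (\<lambda>V. amp_map Z V \<in> grassmannian k N \<and> card {W \<in> PV. amp_map Z W = amp_map Z V} = 1)"
proof -
 have V1: "scale A t * 1\<^sub>m n = scale A t" for t using right_mult_one_mat[OF scale_carrier[OF A]] .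
 have A1: "A * 1\<^sub>m n = A" using right_mult_one_mat[OF A] .
 have Ai: "indep_rows k n A" using good1 A A1 by (simp add: good_proj_def)
 have g: "indep_rows k N (A * Z)" "torus_triv N A Z (A * Z) {1..<n} id" using good A Z by (auto simp: good_proj_def)
 have AZ: "A * Z \<in> carrier_mat k N" using A Z by simp
 have V0P: "row_span n A \<in> pos_orbit n A (1\<^sub>m n) all_pos"
  using pos_orbit_nonempty[OF A one_carrier_mat, of all_pos] Ai by (simp add: A1)
 have irr0: "irred_in (zariski_gr k n) (pos_orbit n A (1\<^sub>m n) all_pos)"
  by (rule pos_orbit_irreducible[OF A one_carrier_mat all_pos_convex]) (use V0P in blast)+
 thus irr: "irred_in (zariski_gr k n) PV" unfolding PV_def by (rule irred_in_closure)
 have "pos_orbit n A (1\<^sub>m n) all_pos \<subseteq> topspace (zariski_gr k n)" using irr0 unfolding irred_in_def by simp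
 hence V0: "row_span n A \<in> PV" unfolding PV_def using closure_of_subset V0P by blast
 have PVGr: "PV \<subseteq> grassmannian k n" using irr topspace_zariski_gr unfolding irred_in_def by blast
 \<comment> \<open>The genericity condition on the image: a scaling that vanishes at some position
   and lands in \<open>U\<close> vanishes altogether.\<close>
 define ok where "ok = (\<lambda>U. U \<in> grassmannian k N \<and> (\<forall>p<n. \<forall>u. row_span N (scale A (\<lambda>l. if l \<in> {..<n} - {p} then u l else 0) * Z) \<subseteq> U \<longrightarrow>
  (\<forall>c\<in>{..<n} - {p}. u c = 0)))"
 have ok_iff: "ok (row_span N C) \<longleftrightarrow> indep_rows k N C \<and> (\<forall>p<n. torus_triv N A Z C ({..<n} - {p}) id)"
  if "C \<in> carrier_mat k N" for C
  unfolding ok_def torus_triv_def row_span_in_gr_iff[OF that] id_apply image_id ..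
 define U where "U = {V \<in> grassmannian k n. ok (amp_map Z V)}"
 have amp: "amp_map Z (row_span n B) = row_span N (B * Z)" if "B \<in> carrier_mat k n" for B
  using amp_map_row_span[OF that Z] .
 have opU: "openin (zariski_gr k n) U"
  unfolding openin_gr_iff
 proof (intro conjI ballI impI)
  show "U \<subseteq> grassmannian k n" by (auto simp: U_def)
  fix B assume B: "B \<in> mats_of_rank k n k" "row_span n B \<in> U"
  have Bc: "B \<in> carrier_mat k n" using B(1) mats_of_rank_iff by blast
  have BZ: "clip_mat k n x * Z \<in> carrier_mat k N" for x by (rule mult_carrier_mat[OF clip_mat_carrier Z])
  have cl: "clip_mat k n B = B" by (rule clip_mat_id[OF Bc])
  have "ok (row_span N (B * Z))" using B(2) amp[OF Bc] by (simp add: U_def)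
  hence okB: "indep_rows k N (B * Z)" "\<And>p. p < n \<Longrightarrow> torus_triv N A Z (B * Z) ({..<n} - {p}) id"
   using ok_iff[of "B * Z"] Bc Z by auto
  have "\<exists>D\<in>fpolys (mat_entries k n). D B \<noteq> 0 \<and> (\<forall>x. D x \<noteq> 0 \<longrightarrow> torus_triv N A Z (clip_mat k n x * Z) ({..<n} - {p}) id)"
   if p: "p < n" for p
  proof (rule torus_triv_open[OF A, where Z = "\<lambda>_. Z" and B = "\<lambda>x. clip_mat k n x * Z"])
   show "indep_rows k N (clip_mat k n B * Z)" "torus_triv N A Z (clip_mat k n B * Z) ({..<n} - {p}) id"
    using okB(1) okB(2)[OF p] by (simp_all add: cl)
  qed (rule Z BZ fpolys.const mult_clip_polys[OF Z] Diff_subset; assumption)+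
  then obtain D where D: "\<forall>p<n. D p \<in> fpolys (mat_entries k n) \<and> D p B \<noteq> 0 \<and>
    (\<forall>x. D p x \<noteq> 0 \<longrightarrow> torus_triv N A Z (clip_mat k n x * Z) ({..<n} - {p}) id)" by metis
  have "\<exists>E\<in>fpolys (mat_entries k n). E B \<noteq> 0 \<and> (\<forall>x. E x \<noteq> 0 \<longrightarrow> indep_rows k N (clip_mat k n x * Z))"
   by (rule indep_rows_open[where B = "\<lambda>x. clip_mat k n x * Z"]) (simp_all only: cl okB(1) mult_clip_polys[OF Z])
  then obtain E where E: "E \<in> fpolys (mat_entries k n)" "E B \<noteq> 0" "\<forall>x. E x \<noteq> 0 \<longrightarrow> indep_rows k N (clip_mat k n x * Z)"
   by (elim bexE conjE)
  show "\<exists>f\<in>mat_polys k n. f B \<noteq> 0 \<and> (\<forall>A'\<in>mats_of_rank k n k. f A' \<noteq> 0 \<longrightarrow> row_span n A' \<in> U)"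
  proof (intro bexI[of _ "\<lambda>x. E x * (\<Prod>p<n. D p x)"] conjI ballI impI)
   show "E B * (\<Prod>p<n. D p B) \<noteq> 0" using E(2) D by auto
   show "(\<lambda>x. E x * (\<Prod>p<n. D p x)) \<in> mat_polys k n" unfolding mat_polys_eq using E(1) D by (intro fpolys_intros) auto
   fix A' assume A': "A' \<in> mats_of_rank k n k" "E A' * (\<Prod>p<n. D p A') \<noteq> 0"
   hence c: "A' \<in> carrier_mat k n" using mats_of_rank_iff by blast
   have "E A' \<noteq> 0" "\<forall>p<n. D p A' \<noteq> 0" using A'(2) by auto
   hence "indep_rows k N (A' * Z)" "\<forall>p<n. torus_triv N A Z (A' * Z) ({..<n} - {p}) id"
    using D E(3) clip_mat_id[OF c] by (metis, metis)
   hence "ok (amp_map Z (row_span n A'))" unfolding amp[OF c] using ok_iff[of "A' * Z"] c Z by simp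
   thus "row_span n A' \<in> U" unfolding U_def grassmannian_def using A'(1) by blast
  qed
 qed
 \<comment> \<open>The condition holds at \<open>A\<close> itself: a scaling that lands in the span
   of \<open>A * Z\<close> is proportional to the all-one scaling, so a single zero entry makes it
   zero.\<close>
 have "torus_triv N A Z (A * Z) ({..<n} - {p}) id" if p: "p < n" for p
  unfolding torus_triv_def
 proof (intro allI impI ballI)
  fix u c assume sub: "row_span N (scale A (\<lambda>l. if l \<in> {..<n} - {p} then u (id l) else 0) * Z) \<subseteq> row_span N (A * Z)"
   and c: "c \<in> id ` ({..<n} - {p})"
  have one: "row_span N (scale A (\<lambda>_. 1) * Z) \<subseteq> row_span N (A * Z)" using scale_one[OF A, of "\<lambda>_. 1"] by simp
  obtain d where d: "\<forall>i<n. (if i \<in> {..<n} - {p} then u (id i) else 0) = d * (1 :: complex)"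
   using torus_triv_proportional[OF A Z AZ g(2) _ n one sub] by auto
  from d[rule_format, OF p] have "d = 0" by simp
  thus "u c = 0" using d[rule_format, of c] c by simp
 qed
 hence "ok (row_span N (A * Z))" using ok_iff[OF AZ] g(1) by simp
 hence V0U: "row_span n A \<in> U" using V0 PVGr amp[OF A] by (auto simp: U_def)
 have fib: "{W \<in> PV. amp_map Z W = amp_map Z V} = {V}" if V: "V \<in> PV" "V \<in> U" for V
 proof -
  have okV: "ok (amp_map Z V)" using V(2) by (simp add: U_def)
  have mono: "row_span N (scale A t * Z) \<subseteq> amp_map Z W" if "row_span n (scale A t) \<subseteq> W" for t W
   using that amp[OF scale_carrier[OF A], of t] unfolding amp_map_def by blast
  have zero: "\<forall>i<n. t i = 0" if t: "row_span N (scale A t * Z) \<subseteq> amp_map Z V" "t p = 0" "p < n" for t p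
  proof -
   have "scale A (\<lambda>l. if l \<in> {..<n} - {p} then t l else 0) = scale A t" by (rule scale_cong[OF A]) (use t in auto)
   hence "\<forall>c\<in>{..<n} - {p}. t c = 0" using okV t(1,3) unfolding ok_def by metis
   thus ?thesis using t(2) by auto
  qed
  have all: "\<forall>i<n. t i \<noteq> 0" if t: "row_span N (scale A t * Z) \<subseteq> amp_map Z V" "\<exists>i<n. t i \<noteq> 0" for t
  proof (intro allI impI notI)
   fix p assume "p < n" "t p = 0"
   hence "\<forall>i<n. t i = 0" using zero[OF t(1)] by blast
   thus False using t(2) by blast
  qed
  from closure_orbit_contains_scaled[OF A n good1 V(1)[unfolded PV_def]]
  obtain t where "(\<exists>i<n. t i \<noteq> 0) \<and> row_span n (scale A t) \<subseteq> V" ..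
  hence t: "\<exists>i<n. t i \<noteq> 0" "row_span n (scale A t) \<subseteq> V" by (rule conjunct1, rule conjunct2)
  have t0: "\<forall>i<n. t i \<noteq> 0" by (rule all[OF mono[OF t(2)] t(1)])
  have full: "W = row_span n (scale A s)" if W: "W \<in> PV" "row_span n (scale A s) \<subseteq> W" and s: "\<forall>i<n. s i \<noteq> 0" for W s
  proof -
   obtain B where B: "W = row_span n B" "B \<in> carrier_mat k n" "indep_rows k n B"
    using W(1) PVGr unfolding grassmannian_def mats_of_rank_iff by (auto simp: mats_of_rank_iff)
   have i: "indep_rows k n (scale A s)" using indep_rows_scale[OF A Ai] s by blast
   from row_span_eqI[OF scale_carrier[OF A] i B(2,3) W(2)[unfolded B(1)]] show ?thesis unfolding B(1) by (rule sym)
  qed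
  have "W = V" if W: "W \<in> PV" "amp_map Z W = amp_map Z V" for W
  proof -
   from closure_orbit_contains_scaled[OF A n good1 W(1)[unfolded PV_def]]
   obtain t' where "(\<exists>i<n. t' i \<noteq> 0) \<and> row_span n (scale A t') \<subseteq> W" ..
   hence t': "\<exists>i<n. t' i \<noteq> 0" "row_span n (scale A t') \<subseteq> W" by (rule conjunct1, rule conjunct2)
   have s': "row_span N (scale A t' * Z) \<subseteq> amp_map Z V" using mono[OF t'(2)] W(2) by simp
   have t'0: "\<forall>i<n. t' i \<noteq> 0" by (rule all[OF s' t'(1)])
   obtain B where B: "V = row_span n B" "B \<in> carrier_mat k n"
    using V(1) PVGr unfolding grassmannian_def by (auto simp: mats_of_rank_iff)
   have BZ: "B * Z \<in> carrier_mat k N" using B Z by simp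
   have aV: "amp_map Z V = row_span N (B * Z)" using amp[OF B(2)] B(1) by simp
   have triv: "torus_triv N A Z (B * Z) {1..<n} id"
   proof -
    have "{1..<n} = {..<n} - {0}" by auto
    thus ?thesis using okV ok_iff[OF BZ] n unfolding aV by simp
   qed
   obtain c where c: "\<forall>i<n. t' i = c * t i"
    using torus_triv_proportional[where t = t and t' = t', OF A Z BZ triv t0[rule_format, OF n] n mono[OF t(2), unfolded aV] s'[unfolded aV]] ..
   have "c \<noteq> 0" using c t'0 n by auto
   hence "row_span n (scale A t') = row_span n (scale A t)" using row_span_scale[OF A \<open>c \<noteq> 0\<close>] c by simp
   thus ?thesis using full[OF W(1) t'(2) t'0] full[OF V(1) t(2) t0] by simp
  qed
  thus ?thesis using V(1) by blast
 qed
 show "generically (subtopology (zariski_gr k n) PV)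
    (\<lambda>V. amp_map Z V \<in> grassmannian k N \<and> card {W \<in> PV. amp_map Z W = amp_map Z V} = 1)"
  unfolding generically_iff[OF irr]
 proof (intro exI[of _ "U \<inter> PV"] conjI ballI)
  show "openin (subtopology (zariski_gr k n) PV) (U \<inter> PV)" unfolding openin_subtopology using opU by blast
  show "U \<inter> PV \<noteq> {}" using V0 V0U by blast
  fix V assume V: "V \<in> U \<inter> PV"
  thus "amp_map Z V \<in> grassmannian k N" unfolding U_def ok_def by blast
  show "card {W \<in> PV. amp_map Z W = amp_map Z V} = 1" using fib[of V] V by simp
 qed
qed

section \<open>Balanced trees\<close>

lemma represents_columns:
 assumes R: "represents G A0" and I: "basis G I" "card I = k_stat G"
  and t: "\<And>a. a < k_stat G \<Longrightarrow> (\<Sum>i\<in>I. A0 $$ (a, i) * t i) = 0" and i: "i \<in> I"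
 shows "t i = 0"
proof -
 let ?k = "k_stat G"
 have fI: "finite I" using basis_subset[OF I(1)] finite_subset by blast
 define xs where "xs = sorted_list_of_set I"
 have xs: "length xs = ?k" "distinct xs" "set xs = I" using fI I by (simp_all add: xs_def)
 have bij: "bij_betw ((!) xs) {..<?k} I" using bij_betw_nth[OF xs(2) _ xs(3)[symmetric], of "{..<?k}"] xs(1) by simp
 have nz: "lminor A0 xs \<noteq> 0" using represents_nonzero[OF R xs(2)] I xs(3) by simp
 have s: "(\<Sum>b<?k. A0 $$ (a, xs ! b) * t (xs ! b)) = 0" if "a < ?k" for a
  using sum.reindex_bij_betw[OF bij, of "\<lambda>i. A0 $$ (a, i) * t i"] t[OF that] by simp
 obtain b where b: "b < ?k" "i = xs ! b" using i xs by (metis in_set_conv_nth)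
 show ?thesis
 proof (rule ccontr)
  assume ne: "t i \<noteq> 0"
  have "\<exists>z. (\<exists>b<?k. z b \<noteq> 0) \<and> (\<forall>a<?k. (\<Sum>b<?k. A0 $$ (a, xs ! b) * z b) = 0)"
   using b ne s by (intro exI[of _ "\<lambda>b. t (xs ! b)"] conjI exI[of _ b] allI impI) simp_all
  thus False using nz unfolding lminor_def xs(1) det_zero_iff_columns[of ?k "\<lambda>a b. A0 $$ (a, xs ! b)"] by (rule_tac notE)
 qed
qed

text \<open>The polynomial is nonzero at the indicator matrix of the partition.\<close>

lemma partition_polynomial:
 assumes R: "represents G A0" and P: "plabic_tree G" and ne: "bdry G \<noteq> []"
  and I: "\<And>l. l < m \<Longrightarrow> basis G (I l) \<and> i0 \<notin> I l" "\<And>j. j < length (bdry G) \<Longrightarrow> j \<noteq> i0 \<Longrightarrow> \<exists>l<m. j \<in> I l"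
 shows "\<exists>f. f \<in> mat_polys m (length (bdry G)) \<and> (\<exists>p\<in>carrier_mat m (length (bdry G)). f p \<noteq> 0) \<and>
  (\<forall>x t. f x \<noteq> 0 \<longrightarrow> t i0 = 0 \<longrightarrow>
   (\<forall>a<k_stat G. \<forall>j<m. (\<Sum>i<length (bdry G). x $$ (j, i) * A0 $$ (a, i) * t i) = 0) \<longrightarrow> (\<forall>i<length (bdry G). t i = 0))"
proof -
 let ?k = "k_stat G" and ?n = "length (bdry G)"
 \<comment> \<open>Row \<open>j\<close> of the indicator matrix restricts the sum to
   \<open>I j\<close>, where the columns of \<open>A0\<close> are independent; the system falls
   apart into one for each basis.\<close>
 define p0 :: "complex mat" where "p0 = mat m ?n (\<lambda>(j, i). of_bool (i \<in> I j))"
 define J where "J = {..<?n} - {i0}"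
 define L where "L = (\<lambda>(a, j) i (x :: complex mat). x $$ (j, i) * A0 $$ (a, i))"
 have "\<exists>D\<in>fpolys (mat_entries m ?n). \<exists>N. (\<forall>i. N i \<in> fpolys (mat_entries m ?n)) \<and> D p0 \<noteq> 0 \<and>
  (\<forall>x t \<tau>. D x \<noteq> 0 \<longrightarrow> (\<forall>\<xi>\<in>{..<?k} \<times> {..<m}. (\<Sum>i\<in>J. L \<xi> i x * t i) = (\<lambda>_ _. 0) \<xi> x * \<tau>) \<longrightarrow> (\<forall>i\<in>J. D x * t i = N i x * \<tau>))"
 proof (rule linear_system_elimination)
  show "finite J" by (simp add: J_def)
  fix \<xi> i assume "\<xi> \<in> {..<?k} \<times> {..<m}" "i \<in> J"
  then obtain a j where aj: "\<xi> = (a, j)" "j < m" "i < ?n" by (auto simp: J_def)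
  hence "(\<lambda>x. x $$ (j, i)) \<in> fpolys (mat_entries m ?n)" by (intro fpolys.gen) (auto simp: mat_entries_def)
  thus "L \<xi> i \<in> fpolys (mat_entries m ?n)" unfolding L_def aj(1) prod.case by (intro fpolys_intros)
 next
  fix t assume t: "\<forall>\<xi>\<in>{..<?k} \<times> {..<m}. (\<Sum>i\<in>J. L \<xi> i p0 * t i) = 0"
  show "\<forall>i\<in>J. t i = 0"
  proof
   fix i assume i: "i \<in> J"
   then obtain l where l: "l < m" "i \<in> I l" using I(2)[of i] by (auto simp: J_def)
   have b: "basis G (I l)" "i0 \<notin> I l" using I(1)[OF l(1)] by simp_all
   have sub: "I l \<subseteq> J" using basis_subset[OF b(1)] b(2) by (auto simp: J_def)
   show "t i = 0"
   proof (rule represents_columns[OF R b(1) basis_card[OF P ne b(1)] _ l(2)])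
    fix a assume a: "a < ?k"
    have "0 = (\<Sum>i\<in>J. L (a, l) i p0 * t i)" using t a l(1) by simp
    also have "\<dots> = (\<Sum>i\<in>I l. A0 $$ (a, i) * t i)"
    proof (rule sum.mono_neutral_cong_right)
     show "finite J" "I l \<subseteq> J" using sub by (simp_all add: J_def)
    qed (use l(1) sub in \<open>auto simp: L_def p0_def J_def\<close>)
    finally show "(\<Sum>i\<in>I l. A0 $$ (a, i) * t i) = 0" by simp
   qed
  qed
 qed (rule fpolys.const)
 then obtain D N where D: "D \<in> fpolys (mat_entries m ?n)" "D p0 \<noteq> 0" and
  DN: "\<forall>x t \<tau>. D x \<noteq> 0 \<longrightarrow> (\<forall>\<xi>\<in>{..<?k} \<times> {..<m}. (\<Sum>i\<in>J. L \<xi> i x * t i) = 0 * \<tau>) \<longrightarrow> (\<forall>i\<in>J. D x * t i = N i x * \<tau>)"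
  by (elim bexE exE conjE)
 have dead: "\<forall>i<?n. t i = 0" if x: "D x \<noteq> 0" "t i0 = 0" and
  sys: "\<forall>a<?k. \<forall>j<m. (\<Sum>i<?n. x $$ (j, i) * A0 $$ (a, i) * t i) = 0" for x t
 proof -
  have "(\<Sum>i\<in>J. L \<xi> i x * t i) = 0 * 0" if \<xi>: "\<xi> \<in> {..<?k} \<times> {..<m}" for \<xi>
  proof -
   obtain a j where aj: "\<xi> = (a, j)" "a < ?k" "j < m" using \<xi> by auto
   have "(\<Sum>i\<in>J. L \<xi> i x * t i) = (\<Sum>i<?n. x $$ (j, i) * A0 $$ (a, i) * t i)"
    unfolding aj(1) L_def J_def using x(2) by (intro sum.mono_neutral_cong_left) auto
   thus ?thesis using sys aj by simp
  qed
  hence "\<forall>\<xi>\<in>{..<?k} \<times> {..<m}. (\<Sum>i\<in>J. L \<xi> i x * t i) = 0 * 0" by (rule ballI)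
  from DN[rule_format, OF x(1) this[rule_format]] have "\<forall>i\<in>J. D x * t i = 0" by simp
  thus ?thesis using x unfolding J_def by auto
 qed
 show ?thesis
 proof (rule exI[of _ D], intro conjI bexI[of _ p0])
  show "D \<in> mat_polys m ?n" using D(1) by (simp add: mat_polys_eq)
  show "D p0 \<noteq> 0" by (rule D(2))
  show "p0 \<in> carrier_mat m ?n" by (simp add: p0_def)
  show "\<forall>x t. D x \<noteq> 0 \<longrightarrow> t i0 = 0 \<longrightarrow>
   (\<forall>a<?k. \<forall>j<m. (\<Sum>i<?n. x $$ (j, i) * A0 $$ (a, i) * t i) = 0) \<longrightarrow> (\<forall>i<?n. t i = 0)"
   by (rule allI, rule allI, rule impI, rule impI, rule impI, rule dead)
 qed
qed

text \<open>A matrix \<open>p\<close> is chosen at which the polynomials for all omitted positions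
  are nonzero. The system \<open>sys p\<close> has \<open>m * k\<close> equations in
  \<open>m * k + 1\<close> unknowns and thus a nonzero solution \<open>t0\<close>, all of whose
  entries are nonzero by \<open>kill\<close>. It serves to build the last \<open>m\<close> columns
  of \<open>Z\<close>.\<close>

lemma good_proj_exists:
 assumes R: "represents G A0" and P: "plabic_tree G" and ne: "bdry G \<noteq> []"
  and n: "length (bdry G) = m * k_stat G + 1"
  and part: "\<And>i0. i0 < length (bdry G) \<Longrightarrow> \<exists>I. (\<forall>l<m. basis G (I l) \<and> i0 \<notin> I l) \<and>
   (\<forall>j<length (bdry G). j \<noteq> i0 \<longrightarrow> (\<exists>l<m. j \<in> I l))"
 shows "\<exists>Z\<in>carrier_mat (length (bdry G)) (k_stat G + m). good_proj A0 Z"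
proof -
 let ?k = "k_stat G" and ?n = "length (bdry G)"
 let ?N = "?k + m"
 have A0: "A0 \<in> carrier_mat ?k ?n" using R by (simp add: represents_def)
 define sys where "sys = (\<lambda>(x :: complex mat) t. \<forall>a<?k. \<forall>j<m. (\<Sum>i<?n. x $$ (j, i) * A0 $$ (a, i) * t i) = 0)"
 have "\<exists>f. f \<in> mat_polys m ?n \<and> (\<exists>p\<in>carrier_mat m ?n. f p \<noteq> 0) \<and>
  (\<forall>x t. f x \<noteq> 0 \<longrightarrow> t i0 = 0 \<longrightarrow> sys x t \<longrightarrow> (\<forall>i<?n. t i = 0))" if i0: "i0 < ?n" for i0
 proof -
  from part[OF i0] obtain I where I: "\<forall>l<m. basis G (I l) \<and> i0 \<notin> I l" "\<forall>j<?n. j \<noteq> i0 \<longrightarrow> (\<exists>l<m. j \<in> I l)"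
   by (elim exE conjE)
  show ?thesis unfolding sys_def by (rule partition_polynomial[OF R P ne I(1)[rule_format] I(2)[rule_format]])
 qed
 hence "\<forall>i0. \<exists>f. i0 < ?n \<longrightarrow> f \<in> mat_polys m ?n \<and> (\<exists>p\<in>carrier_mat m ?n. f p \<noteq> 0) \<and>
  (\<forall>x t. f x \<noteq> 0 \<longrightarrow> t i0 = 0 \<longrightarrow> sys x t \<longrightarrow> (\<forall>i<?n. t i = 0))" by blast
 from choice[OF this] obtain f where f: "\<And>i0. i0 < ?n \<Longrightarrow> f i0 \<in> mat_polys m ?n"
  "\<And>i0. i0 < ?n \<Longrightarrow> \<exists>p\<in>carrier_mat m ?n. f i0 p \<noteq> 0"
  "\<And>i0 x t. i0 < ?n \<Longrightarrow> f i0 x \<noteq> 0 \<Longrightarrow> t i0 = 0 \<Longrightarrow> sys x t \<Longrightarrow> (\<forall>i<?n. t i = 0)" by blast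
 have "\<exists>p\<in>carrier_mat m ?n. \<forall>i\<in>{..<?n}. f i p \<noteq> 0"
  by (rule mat_polys_common_nonzero) (simp_all add: f(1,2))
 then obtain p where p: "p \<in> carrier_mat m ?n" "\<forall>i\<in>{..<?n}. f i p \<noteq> 0" by (elim bexE)
 have kill: "\<forall>i<?n. t i = 0" if "i0 < ?n" "t i0 = 0" "sys p t" for i0 t
  using f(3)[OF that(1) _ that(2,3)] p(2) that(1) by simp
 have "\<exists>t. (\<exists>i\<in>{..<?n}. t i \<noteq> 0) \<and> (\<forall>\<xi>\<in>{..<?k} \<times> {..<m}. (\<Sum>i\<in>{..<?n}. (case \<xi> of (a, j) \<Rightarrow> p $$ (j, i) * A0 $$ (a, i)) * t i) = 0)"
  by (rule underdetermined_system) (simp_all add: n card_cartesian_product mult.commute)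
 then obtain t0 where t0: "\<exists>i\<in>{..<?n}. t0 i \<noteq> 0" "\<forall>\<xi>\<in>{..<?k} \<times> {..<m}. (\<Sum>i\<in>{..<?n}. (case \<xi> of (a, j) \<Rightarrow> p $$ (j, i) * A0 $$ (a, i)) * t0 i) = 0"
  by (elim exE conjE)
 have st0: "sys p t0" unfolding sys_def using t0(2) by auto
 have t0n: "t0 i \<noteq> 0" if "i < ?n" for i
 proof
  assume "t0 i = 0"
  hence "\<forall>i<?n. t0 i = 0" using kill[OF that _ st0] by blast
  thus False using t0(1) by auto
 qed
 obtain xs where xs: "length xs = ?k" "set xs \<subseteq> {..<?n}" "lminor A0 xs \<noteq> 0"
  using indep_rows_lminor[OF represents_indep_rows[OF R P ne]] by (elim exE conjE)
 have xn: "xs ! b < ?n" if "b < ?k" for b using nth_less[OF xs(2,1) that] .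
 \<comment> \<open>The first columns reproduce the invertible block of \<open>A0\<close> at
   \<open>xs\<close>; the others are the rows of \<open>p\<close> weighted by \<open>t0\<close>, so
   that they are annihilated by \<open>A0\<close>. A scaling \<open>s\<close> then keeps the rows
   inside the span only if \<open>s i * t0 i\<close> solves \<open>sys p\<close>.\<close>
 define Z :: "complex mat" where "Z = mat ?n ?N (\<lambda>(i, c). if c < ?k then of_bool (i = xs ! c) else p $$ (c - ?k, i) * t0 i)"
 have Z: "Z \<in> carrier_mat ?n ?N" by (simp add: Z_def)
 have AZ: "A0 * Z \<in> carrier_mat ?k ?N" using A0 Z by simp
 have e1: "(A0 * Z) $$ (a, c) = A0 $$ (a, xs ! c)" if "a < ?k" "c < ?k" for a c
 proof -
  have "(A0 * Z) $$ (a, c) = (\<Sum>i<?n. A0 $$ (a, i) * Z $$ (i, c))" using mult_mat_index[OF A0 Z that(1)] that(2) by simp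
  also have "\<dots> = (\<Sum>i<?n. if i = xs ! c then A0 $$ (a, i) else 0)" using that by (intro sum.cong refl) (simp add: Z_def)
  also have "\<dots> = A0 $$ (a, xs ! c)" using xn[OF that(2)] by simp
  finally show ?thesis .
 qed
 have e2: "(scale A0 s * Z) $$ (a, ?k + j) = (\<Sum>i<?n. p $$ (j, i) * A0 $$ (a, i) * (s i * t0 i))"
  if "a < ?k" "j < m" for a j s
 proof -
  have "(scale A0 s * Z) $$ (a, ?k + j) = (\<Sum>i<?n. A0 $$ (a, i) * s i * Z $$ (i, ?k + j))"
   using scale_mult_index[OF A0 Z that(1), of "?k + j"] that(2) by simp
  also have "\<dots> = (\<Sum>i<?n. p $$ (j, i) * A0 $$ (a, i) * (s i * t0 i))" using that by (intro sum.cong refl) (simp add: Z_def)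
  finally show ?thesis .
 qed
 have e3: "(A0 * Z) $$ (a, ?k + j) = 0" if "a < ?k" "j < m" for a j
 proof -
  have "(A0 * Z) $$ (a, ?k + j) = (\<Sum>i<?n. p $$ (j, i) * A0 $$ (a, i) * t0 i)"
   using e2[OF that, of "\<lambda>_. 1"] scale_one[OF A0, of "\<lambda>_. 1"] by simp
  thus ?thesis using st0 that unfolding sys_def by simp
 qed
 have "indep_rows ?k ?N (A0 * Z)"
  unfolding indep_rows_def
 proof (intro allI impI, rule ccontr)
  fix y a assume y: "\<forall>j<?N. (\<Sum>a<?k. y a * (A0 * Z) $$ (a, j)) = 0" and a: "a < ?k" "y a \<noteq> 0"
  have "\<forall>b<?k. (\<Sum>a<?k. y a * A0 $$ (a, xs ! b)) = 0"
  proof (intro allI impI)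
   fix b assume b: "b < ?k"
   have "(\<Sum>a<?k. y a * A0 $$ (a, xs ! b)) = (\<Sum>a<?k. y a * (A0 * Z) $$ (a, b))" using e1 b by (intro sum.cong refl) simp
   thus "(\<Sum>a<?k. y a * A0 $$ (a, xs ! b)) = 0" using y b by simp
  qed
  hence "lminor A0 xs = 0" unfolding lminor_zero_iff[OF xs(1)] using a by (intro exI[of _ y] conjI exI[of _ a])
  thus False using xs(3) by simp
 qed
 moreover have "torus_triv ?N A0 Z (A0 * Z) {1..<?n} id"
  unfolding torus_triv_def
 proof (intro allI impI ballI)
  fix u :: "nat \<Rightarrow> complex" and c
  define s where "s = (\<lambda>l. if l \<in> {1..<?n} then u (id l) else 0)"
  assume "row_span ?N (scale A0 (\<lambda>l. if l \<in> {1..<?n} then u (id l) else 0) * Z) \<subseteq> row_span ?N (A0 * Z)"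
  hence sub: "row_span ?N (scale A0 s * Z) \<subseteq> row_span ?N (A0 * Z)" unfolding s_def .
  assume "c \<in> id ` {1..<?n}"
  hence c: "c \<in> {1..<?n}" by simp
  have "\<exists>y. \<forall>a<?k. \<forall>j<?N. (scale A0 s * Z) $$ (a, j) = (\<Sum>b<?k. y a b * (A0 * Z) $$ (b, j))"
   using sub row_span_subset_iff[OF mult_carrier_mat[OF scale_carrier[OF A0] Z] AZ] by simp
  then obtain y where y: "\<forall>a<?k. \<forall>j<?N. (scale A0 s * Z) $$ (a, j) = (\<Sum>b<?k. y a b * (A0 * Z) $$ (b, j))" ..
  have "sys p (\<lambda>i. s i * t0 i)"
   unfolding sys_def
  proof (intro allI impI)
   fix a j assume aj: "a < ?k" "j < m"
   have "(\<Sum>i<?n. p $$ (j, i) * A0 $$ (a, i) * (s i * t0 i)) = (\<Sum>b<?k. y a b * (A0 * Z) $$ (b, ?k + j))"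
    unfolding e2[OF aj, symmetric] using y[rule_format, OF aj(1), of "?k + j"] aj(2) by simp
   also have "\<dots> = 0" using e3 aj(2) by (intro sum.neutral) simp
   finally show "(\<Sum>i<?n. p $$ (j, i) * A0 $$ (a, i) * (s i * t0 i)) = 0" .
  qed
  hence "\<forall>i<?n. s i * t0 i = 0" using kill[of 0 "\<lambda>i. s i * t0 i"] ne by (simp add: s_def)
  hence "s c = 0" using t0n[of c] c by auto
  thus "u c = 0" using c by (simp add: s_def)
 qed
 moreover have "dim_row A0 = ?k" "dim_col A0 = ?n" "dim_col Z = ?N" using A0 Z by auto
 ultimately have "good_proj A0 Z" unfolding good_proj_def by simp
 thus ?thesis using Z by (intro bexI)
qed

lemma good_proj_open:
 assumes A: "A \<in> carrier_mat k n" and Z0: "Z0 \<in> carrier_mat n N" "good_proj A Z0"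
 shows "\<exists>f\<in>mat_polys n N. f Z0 \<noteq> 0 \<and> (\<forall>Z\<in>carrier_mat n N. f Z \<noteq> 0 \<longrightarrow> good_proj A Z)"
proof -
 have g: "indep_rows k N (A * Z0)" "torus_triv N A Z0 (A * Z0) {1..<n} id" using Z0 A by (auto simp: good_proj_def)
 have cl: "clip_mat n N Z0 = Z0" by (rule clip_mat_id[OF Z0(1)])
 have Bp: "(\<lambda>x. (A * clip_mat n N x) $$ (a, j)) \<in> fpolys (mat_entries n N)" if "a < k" "j < N" for a j
  unfolding mult_mat_index[OF A clip_mat_carrier that] using clip_mat_polys[OF _ that(2)] by (intro fpolys_intros) auto
 have "\<exists>D\<in>fpolys (mat_entries n N). D Z0 \<noteq> 0 \<and> (\<forall>x. D x \<noteq> 0 \<longrightarrow> torus_triv N A (clip_mat n N x) (A * clip_mat n N x) {1..<n} id)"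
 proof (rule torus_triv_open[OF A, where Z = "clip_mat n N" and B = "\<lambda>x. A * clip_mat n N x"])
  show "indep_rows k N (A * clip_mat n N Z0)" "torus_triv N A (clip_mat n N Z0) (A * clip_mat n N Z0) {1..<n} id"
   using g by (simp_all add: cl)
  show "A * clip_mat n N x \<in> carrier_mat k N" for x by (rule mult_carrier_mat[OF A clip_mat_carrier])
  show "{1..<n} \<subseteq> {..<n}" by auto
 qed (simp_all add: clip_mat_polys Bp del: index_mult_mat)
 then obtain D where D: "D \<in> fpolys (mat_entries n N)" "D Z0 \<noteq> 0"
  "\<forall>x. D x \<noteq> 0 \<longrightarrow> torus_triv N A (clip_mat n N x) (A * clip_mat n N x) {1..<n} id" by (elim bexE conjE)
 have "\<exists>E\<in>fpolys (mat_entries n N). E Z0 \<noteq> 0 \<and> (\<forall>x. E x \<noteq> 0 \<longrightarrow> indep_rows k N (A * clip_mat n N x))"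
  by (rule indep_rows_open[where B = "\<lambda>x. A * clip_mat n N x"]) (simp_all only: cl g Bp)
 then obtain E where E: "E \<in> fpolys (mat_entries n N)" "E Z0 \<noteq> 0" "\<forall>x. E x \<noteq> 0 \<longrightarrow> indep_rows k N (A * clip_mat n N x)"
  by (elim bexE conjE)
 show ?thesis
 proof (intro bexI[of _ "\<lambda>x. E x * D x"] conjI ballI impI)
  show "E Z0 * D Z0 \<noteq> 0" using D E by simp
  show "(\<lambda>x. E x * D x) \<in> mat_polys n N" unfolding mat_polys_eq using D(1) E(1) by (intro fpolys_intros)
  fix Z assume Z: "Z \<in> carrier_mat n N" "E Z * D Z \<noteq> 0"
  have "E Z \<noteq> 0" "D Z \<noteq> 0" using Z(2) by auto
  thus "good_proj A Z" unfolding good_proj_def using D(3) E(3) clip_mat_id[OF Z(1)] A Z(1) by auto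
 qed
qed

text \<open>Good projections contain a nonempty open set of matrices \<open>Z\<close>. Over each of
  them the generic fibre is a point and the image has full dimension, and any other generic
  statement about \<open>Z\<close> can be tested at one of them.\<close>

lemma intersection_number_balanced:
 assumes P: "plabic_tree G" "planar G" and n: "length (bdry G) = m * k_stat G + 1" and bal: "balanced m G"
 shows "intersection_number m G = 1"
proof -
 let ?k = "k_stat G" and ?n = "length (bdry G)"
 let ?N = "?k + m"
 have ne: "bdry G \<noteq> []" and n0: "0 < ?n" using n by auto
 obtain A0 where R: "represents G A0" using represents_ex[OF P ne] by (elim exE)
 have A0: "A0 \<in> carrier_mat ?k ?n" using R by (simp add: represents_def)
 have part: "\<exists>I. (\<forall>l<m. basis G (I l) \<and> i0 \<notin> I l) \<and> (\<forall>j<?n. j \<noteq> i0 \<longrightarrow> (\<exists>l<m. j \<in> I l))" if i0: "i0 < ?n" for i0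
 proof -
  obtain r par dep where rp: "rooted_plabic G r par dep" "rooted_plabic.ri G r = i0" using bdry_rooting[OF P(1) i0] by blast
  interpret rooted_plabic G r par dep by (rule rp)
  have "m * kap x < card (D x) \<and> card (D x) \<le> m * (kap x + 1)" if x: "x \<in> verts G - {r}" for x
  proof -
   have "{x, par x} \<in> edges G" using x edges_eq by auto
   from bal[unfolded balanced_def, rule_format, OF this] show ?thesis unfolding half_tree_balanced[OF P(2) x] .
  qed
  hence "\<exists>I. (\<forall>l<m. good (I l) \<and> ri \<notin> I l) \<and> (\<forall>i<?n. i \<noteq> ri \<longrightarrow> (\<exists>!l. l < m \<and> i \<in> I l))"
   by (rule basis_partition[OF _ n])
  then obtain I where I: "\<forall>l<m. good (I l) \<and> ri \<notin> I l" "\<forall>i<?n. i \<noteq> ri \<longrightarrow> (\<exists>!l. l < m \<and> i \<in> I l)" by (elim exE conjE)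
  show ?thesis
  proof (intro exI[of _ I] conjI allI impI)
   show "basis G (I l)" "i0 \<notin> I l" if "l < m" for l using I(1) that rp(2) basis_good by simp_all
   show "\<exists>l<m. j \<in> I l" if "j < ?n" "j \<noteq> i0" for j
    using ex1_implies_ex[OF I(2)[rule_format, OF that(1)]] that(2) rp(2) by simp
  qed
 qed
 \<comment> \<open>For \<open>m = 0\<close> the root would be the only boundary vertex, but some
   boundary vertex lies below \<open>wtop\<close>.\<close>
 have m: "0 < m"
 proof (rule ccontr)
  assume "\<not> 0 < m"
  hence n1: "?n = 1" using n by simp
  obtain r par dep where "rooted_plabic G r par dep" using bdry_rooting[OF P(1) n0] by blast
  then interpret rooted_plabic G r par dep .
  have "D wtop = {}" using D_wtop n1 ri by auto
  thus False using D_nonempty[OF wtop(1)] by simp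
 qed
 \<comment> \<open>For positive \<open>k\<close> and \<open>m\<close> one has
   \<open>k + m \<le> k * m + 1\<close>, so \<open>Z\<close> has at least as many rows as
   columns.\<close>
 have "1 \<le> ?k" by (simp add: k_stat_def)
 then obtain k' m' where "?k = Suc k'" "m = Suc m'" using m by (cases ?k; cases m) auto
 hence Nn: "?N \<le> ?n" using n by simp
 obtain Z0 where Z0: "Z0 \<in> carrier_mat ?n ?N" "good_proj A0 Z0" using good_proj_exists[OF R P(1) ne n part] by blast
 obtain f where f: "f \<in> mat_polys ?n ?N" "f Z0 \<noteq> 0" "\<forall>Z\<in>carrier_mat ?n ?N. f Z \<noteq> 0 \<longrightarrow> good_proj A0 Z"
  using good_proj_open[OF A0 Z0] by (elim bexE conjE)
 define FR where "FR = mats_of_rank ?n ?N (min ?n ?N)"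
 have irr: "irred_in (zariski_mat ?n ?N) FR" unfolding FR_def by (rule full_rank_irreducible(1)[OF Nn])
 let ?Zs = "subtopology (zariski_mat ?n ?N) FR"
 have Zs: "full_rank_zariski ?n ?N = ?Zs" by (simp add: full_rank_zariski_def FR_def)
 have gen_good: "generically (?Zs) (\<lambda>Z. Z \<in> carrier_mat ?n ?N \<and> good_proj A0 Z)"
  unfolding generically_iff[OF irr]
 proof (intro exI[of _ "{Z \<in> carrier_mat ?n ?N. f Z \<noteq> 0} \<inter> FR"] conjI ballI)
  have "openin (zariski_mat ?n ?N) {Z \<in> carrier_mat ?n ?N. f Z \<noteq> 0}"
   unfolding openin_zariski_mat using f(1) by blast
  thus "openin (?Zs) ({Z \<in> carrier_mat ?n ?N. f Z \<noteq> 0} \<inter> FR)"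
   unfolding openin_subtopology by blast
  obtain Z where "Z \<in> FR" "f Z \<noteq> 0" using full_rank_irreducible(2)[OF Nn f(1) Z0(1) f(2)] unfolding FR_def by blast
  thus "{Z \<in> carrier_mat ?n ?N. f Z \<noteq> 0} \<inter> FR \<noteq> {}" unfolding FR_def mats_of_rank_def by blast
 qed (use f(3) in blast)+
 have good1: "good_proj A0 (1\<^sub>m ?n)" by (rule represents_good_proj[OF R P(1) ne])
 have PV: "positroid_variety G = zariski_gr ?k ?n closure_of pos_orbit ?n A0 (1\<^sub>m ?n) all_pos"
  unfolding positroid_variety_def positroid_cell_pos_orbit[OF P(1) ne R] ..
 have irrPV: "irred_in (zariski_gr ?k ?n) (positroid_variety G)"
  unfolding PV by (rule good_proj_fibre(1)[OF A0 n0 good1 one_carrier_mat good1])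
 have one: "generically_to_one 1 m G Z" if "Z \<in> carrier_mat ?n ?N" "good_proj A0 Z" for Z
  unfolding generically_to_one_def PV by (rule good_proj_fibre(2)[OF A0 n0 good1 that])
 have dim: "enat (?n - 1) \<le> gr_dim ?k ?N (amp_image m G Z)" if Z: "Z \<in> carrier_mat ?n ?N" "good_proj A0 Z" for Z
 proof (rule pos_orbit_dim_ge[OF A0 Z n0])
  show "amp_image m G Z \<subseteq> grassmannian ?k ?N" by (simp add: amp_image_def)
  show "pos_orbit ?N A0 Z all_pos \<subseteq> amp_image m G Z"
  proof
   fix V assume "V \<in> pos_orbit ?N A0 Z all_pos"
   from pos_orbit_cases[OF this] obtain t :: "nat \<Rightarrow> real" where t: "V = row_span ?N (scale A0 (cx t) * Z)" "t \<in> all_pos"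
    "indep_rows (dim_row A0) ?N (scale A0 (cx t) * Z)" .
   let ?B = "scale A0 (cx t)"
   have B: "?B \<in> carrier_mat ?k ?n" using A0 by simp
   have tn: "complex_of_real (t i) \<noteq> 0" for i
   proof -
    have "0 < t i" using t(2) by simp
    thus ?thesis by simp
   qed
   have Bi: "indep_rows ?k ?n ?B" by (rule indep_rows_scale[OF A0 represents_indep_rows[OF R P(1) ne] tn])
   have B1: "?B * 1\<^sub>m ?n = ?B" by (rule right_mult_one_mat[OF B])
   have d: "dim_row A0 = ?k" using A0 by auto
   have mem: "row_span ?n ?B \<in> pos_orbit ?n A0 (1\<^sub>m ?n) all_pos"
    unfolding pos_orbit_def d using t(2) Bi B1 by (intro CollectI exI[of _ t] conjI) simp_all
   have sub: "pos_orbit ?n A0 (1\<^sub>m ?n) all_pos \<subseteq> topspace (zariski_gr ?k ?n)"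
   proof
    fix W assume "W \<in> pos_orbit ?n A0 (1\<^sub>m ?n) all_pos"
    from pos_orbit_cases[OF this] obtain s :: "nat \<Rightarrow> real" where s: "W = row_span ?n (scale A0 (\<lambda>i. of_real (s i)) * 1\<^sub>m ?n)"
     "s \<in> all_pos" "indep_rows (dim_row A0) ?n (scale A0 (\<lambda>i. of_real (s i)) * 1\<^sub>m ?n)" .
    show "W \<in> topspace (zariski_gr ?k ?n)" unfolding topspace_zariski_gr s(1)
     using row_span_in_gr_iff[OF mult_carrier_mat[OF scale_carrier[OF A0] one_carrier_mat]] s(3) d by simp
   qed
   have inPV: "row_span ?n ?B \<in> positroid_variety G" unfolding PV by (rule subsetD[OF closure_of_subset[OF sub] mem])
   have "V = amp_map Z (row_span ?n ?B)" unfolding t(1) by (rule amp_map_row_span[OF B Z(1), symmetric])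
   moreover have "V \<in> grassmannian ?k ?N"
    unfolding t(1) using row_span_in_gr_iff[OF mult_carrier_mat[OF B Z(1)]] t(3) d by simp
   ultimately show "V \<in> amp_image m G Z" unfolding amp_image_def using inPV by (intro IntI image_eqI)
  qed
 qed
 have pd: "positroid_dim G = enat (?n - 1)" by (rule positroid_dim_eq[OF P ne])
 have not0: "\<not> generically (?Zs) (\<lambda>Z. gr_dim ?k ?N (amp_image m G Z) < positroid_dim G)"
 proof
  assume g: "generically (?Zs) (\<lambda>Z. gr_dim ?k ?N (amp_image m G Z) < positroid_dim G)"
  from generically_common[OF irr g gen_good] obtain Z where
   "gr_dim ?k ?N (amp_image m G Z) < positroid_dim G" "Z \<in> carrier_mat ?n ?N" "good_proj A0 Z" by (elim bexE conjE)
  thus False using dim[of Z] pd by simp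
 qed
 \<comment> \<open>For uniqueness, the degree \<open>d\<close> and the degree 1 share a projection
   \<open>Z\<close> and then a point of the variety, whose fibre has only one cardinality.\<close>
 have "(THE d. 0 < d \<and> generically (?Zs) (generically_to_one d m G)) = 1"
 proof (rule the_equality)
  obtain U where U: "openin (?Zs) U" "U \<noteq> {}" "\<forall>Z\<in>U. Z \<in> carrier_mat ?n ?N \<and> good_proj A0 Z"
   using gen_good unfolding generically_iff[OF irr] by (elim exE conjE)
  have "generically (?Zs) (generically_to_one 1 m G)"
   unfolding generically_iff[OF irr] using U one by (intro exI[of _ U] conjI ballI) simp_all
  thus "0 < (1::nat) \<and> generically (?Zs) (generically_to_one 1 m G)" by simp
  fix d :: nat assume "0 < d \<and> generically (?Zs) (generically_to_one d m G)"
  hence g: "generically (?Zs) (generically_to_one d m G)" by (rule conjunct2)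
  from generically_common[OF irr g gen_good] obtain Z where Z: "generically_to_one d m G Z" "Z \<in> carrier_mat ?n ?N" "good_proj A0 Z"
   by (elim bexE conjE)
  from generically_common[OF irrPV Z(1)[unfolded generically_to_one_def] one[OF Z(2,3), unfolded generically_to_one_def]]
  show "d = 1" by (elim bexE conjE) simp
 qed
 thus ?thesis unfolding intersection_number_def Let_def Zs if_not_P[OF not0] .
qed

section \<open>Unbalanced trees\<close>

lemma gr_dim_mono:
 assumes sub: "X \<subseteq> zariski_gr k N closure_of Y"
 shows "gr_dim k N X \<le> gr_dim k N Y"
proof -
 let ?T = "zariski_gr k N"
 have cl: "?T closure_of X \<subseteq> ?T closure_of Y" by (rule closure_of_minimal[OF sub closedin_closure_of])
 note irr = irreducible_closed_subtopology[OF closedin_closure_of]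
 show ?thesis
  unfolding gr_dim_def krull_dim_def
 proof (rule Sup_subset_mono, rule subsetI)
  fix e assume "e \<in> {enat r | r. \<exists>C. (\<forall>i\<le>r. irreducible_closed (subtopology ?T (?T closure_of X)) (C i)) \<and> (\<forall>i<r. C i \<subset> C (Suc i))}"
  then obtain r C where C: "e = enat r" "\<forall>i\<le>r. irreducible_closed (subtopology ?T (?T closure_of X)) (C i)" "\<forall>i<r. C i \<subset> C (Suc i)"
   by (elim CollectE exE conjE)
  have "irreducible_closed (subtopology ?T (?T closure_of Y)) (C i)" if "i \<le> r" for i
   using C(2)[rule_format, OF that] cl unfolding irr by (elim conjE) (intro conjI, assumption, rule subset_trans)
  thus "e \<in> {enat r | r. \<exists>C. (\<forall>i\<le>r. irreducible_closed (subtopology ?T (?T closure_of Y)) (C i)) \<and> (\<forall>i<r. C i \<subset> C (Suc i))}"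
   using C(1,3) by (intro CollectI exI[of _ r] exI[of _ C] conjI allI impI) simp_all
 qed
qed

text \<open>Continuity of the projection where it is defined: the preimage of an open set is open,
  because the product with \<open>Z\<close> is polynomial and keeping the rank is an open
  condition.\<close>

lemma amp_map_closure:
 assumes A: "A \<in> carrier_mat k n" and Z: "Z \<in> carrier_mat n N"
  and V: "V \<in> zariski_gr k n closure_of pos_orbit n A (1\<^sub>m n) all_pos" and VZ: "amp_map Z V \<in> grassmannian k N"
 shows "amp_map Z V \<in> zariski_gr k N closure_of pos_orbit N A Z all_pos"
 unfolding in_closure_of
proof (intro conjI allI impI)
 show "amp_map Z V \<in> topspace (zariski_gr k N)" unfolding topspace_zariski_gr by (rule VZ)
 fix T assume "amp_map Z V \<in> T \<and> openin (zariski_gr k N) T"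
 hence VT: "amp_map Z V \<in> T" and T: "openin (zariski_gr k N) T" by (rule conjunct1, rule conjunct2)
 have TGr: "T \<subseteq> grassmannian k N" using openin_subset[OF T] unfolding topspace_zariski_gr .
 define O' where "O' = {W \<in> grassmannian k n. amp_map Z W \<in> T}"
 have op: "openin (zariski_gr k n) O'"
  unfolding openin_gr_iff
 proof (intro conjI ballI impI)
  show "O' \<subseteq> grassmannian k n" by (auto simp: O'_def)
  fix B assume B: "B \<in> mats_of_rank k n k" "row_span n B \<in> O'"
  have Bc: "B \<in> carrier_mat k n" using B(1) mats_of_rank_iff by blast
  have BZ: "B * Z \<in> carrier_mat k N" by (rule mult_carrier_mat[OF Bc Z])
  have inT: "row_span N (B * Z) \<in> T" using B(2) amp_map_row_span[OF Bc Z] by (simp add: O'_def)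
  hence Bi: "indep_rows k N (B * Z)" using TGr row_span_in_gr_iff[OF BZ] by blast
  hence "B * Z \<in> mats_of_rank k N k" using BZ mats_of_rank_iff by blast
  from openin_gr_ex[OF T this inT] obtain f where f: "f \<in> mat_polys k N" "f (B * Z) \<noteq> 0"
   "\<And>A'. A' \<in> mats_of_rank k N k \<Longrightarrow> f A' \<noteq> 0 \<Longrightarrow> row_span N A' \<in> T" by blast
  have cl: "clip_mat k n B = B" by (rule clip_mat_id[OF Bc])
  have "\<exists>E\<in>fpolys (mat_entries k n). E B \<noteq> 0 \<and> (\<forall>x. E x \<noteq> 0 \<longrightarrow> indep_rows k N (clip_mat k n x * Z))"
   by (rule indep_rows_open[where B = "\<lambda>x. clip_mat k n x * Z"]) (simp_all only: cl Bi mult_clip_polys[OF Z])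
  then obtain E where E: "E \<in> fpolys (mat_entries k n)" "E B \<noteq> 0" "\<forall>x. E x \<noteq> 0 \<longrightarrow> indep_rows k N (clip_mat k n x * Z)"
   by (elim bexE conjE)
  have F: "(\<lambda>x. f (clip_mat k n x * Z)) \<in> fpolys (mat_entries k n)"
  proof (rule fpolys_compose[OF f(1)[unfolded mat_polys_eq]])
   fix x assume "x \<in> mat_entries k N"
   then obtain a j where x: "x = (\<lambda>M. M $$ (a, j))" "a < k" "j < N" unfolding mat_entries_def by blast
   show "(\<lambda>y. x (clip_mat k n y * Z)) \<in> fpolys (mat_entries k n)" unfolding x(1) by (rule mult_clip_polys[OF Z x(2,3)])
  qed
  show "\<exists>f\<in>mat_polys k n. f B \<noteq> 0 \<and> (\<forall>A'\<in>mats_of_rank k n k. f A' \<noteq> 0 \<longrightarrow> row_span n A' \<in> O')"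
  proof (intro bexI[of _ "\<lambda>x. E x * f (clip_mat k n x * Z)"] conjI ballI impI)
   show "E B * f (clip_mat k n B * Z) \<noteq> 0" unfolding cl using E(2) f(2) by simp
   show "(\<lambda>x. E x * f (clip_mat k n x * Z)) \<in> mat_polys k n" unfolding mat_polys_eq by (intro fpolys.mult E(1) F)
   fix A' assume A': "A' \<in> mats_of_rank k n k" "E A' * f (clip_mat k n A' * Z) \<noteq> 0"
   hence c: "A' \<in> carrier_mat k n" using mats_of_rank_iff by blast
   have cA: "clip_mat k n A' = A'" by (rule clip_mat_id[OF c])
   have "E A' \<noteq> 0" and fA: "f (A' * Z) \<noteq> 0" using A'(2) unfolding cA by auto
   hence "indep_rows k N (A' * Z)" using E(3) cA by metis
   hence "A' * Z \<in> mats_of_rank k N k" using mult_carrier_mat[OF c Z] mats_of_rank_iff by blast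
   from f(3)[OF this fA] show "row_span n A' \<in> O'"
    unfolding O'_def using A'(1) amp_map_row_span[OF c Z] by (auto simp: grassmannian_def)
  qed
 qed
 have "V \<in> grassmannian k n" using subsetD[OF closure_of_subset_topspace V] unfolding topspace_zariski_gr .
 hence VO: "V \<in> O'" using VT by (simp add: O'_def)
 have "\<forall>T. V \<in> T \<and> openin (zariski_gr k n) T \<longrightarrow> (\<exists>y. y \<in> pos_orbit n A (1\<^sub>m n) all_pos \<and> y \<in> T)"
  using V unfolding in_closure_of by (rule conjunct2)
 from this[rule_format, OF conjI[OF VO op]] obtain W where "W \<in> pos_orbit n A (1\<^sub>m n) all_pos \<and> W \<in> O'" ..
 hence W: "W \<in> pos_orbit n A (1\<^sub>m n) all_pos" "W \<in> O'" by (rule conjunct1, rule conjunct2)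
 from pos_orbit_cases[OF W(1)] obtain t where t: "W = row_span n (scale A (cx t) * 1\<^sub>m n)" "t \<in> all_pos"
  "indep_rows (dim_row A) n (scale A (cx t) * 1\<^sub>m n)" .
 let ?A = "scale A (cx t)"
 note cA = scale_carrier[OF A]
 have d: "dim_row A = k" using A by auto
 have e: "amp_map Z W = row_span N (?A * Z)" unfolding t(1) right_mult_one_mat[OF cA] by (rule amp_map_row_span[OF cA Z])
 have WT: "amp_map Z W \<in> T" using W(2) by (simp add: O'_def)
 hence "indep_rows k N (?A * Z)" using TGr row_span_in_gr_iff[OF mult_carrier_mat[OF cA Z]] unfolding e by blast
 hence "amp_map Z W \<in> pos_orbit N A Z all_pos" unfolding pos_orbit_def d e using t(2) by blast
 thus "\<exists>y. y \<in> pos_orbit N A Z all_pos \<and> y \<in> T" using WT by (intro exI conjI)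
qed

text \<open>If \<open>D u\<close> is too small it serves itself, with \<open>s = kap u\<close>. If
  it is too large its complement serves: every basis has at most \<open>kap u + 1\<close> elements
  in \<open>D u\<close> and hence at least \<open>k_stat G - (kap u + 1)\<close> outside.\<close>

lemma (in rooted_plabic) deficient_set:
 assumes n: "length (bdry G) = m * k_stat G + 1" and u: "u \<in> verts G - {r}"
  and unb: "\<not> (m * kap u < card (D u) \<and> card (D u) \<le> m * (kap u + 1))"
 shows "\<exists>C s. C \<subseteq> {..<length (bdry G)} \<and> C \<noteq> {} \<and> card C \<le> m * s \<and> (\<forall>I. good I \<longrightarrow> s \<le> card (I \<inter> C))"
proof (cases "card (D u) \<le> m * kap u")
 case True
 have "\<forall>I. good I \<longrightarrow> kap u \<le> card (I \<inter> D u)" using u unfolding good_def by blast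
 thus ?thesis using True D_sub D_nonempty[OF u] by (intro exI[of _ "D u"] exI[of _ "kap u"] conjI)
next
 case False
 let ?n = "length (bdry G)" and ?C = "{..<length (bdry G)} - D u"
 \<comment> \<open>The strict inequality absorbs the \<open>+ 1\<close> in the number of boundary
   vertices, leaving at most \<open>m * (k_stat G - (kap u + 1))\<close> for the complement.\<close>
 have gt: "m * (kap u + 1) + 1 \<le> card (D u)" using False unb by simp
 have cC: "card ?C = ?n - card (D u)" using D_sub by (simp add: card_Diff_subset)
 have "ri \<in> ?C" using ri ri_notin_D[OF u] by simp
 hence ne: "?C \<noteq> {}" by blast
 have "card (D u) + card ?C = ?n" using card_Diff_subset[OF finite_D D_sub, of u] card_mono[OF finite_lessThan D_sub, of u] by simp
 hence le: "card ?C + m * (kap u + 1) \<le> m * k_stat G" using gt n by simp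
 have "card ?C > 0" using ne by (simp add: card_gt_0_iff)
 hence "m * (kap u + 1) < m * k_stat G" using le by simp
 hence lt: "kap u + 1 < k_stat G" unfolding mult_less_cancel1 by (rule conjunct2)
 have "card ?C \<le> m * (k_stat G - (kap u + 1))" using le by (simp add: diff_mult_distrib2)
 moreover have "\<forall>I. good I \<longrightarrow> k_stat G - (kap u + 1) \<le> card (I \<inter> ?C)"
 proof (intro allI impI)
  fix I assume I: "good I"
  hence sub: "I \<subseteq> {..<?n}" and cI: "card I = k_stat G" and du: "card (I \<inter> D u) \<le> kap u + 1" using u unfolding good_def by blast+
  have fI: "finite I" using sub finite_subset by blast
  have "I = (I \<inter> D u) \<union> (I \<inter> ?C)" using sub by auto
  hence "card I \<le> card (I \<inter> D u) + card (I \<inter> ?C)" using card_Un_le by metis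
  thus "k_stat G - (kap u + 1) \<le> card (I \<inter> ?C)" using cI du by simp
 qed
 ultimately show ?thesis using ne by (intro exI[of _ ?C] exI[of _ "k_stat G - (kap u + 1)"] conjI) blast+
qed

text \<open>A normalized matrix of a basis that meets \<open>C\<close> in as few elements as possible has its rows
 at \<open>C\<close> supported on \<open>C\<close>.\<close>

lemma deficient_amp_image_dim:
 assumes P: "plabic_tree G" and ne: "bdry G \<noteq> []" and R: "represents G A0"
  and C: "C \<subseteq> {..<length (bdry G)}" "C \<noteq> {}" "card C \<le> m * s" and def: "\<And>I. basis G I \<Longrightarrow> s \<le> card (I \<inter> C)"
  and Z: "Z \<in> carrier_mat (length (bdry G)) (k_stat G + m)"
 shows "gr_dim (k_stat G) (k_stat G + m) (amp_image m G Z) < enat (m * k_stat G)"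
proof -
 let ?k = "k_stat G" and ?n = "length (bdry G)"
 let ?N = "?k + m"
 have A0: "A0 \<in> carrier_mat ?k ?n" using R by (simp add: represents_def)
 obtain r par dep where "rooted_plabic G r par dep" using bdry_rooting[OF P, of 0] ne by auto
 then interpret rooted_plabic G r par dep .
 obtain I0 where "basis G I0" using exists_good basis_good by blast
 from ex_has_least_nat[of "basis G" I0 "\<lambda>I. card (I \<inter> C)", OF this]
 obtain I where I: "basis G I" "\<forall>J. basis G J \<longrightarrow> card (I \<inter> C) \<le> card (J \<inter> C)" by (elim exE conjE)
 have fI: "finite I" using basis_subset[OF I(1)] finite_subset by blast
 have cI: "card I = ?k" by (rule basis_card[OF P ne I(1)])
 define xs where "xs = sorted_list_of_set I"
 have xs: "length xs = ?k" "set xs \<subseteq> {..<?n}" "distinct xs" "set xs = I"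
  using fI cI basis_subset[OF I(1)] by (simp_all add: xs_def)
 have nz: "lminor A0 xs \<noteq> 0" using represents_nonzero[OF R xs(3)] xs(4) I(1) cI by simp
 define M where "M = norm_mat ?k ?n xs A0"
 have M: "M \<in> carrier_mat ?k ?n" by (simp add: M_def)
 have MA: "row_span ?n A0 = row_span ?n M" unfolding M_def by (rule row_span_norm_mat[OF A0 xs(1,2) nz, symmetric])
 define B where "B = {b. b < ?k \<and> xs ! b \<in> C}"
 \<comment> \<open>A nonzero entry would permit exchanging an element of \<open>C\<close> for
   \<open>j\<close> outside \<open>C\<close>, producing a basis that meets \<open>C\<close> in fewer
   elements than the minimal one.\<close>
 have supp: "M $$ (b, j) = 0" if b: "b \<in> B" and j: "j < ?n" "j \<notin> C" for b j
 proof (rule ccontr)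
  assume "M $$ (b, j) \<noteq> 0"
  hence nz': "lminor A0 (xs[b := j]) \<noteq> 0" using b j by (auto simp: M_def norm_mat_def B_def)
  have bk: "b < ?k" "xs ! b \<in> C" using b by (simp_all add: B_def)
  have d: "distinct (xs[b := j])" using nz' lminor_not_distinct by blast
  have st: "set (xs[b := j]) = insert j (I - {xs ! b})"
   using set_update_distinct[OF xs(3)] bk xs(1,4) by simp
  define I' where "I' = set (xs[b := j])"
  have "lminor A0 (sorted_list_of_set I') \<noteq> 0"
  proof -
   obtain c where "lminor A0 (xs[b := j]) = c * lminor A0 (sorted_list_of_set I')"
    using lminor_sort[OF d] unfolding I'_def by blast
   thus ?thesis using nz' by auto
  qed
  moreover have "card I' = ?k" unfolding I'_def using distinct_card[OF d] xs(1) by simp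
  moreover have "I' \<subseteq> {..<?n}" unfolding I'_def st using xs(2,4) j(1) by auto
  ultimately have "basis G I'" using R unfolding represents_def by (metis of_bool_eq(1))
  hence "card (I \<inter> C) \<le> card (I' \<inter> C)" using I(2) by blast
  also have "I' \<inter> C = (I \<inter> C) - {xs ! b}" unfolding I'_def st using j(2) by auto
  also have "card \<dots> < card (I \<inter> C)"
  proof (rule card_Diff1_less)
   show "xs ! b \<in> I \<inter> C" using bk xs(1,4) nth_mem[of b xs] by auto
  qed (use fI in simp)
  finally show False by simp
 qed
 have "(\<lambda>b. xs ! b) ` B = I \<inter> C" using xs(1,4) by (auto simp: B_def in_set_conv_nth)
 moreover have "inj_on (\<lambda>b. xs ! b) B" using xs(1,3) by (auto simp: B_def inj_on_def nth_eq_iff_index_eq)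
 ultimately have cB: "card B = card (I \<inter> C)" using card_image by fastforce
 obtain c0 where c0: "c0 \<in> C" using C(2) by blast
 have Bk: "B \<subseteq> {..<?k}" by (auto simp: B_def)
 have PV: "positroid_variety G = zariski_gr ?k ?n closure_of pos_orbit ?n A0 (1\<^sub>m ?n) all_pos"
  unfolding positroid_variety_def positroid_cell_pos_orbit[OF P ne R] ..
 have "amp_image m G Z \<subseteq> zariski_gr ?k ?N closure_of pos_orbit ?N A0 Z all_pos"
 proof
  fix V assume "V \<in> amp_image m G Z"
  then obtain W where W: "W \<in> positroid_variety G" "V = amp_map Z W" "V \<in> grassmannian ?k ?N"
   unfolding amp_image_def by blast
  show "V \<in> zariski_gr ?k ?N closure_of pos_orbit ?N A0 Z all_pos"
   unfolding W(2) by (rule amp_map_closure[OF A0 Z W(1)[unfolded PV] W(3)[unfolded W(2)]])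
 qed
 also have "\<dots> \<subseteq> zariski_gr ?k ?N closure_of pos_orbit ?N M Z all_pos"
  by (rule closure_of_mono[OF pos_orbit_cong[OF A0 M MA Z]])
 finally have "gr_dim ?k ?N (amp_image m G Z) \<le> gr_dim ?k ?N (pos_orbit ?N M Z all_pos)" by (rule gr_dim_mono)
 also have "\<dots> \<le> enat (card C - 1 + (?k - card B) * m)"
  by (rule deficient_dim_le[OF M Z C(1) c0 Bk supp])
 \<comment> \<open>Since \<open>card C \<le> m * s \<le> m * card B\<close>, the bound is at most
   \<open>m * k - 1\<close>: the normalized scaling at \<open>c0\<close> provides the
   strictness.\<close>
 also have "\<dots> < enat (m * ?k)"
 proof -
  have "card B \<le> ?k" using card_mono[OF finite_lessThan Bk] by simp
  then obtain d where d: "?k = card B + d" using le_Suc_ex by blast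
  have "s \<le> card B" using def[OF I(1)] cB by simp
  hence "card C \<le> m * card B" using C(3) mult_le_mono2 le_trans by blast
  moreover have "card C > 0" using C(1,2) finite_subset by (auto simp: card_gt_0_iff)
  ultimately have "card C - 1 + d * m < m * (card B + d)" by (simp add: distrib_left mult.commute)
  thus ?thesis by (simp add: d)
 qed
 finally show ?thesis .
qed

lemma intersection_number_unbalanced:
 assumes P: "plabic_tree G" "planar G" and n: "length (bdry G) = m * k_stat G + 1" and unb: "\<not> balanced m G"
 shows "intersection_number m G = 0"
proof -
 let ?k = "k_stat G" and ?n = "length (bdry G)"
 have ne: "bdry G \<noteq> []" using n by auto
 obtain A0 where R: "represents G A0" using represents_ex[OF P ne] by (elim exE)
 obtain u v where uv: "{u, v} \<in> edges G" "\<not> (enat (m * (k_stat (half_tree G u v) - 1)) < positroid_dim (half_tree G u v) \<and>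
   positroid_dim (half_tree G u v) \<le> enat (m * k_stat (half_tree G u v)))"
  using unb unfolding balanced_def by (simp only: not_all not_imp) (elim exE conjE)
 obtain r par dep where rp: "rooted_plabic G r par dep" "u \<in> verts G - {r}" "par u = v"
  using edge_rooting[OF P(1) ne uv(1)] by (elim exE conjE)
 interpret rooted_plabic G r par dep by (rule rp)
 have "\<not> (m * kap u < card (D u) \<and> card (D u) \<le> m * (kap u + 1))"
  using uv(2) unfolding rp(3)[symmetric] half_tree_balanced[OF P(2) rp(2)] .
 from deficient_set[OF n rp(2) this]
 obtain C s where C: "C \<subseteq> {..<?n}" "C \<noteq> {}" "card C \<le> m * s" "\<forall>I. good I \<longrightarrow> s \<le> card (I \<inter> C)"
  by (elim exE conjE)
 \<comment> \<open>The dimension drops for every matrix \<open>Z\<close> in the space, so the whole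
   space serves as the dense open set.\<close>
 have "gr_dim ?k (?k + m) (amp_image m G Z) < positroid_dim G" if "Z \<in> topspace (full_rank_zariski ?n (?k + m))" for Z
 proof -
  have "Z \<in> carrier_mat ?n (?k + m)" using that unfolding full_rank_zariski_def mats_of_rank_def by simp
  thus ?thesis
   using deficient_amp_image_dim[OF P(1) ne R C(1-3), of Z] C(4) basis_good positroid_dim_eq[OF P ne] n by simp
 qed
 hence "generically (full_rank_zariski ?n (?k + m)) (\<lambda>Z. gr_dim ?k (?k + m) (amp_image m G Z) < positroid_dim G)"
  unfolding generically_def by (intro exI[of _ "topspace (full_rank_zariski ?n (?k + m))"] conjI ballI) simp_all
 thus ?thesis unfolding intersection_number_def Let_def by (simp only: if_P)
qed

theorem theorem7p23:
 fixes G :: "'v plabic" and k m :: nat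
 assumes "bipartite_plabic_tree G" and "plabic_type G = (k, k * m + 1)"
 shows "(intersection_number m G = 1 \<longleftrightarrow> balanced m G) \<and>
     (\<not> balanced m G \<longrightarrow> intersection_number m G = 0)"
proof -
 note P = bipartite_plabic_tree_planar[OF assms(1)]
 have n: "length (bdry G) = m * k_stat G + 1" using assms(2) by (auto simp: plabic_type_def mult.commute)
 show ?thesis
 proof (cases "balanced m G")
  case True
  thus ?thesis using intersection_number_balanced[OF P n] by simp
 next
  case False
  thus ?thesis using intersection_number_unbalanced[OF P n] by simp
 qed
qed

end
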